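(* Each $\mathsf{Lie^1Bi}_\infty$ algebra is isomorphic to the tensor product of a contractible $\mathsf{Lie^1Bi}_\infty$ algebra and a minimal one. That is, for every $\mathsf{Lie^1Bi}_\infty$ algebra, with geometric equivalent $(\mathcal M,\omega,\Gamma)$, there are a contractible $\mathsf{Lie^1Bi}_\infty$ algebra $(\mathcal M_1,\omega_1,\Gamma_1)$, a minimal $\mathsf{Lie^1Bi}_\infty$ algebra $(\mathcal M_2,\omega_2,\Gamma_2)$, and an isomorphism $$(\mathcal M,\omega,\Gamma)\simeq(\mathcal M_1,\omega_1,\Gamma_1)\times(\mathcal M_2,\omega_2,\Gamma_2).$$
   Context: $k$ is a field of characteristic $0$; $V[p]^i=V^{i+p}$. $\mathsf{Lie^1Bi}_\infty$ algebras are strongly homotopy Lie 1-bialgebras; such a structure on a graded vector space $V$ is a collection of linear maps $\{\mu_{m,n}:\odot^nV\to\wedge^mV[2-m]\}_{m,n\ge1}$ satisfying a system of quadratic equations, described in geometric language as follows. Geometric presentation. Let $V$ be a graded vector space. Let $\mathcal M$ be the formal graded manifold modelled on the infinitesimal neighbourhood of $0$ in $V\oplus V^*[1]$, with structure sheaf $\mathcal O_{\mathcal M}$; let $t^A$ be linear coordinates on $V$ and $\chi_A$, $|\chi_A|=-|t^A|+1$, the dual coordinates on $V^*[1]$. $\mathcal M$ carries the odd symplectic form $\omega=\sum_A dt^A\wedge d\chi_A$ induced by the natural pairing $V\otimes V^*[1]\to k[1]$. Hence $\mathcal O_{\mathcal M}$ has a degree $-1$ Poisson bracket $\{\ \bullet\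 \}$ with $\{f\bullet g\}=(-1)^{|f||g|+|f|+|g|}\{g\bullet f\}$ satisfying the Jacobi identity. There are two distinguished Lagrangian submanifolds: $\mathcal L$, associated with the subspace $0\oplus V^*[1]$ (given by $t^A=0$), and $\Pi\mathcal L$, associated with $V\oplus 0$ (given by $\chi_A=0$). The distinguished point is $\mathcal L\cap\Pi\mathcal L$, and $I\subset\mathcal O_{\mathcal M}$ is its ideal. A $\mathsf{Lie^1Bi}_\infty$ algebra structure on $V$ is the same as a degree $2$ function $\Gamma\in\mathcal O_{\mathcal M}$ vanishing on $\mathcal L\cup\Pi\mathcal L$ and satisfying $\{\Gamma\bullet\Gamma\}=0$ (its Taylor coefficients encode the maps $\mu_{m,n}$). It is denoted $(\mathcal M,\omega,\Gamma)$. A $\mathsf{Lie^1Bi}_\infty$ morphism from $V$ to $V'$, with data $(\mathcal M,\omega,\Gamma)$ and $(\mathcal M',\omega',\Gamma')$, is a symplectomorphism $F:(\mathcal M,\omega)\to(\mathcal M',\omega')$ such that $F(\mathcal L)\subset\mathcal L'$, $F(\Pi\mathcal L)\subset\Pi\mathcal L'$ and $F^*\Gamma'=\Gamma$. An isomorphism is an invertible such morphism. This geometric language is literal for finite-dimensional $V$, but the notions are meant for infinite-dimensional $V$ as well: they are then read in terms of multilinear maps, e.g. a morphism is given by collections $\{F_{m,n}:\odot^mV\to\wedge^nV\otimes V'[-n]\}_{m\ge1,n\ge0}$ and $\{\bar F_{m,n}:\odot^mV\otimes V'[n-1]\to\wedge^nV\}_{n\ge0,m\ge1}$, with the defining equations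 reinterpreted accordingly. Contractible: differentials $d:V\to V$ are in one-to-one correspondence with quadratic degree $2$ functions $\Gamma_{quad}$ on $(\mathcal M,\omega)$ vanishing on $\mathcal L\cup\Pi\mathcal L$ with $\{\Gamma_{quad}\bullet\Gamma_{quad}\}=0$. If $H^*(V,d)=0$, the data $(\mathcal M,\omega,\Gamma_{quad})$ is called a contractible $\mathsf{Lie^1Bi}_\infty$ structure on $V$. Minimal: $(\mathcal M,\omega,\Gamma)$ is minimal if $\Gamma=0\bmod I^3$, i.e. the formal power series $\Gamma$ begins with terms at least cubic. Tensor product: the tensor product of the algebras corresponding to $(\mathcal M_i,\omega_i,\Gamma_i)$, $i=1,2$, is the algebra corresponding to the product $(\mathcal M_1\times\mathcal M_2,\ \omega_1+\omega_2,\ \Gamma_1+\Gamma_2)$ (pullbacks to the product understood). *)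

theory Defs
  imports Complex_Main
begin

section \<open>Graded vector spaces\<close>

text \<open>
  A graded vector space is a family of subspaces \<open>V i\<close> (\<open>i\<close> an integer) of an ambient vector space
  whose sum is direct; the graded space itself is that direct sum, and no finiteness of any
  kind is imposed. The ambient space only serves as a carrier.
\<close>

definition graded_space :: "('k::field \<Rightarrow> 'v::ab_group_add \<Rightarrow> 'v) \<Rightarrow> (int \<Rightarrow> 'v set) \<Rightarrow> bool" where
  "graded_space scale V \<longleftrightarrow>
     (\<forall>i. module.subspace scale (V i)) \<and>
     (\<forall>I v. finite I \<longrightarrow> (\<forall>i\<in>I. v i \<in> V i) \<longrightarrow> (\<Sum>i\<in>I. v i) = 0 \<longrightarrow> (\<forall>i\<in>I. v i = 0))"

definition homogeneous_basis ::
  "('k::field \<Rightarrow> 'v::ab_group_add \<Rightarrow> 'v) \<Rightarrow> (int \<Rightarrow> 'v set) \<Rightarrow> 'v set \<Rightarrow> bool" where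
  "homogeneous_basis scale V B \<longleftrightarrow>
     B \<subseteq> (\<Union>i. V i) \<and> \<not> module.dependent scale B \<and> (\<forall>i. V i \<subseteq> module.span scale B)"

text \<open>Only meaningful for nonzero homogeneous \<open>v\<close>.\<close>

definition vdeg :: "(int \<Rightarrow> 'v set) \<Rightarrow> 'v \<Rightarrow> int" where
  "vdeg V v = (THE i. v \<in> V i)"

text \<open>Differentials \<open>d\<close> are determined on the graded space only; the linear extension to the
  ambient space is immaterial.\<close>

definition differential ::
  "('k::field \<Rightarrow> 'v::ab_group_add \<Rightarrow> 'v) \<Rightarrow> (int \<Rightarrow> 'v set) \<Rightarrow> ('v \<Rightarrow> 'v) \<Rightarrow> bool" where
  "differential scale V d \<longleftrightarrow>
     Vector_Spaces.linear scale scale d \<and>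
     (\<forall>i. d ` V i \<subseteq> V (i + 1)) \<and> (\<forall>i. \<forall>v\<in>V i. d (d v) = 0)"

definition acyclic_differential :: "(int \<Rightarrow> 'v::zero set) \<Rightarrow> ('v \<Rightarrow> 'v) \<Rightarrow> bool" where
  "acyclic_differential V d \<longleftrightarrow> (\<forall>i. {v \<in> V i. d v = 0} = d ` V (i - 1))"


section \<open>Functions on the formal manifold\<close>

text \<open>
  Let \<open>B\<close> be a homogeneous basis of \<open>V\<close>. The formal manifold modelled on \<open>V \<oplus> V\<^sup>*[1]\<close> has, for every
  \<open>b \<in> B\<close>, the linear coordinate \<open>Tc b\<close> (that is \<open>t\<^sup>b\<close>) on \<open>V\<close> and the dual coordinate \<open>Chi b\<close>
  (that is \<open>\<chi>\<^sub>b\<close>) on \<open>V\<^sup>*[1]\<close>.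
\<close>

datatype 'v coord = Tc 'v | Chi 'v

definition coords :: "'v set \<Rightarrow> 'v coord set" where
  "coords B = Tc ` B \<union> Chi ` B"

fun cdeg :: "(int \<Rightarrow> 'v set) \<Rightarrow> 'v coord \<Rightarrow> int" where
  "cdeg V (Tc b) = - vdeg V b"
| "cdeg V (Chi b) = vdeg V b + 1"

definition ksign :: "int \<Rightarrow> int \<Rightarrow> 'k::ring_1" where
  "ksign p q = (if odd p \<and> odd q then - 1 else 1)"

text \<open>
  A formal power series is given by its family of Taylor coefficients: \<open>f\<close>, a graded-symmetric
  function on words in the coordinates, stands for
  \<open>\<Sum>\<^sub>n 1/n! \<Sum> f [x\<^sub>1,\<dots>,x\<^sub>n] x\<^sub>1 \<cdots> x\<^sub>n\<close>. The coefficients with \<open>n\<close> letters \<open>t\<close> and \<open>m\<close> letters \<open>\<chi>\<close>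
  are the matrix entries of a linear map from the \<open>n\<close>-th symmetric power of \<open>V\<close> to the \<open>m\<close>-th
  symmetric power of \<open>V[-1]\<close>, i.e. to the \<open>m\<close>-th exterior power of \<open>V\<close> up to a shift. The last
  clause of \<open>is_function\<close> says that the value of this map on each argument is a finite sum of
  monomials; it holds automatically if \<open>V\<close> is finite-dimensional.
\<close>

type_synonym ('v, 'k) series = "'v coord list \<Rightarrow> 'k"

definition is_function :: "(int \<Rightarrow> 'v set) \<Rightarrow> 'v set \<Rightarrow> ('v, 'k::field_char_0) series \<Rightarrow> bool" where
  "is_function V B f \<longleftrightarrow>
     (\<forall>w. \<not> set w \<subseteq> coords B \<longrightarrow> f w = 0) \<and>
     (\<forall>u x y w. f (u @ [x, y] @ w) = ksign (cdeg V x) (cdeg V y) * f (u @ [y, x] @ w)) \<and>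
     (\<forall>as m. finite {bs. length bs = m \<and> f (map Tc as @ map Chi bs) \<noteq> 0})"

definition has_degree :: "(int \<Rightarrow> 'v set) \<Rightarrow> int \<Rightarrow> ('v, 'k::field_char_0) series \<Rightarrow> bool" where
  "has_degree V p f \<longleftrightarrow> (\<forall>w. f w \<noteq> 0 \<longrightarrow> sum_list (map (cdeg V) w) = p)"

definition coord_fun :: "'v coord \<Rightarrow> ('v, 'k::field_char_0) series" where
  "coord_fun x = (\<lambda>w. if w = [x] then 1 else 0)"

text \<open>\<open>shuffle_sign V w S\<close> is the Koszul sign of moving the letters of \<open>w\<close> at the positions in \<open>S\<close>
  to the front.\<close>

definition shuffle_sign :: "(int \<Rightarrow> 'v set) \<Rightarrow> 'v coord list \<Rightarrow> nat set \<Rightarrow> 'k::field_char_0" where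
  "shuffle_sign V w S =
     (\<Prod>(i, j) \<in> {(i, j). i < j \<and> j < length w \<and> i \<notin> S \<and> j \<in> S}.
        ksign (cdeg V (w ! i)) (cdeg V (w ! j)))"

definition fmul ::
  "(int \<Rightarrow> 'v set) \<Rightarrow> ('v, 'k::field_char_0) series \<Rightarrow> ('v, 'k) series \<Rightarrow> ('v, 'k) series" where
  "fmul V f g = (\<lambda>w. \<Sum>S\<in>Pow {..<length w}. shuffle_sign V w S * f (nths w S) * g (nths w (- S)))"

definition fone :: "('v, 'k::field_char_0) series" where
  "fone = (\<lambda>w. if w = [] then 1 else 0)"

definition fprod :: "(int \<Rightarrow> 'v set) \<Rightarrow> ('v, 'k::field_char_0) series list \<Rightarrow> ('v, 'k) series" where
  "fprod V fs = foldr (fmul V) fs fone"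

text \<open>Left and right partial derivatives.\<close>

definition dL :: "'v coord \<Rightarrow> ('v, 'k::field_char_0) series \<Rightarrow> ('v, 'k) series" where
  "dL x f = (\<lambda>w. f (x # w))"

definition dR :: "'v coord \<Rightarrow> ('v, 'k::field_char_0) series \<Rightarrow> ('v, 'k) series" where
  "dR x f = (\<lambda>w. f (w @ [x]))"

text \<open>Infinite sums with only finitely many nonzero terms. The finiteness conditions in
  \<open>is_function\<close> and \<open>formal_map\<close> guarantee that all the sums below are of this kind.\<close>

definition lfsum :: "'i set \<Rightarrow> ('i \<Rightarrow> 'k::comm_monoid_add) \<Rightarrow> 'k" where
  "lfsum A h = (\<Sum>i\<in>{i \<in> A. h i \<noteq> 0}. h i)"

text \<open>
  The Poisson bracket of degree \<open>-1\<close> of the odd symplectic form \<open>\<Sum> dt\<^sup>b \<and> d\<chi>\<^sub>b\<close>, normalised by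
  \<open>{t\<^sup>b \<bullet> \<chi>\<^sub>b} = 1\<close>. Written with right and left derivatives it carries no further signs, and
  it satisfies \<open>{f \<bullet> g} = (-1)\<^bsup>|f||g|+|f|+|g|\<^esup> {g \<bullet> f}\<close>.
\<close>

definition bracket ::
  "(int \<Rightarrow> 'v set) \<Rightarrow> 'v set \<Rightarrow> ('v, 'k::field_char_0) series \<Rightarrow> ('v, 'k) series \<Rightarrow> ('v, 'k) series"
where
  "bracket V B f g = (\<lambda>w. lfsum B (\<lambda>b.
     fmul V (dR (Tc b) f) (dL (Chi b) g) w - fmul V (dR (Chi b) f) (dL (Tc b) g) w))"

text \<open>The ideals of the Lagrangian submanifolds \<open>t = 0\<close> (called \<open>L\<close>) and \<open>\<chi> = 0\<close> (called \<open>\<Pi>L\<close>).\<close>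

definition vanishes_on_L :: "('v, 'k::field_char_0) series \<Rightarrow> bool" where
  "vanishes_on_L f \<longleftrightarrow> (\<forall>bs. f (map Chi bs) = 0)"

definition vanishes_on_PiL :: "('v, 'k::field_char_0) series \<Rightarrow> bool" where
  "vanishes_on_PiL f \<longleftrightarrow> (\<forall>as. f (map Tc as) = 0)"


section \<open>Strongly homotopy Lie 1-bialgebras\<close>

definition lie1bi ::
  "('k::field_char_0 \<Rightarrow> 'v::ab_group_add \<Rightarrow> 'v) \<Rightarrow> (int \<Rightarrow> 'v set) \<Rightarrow> 'v set \<Rightarrow> ('v, 'k) series \<Rightarrow> bool"
where
  "lie1bi scale V B \<Gamma> \<longleftrightarrow>
     graded_space scale V \<and> homogeneous_basis scale V B \<and>
     is_function V B \<Gamma> \<and> has_degree V 2 \<Gamma> \<and>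
     vanishes_on_L \<Gamma> \<and> vanishes_on_PiL \<Gamma> \<and>
     bracket V B \<Gamma> \<Gamma> = (\<lambda>w. 0)"

text \<open>The quadratic function \<open>\<Sum> t\<^sup>a d\<^sub>a\<^sup>b \<chi>\<^sub>b\<close> corresponds to the differential \<open>d e\<^sub>a = \<Sum> d\<^sub>a\<^sup>b e\<^sub>b\<close>.\<close>

definition contractible ::
  "('k::field_char_0 \<Rightarrow> 'v::ab_group_add \<Rightarrow> 'v) \<Rightarrow> (int \<Rightarrow> 'v set) \<Rightarrow> 'v set \<Rightarrow> ('v, 'k) series \<Rightarrow> bool"
where
  "contractible scale V B \<Gamma> \<longleftrightarrow>
     lie1bi scale V B \<Gamma> \<and>
     (\<forall>w. length w \<noteq> 2 \<longrightarrow> \<Gamma> w = 0) \<and>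
     (\<exists>d. differential scale V d \<and>
          (\<forall>a\<in>B. \<forall>b\<in>B. \<Gamma> [Tc a, Chi b] = module.representation scale B (d a) b) \<and>
          acyclic_differential V d)"

definition minimal ::
  "('k::field_char_0 \<Rightarrow> 'v::ab_group_add \<Rightarrow> 'v) \<Rightarrow> (int \<Rightarrow> 'v set) \<Rightarrow> 'v set \<Rightarrow> ('v, 'k) series \<Rightarrow> bool"
where
  "minimal scale V B \<Gamma> \<longleftrightarrow> lie1bi scale V B \<Gamma> \<and> (\<forall>w. length w < 3 \<longrightarrow> \<Gamma> w = 0)"


section \<open>Morphisms\<close>

text \<open>
  A formal map \<open>F\<close> from the manifold of \<open>(V, B)\<close> to that of \<open>(V', B')\<close> is given by the pullbacks
  \<open>F x\<close> of the coordinates \<open>x\<close> of the target. It is required to map \<open>L\<close> to \<open>L'\<close> and \<open>\<Pi>L\<close> to \<open>\<Pi>L'\<close>,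
  hence the distinguished point to the distinguished point. The family of all \<open>F (Tc b')\<close> encodes
  linear maps from symmetric powers of \<open>V\<close> to exterior powers of \<open>V\<close> tensored with \<open>V'\<close>; hence
  the last clause, which again is automatic in finite dimensions. For the \<open>F (Chi b')\<close>, which encode
  linear maps defined on symmetric powers of \<open>V\<close> tensored with \<open>V'\<close>, the condition in
  \<open>is_function\<close> is all that is needed.
\<close>

definition formal_map ::
  "(int \<Rightarrow> 'v set) \<Rightarrow> 'v set \<Rightarrow> (int \<Rightarrow> 'w set) \<Rightarrow> 'w set \<Rightarrow>
     ('w coord \<Rightarrow> ('v, 'k::field_char_0) series) \<Rightarrow> bool" where
  "formal_map V B V' B' F \<longleftrightarrow>
     (\<forall>x\<in>coords B'. is_function V B (F x) \<and> has_degree V (cdeg V' x) (F x)) \<and>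
     (\<forall>b\<in>B'. vanishes_on_L (F (Tc b))) \<and>
     (\<forall>b\<in>B'. vanishes_on_PiL (F (Chi b))) \<and>
     (\<forall>as m. finite {(b, bs). b \<in> B' \<and> length bs = m \<and> F (Tc b) (map Tc as @ map Chi bs) \<noteq> 0})"

text \<open>Pullback of a function along \<open>F\<close>: substitution of the \<open>F x\<close> into the power series.\<close>

definition pullback ::
  "(int \<Rightarrow> 'v set) \<Rightarrow> 'w set \<Rightarrow> ('w coord \<Rightarrow> ('v, 'k::field_char_0) series) \<Rightarrow>
     ('w, 'k) series \<Rightarrow> ('v, 'k) series" where
  "pullback V B' F f = (\<lambda>w. lfsum (lists (coords B')) (\<lambda>u.
     f u / of_nat (fact (length u)) * fprod V (map F u) w))"

text \<open>
  A 2-form is represented by its coefficients \<open>\<Omega> x y\<close>, the form being \<open>1/2 \<Sum> dx (\<Omega> x y) dy\<close>.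
  With \<open>df = \<Sum> dx dL x f\<close> and \<open>dg = \<Sum> (dR y g) dy\<close> one has
  \<open>df \<and> dg = \<Sum> dx (dL x f) (dR y g) dy\<close>; the second term below is the graded
  antisymmetrisation. Its sign is the correct one when \<open>|f| + |g|\<close> is odd, which is the only
  case used: then \<open>dx h dy = - (-1)\<^bsup>|x||y|\<^esup> dy h dx\<close> for \<open>h\<close> of parity \<open>1 + |x| + |y|\<close>.
\<close>

definition d_wedge_d ::
  "(int \<Rightarrow> 'v set) \<Rightarrow> ('v, 'k::field_char_0) series \<Rightarrow> ('v, 'k) series \<Rightarrow>
     'v coord \<Rightarrow> 'v coord \<Rightarrow> ('v, 'k) series" where
  "d_wedge_d V f g x y = (\<lambda>w. fmul V (dL x f) (dR y g) w -
     ksign (cdeg V x) (cdeg V y) * fmul V (dL y f) (dR x g) w)"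

text \<open>The pullback \<open>\<Sum> d(F\<^sup>*t\<^sup>b) \<and> d(F\<^sup>*\<chi>\<^sub>b)\<close> of the symplectic form of the target, and the
  symplectic form itself.\<close>

definition pullback_omega ::
  "(int \<Rightarrow> 'v set) \<Rightarrow> 'w set \<Rightarrow> ('w coord \<Rightarrow> ('v, 'k::field_char_0) series) \<Rightarrow>
     'v coord \<Rightarrow> 'v coord \<Rightarrow> ('v, 'k) series" where
  "pullback_omega V B' F x y = (\<lambda>w. lfsum B' (\<lambda>b. d_wedge_d V (F (Tc b)) (F (Chi b)) x y w))"

definition omega ::
  "(int \<Rightarrow> 'v set) \<Rightarrow> 'v set \<Rightarrow> 'v coord \<Rightarrow> 'v coord \<Rightarrow> ('v, 'k::field_char_0) series" where
  "omega V B = pullback_omega V B coord_fun"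

definition lie1bi_morphism ::
  "(int \<Rightarrow> 'v set) \<Rightarrow> 'v set \<Rightarrow> ('v, 'k::field_char_0) series \<Rightarrow>
   (int \<Rightarrow> 'w set) \<Rightarrow> 'w set \<Rightarrow> ('w, 'k) series \<Rightarrow>
     ('w coord \<Rightarrow> ('v, 'k) series) \<Rightarrow> bool" where
  "lie1bi_morphism V B \<Gamma> V' B' \<Gamma>' F \<longleftrightarrow>
     formal_map V B V' B' F \<and>
     (\<forall>x\<in>coords B. \<forall>y\<in>coords B. pullback_omega V B' F x y = omega V B x y) \<and>
     pullback V B' F \<Gamma>' = \<Gamma>"

definition lie1bi_isomorphic ::
  "(int \<Rightarrow> 'v set) \<Rightarrow> 'v set \<Rightarrow> ('v, 'k::field_char_0) series \<Rightarrow>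
   (int \<Rightarrow> 'w set) \<Rightarrow> 'w set \<Rightarrow> ('w, 'k) series \<Rightarrow> bool" where
  "lie1bi_isomorphic V B \<Gamma> V' B' \<Gamma>' \<longleftrightarrow>
     (\<exists>F G. lie1bi_morphism V B \<Gamma> V' B' \<Gamma>' F \<and> lie1bi_morphism V' B' \<Gamma>' V B \<Gamma> G \<and>
        (\<forall>x\<in>coords B. pullback V B' F (G x) = coord_fun x) \<and>
        (\<forall>y\<in>coords B'. pullback V' B G (F y) = coord_fun y))"


section \<open>Tensor products\<close>

text \<open>The product of the manifolds is modelled on the direct sum \<open>V1 \<oplus> V2\<close> with the basis
  \<open>(b, 0)\<close>, \<open>(0, b)\<close>; in these coordinates its symplectic form is the sum of the two.\<close>

definition prod_space :: "(int \<Rightarrow> 'v set) \<Rightarrow> (int \<Rightarrow> 'w set) \<Rightarrow> int \<Rightarrow> ('v \<times> 'w) set" where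
  "prod_space V1 V2 i = V1 i \<times> V2 i"

definition prod_basis :: "'v::zero set \<Rightarrow> 'w::zero set \<Rightarrow> ('v \<times> 'w) set" where
  "prod_basis B1 B2 = (\<lambda>b. (b, 0)) ` B1 \<union> (\<lambda>b. (0, b)) ` B2"

text \<open>Pullbacks along the two projections: a function of some of the coordinates is regarded as a
  function of all of them.\<close>

definition pr1_pullback :: "('v, 'k::field_char_0) series \<Rightarrow> ('v \<times> 'w::zero, 'k) series" where
  "pr1_pullback f = (\<lambda>w. if set w \<subseteq> range (map_coord (\<lambda>b. (b, 0)))
     then f (map (map_coord fst) w) else 0)"

definition pr2_pullback :: "('w, 'k::field_char_0) series \<Rightarrow> ('v::zero \<times> 'w, 'k) series" where
  "pr2_pullback f = (\<lambda>w. if set w \<subseteq> range (map_coord (\<lambda>b. (0, b)))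
     then f (map (map_coord snd) w) else 0)"

definition tensor_fun ::
  "('v::zero, 'k::field_char_0) series \<Rightarrow> ('w::zero, 'k) series \<Rightarrow> ('v \<times> 'w, 'k) series" where
  "tensor_fun \<Gamma>1 \<Gamma>2 = (\<lambda>w. pr1_pullback \<Gamma>1 w + pr2_pullback \<Gamma>2 w)"

end

theory Submission
  imports Defs "HOL-Library.Multiset"
begin

text \<open>
  Split \<open>(V, d)\<close> as \<open>W \<oplus> d W \<oplus> H\<close> with \<open>d = 0\<close> on \<open>H\<close>, and let \<open>D = {\<Gamma>\<^sub>q\<^sub>u\<^sub>a\<^sub>d \<bullet> _}\<close>. The derivation \<open>h\<close> that inverts
  the identification of the coordinates on \<open>W\<close> and \<open>d W\<close> satisfies \<open>D h + h D = N\<close>, where \<open>N\<close> counts the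
  factors of a monomial that belong to the contractible part. Suppose that \<open>\<Gamma>\<close> agrees up to order \<open>n\<close> with
  \<open>exp(ad\<^sub>S) (\<Gamma>\<^sub>q\<^sub>u\<^sub>a\<^sub>d + \<gamma>)\<close>, where \<open>\<gamma>\<close> depends on the coordinates of \<open>H\<close> only, and let \<open>R\<close> be the difference
  in order \<open>n + 1\<close>. The equation \<open>{\<Gamma> \<bullet> \<Gamma>} = 0\<close> gives \<open>D R = 0\<close>, so \<open>R\<close> is the sum of its \<open>H\<close>-part and
  \<open>D h (R/N)\<close>: adding the former to \<open>\<gamma>\<close> and \<open>- h (R/N)\<close> to \<open>S\<close> improves the agreement by one order. In the limit
  one obtains a Hamiltonian flow \<open>exp(ad\<^sub>S)\<close>, a Poisson automorphism, that takes \<open>\<Gamma>\<^sub>q\<^sub>u\<^sub>a\<^sub>d + \<gamma>\<close> to \<open>\<Gamma>\<close>.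

  A continuous isomorphism \<open>\<phi>\<close> of Poisson algebras is the pullback along the formal map with components
  \<open>\<phi> x\<close>, \<open>x\<close> a coordinate, by Taylor expansion, and it preserves the symplectic form. So the linear
  change of basis and the flow may be composed as maps of algebras, and no composition of
  formal maps is needed.
\<close>


section \<open>Sums with finite support\<close>

text \<open>Two obstacles shape the proof. First, \<open>V\<close> may be infinite-dimensional: a
  function has infinitely many inputs but only finitely many outputs for each of them, so the
  bracket is an infinite contraction, and sums may be exchanged only under joint finiteness. The
  finiteness clause is therefore carried along for whole families; in every contraction the
  derivative by a \<chi> supplies it. Second, signs: \<open>S\<close> has degree 1 and the bracket
  degree -1, so \<open>ad_S\<close> is an even derivation of both products.

  Why \<open>D R = 0\<close>: in order n + 1 the equation for \<Gamma> reads
  \<open>2 D R + {\<gamma> \<bullet> \<gamma>} = 0\<close>. Every monomial of \<open>D R\<close>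
  contains a contractible coordinate and none of \<open>{\<gamma> \<bullet> \<gamma>}\<close> does,
  so both terms vanish. Hence the master equation for \<gamma> is not carried through the induction;
  it is recovered at the end by applying \<open>exp(- ad_S)\<close> to that of \<Gamma>. The
  operator \<open>h\<close> lowers the degree by one and respects the order and the vanishing on
  both Lagrangians, so each correction of \<open>S\<close> again generates an admissible flow.
  Characteristic 0 enters through \<open>N\<close>, the factor 2 and the factorials.\<close>

lemma lfsum_eq_sum:
  assumes "finite F" "F \<subseteq> A" "\<And>i. i \<in> A \<Longrightarrow> i \<notin> F \<Longrightarrow> h i = 0"
  shows "lfsum A h = sum h F"
  unfolding lfsum_def
proof (rule sum.mono_neutral_cong_left)
  show "{i \<in> A. h i \<noteq> 0} \<subseteq> F" using assms(3) by blast
qed (use assms in auto)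

lemma lfsum_cong:
  assumes "\<And>i. i \<in> A \<Longrightarrow> h i = h' i"
  shows "lfsum A h = lfsum A h'"
proof -
  have "{i \<in> A. h i \<noteq> 0} = {i \<in> A. h' i \<noteq> 0}" using assms by auto
  thus ?thesis unfolding lfsum_def using assms by (auto intro: sum.cong)
qed

lemma lfsum_zero [simp]: "lfsum A (\<lambda>i. 0) = 0"
  by (simp add: lfsum_def)

lemma lfsum_nonzeroD: "lfsum A h \<noteq> 0 \<Longrightarrow> \<exists>i\<in>A. h i \<noteq> 0"
  unfolding lfsum_def by (metis (mono_tags, lifting) mem_Collect_eq sum.not_neutral_contains_not_neutral)

lemma lfsum_finite: "finite A \<Longrightarrow> lfsum A h = sum h A"
  by (rule lfsum_eq_sum) auto

lemma lfsum_add: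
  fixes h h' :: "'i \<Rightarrow> 'k::ab_group_add"
  assumes "finite {i \<in> A. h i \<noteq> 0}" "finite {i \<in> A. h' i \<noteq> 0}"
  shows "lfsum A (\<lambda>i. h i + h' i) = lfsum A h + lfsum A h'"
proof -
  let ?F = "{i \<in> A. h i \<noteq> 0} \<union> {i \<in> A. h' i \<noteq> 0}"
  have "lfsum A (\<lambda>i. h i + h' i) = sum (\<lambda>i. h i + h' i) ?F" "lfsum A h = sum h ?F" "lfsum A h' = sum h' ?F"
    using assms by (auto intro!: lfsum_eq_sum)
  thus ?thesis by (simp add: sum.distrib)
qed

lemma lfsum_cmult:
  fixes h :: "'i \<Rightarrow> 'k::field"
  shows "lfsum A (\<lambda>i. c * h i) = c * lfsum A h"
proof (cases "c = 0")
  case False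
  hence "{i \<in> A. c * h i \<noteq> 0} = {i \<in> A. h i \<noteq> 0}" by auto
  thus ?thesis by (simp add: lfsum_def sum_distrib_left)
qed (simp add: lfsum_def)

lemma lfsum_uminus:
  fixes h :: "'i \<Rightarrow> 'k::field"
  shows "lfsum A (\<lambda>i. - h i) = - lfsum A h"
  using lfsum_cmult[of A "-1" h] by simp

lemma lfsum_diff:
  fixes h h' :: "'i \<Rightarrow> 'k::field"
  assumes "finite {i \<in> A. h i \<noteq> 0}" "finite {i \<in> A. h' i \<noteq> 0}"
  shows "lfsum A (\<lambda>i. h i - h' i) = lfsum A h - lfsum A h'"
  using lfsum_add[of A h "\<lambda>i. - h' i"] assms by (simp add: lfsum_uminus)

lemma lfsum_reindex:
  assumes "inj_on r A"
  shows "lfsum (r ` A) h = lfsum A (\<lambda>i. h (r i))"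
proof -
  have "{i \<in> r ` A. h i \<noteq> 0} = r ` {i \<in> A. h (r i) \<noteq> 0}" by auto
  moreover have "inj_on r {i \<in> A. h (r i) \<noteq> 0}" using assms by (auto simp: inj_on_def)
  ultimately show ?thesis by (simp add: lfsum_def sum.reindex)
qed

lemma lfsum_superset:
  assumes "A \<subseteq> A'" "\<And>i. i \<in> A' \<Longrightarrow> i \<notin> A \<Longrightarrow> h i = 0"
  shows "lfsum A' h = lfsum A h"
proof -
  have "{i \<in> A'. h i \<noteq> 0} = {i \<in> A. h i \<noteq> 0}" using assms by auto
  thus ?thesis by (simp add: lfsum_def)
qed

lemma lfsum_Un:
  fixes h :: "'i \<Rightarrow> 'k::field"
  assumes "A \<inter> A' = {}" "finite {i \<in> A. h i \<noteq> 0}" "finite {i \<in> A'. h i \<noteq> 0}"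
  shows "lfsum (A \<union> A') h = lfsum A h + lfsum A' h"
proof -
  have "{i \<in> A \<union> A'. h i \<noteq> 0} = {i \<in> A. h i \<noteq> 0} \<union> {i \<in> A'. h i \<noteq> 0}" by auto
  thus ?thesis using assms by (simp add: lfsum_def) (subst sum.union_disjoint; auto)
qed

lemma lfsum_single:
  assumes "j \<in> A"
  shows "lfsum A (\<lambda>i. if i = j then h i else 0) = h j"
proof -
  have "lfsum A (\<lambda>i. if i = j then h i else 0) = sum (\<lambda>i. if i = j then h i else 0) {j}"
    using assms by (intro lfsum_eq_sum) auto
  thus ?thesis by simp
qed

lemma lfsum_Times:
  fixes h :: "'i \<Rightarrow> 'j \<Rightarrow> 'k::field"
  assumes "finite {(i, j). i \<in> A \<and> j \<in> B \<and> h i j \<noteq> 0}"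
  shows "lfsum A (\<lambda>i. lfsum B (h i)) = lfsum (A \<times> B) (\<lambda>(i, j). h i j)"
proof -
  let ?P = "{(i, j). i \<in> A \<and> j \<in> B \<and> h i j \<noteq> 0}"
  let ?FA = "fst ` ?P" and ?FB = "snd ` ?P"
  have fin: "finite ?FA" "finite ?FB" using assms by auto
  have mem: "i \<in> ?FA" "j \<in> ?FB" if "i \<in> A" "j \<in> B" "h i j \<noteq> 0" for i j
    using that by force+
  have inner: "lfsum B (h i) = sum (h i) ?FB" if "i \<in> A" for i
    using fin that mem by (intro lfsum_eq_sum) auto
  have "lfsum A (\<lambda>i. lfsum B (h i)) = lfsum A (\<lambda>i. sum (h i) ?FB)"
    by (rule lfsum_cong) (simp add: inner)
  also have "\<dots> = (\<Sum>i\<in>?FA. sum (h i) ?FB)"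
  proof (rule lfsum_eq_sum)
    show "?FA \<subseteq> A" by auto
    fix i assume "i \<in> A" "i \<notin> ?FA"
    thus "sum (h i) ?FB = 0" by (intro sum.neutral) (use mem in auto)
  qed (rule fin)
  also have "\<dots> = sum (\<lambda>(i, j). h i j) (?FA \<times> ?FB)" by (simp add: sum.cartesian_product)
  also have "\<dots> = lfsum (A \<times> B) (\<lambda>(i, j). h i j)"
  proof (rule lfsum_eq_sum[symmetric])
    show "finite (?FA \<times> ?FB)" using fin by simp
    show "?FA \<times> ?FB \<subseteq> A \<times> B" by auto
    fix p assume "p \<in> A \<times> B" "p \<notin> ?FA \<times> ?FB"
    then obtain i j where "p = (i, j)" "i \<in> A" "j \<in> B" "\<not> (i \<in> ?FA \<and> j \<in> ?FB)" by blast
    thus "(case p of (i, j) \<Rightarrow> h i j) = 0" using mem[of i j] by auto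
  qed
  finally show ?thesis .
qed

text \<open>Joint finiteness of the support is essential: with finite rows and columns only,
  cancellations can make the two iterated sums differ (take 1 on the diagonal and -1 next to
  it).\<close>

lemma lfsum_swap:
  fixes h :: "'i \<Rightarrow> 'j \<Rightarrow> 'k::field"
  assumes "finite {(i, j). i \<in> A \<and> j \<in> B \<and> h i j \<noteq> 0}"
  shows "lfsum A (\<lambda>i. lfsum B (h i)) = lfsum B (\<lambda>j. lfsum A (\<lambda>i. h i j))"
proof -
  have sw: "{(j, i). j \<in> B \<and> i \<in> A \<and> h i j \<noteq> 0} = prod.swap ` {(i, j). i \<in> A \<and> j \<in> B \<and> h i j \<noteq> 0}"
    by force
  have "lfsum B (\<lambda>j. lfsum A (\<lambda>i. h i j)) = lfsum (B \<times> A) (\<lambda>(j, i). h i j)"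
    using assms by (intro lfsum_Times) (simp add: sw)
  also have "B \<times> A = prod.swap ` (A \<times> B)" by force
  also have "lfsum \<dots> (\<lambda>(j, i). h i j) = lfsum (A \<times> B) (\<lambda>p. case prod.swap p of (j, i) \<Rightarrow> h i j)"
    by (rule lfsum_reindex) simp
  also have "\<dots> = lfsum (A \<times> B) (\<lambda>(i, j). h i j)" by (rule lfsum_cong) auto
  finally show ?thesis using lfsum_Times[OF assms] by simp
qed


section \<open>The algebra of functions\<close>

lemma ksign_add_right: "ksign p (q + r) = ksign p q * ksign p r"
  by (auto simp: ksign_def)

lemma ksign_add_left: "ksign (p + q) r = ksign p r * ksign q r"
  by (auto simp: ksign_def)

lemma ksign_commute: "ksign p q = ksign q p"
  by (auto simp: ksign_def)

lemma ksign_square [simp]: "ksign p q * ksign p q = 1"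
  by (auto simp: ksign_def)

lemma ksign_square_left [simp]: "ksign p q * (ksign p q * c) = c"
  by (auto simp: ksign_def)

lemma ksign_zero [simp]: "ksign p 0 = 1" "ksign 0 p = 1"
  by (auto simp: ksign_def)

lemma ksign_nonzero [simp]: "ksign p q \<noteq> (0::'k::ring_char_0)"
  by (auto simp: ksign_def)

definition wdeg :: "(int \<Rightarrow> 'v set) \<Rightarrow> 'v coord list \<Rightarrow> int" where
  "wdeg V w = sum_list (map (cdeg V) w)"

lemma wdeg_simps [simp]: "wdeg V [] = 0" "wdeg V (x # w) = cdeg V x + wdeg V w"
  "wdeg V (u @ w) = wdeg V u + wdeg V w"
  by (auto simp: wdeg_def)

text \<open>The sign that arises when an object of degree \<open>p\<close> is moved past \<open>f\<close>. With this twist the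
  product rules hold for inhomogeneous \<open>f\<close> as well.\<close>

definition tw :: "(int \<Rightarrow> 'v set) \<Rightarrow> int \<Rightarrow> ('v, 'k::field_char_0) series \<Rightarrow> ('v, 'k) series" where
  "tw V p f = (\<lambda>w. ksign p (wdeg V w) * f w)"

lemma dL_tw: "dL x (tw V p f) = (\<lambda>w. ksign p (cdeg V x) * tw V p (dL x f) w)"
  by (auto simp: dL_def tw_def ksign_add_right mult_ac)

lemma dR_tw: "dR x (tw V p f) = (\<lambda>w. ksign p (cdeg V x) * tw V p (dR x f) w)"
  by (auto simp: dR_def tw_def ksign_add_right mult_ac)

lemma tw_tw: "tw V p (tw V q f) = tw V (p + q) f"
  by (auto simp: tw_def ksign_add_left mult_ac)

lemma tw_even: "even p \<Longrightarrow> tw V p f = f"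
  by (auto simp: tw_def ksign_def)

lemma tw_cong: "even (p - q) \<Longrightarrow> tw V p f = tw V q f"
  by (auto simp: tw_def ksign_def)

lemma dL_mult: "dL x (\<lambda>w. c * f w) = (\<lambda>w. c * dL x f w)"
  by (auto simp: dL_def)

lemma dL_dR: "dL x (dR y f) = dR y (dL x f)"
  by (auto simp: dL_def dR_def)

lemma shuffle_sign_Nil [simp]: "shuffle_sign V [] S = 1"
  by (simp add: shuffle_sign_def)

lemma finite_index_pairs: "finite {(i, j). i < j \<and> j < (n::nat) \<and> P i j}"
  by (rule finite_subset[of _ "{..<n} \<times> {..<n}"]) auto

lemma prod_ksign_nths:
  "(\<Prod>j\<in>{j. j < length w \<and> j \<in> S}. ksign p (cdeg V (w ! j))) = (ksign p (wdeg V (nths w S)) :: 'k::field_char_0)"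
proof (induction w arbitrary: S)
  case (Cons x w)
  let ?S' = "{j. Suc j \<in> S}"
  have "{j. j < length (x # w) \<and> j \<in> S} = (if 0 \<in> S then {0} else {}) \<union> Suc ` {j. j < length w \<and> j \<in> ?S'}"
    (is "?L = ?A \<union> ?R")
    by (auto simp: less_Suc_eq_0_disj split: if_splits)
  moreover have "?A \<inter> ?R = {}" by auto
  moreover have "(\<Prod>j\<in>?R. ksign p (cdeg V ((x # w) ! j))) = (ksign p (wdeg V (nths w ?S')) :: 'k)"
    using Cons.IH[of ?S'] by (subst prod.reindex) auto
  ultimately have "(\<Prod>j\<in>?L. ksign p (cdeg V ((x # w) ! j)))
     = (\<Prod>j\<in>?A. ksign p (cdeg V ((x # w) ! j))) * (ksign p (wdeg V (nths w ?S')) :: 'k)"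
    by (simp add: prod.union_disjoint)
  thus ?case by (auto simp: nths_Cons ksign_add_right)
qed simp

text \<open>A selected first letter creates no inversion; an unselected one is overtaken by every
  selected letter of the tail, and the degrees of these add up inside one sign.\<close>

lemma shuffle_sign_Cons:
  "(shuffle_sign V (x # w) S :: 'k::field_char_0) =
    (if 0 \<in> S then 1 else ksign (cdeg V x) (wdeg V (nths w {j. Suc j \<in> S}))) * shuffle_sign V w {j. Suc j \<in> S}"
proof -
  let ?S' = "{j. Suc j \<in> S}"
  let ?A = "{(i, j). i < j \<and> j < length (x # w) \<and> i \<notin> S \<and> j \<in> S}"
  let ?B = "{(i, j). i < j \<and> j < length w \<and> i \<notin> ?S' \<and> j \<in> ?S'}"
  let ?Z = "if 0 \<in> S then {} else (\<lambda>j. (0::nat, Suc j)) ` {j. j < length w \<and> j \<in> ?S'}"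
  have A: "?A = ?Z \<union> map_prod Suc Suc ` ?B"
  proof (intro set_eqI iffI)
    fix p assume "p \<in> ?A"
    then obtain i j where p: "p = (i, j)" "i < j" "j < Suc (length w)" "i \<notin> S" "j \<in> S" by auto
    then obtain j' where j': "j = Suc j'" by (cases j) auto
    show "p \<in> ?Z \<union> map_prod Suc Suc ` ?B"
    proof (cases i)
      case 0
      thus ?thesis using p j' by auto
    next
      case (Suc i')
      hence "(i', j') \<in> ?B" using p j' by auto
      hence "map_prod Suc Suc (i', j') \<in> map_prod Suc Suc ` ?B" by (rule imageI)
      thus ?thesis using p Suc j' by simp
    qed
  qed (auto split: if_splits)
  have fin: "finite ?B" by (rule finite_index_pairs)
  have "(shuffle_sign V (x # w) S :: 'k) = (\<Prod>(i, j)\<in>?Z. ksign (cdeg V ((x # w) ! i)) (cdeg V ((x # w) ! j))) *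
     (\<Prod>(i, j)\<in>map_prod Suc Suc ` ?B. ksign (cdeg V ((x # w) ! i)) (cdeg V ((x # w) ! j)))"
    unfolding shuffle_sign_def A by (rule prod.union_disjoint) (use fin in \<open>auto split: if_splits\<close>)
  also have "(\<Prod>(i, j)\<in>map_prod Suc Suc ` ?B. ksign (cdeg V ((x # w) ! i)) (cdeg V ((x # w) ! j)) :: 'k)
     = shuffle_sign V w ?S'"
    unfolding shuffle_sign_def
    by (subst prod.reindex) (auto simp: inj_on_def intro!: prod.cong)
  also have "(\<Prod>(i, j)\<in>?Z. ksign (cdeg V ((x # w) ! i)) (cdeg V ((x # w) ! j)) :: 'k)
     = (if 0 \<in> S then 1 else ksign (cdeg V x) (wdeg V (nths w ?S')))"
    by (auto simp: prod.reindex inj_on_def prod_ksign_nths[symmetric])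
  finally show ?thesis .
qed

lemma fmul_Nil [simp]: "fmul V f g [] = f [] * g []"
  by (simp add: fmul_def)

text \<open>The graded Leibniz rule at the level of coefficients: the first letter belongs to the
  left factor or has to pass it. Most identities for products follow from it by induction on the
  word.\<close>

lemma fmul_Cons:
  "fmul V f g (x # w) = fmul V (dL x f) g w + fmul V (tw V (cdeg V x) f) (dL x g) w"
proof -
  let ?t = "\<lambda>S. shuffle_sign V (x # w) S * f (nths (x # w) S) * g (nths (x # w) (- S))"
  let ?P = "Pow {..<length w}"
  have P: "Pow {..<length (x # w)} = (\<lambda>S. insert 0 (Suc ` S)) ` ?P \<union> (\<lambda>S. Suc ` S) ` ?P"
  proof -
    have "{..<length (x # w)} = insert 0 (Suc ` {..<length w})"
      by (simp add: lessThan_Suc_eq_insert_0)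
    moreover have "Pow (Suc ` {..<length w}) = (\<lambda>S. Suc ` S) ` ?P"
      using image_Pow_surj[of Suc "{..<length w}"] by auto
    ultimately show ?thesis by (simp add: Pow_insert image_image Un_commute)
  qed
  have s1: "{j. Suc j \<in> insert 0 (Suc ` S)} = S" "{j. Suc j \<in> - insert 0 (Suc ` S)} = - S"
     "{j. Suc j \<in> Suc ` S} = S" "{j. Suc j \<in> - (Suc ` S)} = - S"
    "{j. Suc j \<notin> insert 0 (Suc ` S)} = - S" "{j. Suc j \<notin> Suc ` S} = - S"
    "0 \<notin> Suc ` S" for S by auto
  have i1: "inj_on (\<lambda>S. insert 0 (Suc ` S)) ?P" "inj_on (\<lambda>S. Suc ` S) ?P"
    by (intro inj_onI; metis s1(1,3))+
  have "fmul V f g (x # w) = (\<Sum>S\<in>(\<lambda>S. insert 0 (Suc ` S)) ` ?P. ?t S) + (\<Sum>S\<in>(\<lambda>S. Suc ` S) ` ?P. ?t S)"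
    unfolding fmul_def P by (rule sum.union_disjoint) auto
  also have "(\<Sum>S\<in>(\<lambda>S. insert 0 (Suc ` S)) ` ?P. ?t S) = fmul V (dL x f) g w"
    unfolding fmul_def by (subst sum.reindex[OF i1(1)])
      (auto simp: shuffle_sign_Cons nths_Cons s1 dL_def intro!: sum.cong)
  also have "(\<Sum>S\<in>(\<lambda>S. Suc ` S) ` ?P. ?t S) = fmul V (tw V (cdeg V x) f) (dL x g) w"
    unfolding fmul_def by (subst sum.reindex[OF i1(2)])
      (auto simp: shuffle_sign_Cons nths_Cons s1 dL_def tw_def mult_ac intro!: sum.cong)
  finally show ?thesis .
qed

lemma dL_fmul:
  "dL x (fmul V f g) = (\<lambda>w. fmul V (dL x f) g w + fmul V (tw V (cdeg V x) f) (dL x g) w)"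
  by (rule ext) (simp add: dL_def[of x "fmul V f g"] fmul_Cons)

lemma fmul_add_left: "fmul V (\<lambda>w. f w + f' w) g w = fmul V f g w + fmul V f' g w"
  by (simp add: fmul_def algebra_simps sum.distrib)

lemma fmul_add_right: "fmul V f (\<lambda>w. g w + g' w) w = fmul V f g w + fmul V f g' w"
  by (simp add: fmul_def algebra_simps sum.distrib)

lemma fmul_mult_left: "fmul V (\<lambda>w. c * f w) g w = c * fmul V f g w"
  by (simp add: fmul_def algebra_simps sum_distrib_left)

lemma fmul_mult_right: "fmul V f (\<lambda>w. c * g w) w = c * fmul V f g w"
  by (simp add: fmul_def algebra_simps sum_distrib_left)

lemma fmul_zero [simp]: "fmul V (\<lambda>w. 0) g w = 0" "fmul V f (\<lambda>w. 0) w = 0"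
  by (simp_all add: fmul_def)

text \<open>Degrees of words add, so moving past a product means moving past both factors.\<close>

lemma tw_fmul:
  fixes f g :: "('v, 'k::field_char_0) series"
  shows "tw V p (fmul V f g) = fmul V (tw V p f) (tw V p g)"
proof (rule ext)
  fix w show "tw V p (fmul V f g) w = fmul V (tw V p f) (tw V p g) w"
  proof (induction w arbitrary: f g)
    case Nil
    show ?case by (simp add: tw_def)
  next
    case (Cons x w)
    have IH: "ksign p (wdeg V w) * fmul V f g w = fmul V (tw V p f) (tw V p g) w" for f g :: "('v, 'k) series"
      using Cons.IH[of f g] by (simp add: tw_def)
    show ?case
      by (simp add: tw_def[of V p "fmul V f g"] fmul_Cons ksign_add_right dL_tw fmul_mult_left
          fmul_mult_right IH tw_tw add.commute distrib_left mult.assoc)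
  qed
qed

lemma fmul_assoc: "fmul V (fmul V f g) h = fmul V f (fmul V g h)"
proof (rule ext)
  fix w show "fmul V (fmul V f g) h w = fmul V f (fmul V g h) w"
    by (induction w arbitrary: f g h)
      (simp_all add: fmul_Cons dL_fmul fmul_add_left fmul_add_right tw_fmul)
qed

lemma fmul_fone: "fmul V fone f = f" "fmul V f fone = f"
proof -
  have d: "dL x fone = (\<lambda>w. 0)" "tw V p fone = fone" for x p
    by (auto simp: dL_def fone_def tw_def)
  have "fmul V fone f w = f w \<and> fmul V f fone w = f w" for w
    by (induction w arbitrary: f) (simp_all add: fmul_Cons d, simp_all add: fone_def dL_def)
  thus "fmul V fone f = f" "fmul V f fone = f" by auto
qed

lemma dR_fmul:
  "dR x (fmul V f g) = (\<lambda>w. fmul V f (dR x g) w + fmul V (dR x f) (tw V (cdeg V x) g) w)"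
proof (rule ext)
  fix w
  have "fmul V f g (w @ [x]) = fmul V f (dR x g) w + fmul V (dR x f) (tw V (cdeg V x) g) w"
  proof (induction w arbitrary: f g)
    case Nil
    show ?case by (simp add: fmul_Cons) (simp add: dL_def dR_def tw_def)
  next
    case (Cons a w)
    show ?case
      by (simp add: fmul_Cons Cons.IH dL_dR dR_tw dL_tw fmul_mult_left fmul_mult_right ksign_commute)
  qed
  thus "dR x (fmul V f g) w = fmul V f (dR x g) w + fmul V (dR x f) (tw V (cdeg V x) g) w"
    by (simp add: dR_def[of x "fmul V f g"])
qed

definition has_parity :: "(int \<Rightarrow> 'v set) \<Rightarrow> int \<Rightarrow> ('v, 'k::field_char_0) series \<Rightarrow> bool" where
  "has_parity V p f \<longleftrightarrow> (\<forall>w. f w \<noteq> 0 \<longrightarrow> even (wdeg V w - p))"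

lemma has_degree_parity: "has_degree V p f \<Longrightarrow> has_parity V p f"
  by (auto simp: has_degree_def has_parity_def wdeg_def)

lemma has_parity_dL:
  assumes "has_parity V p f"
  shows "has_parity V (p - cdeg V x) (dL x f)"
  unfolding has_parity_def dL_def
proof (intro allI impI)
  fix w assume "f (x # w) \<noteq> 0"
  hence "even (wdeg V (x # w) - p)" using assms unfolding has_parity_def by blast
  thus "even (wdeg V w - (p - cdeg V x))" by (simp add: algebra_simps)
qed

lemma has_parity_dR:
  assumes "has_parity V p f"
  shows "has_parity V (p - cdeg V x) (dR x f)"
  unfolding has_parity_def dR_def
proof (intro allI impI)
  fix w assume "f (w @ [x]) \<noteq> 0"
  hence "even (wdeg V (w @ [x]) - p)" using assms unfolding has_parity_def by blast
  thus "even (wdeg V w - (p - cdeg V x))" by (simp add: algebra_simps)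
qed

lemma tw_parity:
  assumes "has_parity V p f"
  shows "tw V q f = (\<lambda>w. ksign q p * f w)"
proof (rule ext)
  fix w show "tw V q f w = ksign q p * f w"
  proof (cases "f w = 0")
    case False
    hence "even (wdeg V w - p)" using assms by (simp add: has_parity_def)
    thus ?thesis by (auto simp: tw_def ksign_def)
  qed (simp add: tw_def)
qed

text \<open>The sign is carried by \<open>tw\<close> on the other factor, which may therefore be
  inhomogeneous.\<close>

lemma fmul_commute_parity:
  assumes "has_parity V p g"
  shows "fmul V g f = fmul V (tw V p f) g"
proof (rule ext)
  fix w show "fmul V g f w = fmul V (tw V p f) g w"
    using assms
  proof (induction w arbitrary: f g p)
    case Nil
    thus ?case by (simp add: tw_def mult.commute)
  next
    case (Cons x w)
    have "tw V (p - cdeg V x) f = tw V (cdeg V x + p) f" by (rule tw_cong) simp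
    hence "fmul V (dL x g) f w = fmul V (tw V (cdeg V x + p) f) (dL x g) w"
      using Cons.IH[OF has_parity_dL[OF Cons.prems]] by metis
    moreover have "fmul V (tw V (cdeg V x) g) (dL x f) w = ksign (cdeg V x) p * fmul V (tw V p (dL x f)) g w"
      using Cons.IH[OF Cons.prems] by (simp add: tw_parity[OF Cons.prems] fmul_mult_left)
    ultimately show ?case
      by (simp add: fmul_Cons dL_tw tw_tw fmul_mult_left ksign_commute)
  qed
qed

lemma has_degree_fmul:
  assumes "has_degree V p f" "has_degree V q g"
  shows "has_degree V (p + q) (fmul V f g)"
proof -
  have "wdeg V w = p + q" if "fmul V f g w \<noteq> 0" "has_degree V p f" "has_degree V q g" for w
    using that
  proof (induction w arbitrary: f g p q)
    case Nil
    hence "f [] \<noteq> 0" "g [] \<noteq> 0" by auto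
    hence "p = 0" "q = 0" using Nil unfolding has_degree_def by fastforce+
    thus ?case by simp
  next
    case (Cons x w)
    have d: "has_degree V (r - cdeg V x) (dL x h)" "has_degree V r (tw V s h)" if "has_degree V r h" for r s h
      using that unfolding has_degree_def dL_def tw_def by force+
    from Cons.prems(1) consider "fmul V (dL x f) g w \<noteq> 0" | "fmul V (tw V (cdeg V x) f) (dL x g) w \<noteq> 0"
      by (force simp: fmul_Cons)
    thus ?case
    proof cases
      case 1
      from Cons.IH[OF 1 d(1)[OF Cons.prems(2)] Cons.prems(3)] show ?thesis by simp
    next
      case 2
      from Cons.IH[OF 2 d(2)[OF Cons.prems(2)] d(1)[OF Cons.prems(3)]] show ?thesis by simp
    qed
  qed
  thus ?thesis using assms by (auto simp: has_degree_def wdeg_def)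
qed

text \<open>Discards the signs and keeps the supports: vanishing and finiteness statements pass to
  products in this way.\<close>

lemma fmul_support:
  assumes "fmul V f g w \<noteq> 0"
  shows "\<exists>u v. w \<in> shuffles u v \<and> f u \<noteq> 0 \<and> g v \<noteq> 0"
  using assms
proof (induction w arbitrary: f g)
  case Nil
  thus ?case by auto
next
  case (Cons x w)
  then consider "fmul V (dL x f) g w \<noteq> 0" | "fmul V (tw V (cdeg V x) f) (dL x g) w \<noteq> 0"
    by (force simp: fmul_Cons)
  thus ?case
  proof cases
    case 1
    from Cons.IH[OF 1] obtain u v where "w \<in> shuffles u v" "f (x # u) \<noteq> 0" "g v \<noteq> 0"
      by (auto simp: dL_def)
    thus ?thesis by (intro exI[of _ "x # u"] exI[of _ v]) (auto intro: Cons_in_shuffles_leftI)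
  next
    case 2
    from Cons.IH[OF 2] obtain u v where "w \<in> shuffles u v" "f u \<noteq> 0" "g (x # v) \<noteq> 0"
      by (auto simp: dL_def tw_def)
    thus ?thesis by (intro exI[of _ u] exI[of _ "x # v"]) (auto intro: Cons_in_shuffles_rightI)
  qed
qed

lemma finite_unshuffle: "finite {(u, v). w \<in> shuffles u v}"
proof -
  let ?L = "{u. set u \<subseteq> set w \<and> length u \<le> length w}"
  have "{(u, v). w \<in> shuffles u v} \<subseteq> ?L \<times> ?L"
    using set_shuffles length_shuffles by fastforce
  moreover have "finite ?L" by (rule finite_lists_length_le) simp
  ultimately show ?thesis by (meson finite_SigmaI finite_subset)
qed

text \<open>The symmetry clause of \<open>is_function\<close> on its own, since sign computations
  involve neither the support nor the finiteness clause.\<close>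

definition gsym :: "(int \<Rightarrow> 'v set) \<Rightarrow> ('v, 'k::field_char_0) series \<Rightarrow> bool" where
  "gsym V f \<longleftrightarrow> (\<forall>u x y w. f (u @ [x, y] @ w) = ksign (cdeg V x) (cdeg V y) * f (u @ [y, x] @ w))"

lemma gsymD: "gsym V f \<Longrightarrow> f (u @ x # y # w) = ksign (cdeg V x) (cdeg V y) * f (u @ y # x # w)"
  unfolding gsym_def by (metis append_Cons append_Nil)

lemma gsymI:
  assumes "\<And>u x y w. f (u @ x # y # w) = ksign (cdeg V x) (cdeg V y) * f (u @ y # x # w)"
  shows "gsym V f"
  unfolding gsym_def using assms by (metis append_Cons append_Nil)

lemma gsym_dL: "gsym V f \<Longrightarrow> gsym V (dL x f)"
  unfolding gsym_def dL_def by (metis append_Cons)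

lemma gsym_dR:
  assumes "gsym V f"
  shows "gsym V (dR x f)"
  unfolding gsym_def
proof (intro allI)
  fix u a b w
  show "dR x f (u @ [a, b] @ w) = ksign (cdeg V a) (cdeg V b) * dR x f (u @ [b, a] @ w)"
    using gsymD[OF assms, of u a b "w @ [x]"] by (simp add: dR_def)
qed

lemma gsym_tw:
  assumes "gsym V f"
  shows "gsym V (tw V p f)"
  unfolding gsym_def
proof (intro allI)
  fix u a b w
  show "tw V p f (u @ [a, b] @ w) = ksign (cdeg V a) (cdeg V b) * tw V p f (u @ [b, a] @ w)"
    using gsymD[OF assms, of u a b w] by (simp add: tw_def add.left_commute mult.left_commute)
qed

lemma dL_dL:
  assumes "gsym V f"
  shows "dL x (dL y f) = (\<lambda>w. ksign (cdeg V x) (cdeg V y) * dL y (dL x f) w)"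
proof (rule ext)
  fix w
  show "dL x (dL y f) w = ksign (cdeg V x) (cdeg V y) * dL y (dL x f) w"
    using gsymD[OF assms, of "[]" y x w] by (simp add: dL_def ksign_commute)
qed

lemma gsym_fmul:
  fixes f g :: "('v, 'k::field_char_0) series"
  assumes "gsym V f" "gsym V g"
  shows "gsym V (fmul V f g)"
proof -
  have "fmul V f g (u @ [x, y] @ w) = ksign (cdeg V x) (cdeg V y) * fmul V f g (u @ [y, x] @ w)" for u x y w
    using assms
  proof (induction u arbitrary: f g)
    case Nil
    let ?k = "ksign (cdeg V x) (cdeg V y) :: 'k"
    have k: "ksign (cdeg V y) (cdeg V x) = ?k" by (rule ksign_commute)
    have "dL y (dL x f) = (\<lambda>w. ?k * dL x (dL y f) w)" "dL y (dL x g) = (\<lambda>w. ?k * dL x (dL y g) w)"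
      using dL_dL[OF Nil(1), of y x] dL_dL[OF Nil(2), of y x] by (simp_all add: k)
    thus ?case
      by (simp add: fmul_Cons dL_tw fmul_mult_left fmul_mult_right tw_tw add.commute k distrib_left)
  next
    case (Cons a u)
    show ?case
      using Cons.IH[of "dL a f" g] Cons.IH[of "tw V (cdeg V a) f" "dL a g"] Cons.prems
      by (simp add: fmul_Cons gsym_dL gsym_tw distrib_left)
  qed
  thus ?thesis unfolding gsym_def by blast
qed

lemma gsym_move:
  assumes "gsym V f"
  shows "f (p @ x # u @ s) = ksign (cdeg V x) (wdeg V u) * f (p @ u @ x # s)"
proof (induction u arbitrary: p)
  case (Cons y u)
  have "f (p @ x # y # u @ s) = ksign (cdeg V x) (cdeg V y) * f ((p @ [y]) @ x # u @ s)"
    using gsymD[OF assms, of p x y "u @ s"] by simp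
  thus ?case using Cons.IH[of "p @ [y]"] by (simp add: ksign_add_right mult.assoc)
qed simp

lemma dR_eq_dL: "gsym V f \<Longrightarrow> dR x f = tw V (cdeg V x) (dL x f)"
  using gsym_move[of V f "[]" x _ "[]"] by (auto simp: dL_def dR_def tw_def)

lemma dL_eq_dR: "gsym V f \<Longrightarrow> dL x f = tw V (cdeg V x) (dR x f)"
  using gsym_move[of V f "[]" x _ "[]"] by (auto simp: dL_def dR_def tw_def)

lemma gsym_move_nonzero:
  assumes "gsym V f"
  shows "f (p @ x # u @ s) \<noteq> 0 \<longleftrightarrow> f (p @ u @ x # s) \<noteq> 0"
  using gsym_move[OF assms, of p x u s] by simp

text \<open>Koszul signs are units, so as far as nonvanishing is concerned letters may be permuted
  freely.\<close>

lemma gsym_permute: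
  assumes "gsym V f" "mset u = mset v"
  shows "f (p @ u) \<noteq> 0 \<longleftrightarrow> f (p @ v) \<noteq> 0"
  using assms(2)
proof (induction u arbitrary: v p)
  case (Cons x u)
  then obtain v1 v2 where v: "v = v1 @ x # v2"
    by (metis in_set_conv_decomp list.set_intros(1) set_mset_mset)
  hence "mset u = mset (v1 @ v2)" using Cons.prems by simp
  from Cons.IH[OF this, of "p @ [x]"] show ?case
    using gsym_move_nonzero[OF assms(1), of p x v1 v2] v by simp
qed simp


section \<open>Summable families of functions\<close>

text \<open>The condition of \<open>is_function\<close>, made uniform over an index set: for fixed inputs and a fixed
  number of outputs only finitely many members of the family contribute. Contractions and infinite
  sums are well behaved on such families only.\<close>

definition fam :: "(int \<Rightarrow> 'v set) \<Rightarrow> 'v set \<Rightarrow> 'i set \<Rightarrow> ('i \<Rightarrow> ('v, 'k::field_char_0) series) \<Rightarrow> bool" where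
  "fam V B I f \<longleftrightarrow>
     (\<forall>i\<in>I. gsym V (f i) \<and> (\<forall>w. \<not> set w \<subseteq> coords B \<longrightarrow> f i w = 0)) \<and>
     (\<forall>as m. finite {(i, bs). i \<in> I \<and> length bs = m \<and> f i (map Tc as @ map Chi bs) \<noteq> 0})"

lemma famI:
  assumes "\<And>i. i \<in> I \<Longrightarrow> gsym V (f i)" "\<And>i w. i \<in> I \<Longrightarrow> \<not> set w \<subseteq> coords B \<Longrightarrow> f i w = 0"
    "\<And>as m. finite {(i, bs). i \<in> I \<and> length bs = m \<and> f i (map Tc as @ map Chi bs) \<noteq> 0}"
  shows "fam V B I f"
  using assms by (auto simp: fam_def)

lemma fam_gsym: "fam V B I f \<Longrightarrow> i \<in> I \<Longrightarrow> gsym V (f i)"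
  by (simp add: fam_def)

lemma fam_outside: "fam V B I f \<Longrightarrow> i \<in> I \<Longrightarrow> \<not> set w \<subseteq> coords B \<Longrightarrow> f i w = 0"
  by (simp add: fam_def)

lemma fam_normal_finite:
  "fam V B I f \<Longrightarrow> finite {(i, bs). i \<in> I \<and> length bs = m \<and> f i (map Tc as @ map Chi bs) \<noteq> 0}"
  by (simp add: fam_def)

lemma fam_singleton: "fam V B {j} f \<longleftrightarrow> is_function V B (f j)"
proof -
  have "{(i, bs). i \<in> {j} \<and> length bs = m \<and> f i (map Tc as @ map Chi bs) \<noteq> 0}
     = Pair j ` {bs. length bs = m \<and> f j (map Tc as @ map Chi bs) \<noteq> 0}" for as m
    by auto
  hence "(\<forall>as m. finite {(i, bs). i \<in> {j} \<and> length bs = m \<and> f i (map Tc as @ map Chi bs) \<noteq> 0})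
     \<longleftrightarrow> (\<forall>as m. finite {bs. length bs = m \<and> f j (map Tc as @ map Chi bs) \<noteq> 0})"
    by (simp add: finite_image_iff inj_on_def)
  thus ?thesis unfolding fam_def is_function_def gsym_def by blast
qed

lemma fam_is_function: "fam V B I f \<Longrightarrow> i \<in> I \<Longrightarrow> is_function V B (f i)"
proof -
  assume f: "fam V B I f" and i: "i \<in> I"
  have "fam V B {i} f"
  proof (rule famI)
    fix as m
    show "finite {(j, bs). j \<in> {i} \<and> length bs = m \<and> f j (map Tc as @ map Chi bs) \<noteq> 0}"
      by (rule finite_subset[OF _ fam_normal_finite[OF f, of m as]])
        (use i in auto)
  qed (use f i in \<open>auto simp: fam_def\<close>)
  thus ?thesis by (simp add: fam_singleton)
qed

fun tcs :: "'v coord list \<Rightarrow> 'v list" where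
  "tcs [] = []" | "tcs (Tc a # w) = a # tcs w" | "tcs (Chi a # w) = tcs w"

fun chs :: "'v coord list \<Rightarrow> 'v list" where
  "chs [] = []" | "chs (Tc a # w) = chs w" | "chs (Chi a # w) = a # chs w"

lemma mset_tcs_chs: "mset w = mset (map Tc (tcs w) @ map Chi (chs w))"
  by (induction w rule: tcs.induct) auto

text \<open>Sorts a word into the normal order, inputs before outputs, in which the finiteness
  clause is phrased.\<close>

lemma gsym_tcs_chs: "gsym V f \<Longrightarrow> f w \<noteq> 0 \<longleftrightarrow> f (map Tc (tcs w) @ map Chi (chs w)) \<noteq> 0"
  using gsym_permute[of V f w _ "[]"] mset_tcs_chs[of w] by (metis append_Nil)

text \<open>Sorting the fixed letters \<open>u\<close> and \<open>v\<close> gives fixed inputs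
  \<open>as\<close> and a fixed initial segment \<open>cs\<close> of the outputs, so the free
  outputs \<open>bs\<close> form the rest of an output word of known length.\<close>

lemma fam_finite:
  assumes "fam V B I f"
  shows "finite {(i, bs). i \<in> I \<and> length bs = m \<and> f i (u @ map Chi bs @ v) \<noteq> 0}"
proof -
  define as cs where "as = tcs (u @ v)" and "cs = chs (u @ v)"
  let ?F = "{(i, bs). i \<in> I \<and> length bs = length cs + m \<and> f i (map Tc as @ map Chi bs) \<noteq> 0}"
  have "{(i, bs). i \<in> I \<and> length bs = m \<and> f i (u @ map Chi bs @ v) \<noteq> 0}
      \<subseteq> (\<lambda>(i, bs). (i, drop (length cs) bs)) ` ?F"
  proof clarify
    fix i bs assume i: "i \<in> I" and nz: "f i (u @ map Chi bs @ v) \<noteq> 0"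
    have "mset (u @ map Chi bs @ v) = mset (u @ v) + mset (map Chi bs)" by simp
    also have "\<dots> = mset (map Tc as @ map Chi (cs @ bs))"
      unfolding as_def cs_def by (subst mset_tcs_chs) simp
    finally have "f i (map Tc as @ map Chi (cs @ bs)) \<noteq> 0"
      using nz gsym_permute[OF fam_gsym[OF assms i], of "u @ map Chi bs @ v" _ "[]"] by simp
    thus "(i, bs) \<in> (\<lambda>(i, bs). (i, drop (length cs) bs)) `
        {(i, bs'). i \<in> I \<and> length bs' = length cs + length bs \<and> f i (map Tc as @ map Chi bs') \<noteq> 0}"
      using i by (intro rev_image_eqI[of "(i, cs @ bs)"]) auto
  qed
  moreover have "finite ?F" using assms by (simp add: fam_def)
  ultimately show ?thesis by (meson finite_imageI finite_subset)
qed

text \<open>The case without free outputs: the family can be summed coefficient by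
  coefficient.\<close>

lemma fam_pointwise: "fam V B I f \<Longrightarrow> finite {i \<in> I. f i w \<noteq> 0}"
proof -
  assume "fam V B I f"
  from fam_finite[OF this, of 0 w "[]"]
  have "finite (fst ` {(i, bs). i \<in> I \<and> length bs = 0 \<and> f i (w @ map Chi bs @ []) \<noteq> 0})"
    by (rule finite_imageI)
  moreover have "{i \<in> I. f i w \<noteq> 0} \<subseteq> fst ` {(i, bs). i \<in> I \<and> length bs = 0 \<and> f i (w @ map Chi bs @ []) \<noteq> 0}"
    by force
  ultimately show ?thesis by (rule finite_subset[rotated])
qed

lemma fam_subset:
  assumes "fam V B I f" "J \<subseteq> I" "\<And>i. i \<in> J \<Longrightarrow> gsym V (g i)"
    "\<And>i w. i \<in> J \<Longrightarrow> g i w \<noteq> 0 \<Longrightarrow> f i w \<noteq> 0"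
  shows "fam V B J g"
proof (rule famI)
  fix i w assume "i \<in> J" "\<not> set w \<subseteq> coords B"
  thus "g i w = 0" using assms fam_outside[OF assms(1)] by (metis subsetD)
next
  fix as m
  show "finite {(i, bs). i \<in> J \<and> length bs = m \<and> g i (map Tc as @ map Chi bs) \<noteq> 0}"
    by (rule finite_subset[OF _ fam_normal_finite[OF assms(1), of m as]])
      (use assms in auto)
qed (use assms in auto)

lemma gsym_mult:
  assumes "gsym V f"
  shows "gsym V (\<lambda>w. c * f w)"
proof (rule gsymI)
  fix u x y w
  show "c * f (u @ x # y # w) = ksign (cdeg V x) (cdeg V y) * (c * f (u @ y # x # w))"
    using gsymD[OF assms, of u x y w] by simp
qed

lemma gsym_add:
  assumes "gsym V f" "gsym V g"
  shows "gsym V (\<lambda>w. f w + g w)"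
proof (rule gsymI)
  fix u x y w
  show "f (u @ x # y # w) + g (u @ x # y # w)
      = ksign (cdeg V x) (cdeg V y) * (f (u @ y # x # w) + g (u @ y # x # w))"
    using gsymD[OF assms(1), of u x y w] gsymD[OF assms(2), of u x y w] by (simp add: distrib_left)
qed

lemma gsym_lfsum:
  assumes "\<And>i. i \<in> I \<Longrightarrow> gsym V (f i)"
  shows "gsym V (\<lambda>w. lfsum I (\<lambda>i. f i w))"
proof (rule gsymI)
  fix u x y w
  have "lfsum I (\<lambda>i. f i (u @ x # y # w)) = lfsum I (\<lambda>i. ksign (cdeg V x) (cdeg V y) * f i (u @ y # x # w))"
    by (intro lfsum_cong gsymD assms)
  thus "lfsum I (\<lambda>i. f i (u @ x # y # w)) = ksign (cdeg V x) (cdeg V y) * lfsum I (\<lambda>i. f i (u @ y # x # w))"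
    by (simp add: lfsum_cmult)
qed

lemma fam_mult: "fam V B I f \<Longrightarrow> fam V B I (\<lambda>i w. c i * f i w)"
  by (rule fam_subset) (auto intro: gsym_mult fam_gsym)

lemma tw_nonzero [simp]: "tw V p f w \<noteq> 0 \<longleftrightarrow> f w \<noteq> 0"
  by (simp add: tw_def)

lemma fam_tw:
  assumes "fam V B I f"
  shows "fam V B I (\<lambda>i. tw V p (f i))"
  by (rule fam_subset[OF assms]) (use fam_gsym[OF assms] in \<open>auto intro: gsym_tw\<close>)

lemma fam_mono: "fam V B I f \<Longrightarrow> J \<subseteq> I \<Longrightarrow> fam V B J f"
  by (rule fam_subset) (auto intro: fam_gsym)

lemma fam_cong:
  assumes "fam V B I f" "\<And>i. i \<in> I \<Longrightarrow> f i = g i"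
  shows "fam V B I g"
  by (rule fam_subset[OF assms(1)]) (use fam_gsym[OF assms(1)] assms(2) in auto)

lemma fam_add:
  assumes "fam V B I f" "fam V B I g"
  shows "fam V B I (\<lambda>i w. f i w + g i w)"
proof (rule famI)
  fix as m
  have "finite ({(i, bs). i \<in> I \<and> length bs = m \<and> f i (map Tc as @ map Chi bs) \<noteq> 0} \<union>
     {(i, bs). i \<in> I \<and> length bs = m \<and> g i (map Tc as @ map Chi bs) \<noteq> 0})"
    using assms by (simp add: fam_def)
  thus "finite {(i, bs). i \<in> I \<and> length bs = m \<and>
      f i (map Tc as @ map Chi bs) + g i (map Tc as @ map Chi bs) \<noteq> 0}"
    by (rule finite_subset[rotated]) auto
qed (use assms in \<open>auto simp: fam_outside intro: gsym_add fam_gsym\<close>)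

lemma fam_reindex:
  assumes "fam V B I f" "inj_on r J" "r ` J \<subseteq> I"
  shows "fam V B J (\<lambda>j. f (r j))"
proof (rule famI)
  fix as m
  let ?S = "{(j, bs). j \<in> J \<and> length bs = m \<and> f (r j) (map Tc as @ map Chi bs) \<noteq> 0}"
  have "(\<lambda>(j, bs). (r j, bs)) ` ?S \<subseteq> {(i, bs). i \<in> I \<and> length bs = m \<and> f i (map Tc as @ map Chi bs) \<noteq> 0}"
    using assms(3) by auto
  hence "finite ((\<lambda>(j, bs). (r j, bs)) ` ?S)"
    by (rule finite_subset[OF _ fam_normal_finite[OF assms(1)]])
  moreover have "inj_on (\<lambda>(j, bs). (r j, bs)) ?S" using assms(2) by (auto simp: inj_on_def)
  ultimately show "finite ?S" by (rule finite_imageD)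
qed (use assms in \<open>auto intro: fam_gsym fam_outside\<close>)

lemma fam_Un:
  assumes "fam V B I f" "fam V B J f"
  shows "fam V B (I \<union> J) f"
proof (rule famI)
  fix as m
  have "finite ({(i, bs). i \<in> I \<and> length bs = m \<and> f i (map Tc as @ map Chi bs) \<noteq> 0} \<union>
     {(i, bs). i \<in> J \<and> length bs = m \<and> f i (map Tc as @ map Chi bs) \<noteq> 0})"
    using assms by (simp add: fam_def)
  thus "finite {(i, bs). i \<in> I \<union> J \<and> length bs = m \<and> f i (map Tc as @ map Chi bs) \<noteq> 0}"
    by (rule finite_subset[rotated]) auto
qed (use assms in \<open>auto intro: fam_gsym fam_outside\<close>)

lemma fam_finite_index:
  assumes "finite I" "\<And>i. i \<in> I \<Longrightarrow> is_function V B (f i)"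
  shows "fam V B I f"
  using assms
proof (induction I rule: finite_induct)
  case (insert i I)
  have "fam V B ({i} \<union> I) f"
    by (rule fam_Un) (use insert in \<open>auto simp: fam_singleton\<close>)
  thus ?case by simp
qed (simp add: fam_def)

lemma fam_dL: "fam V B I f \<Longrightarrow> fam V B I (\<lambda>i. dL x (f i))"
proof (rule famI)
  fix as m
  assume f: "fam V B I f"
  show "finite {(i, bs). i \<in> I \<and> length bs = m \<and> dL x (f i) (map Tc as @ map Chi bs) \<noteq> 0}"
    using fam_finite[OF f, of m "x # map Tc as" "[]"] by (simp add: dL_def)
qed (auto simp: dL_def fam_outside intro: gsym_dL[unfolded dL_def] fam_gsym)

lemma fam_dR: "fam V B I f \<Longrightarrow> fam V B I (\<lambda>i. dR x (f i))"
proof (rule famI)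
  fix as m
  assume f: "fam V B I f"
  show "finite {(i, bs). i \<in> I \<and> length bs = m \<and> dR x (f i) (map Tc as @ map Chi bs) \<noteq> 0}"
    using fam_finite[OF f, of m "map Tc as" "[x]"] by (simp add: dR_def)
qed (auto simp: dR_def fam_outside intro: gsym_dR[unfolded dR_def] fam_gsym)

text \<open>Differentiating by \<chi> turns an output into an index, and for given inputs there are
  finitely many outputs. The derivatives by all \<open>Tc b\<close> do not form such a family in
  general, because inputs are unrestricted.\<close>

lemma fam_dL_Chi:
  assumes "fam V B I f"
  shows "fam V B (I \<times> B) (\<lambda>(i, b). dL (Chi b) (f i))"
proof (rule famI)
  fix as m
  let ?F = "{(i, bs). i \<in> I \<and> length bs = Suc m \<and> f i (map Tc as @ map Chi bs) \<noteq> 0}"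
  have "{(ib, bs). ib \<in> I \<times> B \<and> length bs = m \<and> (case ib of (i, b) \<Rightarrow> dL (Chi b) (f i)) (map Tc as @ map Chi bs) \<noteq> 0}
     \<subseteq> (\<lambda>(i, bs). ((i, hd bs), tl bs)) ` ?F"
  proof clarify
    fix i b bs
    assume i: "i \<in> I" and nz: "dL (Chi b) (f i) (map Tc as @ map Chi bs) \<noteq> 0"
    have "f i (map Tc as @ map Chi (b # bs)) \<noteq> 0"
      using nz gsym_move_nonzero[OF fam_gsym[OF assms i], of "[]" "Chi b" "map Tc as" "map Chi bs"]
      by (simp add: dL_def)
    thus "((i, b), bs) \<in> (\<lambda>(i, bs). ((i, hd bs), tl bs)) `
        {(i, bs'). i \<in> I \<and> length bs' = Suc (length bs) \<and> f i (map Tc as @ map Chi bs') \<noteq> 0}"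
      using i by (intro rev_image_eqI[of "(i, b # bs)"]) auto
  qed
  moreover have "finite ?F" using assms by (simp add: fam_def)
  ultimately show "finite {(ib, bs). ib \<in> I \<times> B \<and> length bs = m \<and>
      (case ib of (i, b) \<Rightarrow> dL (Chi b) (f i)) (map Tc as @ map Chi bs) \<noteq> 0}"
    by (meson finite_imageI finite_subset)
next
  fix p w assume "p \<in> I \<times> B" "\<not> set w \<subseteq> coords B"
  thus "(case p of (i, b) \<Rightarrow> dL (Chi b) (f i)) w = 0"
    using fam_outside[OF assms, of "fst p" "Chi (snd p) # w"] by (auto simp: dL_def)
qed (use fam_gsym[OF assms] in \<open>auto intro: gsym_dL\<close>)

lemma fam_dR_Chi:
  assumes "fam V B I f"
  shows "fam V B (I \<times> B) (\<lambda>(i, b). dR (Chi b) (f i))"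
proof (rule fam_subset[OF fam_dL_Chi[OF assms]])
  fix p w
  assume p: "p \<in> I \<times> B" and "(case p of (i, b) \<Rightarrow> dR (Chi b) (f i)) w \<noteq> 0"
  thus "(case p of (i, b) \<Rightarrow> dL (Chi b) (f i)) w \<noteq> 0"
    using gsym_move_nonzero[OF fam_gsym[OF assms], of "fst p" "[]" "Chi (snd p)" w "[]"]
    by (auto simp: dL_def dR_def)
qed (use fam_gsym[OF assms] in \<open>auto intro: gsym_dR\<close>)

lemma fam_lfsum:
  assumes "fam V B (I \<times> J) h"
  shows "fam V B I (\<lambda>i w. lfsum J (\<lambda>j. h (i, j) w))"
proof (rule famI)
  fix as m
  let ?F = "{(p, bs). p \<in> I \<times> J \<and> length bs = m \<and> h p (map Tc as @ map Chi bs) \<noteq> 0}"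
  have "{(i, bs). i \<in> I \<and> length bs = m \<and> lfsum J (\<lambda>j. h (i, j) (map Tc as @ map Chi bs)) \<noteq> 0}
     \<subseteq> (\<lambda>((i, j), bs). (i, bs)) ` ?F"
  proof clarify
    fix i bs assume i: "i \<in> I" and "lfsum J (\<lambda>j. h (i, j) (map Tc as @ map Chi bs)) \<noteq> 0"
    then obtain j where "j \<in> J" "h (i, j) (map Tc as @ map Chi bs) \<noteq> 0" by (auto dest: lfsum_nonzeroD)
    thus "(i, bs) \<in> (\<lambda>((i, j), bs). (i, bs)) `
        {(p, bs'). p \<in> I \<times> J \<and> length bs' = length bs \<and> h p (map Tc as @ map Chi bs') \<noteq> 0}"
      using i by (intro rev_image_eqI[of "((i, j), bs)"]) auto
  qed
  moreover have "finite ?F" using assms by (simp add: fam_def)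
  ultimately show "finite {(i, bs). i \<in> I \<and> length bs = m \<and>
      lfsum J (\<lambda>j. h (i, j) (map Tc as @ map Chi bs)) \<noteq> 0}"
    by (meson finite_imageI finite_subset)
next
  fix i w assume i: "i \<in> I" "\<not> set w \<subseteq> coords B"
  have "lfsum J (\<lambda>j. h (i, j) w) = lfsum J (\<lambda>j. 0)"
    by (rule lfsum_cong) (use i fam_outside[OF assms] in auto)
  thus "lfsum J (\<lambda>j. h (i, j) w) = 0" by simp
qed (use assms in \<open>auto intro!: gsym_lfsum fam_gsym\<close>)

lemma is_function_lfsum: "fam V B J h \<Longrightarrow> is_function V B (\<lambda>w. lfsum J (\<lambda>j. h j w))"
proof -
  assume "fam V B J h"
  hence "fam V B ({()} \<times> J) (\<lambda>p. h (snd p))" by (rule fam_reindex) (auto simp: inj_on_def)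
  from fam_lfsum[OF this] show ?thesis by (simp add: fam_singleton)
qed

lemma shuffles_append_cases:
  assumes "xs @ ys \<in> shuffles u v"
  shows "\<exists>u1 u2 v1 v2. u = u1 @ u2 \<and> v = v1 @ v2 \<and> xs \<in> shuffles u1 v1 \<and> ys \<in> shuffles u2 v2"
  using assms
proof (induction xs arbitrary: u v)
  case Nil
  thus ?case by (intro exI[of _ "[]"] exI[of _ u] exI[of _ v]) auto
next
  case (Cons x xs)
  from Cons.prems consider u' where "u = x # u'" "xs @ ys \<in> shuffles u' v"
    | v' where "v = x # v'" "xs @ ys \<in> shuffles u v'"
    by (auto simp: Cons_in_shuffles_iff neq_Nil_conv)
  thus ?case
  proof cases
    case 1
    from Cons.IH[OF 1(2)] obtain u1 u2 v1 v2 where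
      "u' = u1 @ u2" "v = v1 @ v2" "xs \<in> shuffles u1 v1" "ys \<in> shuffles u2 v2" by blast
    thus ?thesis using 1 by (intro exI[of _ "x # u1"] exI[of _ u2] exI[of _ v1] exI[of _ v2])
      (auto intro: Cons_in_shuffles_leftI)
  next
    case 2
    from Cons.IH[OF 2(2)] obtain u1 u2 v1 v2 where
      "u = u1 @ u2" "v' = v1 @ v2" "xs \<in> shuffles u1 v1" "ys \<in> shuffles u2 v2" by blast
    thus ?thesis using 2 by (intro exI[of _ u1] exI[of _ u2] exI[of _ "x # v1"] exI[of _ v2])
      (auto intro: Cons_in_shuffles_rightI)
  qed
qed

lemma map_shuffles_cases:
  assumes "map h xs \<in> shuffles u v"
  shows "\<exists>u' v'. u = map h u' \<and> v = map h v' \<and> xs \<in> shuffles u' v'"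
  using assms
proof (induction xs arbitrary: u v)
  case (Cons x xs)
  from Cons.prems consider u' where "u = h x # u'" "map h xs \<in> shuffles u' v"
    | v' where "v = h x # v'" "map h xs \<in> shuffles u v'"
    by (auto simp: Cons_in_shuffles_iff neq_Nil_conv)
  thus ?case
  proof cases
    case 1
    from Cons.IH[OF 1(2)] obtain u1 v1 where "u' = map h u1" "v = map h v1" "xs \<in> shuffles u1 v1" by blast
    thus ?thesis using 1 by (intro exI[of _ "x # u1"] exI[of _ v1]) (auto intro: Cons_in_shuffles_leftI)
  next
    case 2
    from Cons.IH[OF 2(2)] obtain u1 v1 where "u = map h u1" "v' = map h v1" "xs \<in> shuffles u1 v1" by blast
    thus ?thesis using 2 by (intro exI[of _ u1] exI[of _ "x # v1"]) (auto intro: Cons_in_shuffles_rightI)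
  qed
qed auto

text \<open>Subwords of a normally ordered word are normally ordered, so the finiteness clauses of
  the two factors apply directly.\<close>

lemma fmul_support_split:
  assumes "fmul V f g (map Tc as @ map Chi bs) \<noteq> 0"
  shows "\<exists>as1 as2 bs1 bs2. as \<in> shuffles as1 as2 \<and> bs \<in> shuffles bs1 bs2 \<and>
     f (map Tc as1 @ map Chi bs1) \<noteq> 0 \<and> g (map Tc as2 @ map Chi bs2) \<noteq> 0"
proof -
  obtain u v where uv: "map Tc as @ map Chi bs \<in> shuffles u v" "f u \<noteq> 0" "g v \<noteq> 0"
    using fmul_support[OF assms] by blast
  obtain u1 u2 v1 v2 where s: "u = u1 @ u2" "v = v1 @ v2" "map Tc as \<in> shuffles u1 v1" "map Chi bs \<in> shuffles u2 v2"
    using shuffles_append_cases[OF uv(1)] by blast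
  from map_shuffles_cases[OF s(3)] map_shuffles_cases[OF s(4)] show ?thesis using s uv by blast
qed

lemma finite_split:
  assumes "\<And>as m. finite {(j, bs). j \<in> J \<and> length bs = m \<and> G j as bs}"
    and "\<And>j as m. j \<in> J \<Longrightarrow> finite {(i, bs). i \<in> I j \<and> length bs = m \<and> F j i as bs}"
  shows "finite {((j, i), bs). j \<in> J \<and> i \<in> I j \<and> length bs = m \<and>
     (\<exists>as1 as2 bs1 bs2. as \<in> shuffles as1 as2 \<and> bs \<in> shuffles bs1 bs2 \<and> F j i as1 bs1 \<and> G j as2 bs2)}"
    (is "finite ?S")
proof -
  let ?U = "\<Union>(as1, as2)\<in>{(as1, as2). as \<in> shuffles as1 as2}. \<Union>m1\<in>{..m}. \<Union>m2\<in>{..m}.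
    \<Union>(j, bs2)\<in>{(j, bs). j \<in> J \<and> length bs = m2 \<and> G j as2 bs}.
    \<Union>(i, bs1)\<in>{(i, bs). i \<in> I j \<and> length bs = m1 \<and> F j i as1 bs}. Pair (j, i) ` shuffles bs1 bs2"
  have fin: "finite ?U"
    using assms by (auto intro!: finite_UN_I finite_unshuffle split: prod.splits)
  show ?thesis
  proof (rule finite_subset[OF _ fin], clarify)
    fix j i bs as1 as2 bs1 bs2
    assume *: "j \<in> J" "i \<in> I j" "m = length bs" "as \<in> shuffles as1 as2" "bs \<in> shuffles bs1 bs2"
      "F j i as1 bs1" "G j as2 bs2"
    hence "length bs1 \<le> length bs" "length bs2 \<le> length bs" using length_shuffles by fastforce+
    with * show "((j, i), bs) \<in> (\<Union>(as1, as2)\<in>{(as1, as2). as \<in> shuffles as1 as2}. \<Union>m1\<in>{..length bs}. \<Union>m2\<in>{..length bs}.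
    \<Union>(j, bs2)\<in>{(j, bs). j \<in> J \<and> length bs = m2 \<and> G j as2 bs}.
    \<Union>(i, bs1)\<in>{(i, bs). i \<in> I j \<and> length bs = m1 \<and> F j i as1 bs}. Pair (j, i) ` shuffles bs1 bs2)"
      by (simp add: Bex_def image_iff) blast
  qed
qed

lemma fam_fmul_left:
  assumes g: "fam V B J g" and f: "\<And>j. j \<in> J \<Longrightarrow> fam V B (I j) (f j)"
  shows "fam V B (Sigma J I) (\<lambda>(j, i). fmul V (f j i) (g j))"
proof (rule famI)
  fix as m
  show "finite {(p, bs). p \<in> Sigma J I \<and> length bs = m \<and> (case p of (j, i) \<Rightarrow> fmul V (f j i) (g j)) (map Tc as @ map Chi bs) \<noteq> 0}"
    by (rule finite_subset[OF _ finite_split[of J "\<lambda>j as bs. g j (map Tc as @ map Chi bs) \<noteq> 0" I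
            "\<lambda>j i as bs. f j i (map Tc as @ map Chi bs) \<noteq> 0" m as]])
      (use g f in \<open>auto simp: fam_def dest!: fmul_support_split\<close>)
next
  fix p w assume p: "p \<in> Sigma J I" and w: "\<not> set w \<subseteq> coords B"
  show "(case p of (j, i) \<Rightarrow> fmul V (f j i) (g j)) w = 0"
  proof (rule ccontr)
    assume "\<not> ?thesis"
    then obtain u v where "w \<in> shuffles u v" "f (fst p) (snd p) u \<noteq> 0" "g (fst p) v \<noteq> 0"
      using p by (auto dest: fmul_support)
    thus False using w p set_shuffles fam_outside[OF g, of "fst p" v] fam_outside[OF f, of "fst p" "snd p" u]
      by fastforce
  qed
qed (use fam_gsym[OF g] fam_gsym[OF f] in \<open>auto intro!: gsym_fmul\<close>)

lemma fam_fmul_right: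
  assumes g: "fam V B J g" and f: "\<And>j. j \<in> J \<Longrightarrow> fam V B (I j) (f j)"
  shows "fam V B (Sigma J I) (\<lambda>(j, i). fmul V (g j) (f j i))"
proof (rule famI)
  fix as m
  show "finite {(p, bs). p \<in> Sigma J I \<and> length bs = m \<and> (case p of (j, i) \<Rightarrow> fmul V (g j) (f j i)) (map Tc as @ map Chi bs) \<noteq> 0}"
  proof (rule finite_subset[OF _ finite_split[of J "\<lambda>j as bs. g j (map Tc as @ map Chi bs) \<noteq> 0" I
            "\<lambda>j i as bs. f j i (map Tc as @ map Chi bs) \<noteq> 0" m as]], goal_cases)
    case 1
    show ?case
      by (auto dest!: fmul_support_split) (metis shuffles_commutes)
  qed (use g f in \<open>auto simp: fam_def\<close>)
next
  fix p w assume p: "p \<in> Sigma J I" and w: "\<not> set w \<subseteq> coords B"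
  show "(case p of (j, i) \<Rightarrow> fmul V (g j) (f j i)) w = 0"
  proof (rule ccontr)
    assume "\<not> ?thesis"
    then obtain u v where "w \<in> shuffles u v" "g (fst p) u \<noteq> 0" "f (fst p) (snd p) v \<noteq> 0"
      using p by (auto dest: fmul_support)
    thus False using w p set_shuffles fam_outside[OF g, of "fst p" u] fam_outside[OF f, of "fst p" "snd p" v]
      by fastforce
  qed
qed (use fam_gsym[OF g] fam_gsym[OF f] in \<open>auto intro!: gsym_fmul\<close>)

lemma is_function_fmul: "is_function V B f \<Longrightarrow> is_function V B g \<Longrightarrow> is_function V B (fmul V f g)"
  using fam_fmul_left[of V B "{()}" "\<lambda>_. g" "\<lambda>_. {()}" "\<lambda>_ _. f"]
  by (auto simp: fam_singleton intro: fam_is_function dest: fam_is_function)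

lemma is_function_dL: "is_function V B f \<Longrightarrow> is_function V B (dL x f)"
  using fam_dL[of V B "{()}" "\<lambda>_. f"] by (simp add: fam_singleton)

lemma is_function_dR: "is_function V B f \<Longrightarrow> is_function V B (dR x f)"
  using fam_dR[of V B "{()}" "\<lambda>_. f"] by (simp add: fam_singleton)

lemma is_function_tw: "is_function V B f \<Longrightarrow> is_function V B (tw V p f)"
  using fam_tw[of V B "{()}" "\<lambda>_. f"] by (simp add: fam_singleton)

lemma is_function_mult: "is_function V B f \<Longrightarrow> is_function V B (\<lambda>w. c * f w)"
  using fam_mult[of V B "{()}" "\<lambda>_. f" "\<lambda>_. c"] by (simp add: fam_singleton)

lemma is_function_add: "is_function V B f \<Longrightarrow> is_function V B g \<Longrightarrow> is_function V B (\<lambda>w. f w + g w)"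
  using fam_add[of V B "{()}" "\<lambda>_. f" "\<lambda>_. g"] by (simp add: fam_singleton)

lemma is_function_gsym: "is_function V B f \<Longrightarrow> gsym V f"
  unfolding is_function_def gsym_def by blast

lemma is_function_outside: "is_function V B f \<Longrightarrow> \<not> set w \<subseteq> coords B \<Longrightarrow> f w = 0"
  by (simp add: is_function_def)

lemma fmul_lfsum_right:
  assumes "\<And>w. finite {i \<in> I. g i w \<noteq> 0}"
  shows "fmul V f (\<lambda>w. lfsum I (\<lambda>i. g i w)) w = lfsum I (\<lambda>i. fmul V f (g i) w)"
proof -
  let ?F = "\<Union>S\<in>Pow {..<length w}. {i \<in> I. g i (nths w (- S)) \<noteq> 0}"
  have fin: "finite ?F" using assms by auto
  have "lfsum I (\<lambda>i. fmul V f (g i) w) = (\<Sum>i\<in>?F. fmul V f (g i) w)"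
    by (rule lfsum_eq_sum) (use fin in \<open>auto simp: fmul_def intro!: sum.neutral\<close>)
  also have "\<dots> = (\<Sum>S\<in>Pow {..<length w}. \<Sum>i\<in>?F. shuffle_sign V w S * f (nths w S) * g i (nths w (- S)))"
    unfolding fmul_def by (rule sum.swap)
  also have "\<dots> = fmul V f (\<lambda>w. lfsum I (\<lambda>i. g i w)) w"
    unfolding fmul_def
  proof (rule sum.cong)
    fix S assume S: "S \<in> Pow {..<length w}"
    have "lfsum I (\<lambda>i. g i (nths w (- S))) = (\<Sum>i\<in>?F. g i (nths w (- S)))"
      by (rule lfsum_eq_sum) (use fin S in auto)
    thus "(\<Sum>i\<in>?F. shuffle_sign V w S * f (nths w S) * g i (nths w (- S)))
       = shuffle_sign V w S * f (nths w S) * lfsum I (\<lambda>i. g i (nths w (- S)))"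
      by (simp add: sum_distrib_left)
  qed simp
  finally show ?thesis by simp
qed

lemma fmul_lfsum_left:
  assumes "\<And>w. finite {i \<in> I. f i w \<noteq> 0}"
  shows "fmul V (\<lambda>w. lfsum I (\<lambda>i. f i w)) g w = lfsum I (\<lambda>i. fmul V (f i) g w)"
proof -
  let ?F = "\<Union>S\<in>Pow {..<length w}. {i \<in> I. f i (nths w S) \<noteq> 0}"
  have fin: "finite ?F" using assms by auto
  have "lfsum I (\<lambda>i. fmul V (f i) g w) = (\<Sum>i\<in>?F. fmul V (f i) g w)"
    by (rule lfsum_eq_sum) (use fin in \<open>auto simp: fmul_def intro!: sum.neutral\<close>)
  also have "\<dots> = (\<Sum>S\<in>Pow {..<length w}. \<Sum>i\<in>?F. shuffle_sign V w S * f i (nths w S) * g (nths w (- S)))"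
    unfolding fmul_def by (rule sum.swap)
  also have "\<dots> = fmul V (\<lambda>w. lfsum I (\<lambda>i. f i w)) g w"
    unfolding fmul_def
  proof (rule sum.cong)
    fix S assume S: "S \<in> Pow {..<length w}"
    have "lfsum I (\<lambda>i. f i (nths w S)) = (\<Sum>i\<in>?F. f i (nths w S))"
      by (rule lfsum_eq_sum) (use fin S in auto)
    thus "(\<Sum>i\<in>?F. shuffle_sign V w S * f i (nths w S) * g (nths w (- S)))
       = shuffle_sign V w S * lfsum I (\<lambda>i. f i (nths w S)) * g (nths w (- S))"
      by (simp add: sum_distrib_left sum_distrib_right)
  qed simp
  finally show ?thesis by simp
qed

lemma fmul_sum_left: "finite I \<Longrightarrow> fmul V (\<lambda>w. \<Sum>i\<in>I. f i w) g w = (\<Sum>i\<in>I. fmul V (f i) g w)"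
  using fmul_lfsum_left[of I f V g w] by (simp add: lfsum_finite)

lemma fmul_sum_right: "finite I \<Longrightarrow> fmul V f (\<lambda>w. \<Sum>i\<in>I. g i w) w = (\<Sum>i\<in>I. fmul V f (g i) w)"
  using fmul_lfsum_right[of I g V f w] by (simp add: lfsum_finite)


section \<open>The Poisson bracket\<close>

fun dual :: "'v coord \<Rightarrow> 'v coord" where
  "dual (Tc b) = Chi b" | "dual (Chi b) = Tc b"

fun eps :: "'v coord \<Rightarrow> 'k::field_char_0" where
  "eps (Tc b) = 1" | "eps (Chi b) = - 1"

lemma dual_dual [simp]: "dual (dual z) = z"
  by (cases z) auto

lemma eps_dual [simp]: "eps (dual z) = - eps z"
  by (cases z) auto

lemma eps_square [simp]: "eps z * eps z = 1"
  by (cases z) auto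

lemma cdeg_dual [simp]: "cdeg V (dual z) = 1 - cdeg V z"
  by (cases z) auto

lemma Tc_coords [simp]: "Tc b \<in> coords B \<longleftrightarrow> b \<in> B"
  by (auto simp: coords_def)

lemma Chi_coords [simp]: "Chi b \<in> coords B \<longleftrightarrow> b \<in> B"
  by (auto simp: coords_def)

lemma dual_coords [simp]: "dual z \<in> coords B \<longleftrightarrow> z \<in> coords B"
  by (cases z) auto

text \<open>With \<open>dual\<close> and \<open>eps\<close> the two halves of the bracket become a
  single sum over all coordinates, so that sign computations treat t and \<chi> alike.\<close>

definition cterm :: "(int \<Rightarrow> 'v set) \<Rightarrow> ('v, 'k::field_char_0) series \<Rightarrow> ('v, 'k) series \<Rightarrow> 'v coord \<Rightarrow> ('v, 'k) series"
  where "cterm V f g z = (\<lambda>w. eps z * fmul V (dR z f) (dL (dual z) g) w)"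

text \<open>Exactly one of the two derivatives in a term is by a \<chi>. The family of these is
  summable together with the contraction index, and for each value of that index the derivatives by
  t are summable; this is why the contraction is finite.\<close>

lemma fam_cterm:
  assumes f: "fam V B I f" and g: "fam V B J g"
  shows "fam V B ((I \<times> J) \<times> coords B) (\<lambda>((i, j), z). cterm V (f i) (g j) z)"
proof -
  have "fam V B (Sigma (J \<times> B) (\<lambda>_. I)) (\<lambda>(jb, i). fmul V (dR (Tc (snd jb)) (f i)) (case jb of (j, b) \<Rightarrow> dL (Chi b) (g j)))"
    by (rule fam_fmul_left[OF fam_dL_Chi[OF g]]) (rule fam_dR[OF f])
  hence "fam V B ((I \<times> J) \<times> Tc ` B)
     (\<lambda>p. (\<lambda>(jb, i). fmul V (dR (Tc (snd jb)) (f i)) (case jb of (j, b) \<Rightarrow> dL (Chi b) (g j)))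
        ((snd (fst p), case snd p of Tc b \<Rightarrow> b), fst (fst p)))"
    by (rule fam_reindex) (auto simp: inj_on_def)
  hence "fam V B ((I \<times> J) \<times> Tc ` B) (\<lambda>((i, j), z). fmul V (dR z (f i)) (dL (dual z) (g j)))"
    by (rule fam_cong) auto
  moreover
  have "fam V B (Sigma (I \<times> B) (\<lambda>_. J)) (\<lambda>(ib, j). fmul V (case ib of (i, b) \<Rightarrow> dR (Chi b) (f i)) (dL (Tc (snd ib)) (g j)))"
    by (rule fam_fmul_right[OF fam_dR_Chi[OF f]]) (rule fam_dL[OF g])
  hence "fam V B ((I \<times> J) \<times> Chi ` B)
     (\<lambda>p. (\<lambda>(ib, j). fmul V (case ib of (i, b) \<Rightarrow> dR (Chi b) (f i)) (dL (Tc (snd ib)) (g j)))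
        ((fst (fst p), case snd p of Chi b \<Rightarrow> b), snd (fst p)))"
    by (rule fam_reindex) (auto simp: inj_on_def)
  hence "fam V B ((I \<times> J) \<times> Chi ` B) (\<lambda>((i, j), z). fmul V (dR z (f i)) (dL (dual z) (g j)))"
    by (rule fam_cong) auto
  ultimately have "fam V B ((I \<times> J) \<times> coords B) (\<lambda>((i, j), z). fmul V (dR z (f i)) (dL (dual z) (g j)))"
    unfolding coords_def Times_Un_distrib1 Sigma_Un_distrib2 by (rule fam_Un)
  from fam_mult[OF this, of "\<lambda>p. eps (snd p)"] show ?thesis
    by (rule fam_cong) (auto simp: cterm_def)
qed

lemma fam_cterm_single:
  assumes "is_function V B f" "is_function V B g"
  shows "fam V B (coords B) (cterm V f g)"
proof -
  have "fam V B (({()} \<times> {()}) \<times> coords B) (\<lambda>((i, j), z). cterm V f g z)"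
    by (rule fam_cterm) (use assms in \<open>auto simp: fam_singleton\<close>)
  hence "fam V B (coords B) (\<lambda>z. (\<lambda>((i, j), z). cterm V f g z) (((), ()), z))"
    by (rule fam_reindex) (auto simp: inj_on_def)
  thus ?thesis by simp
qed

lemma fam_cterm_right:
  assumes "is_function V B f" "fam V B J g"
  shows "fam V B (J \<times> coords B) (\<lambda>(j, z). cterm V f (g j) z)"
proof -
  have "fam V B (({()} \<times> J) \<times> coords B) (\<lambda>((i, j), z). cterm V f (g j) z)"
    by (rule fam_cterm) (use assms in \<open>auto simp: fam_singleton\<close>)
  hence "fam V B (J \<times> coords B) (\<lambda>p. (\<lambda>((i, j), z). cterm V f (g j) z) (((), fst p), snd p))"
    by (rule fam_reindex) (auto simp: inj_on_def)
  thus ?thesis by (rule fam_cong) auto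
qed

lemma fam_cterm_left:
  assumes "fam V B I f" "is_function V B g"
  shows "fam V B (I \<times> coords B) (\<lambda>(i, z). cterm V (f i) g z)"
proof -
  have "fam V B ((I \<times> {()}) \<times> coords B) (\<lambda>((i, j), z). cterm V (f i) g z)"
    by (rule fam_cterm) (use assms in \<open>auto simp: fam_singleton\<close>)
  hence "fam V B (I \<times> coords B) (\<lambda>p. (\<lambda>((i, j), z). cterm V (f i) g z) ((fst p, ()), snd p))"
    by (rule fam_reindex) (auto simp: inj_on_def)
  thus ?thesis by (rule fam_cong) auto
qed

lemma lfsum_coords:
  fixes h :: "'v coord \<Rightarrow> 'k::field"
  assumes "finite {z \<in> coords B. h z \<noteq> 0}"
  shows "lfsum (coords B) h = lfsum B (\<lambda>b. h (Tc b) + h (Chi b))"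
proof -
  have fin: "finite {z \<in> Tc ` B. h z \<noteq> 0}" "finite {z \<in> Chi ` B. h z \<noteq> 0}"
    by (rule finite_subset[OF _ assms]; auto simp: coords_def)+
  have "finite (Tc -` {z \<in> Tc ` B. h z \<noteq> 0})" "finite (Chi -` {z \<in> Chi ` B. h z \<noteq> 0})"
    by (rule finite_vimageI[OF fin(1)], simp add: inj_def) (rule finite_vimageI[OF fin(2)], simp add: inj_def)
  moreover have "Tc -` {z \<in> Tc ` B. h z \<noteq> 0} = {b \<in> B. h (Tc b) \<noteq> 0}"
    "Chi -` {z \<in> Chi ` B. h z \<noteq> 0} = {b \<in> B. h (Chi b) \<noteq> 0}" by auto
  ultimately have fin': "finite {b \<in> B. h (Tc b) \<noteq> 0}" "finite {b \<in> B. h (Chi b) \<noteq> 0}" by simp_all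
  have "lfsum (coords B) h = lfsum (Tc ` B) h + lfsum (Chi ` B) h"
    unfolding coords_def by (rule lfsum_Un) (use fin in auto)
  also have "\<dots> = lfsum B (\<lambda>b. h (Tc b)) + lfsum B (\<lambda>b. h (Chi b))"
    by (simp add: lfsum_reindex inj_on_def)
  finally show ?thesis using fin' by (simp add: lfsum_add)
qed

lemma bracket_cterm:
  assumes "is_function V B f" "is_function V B g"
  shows "bracket V B f g = (\<lambda>w. lfsum (coords B) (\<lambda>z. cterm V f g z w))"
  unfolding bracket_def
  by (rule ext) (simp add: lfsum_coords[OF fam_pointwise[OF fam_cterm_single[OF assms]]], simp add: cterm_def)

lemma is_function_bracket:
  assumes "is_function V B f" "is_function V B g"
  shows "is_function V B (bracket V B f g)"
  unfolding bracket_cterm[OF assms] by (rule is_function_lfsum[OF fam_cterm_single[OF assms]])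

lemma cterm_lfsum_right:
  assumes "\<And>w. finite {i \<in> I. g i w \<noteq> 0}"
  shows "cterm V f (\<lambda>w. lfsum I (\<lambda>i. g i w)) z w = lfsum I (\<lambda>i. cterm V f (g i) z w)"
proof -
  have "dL (dual z) (\<lambda>w. lfsum I (\<lambda>i. g i w)) = (\<lambda>w. lfsum I (\<lambda>i. dL (dual z) (g i) w))"
    by (simp add: dL_def)
  moreover have "finite {i \<in> I. dL (dual z) (g i) v \<noteq> 0}" for v using assms by (simp add: dL_def)
  ultimately show ?thesis by (simp add: cterm_def fmul_lfsum_right lfsum_cmult)
qed

lemma cterm_lfsum_left:
  assumes "\<And>w. finite {i \<in> I. f i w \<noteq> 0}"
  shows "cterm V (\<lambda>w. lfsum I (\<lambda>i. f i w)) g z w = lfsum I (\<lambda>i. cterm V (f i) g z w)"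
proof -
  have "dR z (\<lambda>w. lfsum I (\<lambda>i. f i w)) = (\<lambda>w. lfsum I (\<lambda>i. dR z (f i) w))"
    by (simp add: dR_def)
  moreover have "finite {i \<in> I. dR z (f i) v \<noteq> 0}" for v using assms by (simp add: dR_def)
  ultimately show ?thesis by (simp add: cterm_def fmul_lfsum_left lfsum_cmult)
qed

lemma fam_support_Times:
  assumes "fam V B (I \<times> J) (\<lambda>(i, j). h i j)"
  shows "finite {(i, j). i \<in> I \<and> j \<in> J \<and> h i j w \<noteq> 0}"
  by (rule finite_subset[OF _ fam_pointwise[OF assms, of w]]) auto

lemma fam_bracket:
  assumes "is_function V B f" "fam V B I g"
  shows "fam V B I (\<lambda>i. bracket V B f (g i))"
proof (rule fam_cong)
  show "fam V B I (\<lambda>i w. lfsum (coords B) (\<lambda>z. (\<lambda>(i, z). cterm V f (g i) z) (i, z) w))"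
    by (rule fam_lfsum) (rule fam_cterm_right[OF assms])
qed (use assms in \<open>simp add: bracket_cterm fam_is_function\<close>)

lemma bracket_lfsum:
  assumes "is_function V B f" "fam V B I g"
  shows "bracket V B f (\<lambda>w. lfsum I (\<lambda>i. g i w)) w = lfsum I (\<lambda>i. bracket V B f (g i) w)"
proof -
  have "bracket V B f (\<lambda>w. lfsum I (\<lambda>i. g i w)) w = lfsum (coords B) (\<lambda>z. lfsum I (\<lambda>i. cterm V f (g i) z w))"
    using assms by (simp add: bracket_cterm is_function_lfsum cterm_lfsum_right fam_pointwise)
  also have "\<dots> = lfsum I (\<lambda>i. lfsum (coords B) (\<lambda>z. cterm V f (g i) z w))"
    by (rule lfsum_swap[symmetric]) (rule fam_support_Times[OF fam_cterm_right[OF assms]])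
  also have "\<dots> = lfsum I (\<lambda>i. bracket V B f (g i) w)"
    by (rule lfsum_cong) (use assms in \<open>simp add: bracket_cterm fam_is_function\<close>)
  finally show ?thesis .
qed

lemma bracket_mult_right: "bracket V B f (\<lambda>w. c * g w) w = c * bracket V B f g w"
  unfolding bracket_def by (simp add: dL_mult fmul_mult_right lfsum_cmult[symmetric] right_diff_distrib)

lemma bracket_mult_left: "bracket V B (\<lambda>w. c * f w) g w = c * bracket V B f g w"
  unfolding bracket_def by (simp add: dR_def fmul_mult_left lfsum_cmult[symmetric] right_diff_distrib)

lemma bracket_add_right:
  assumes "is_function V B f" "is_function V B g" "is_function V B h"
  shows "bracket V B f (\<lambda>w. g w + h w) w = bracket V B f g w + bracket V B f h w"
proof -
  have "cterm V f (\<lambda>w. g w + h w) z w = cterm V f g z w + cterm V f h z w" for z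
    by (simp add: cterm_def dL_def fmul_add_right distrib_left)
  thus ?thesis using assms
    by (simp add: bracket_cterm is_function_add lfsum_add fam_pointwise[OF fam_cterm_single])
qed

lemma bracket_add_left:
  assumes "is_function V B f" "is_function V B g" "is_function V B h"
  shows "bracket V B (\<lambda>w. f w + g w) h w = bracket V B f h w + bracket V B g h w"
proof -
  have "cterm V (\<lambda>w. f w + g w) h z w = cterm V f h z w + cterm V g h z w" for z
    by (simp add: cterm_def dR_def fmul_add_left distrib_left)
  thus ?thesis using assms
    by (simp add: bracket_cterm is_function_add lfsum_add fam_pointwise[OF fam_cterm_single])
qed

lemma has_degreeD: "has_degree V p f \<Longrightarrow> f w \<noteq> 0 \<Longrightarrow> wdeg V w = p"
  by (simp add: has_degree_def wdeg_def)

lemma has_degreeI: "(\<And>w. f w \<noteq> 0 \<Longrightarrow> wdeg V w = p) \<Longrightarrow> has_degree V p f"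
  by (simp add: has_degree_def wdeg_def)

lemma has_degree_dL:
  assumes "has_degree V p f"
  shows "has_degree V (p - cdeg V x) (dL x f)"
proof (rule has_degreeI)
  fix w assume "dL x f w \<noteq> 0"
  thus "wdeg V w = p - cdeg V x" using has_degreeD[OF assms, of "x # w"] by (simp add: dL_def)
qed

lemma has_degree_dR:
  assumes "has_degree V p f"
  shows "has_degree V (p - cdeg V x) (dR x f)"
proof (rule has_degreeI)
  fix w assume "dR x f w \<noteq> 0"
  thus "wdeg V w = p - cdeg V x" using has_degreeD[OF assms, of "w @ [x]"] by (simp add: dR_def)
qed

lemma bracket_nonzero:
  assumes "bracket V B f g w \<noteq> 0"
  shows "\<exists>z\<in>coords B. fmul V (dR z f) (dL (dual z) g) w \<noteq> 0"
proof -
  from assms obtain b where "b \<in> B"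
    "fmul V (dR (Tc b) f) (dL (Chi b) g) w - fmul V (dR (Chi b) f) (dL (Tc b) g) w \<noteq> 0"
    unfolding bracket_def by (auto dest!: lfsum_nonzeroD)
  hence "fmul V (dR (Tc b) f) (dL (dual (Tc b)) g) w \<noteq> 0 \<or> fmul V (dR (Chi b) f) (dL (dual (Chi b)) g) w \<noteq> 0"
    by auto
  thus ?thesis using \<open>b \<in> B\<close> by (metis Tc_coords Chi_coords)
qed

lemma bracket_support:
  assumes "bracket V B f g w \<noteq> 0"
  shows "\<exists>z\<in>coords B. \<exists>u v. w \<in> shuffles u v \<and> f (u @ [z]) \<noteq> 0 \<and> g (dual z # v) \<noteq> 0"
  using bracket_nonzero[OF assms] by (auto dest!: fmul_support simp: dL_def dR_def)

lemma has_degree_bracket: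
  assumes "has_degree V p f" "has_degree V q g"
  shows "has_degree V (p + q - 1) (bracket V B f g)"
  unfolding has_degree_def
proof (intro allI impI)
  fix w assume "bracket V B f g w \<noteq> 0"
  then obtain z where "fmul V (dR z f) (dL (dual z) g) w \<noteq> 0" using bracket_nonzero by blast
  moreover have "has_degree V ((p - cdeg V z) + (q - cdeg V (dual z))) (fmul V (dR z f) (dL (dual z) g))"
    by (intro has_degree_fmul has_degree_dR has_degree_dL assms)
  ultimately show "sum_list (map (cdeg V) w) = p + q - 1" by (auto simp: has_degree_def)
qed

lemma vanishes_on_L_bracket:
  assumes "vanishes_on_L f" "vanishes_on_L g"
  shows "vanishes_on_L (bracket V B f g)"
  unfolding vanishes_on_L_def
proof (rule allI, rule ccontr)
  fix bs assume "bracket V B f g (map Chi bs) \<noteq> 0"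
  then obtain z u v where *: "map Chi bs \<in> shuffles u v" "f (u @ [z]) \<noteq> 0" "g (dual z # v) \<noteq> 0"
    using bracket_support by blast
  obtain us vs where "u = map Chi us" "v = map Chi vs" using map_shuffles_cases[OF *(1)] by blast
  thus False using * assms unfolding vanishes_on_L_def
    by (cases z) (auto, metis list.map(2), metis list.map map_append)
qed

lemma vanishes_on_PiL_bracket:
  assumes "vanishes_on_PiL f" "vanishes_on_PiL g"
  shows "vanishes_on_PiL (bracket V B f g)"
  unfolding vanishes_on_PiL_def
proof (rule allI, rule ccontr)
  fix bs assume "bracket V B f g (map Tc bs) \<noteq> 0"
  then obtain z u v where *: "map Tc bs \<in> shuffles u v" "f (u @ [z]) \<noteq> 0" "g (dual z # v) \<noteq> 0"
    using bracket_support by blast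
  obtain us vs where "u = map Tc us" "v = map Tc vs" using map_shuffles_cases[OF *(1)] by blast
  thus False using * assms unfolding vanishes_on_PiL_def
    by (cases z) (auto, metis list.map map_append, metis list.map(2))
qed

text \<open>Exchanging the factors and the sides of the derivatives gives three Koszul signs. As
  \<open>z\<close> and \<open>dual z\<close> have degrees of sum 1, their product does not depend on
  \<open>z\<close>; the change from \<open>eps z\<close> to \<open>eps (dual z)\<close> gives the
  remaining minus sign.\<close>

lemma bracket_commute:
  fixes f g :: "('v, 'k::field_char_0) series"
  assumes f: "is_function V B f" "has_parity V p f" and g: "is_function V B g" "has_parity V q g"
  shows "bracket V B f g w = (if odd (p * q + p + q) then - 1 else 1) * bracket V B g f w"
proof -
  define c where "c = (if odd (p * q + p + q) then - 1 else 1 :: 'k)"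
  have "cterm V f g z w = c * cterm V g f (dual z) w" for z
  proof -
    have pf: "has_parity V (p - cdeg V z) (dR z f)" "has_parity V (p - cdeg V z) (dL z f)"
      and pg: "has_parity V (q - cdeg V (dual z)) (dR (dual z) g)" "has_parity V (q - cdeg V (dual z)) (dL (dual z) g)"
      using assms by (auto intro: has_parity_dL has_parity_dR simp del: cdeg_dual)
    have "dL (dual z) g = (\<lambda>w. ksign (cdeg V (dual z)) (q - cdeg V (dual z)) * dR (dual z) g w)"
      using dL_eq_dR[OF is_function_gsym[OF g(1)], of "dual z"] tw_parity[OF pg(1)] by simp
    moreover have "dR z f = (\<lambda>w. ksign (cdeg V z) (p - cdeg V z) * dL z f w)"
      using dR_eq_dL[OF is_function_gsym[OF f(1)], of z] tw_parity[OF pf(2)] by simp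
    ultimately have "fmul V (dR z f) (dL (dual z) g) w = ksign (p - cdeg V z) (q - cdeg V (dual z)) *
       (ksign (cdeg V (dual z)) (q - cdeg V (dual z)) * (ksign (cdeg V z) (p - cdeg V z) * fmul V (dR (dual z) g) (dL z f) w))"
      using fmul_commute_parity[OF pf(1), of "dL (dual z) g"] tw_parity[OF pg(2), of "p - cdeg V z"]
      by (simp add: fmul_mult_left fmul_mult_right)
    moreover have "ksign (p - cdeg V z) (q - cdeg V (dual z)) * (ksign (cdeg V (dual z)) (q - cdeg V (dual z)) * ksign (cdeg V z) (p - cdeg V z)) = - c"
      by (auto simp: ksign_def c_def)
    ultimately have "fmul V (dR z f) (dL (dual z) g) w = - c * fmul V (dR (dual z) g) (dL z f) w"
      by (metis mult.assoc)
    thus ?thesis by (simp add: cterm_def)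
  qed
  hence "bracket V B f g w = lfsum (coords B) (\<lambda>z. c * cterm V g f (dual z) w)"
    by (simp only: bracket_cterm[OF f(1) g(1)])
  also have "\<dots> = c * lfsum (coords B) (\<lambda>z. cterm V g f (dual z) w)" by (rule lfsum_cmult)
  also have "lfsum (coords B) (\<lambda>z. cterm V g f (dual z) w) = lfsum (dual ` coords B) (\<lambda>z. cterm V g f z w)"
    by (rule lfsum_reindex[symmetric]) (metis dual_dual inj_onI)
  also have "dual ` coords B = coords B" by (metis (no_types, lifting) dual_coords dual_dual image_iff subsetI subset_antisym image_subsetI)
  finally show ?thesis using bracket_cterm[OF g(1) f(1)] by (simp add: c_def)
qed

lemma fam_fmul_single_left:
  assumes "fam V B I f" "is_function V B g"
  shows "fam V B I (\<lambda>i. fmul V (f i) g)"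
proof -
  have "fam V B (Sigma {()} (\<lambda>_. I)) (\<lambda>(j, i). fmul V (f i) g)"
    by (rule fam_fmul_left) (use assms in \<open>auto simp: fam_singleton\<close>)
  hence "fam V B I (\<lambda>i. (\<lambda>(j, i). fmul V (f i) g) ((), i))"
    by (rule fam_reindex) (auto simp: inj_on_def)
  thus ?thesis by simp
qed

lemma fam_fmul_single_right:
  assumes "is_function V B f" "fam V B I g"
  shows "fam V B I (\<lambda>i. fmul V f (g i))"
proof -
  have "fam V B (Sigma {()} (\<lambda>_. I)) (\<lambda>(j, i). fmul V f (g i))"
    by (rule fam_fmul_right) (use assms in \<open>auto simp: fam_singleton\<close>)
  hence "fam V B I (\<lambda>i. (\<lambda>(j, i). fmul V f (g i)) ((), i))"
    by (rule fam_reindex) (auto simp: inj_on_def)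
  thus ?thesis by simp
qed

text \<open>For odd \<open>S\<close> the parity of \<open>dR z S\<close> is that of
  \<open>dual z\<close>. Passing it across \<open>f\<close> therefore undoes the twist that the
  Leibniz rule for \<open>dL (dual z)\<close> has left on \<open>f\<close>.\<close>

lemma fmul_dR_tw:
  assumes "has_parity V 1 S"
  shows "fmul V (dR z S) (fmul V (tw V (cdeg V (dual z)) f) h) = fmul V f (fmul V (dR z S) h)"
proof -
  have "fmul V (dR z S) (tw V (cdeg V (dual z)) f) = fmul V (tw V (1 - cdeg V z) (tw V (cdeg V (dual z)) f)) (dR z S)"
    by (rule fmul_commute_parity[OF has_parity_dR[OF assms]])
  also have "tw V (1 - cdeg V z) (tw V (cdeg V (dual z)) f) = f"
    by (simp add: tw_tw tw_even)
  finally show ?thesis by (metis fmul_assoc)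
qed

text \<open>For odd \<open>S\<close> the operator \<open>ad_S\<close> is even, hence a derivation
  without signs.\<close>

lemma bracket_fmul:
  assumes S: "is_function V B S" "has_parity V 1 S" and f: "is_function V B f" and g: "is_function V B g"
  shows "bracket V B S (fmul V f g) w = fmul V (bracket V B S f) g w + fmul V f (bracket V B S g) w"
proof -
  have eq: "cterm V S (fmul V f g) z w = fmul V (cterm V S f z) g w + fmul V f (cterm V S g z) w" for z
    by (simp add: cterm_def dL_fmul fmul_add_right fmul_dR_tw[OF S(2)] fmul_mult_left fmul_mult_right
        fmul_assoc distrib_left del: cdeg_dual)
  have F: "fam V B (coords B) (cterm V S f)" "fam V B (coords B) (cterm V S g)"
    using fam_cterm_single[OF S(1)] f g by auto
  have fin: "finite {z \<in> coords B. fmul V (cterm V S f z) g w \<noteq> 0}"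
    by (rule fam_pointwise[OF fam_fmul_single_left[OF F(1) g]])
  have fin': "finite {z \<in> coords B. fmul V f (cterm V S g z) w \<noteq> 0}"
    by (rule fam_pointwise[OF fam_fmul_single_right[OF f F(2)]])
  have "bracket V B S (fmul V f g) w = lfsum (coords B) (\<lambda>z. fmul V (cterm V S f z) g w)
      + lfsum (coords B) (\<lambda>z. fmul V f (cterm V S g z) w)"
    by (simp add: bracket_cterm[OF S(1) is_function_fmul[OF f g]] eq lfsum_add fin fin')
  thus ?thesis
    by (simp add: bracket_cterm S f g fmul_lfsum_left[OF fam_pointwise[OF F(1)]]
        fmul_lfsum_right[OF fam_pointwise[OF F(2)]])
qed

text \<open>Expansion yields three kinds of terms, by the function that is differentiated twice:
  \<open>I1\<close> for \<open>f\<close>, \<open>I2\<close> for \<open>g\<close>, \<open>J\<close>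
  for \<open>S\<close>. The first two occur on both sides; the two sums of \<open>J\<close> cancel
  after renaming \<open>y\<close> to \<open>dual y\<close>, which permutes \<open>C\<close>.
  Finiteness of \<open>C\<close> permits the rearrangement.\<close>

lemma jacobi_finite:
  fixes S f g :: "('v, 'k::field_char_0) series"
  assumes S: "gsym V S" "has_parity V 1 S" and f: "gsym V f" and g: "gsym V g"
    and C: "finite C" "dual ` C = C"
  shows "(\<Sum>y\<in>C. \<Sum>z\<in>C. cterm V S (cterm V f g z) y w)
     = (\<Sum>z\<in>C. \<Sum>y\<in>C. cterm V f (cterm V S g y) z w) + (\<Sum>y\<in>C. \<Sum>z\<in>C. cterm V (cterm V S f y) g z w)"
proof -
  define I1 where "I1 y z = eps y * eps z * fmul V (dR y S) (fmul V (dL (dual y) (dR z f)) (dL (dual z) g)) w" for y z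
  define I2 where "I2 y z = eps y * eps z * fmul V (dR z f) (fmul V (dR y S) (dL (dual y) (dL (dual z) g))) w" for y z
  define J where "J y z = eps y * eps z * fmul V (dR z f) (fmul V (dR y (dR (dual z) S)) (dL (dual y) g)) w" for y z
  have X1: "cterm V S (cterm V f g z) y w = I1 y z + I2 y z" for y z
    by (simp add: cterm_def dL_mult dL_fmul fmul_mult_right fmul_add_right fmul_dR_tw[OF S(2)]
        I1_def I2_def distrib_left mult.assoc del: cdeg_dual)
  have X2: "cterm V f (cterm V S g y) z w = J y z + I2 y z" for y z
  proof -
    have "tw V (cdeg V (dual z)) (dR y S) = (\<lambda>w. ksign (cdeg V (dual z)) (cdeg V (dual y)) * dR y S w)"
      using tw_parity[OF has_parity_dR[OF S(2)], of "cdeg V (dual z)" y] by simp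
    moreover have "dL (dual z) (dL (dual y) g) = (\<lambda>w. ksign (cdeg V (dual z)) (cdeg V (dual y)) * dL (dual y) (dL (dual z) g) w)"
      by (rule dL_dL[OF g])
    moreover have "dL (dual z) S = dR (dual z) S"
      using dL_eq_dR[OF S(1), of "dual z"] tw_parity[OF has_parity_dR[OF S(2)], of "cdeg V (dual z)" "dual z"]
      by (auto simp: ksign_def)
    ultimately show ?thesis
      by (simp add: cterm_def dL_mult dL_fmul fmul_mult_right fmul_mult_left fmul_add_right dL_dR
          I2_def J_def distrib_left mult.assoc mult.left_commute[of "eps z"] del: cdeg_dual)
  qed
  have X3: "cterm V (cterm V S f y) g z w = I1 y z - J z (dual y)" for y z
  proof -
    have "fmul V (dR z (dR y S)) (tw V (cdeg V z) (dL (dual y) f))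
       = fmul V (tw V (1 - cdeg V y - cdeg V z) (tw V (cdeg V z) (dL (dual y) f))) (dR z (dR y S))"
      by (rule fmul_commute_parity) (intro has_parity_dR S(2))
    also have "tw V (1 - cdeg V y - cdeg V z) (tw V (cdeg V z) (dL (dual y) f)) = dR (dual y) f"
      using dR_eq_dL[OF f, of "dual y"] by (simp add: tw_tw)
    finally have "fmul V (dR z (dR y S)) (tw V (cdeg V z) (dL (dual y) f)) = fmul V (dR (dual y) f) (dR z (dR y S))" .
    moreover have "dR z (\<lambda>w. eps y * fmul V (dR y S) (dL (dual y) f) w)
        = (\<lambda>w. eps y * dR z (fmul V (dR y S) (dL (dual y) f)) w)" by (simp add: dR_def)
    ultimately show ?thesis
      by (simp add: cterm_def dR_fmul fmul_mult_left fmul_add_left fmul_assoc dL_dR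
          I1_def J_def distrib_left mult.assoc mult.left_commute[of "eps z"])
  qed
  have inj: "inj_on dual C" by (metis dual_dual inj_onI)
  have "(\<Sum>y\<in>C. \<Sum>z\<in>C. J z (dual y)) = (\<Sum>y\<in>dual ` C. \<Sum>z\<in>C. J z y)"
    by (simp add: sum.reindex[OF inj])
  hence "(\<Sum>y\<in>C. \<Sum>z\<in>C. J z (dual y)) = (\<Sum>z\<in>C. \<Sum>y\<in>C. J y z)" by (simp add: C)
  moreover have "(\<Sum>z\<in>C. \<Sum>y\<in>C. I2 y z) = (\<Sum>y\<in>C. \<Sum>z\<in>C. I2 y z)" by (rule sum.swap)
  ultimately show ?thesis by (simp add: X1 X2 X3 sum.distrib sum_subtractf)
qed

lemma fam_cterm_cterm:
  assumes S: "is_function V B S" and f: "is_function V B f" and g: "is_function V B g"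
  shows "fam V B (coords B \<times> coords B) (\<lambda>(z, y). cterm V S (cterm V f g z) y)"
    "fam V B (coords B \<times> coords B) (\<lambda>(y, z). cterm V (cterm V S f y) g z)"
  using fam_cterm_right[OF S fam_cterm_single[OF f g]] fam_cterm_left[OF fam_cterm_single[OF S f] g]
  by auto

lemma bracket_bracket_right:
  assumes S: "is_function V B S" and f: "is_function V B f" and g: "is_function V B g"
  shows "bracket V B S (bracket V B f g) w = lfsum (coords B) (\<lambda>y. lfsum (coords B) (\<lambda>z. cterm V S (cterm V f g z) y w))"
  by (simp add: bracket_cterm[OF S is_function_bracket[OF f g]])
    (simp add: bracket_cterm[OF f g] cterm_lfsum_right fam_pointwise[OF fam_cterm_single[OF f g]])

lemma bracket_bracket_left:
  assumes S: "is_function V B S" and f: "is_function V B f" and g: "is_function V B g"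
  shows "bracket V B (bracket V B S f) g w = lfsum (coords B) (\<lambda>z. lfsum (coords B) (\<lambda>y. cterm V (cterm V S f y) g z w))"
  by (simp add: bracket_cterm[OF is_function_bracket[OF S f] g])
    (simp add: bracket_cterm[OF S f] cterm_lfsum_left fam_pointwise[OF fam_cterm_single[OF S f]])

lemma lfsum_lfsum_finite:
  fixes h :: "'i \<Rightarrow> 'i \<Rightarrow> 'k::field"
  assumes "finite C" "C \<subseteq> A" "\<And>i j. i \<in> A \<Longrightarrow> j \<in> A \<Longrightarrow> h i j \<noteq> 0 \<Longrightarrow> i \<in> C \<and> j \<in> C"
  shows "lfsum A (\<lambda>i. lfsum A (h i)) = (\<Sum>i\<in>C. \<Sum>j\<in>C. h i j)"
proof -
  have "lfsum A (\<lambda>i. lfsum A (h i)) = lfsum A (\<lambda>i. \<Sum>j\<in>C. h i j)"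
    by (intro lfsum_cong lfsum_eq_sum) (use assms in auto)
  also have "\<dots> = (\<Sum>i\<in>C. \<Sum>j\<in>C. h i j)"
    by (rule lfsum_eq_sum) (use assms in \<open>auto intro!: sum.neutral\<close>)
  finally show ?thesis .
qed

text \<open>At a given word only finitely many pairs of coordinates contribute to the three double
  contractions. \<open>C\<close> collects them and is closed under \<open>dual\<close>, which
  reduces the claim to \<open>jacobi_finite\<close>.\<close>

lemma jacobi:
  assumes S: "is_function V B S" "has_parity V 1 S" and f: "is_function V B f" and g: "is_function V B g"
  shows "bracket V B S (bracket V B f g) w = bracket V B (bracket V B S f) g w + bracket V B f (bracket V B S g) w"
proof -
  let ?P1 = "{(z, y). z \<in> coords B \<and> y \<in> coords B \<and> cterm V S (cterm V f g z) y w \<noteq> 0}"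
  let ?P2 = "{(y, z). y \<in> coords B \<and> z \<in> coords B \<and> cterm V f (cterm V S g y) z w \<noteq> 0}"
  let ?P3 = "{(y, z). y \<in> coords B \<and> z \<in> coords B \<and> cterm V (cterm V S f y) g z w \<noteq> 0}"
  let ?P = "?P1 \<union> ?P2 \<union> ?P3"
  define C0 where "C0 = fst ` ?P \<union> snd ` ?P"
  define C where "C = C0 \<union> dual ` C0"
  have "finite ?P"
    using fam_support_Times[OF fam_cterm_cterm(1)[OF S(1) f g]] fam_support_Times[OF fam_cterm_cterm(1)[OF f S(1) g]]
      fam_support_Times[OF fam_cterm_cterm(2)[OF S(1) f g]] by simp
  hence C: "finite C" "dual ` C = C" "C \<subseteq> coords B"
    by (auto simp: C_def C0_def image_Un image_image Un_commute)
  have mem: "z \<in> C \<and> y \<in> C" if "(z, y) \<in> ?P" for z y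
    using imageI[OF that, of fst] imageI[OF that, of snd] unfolding C_def C0_def by simp
  have mem1: "y \<in> C \<and> z \<in> C" if "y \<in> coords B" "z \<in> coords B" "cterm V S (cterm V f g z) y w \<noteq> 0" for y z
    using mem[of z y] that by blast
  have mem2: "z \<in> C \<and> y \<in> C" if "z \<in> coords B" "y \<in> coords B" "cterm V f (cterm V S g y) z w \<noteq> 0" for y z
    using mem[of y z] that by blast
  have mem3: "z \<in> C \<and> y \<in> C" if "z \<in> coords B" "y \<in> coords B" "cterm V (cterm V S f y) g z w \<noteq> 0" for y z
    using mem[of y z] that by blast
  have "bracket V B S (bracket V B f g) w = (\<Sum>y\<in>C. \<Sum>z\<in>C. cterm V S (cterm V f g z) y w)"
    unfolding bracket_bracket_right[OF S(1) f g] by (rule lfsum_lfsum_finite[OF C(1,3) mem1])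
  moreover have "bracket V B f (bracket V B S g) w = (\<Sum>z\<in>C. \<Sum>y\<in>C. cterm V f (cterm V S g y) z w)"
    unfolding bracket_bracket_right[OF f S(1) g] by (rule lfsum_lfsum_finite[OF C(1,3) mem2])
  moreover have "bracket V B (bracket V B S f) g w = (\<Sum>z\<in>C. \<Sum>y\<in>C. cterm V (cterm V S f y) g z w)"
    unfolding bracket_bracket_left[OF S(1) f g] by (rule lfsum_lfsum_finite[OF C(1,3) mem3])
  moreover have "\<dots> = (\<Sum>y\<in>C. \<Sum>z\<in>C. cterm V (cterm V S f y) g z w)" by (rule sum.swap)
  ultimately show ?thesis
    using jacobi_finite[OF is_function_gsym[OF S(1)] S(2) is_function_gsym[OF f] is_function_gsym[OF g] C(1,2), of w]
    by simp
qed


section \<open>Coordinates and Taylor expansion\<close>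

lemma fmul_uminus_left: "fmul V (\<lambda>w. - f w) g w = - fmul V f g w"
  using fmul_mult_left[of V "-1" f g w] by simp

lemma fmul_uminus_right: "fmul V f (\<lambda>w. - g w) w = - fmul V f g w"
  using fmul_mult_right[of V f "-1" g w] by simp

lemma eps_square_left [simp]: "eps z * (eps z * c) = c"
  by (cases z) auto

lemma dL_coord_fun: "dL x (coord_fun y) = (if x = y then fone else (\<lambda>w. 0))"
  by (auto simp: dL_def coord_fun_def fone_def)

lemma dR_coord_fun: "dR x (coord_fun y) = (if x = y then fone else (\<lambda>w. 0))"
  by (auto simp: dR_def coord_fun_def fone_def append_eq_Cons_conv)

lemma coord_fun_nonzero [simp]: "coord_fun x w \<noteq> 0 \<longleftrightarrow> w = [x]"
  by (simp add: coord_fun_def)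

lemma coord_fun_outside: "x \<in> coords B \<Longrightarrow> \<not> set w \<subseteq> coords B \<Longrightarrow> coord_fun x w = 0"
  by (auto simp: coord_fun_def)

lemma gsym_coord_fun: "gsym V (coord_fun x)"
  by (auto intro!: gsymI simp: coord_fun_def append_eq_Cons_conv)

lemma tw_coord_fun: "tw V p (coord_fun x) = (\<lambda>w. ksign p (cdeg V x) * coord_fun x w)"
  by (auto simp: tw_def coord_fun_def)

lemma has_degree_coord_fun: "has_degree V (cdeg V x) (coord_fun x)"
  by (rule has_degreeI) simp

lemma fam_coord_fun_Tc: "fam V B B (\<lambda>b. coord_fun (Tc b) :: ('v, 'k::field_char_0) series)"
proof (rule famI)
  fix as m
  have "{(i, bs). i \<in> B \<and> length bs = m \<and> coord_fun (Tc i) (map Tc as @ map Chi bs) \<noteq> (0::'k)} \<subseteq> {(hd as, [])}"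
    by (auto simp: append_eq_Cons_conv Cons_eq_append_conv)
  thus "finite {(i, bs). i \<in> B \<and> length bs = m \<and> coord_fun (Tc i) (map Tc as @ map Chi bs) \<noteq> (0::'k)}"
    by (rule finite_subset) simp
qed (auto simp: gsym_coord_fun intro: coord_fun_outside)

lemma is_function_coord_fun:
  assumes "x \<in> coords B"
  shows "is_function V B (coord_fun x :: ('v, 'k::field_char_0) series)"
proof (cases x)
  case (Tc b)
  thus ?thesis using fam_is_function[OF fam_coord_fun_Tc, of b B V] assms by simp
next
  case (Chi b)
  have "fam V B {()} (\<lambda>_. coord_fun x :: ('v, 'k) series)"
  proof (rule famI)
    fix as m
    have "{(i, bs). i \<in> {()} \<and> length bs = m \<and> coord_fun x (map Tc as @ map Chi bs) \<noteq> (0::'k)} \<subseteq> {((), [b])}"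
      using Chi by (auto simp: append_eq_Cons_conv Cons_eq_append_conv)
    thus "finite {(i, bs). i \<in> {()} \<and> length bs = m \<and> coord_fun x (map Tc as @ map Chi bs) \<noteq> (0::'k)}"
      by (rule finite_subset) simp
  qed (use assms in \<open>auto simp: gsym_coord_fun intro: coord_fun_outside\<close>)
  thus ?thesis by (simp add: fam_singleton)
qed

lemma vanishes_on_L_Tc: "vanishes_on_L (coord_fun (Tc b))"
  by (auto simp: vanishes_on_L_def coord_fun_def)

lemma vanishes_on_PiL_Chi: "vanishes_on_PiL (coord_fun (Chi b))"
  by (auto simp: vanishes_on_PiL_def coord_fun_def)

lemma is_function_fone: "is_function V B (fone :: ('v, 'k::field_char_0) series)"
proof -
  have "fam V B {()} (\<lambda>_. fone :: ('v, 'k) series)"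
  proof (rule famI)
    fix as m
    have "{(i, bs). i \<in> {()} \<and> length bs = m \<and> fone (map Tc as @ map Chi bs) \<noteq> (0::'k)} \<subseteq> {((), [])}"
      by (auto simp: fone_def split: if_splits)
    thus "finite {(i, bs). i \<in> {()} \<and> length bs = m \<and> fone (map Tc as @ map Chi bs) \<noteq> (0::'k)}"
      by (rule finite_subset) simp
  qed (auto simp: fone_def intro!: gsymI)
  thus ?thesis by (simp add: fam_singleton)
qed

lemma is_function_zero: "is_function V B (\<lambda>w. 0)"
  using is_function_mult[OF is_function_fone, of V B 0] by simp

text \<open>Each letter of \<open>w\<close> that lies in \<open>A\<close> can be the one split off.
  The case of all letters gives Taylor expansion, that of the contractible letters gives the
  operator \<open>N\<close> of the homotopy formula.\<close>

lemma euler_identity: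
  assumes "gsym V f" "finite A"
  shows "(\<Sum>x\<in>A. fmul V (coord_fun x) (dL x f) w) = of_nat (length (filter (\<lambda>x. x \<in> A) w)) * f w"
  using assms(1)
proof (induction w arbitrary: f)
  case (Cons y w)
  have "fmul V (coord_fun x) (dL x f) (y # w) = (if x = y then dL y f w else 0) + fmul V (coord_fun x) (dL x (dL y f)) w" for x
    using dL_dL[OF Cons.prems, of y x]
    by (simp add: fmul_Cons dL_coord_fun tw_coord_fun fmul_mult_left fmul_mult_right fmul_fone ksign_commute)
  hence "(\<Sum>x\<in>A. fmul V (coord_fun x) (dL x f) (y # w))
     = (\<Sum>x\<in>A. if x = y then dL y f w else 0) + of_nat (length (filter (\<lambda>x. x \<in> A) w)) * dL y f w"
    using Cons.IH[OF gsym_dL[OF Cons.prems], of y] by (simp add: sum.distrib)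
  also have "(\<Sum>x\<in>A. if x = y then dL y f w else 0) = (if y \<in> A then dL y f w else 0)"
    using assms(2) by simp
  finally show ?case by (simp add: dL_def algebra_simps)
qed (simp add: coord_fun_def)

definition monom :: "(int \<Rightarrow> 'v set) \<Rightarrow> 'v coord list \<Rightarrow> ('v, 'k::field_char_0) series" where
  "monom V u = fprod V (map coord_fun u)"

lemma monom_simps: "monom V [] = fone" "monom V (x # u) = fmul V (coord_fun x) (monom V u)"
  by (simp_all add: monom_def fprod_def)

lemma monom_support: "monom V u w \<noteq> (0 :: 'k::field_char_0) \<Longrightarrow> mset u = mset w"
proof (induction u arbitrary: w)
  case Nil
  thus ?case by (auto simp: monom_simps fone_def split: if_splits)
next
  case (Cons x u)
  hence "fmul V (coord_fun x) (monom V u) w \<noteq> (0 :: 'k)" by (simp add: monom_simps)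
  then obtain v where "w \<in> shuffles [x] v" "monom V u v \<noteq> (0 :: 'k)"
    using fmul_support by fastforce
  thus ?case using Cons.IH[of v] mset_shuffles[of w "[x]" v] by simp
qed

lemma is_function_monom: "set u \<subseteq> coords B \<Longrightarrow> is_function V B (monom V u)"
  by (induction u) (auto simp: monom_simps is_function_fone intro!: is_function_fmul is_function_coord_fun)

text \<open>Induction on the order: splitting off the first letter of \<open>u\<close> leaves the
  Euler operator applied to the part of order n + 1, and this supplies the factor n + 1 of the
  factorial.\<close>

lemma taylor_homogeneous:
  fixes h :: "('v, 'k::field_char_0) series"
  assumes "finite A" "gsym V h"
  shows "(\<Sum>u\<in>{u. set u \<subseteq> A \<and> length u = n}. h u * monom V u w)
     = (if length w = n \<and> set w \<subseteq> A then fact n * h w else 0)"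
  using assms(2)
proof (induction n arbitrary: h w)
  case 0
  have "{u. set u \<subseteq> A \<and> length u = 0} = {[]}" by auto
  thus ?case by (simp add: monom_simps fone_def)
next
  case (Suc n)
  let ?L = "\<lambda>n. {u. set u \<subseteq> A \<and> length u = n}"
  \<comment> \<open>The induction hypothesis returns derivatives of \<open>h\<close> cut down to
    words of length n over \<open>A\<close>; these are the derivatives of the truncation
    \<open>h'\<close>, to which the Euler identity applies.\<close>
  define h' where "h' = (\<lambda>w. if length w = Suc n \<and> set w \<subseteq> A then h w else 0)"
  have h': "gsym V h'"
  proof (rule gsymI)
    fix u x y v
    show "h' (u @ x # y # v) = ksign (cdeg V x) (cdeg V y) * h' (u @ y # x # v)"
      using gsymD[OF Suc.prems, of u x y v] by (simp add: h'_def)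
  qed
  have L: "?L (Suc n) = (\<lambda>(x, u). x # u) ` (A \<times> ?L n)"
  proof (intro set_eqI iffI)
    fix u assume "u \<in> ?L (Suc n)"
    thus "u \<in> (\<lambda>(x, u). x # u) ` (A \<times> ?L n)" by (cases u) (auto intro!: rev_image_eqI)
  qed auto
  have fin: "finite (?L n)" using finite_lists_length_eq[OF assms(1), of n] by simp
  have dLh': "(\<Sum>u\<in>?L n. dL x h u * monom V u w) = fact n * dL x h' w" if "x \<in> A" for x w
    using Suc.IH[OF gsym_dL[OF Suc.prems], of x w] that by (auto simp: h'_def dL_def)
  have "(\<Sum>u\<in>?L (Suc n). h u * monom V u w) = (\<Sum>(x, u)\<in>A \<times> ?L n. h (x # u) * monom V (x # u) w)"
    unfolding L by (subst sum.reindex) (auto simp: inj_on_def case_prod_beta)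
  also have "\<dots> = (\<Sum>x\<in>A. \<Sum>u\<in>?L n. fmul V (coord_fun x) (\<lambda>v. dL x h u * monom V u v) w)"
    by (simp add: sum.cartesian_product monom_simps fmul_mult_right dL_def)
  also have "\<dots> = (\<Sum>x\<in>A. fmul V (coord_fun x) (\<lambda>v. \<Sum>u\<in>?L n. dL x h u * monom V u v) w)"
    using fin by (simp add: fmul_sum_right)
  also have "\<dots> = (\<Sum>x\<in>A. fact n * fmul V (coord_fun x) (dL x h') w)"
    by (rule sum.cong) (simp_all add: dLh' fmul_mult_right)
  also have "\<dots> = fact n * (\<Sum>x\<in>A. fmul V (coord_fun x) (dL x h') w)"
    by (simp add: sum_distrib_left)
  also have "(\<Sum>x\<in>A. fmul V (coord_fun x) (dL x h') w) = of_nat (length w) * h' w"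
  proof (cases "set w \<subseteq> A")
    case True
    hence "filter (\<lambda>x. x \<in> A) w = w" by (auto simp: filter_id_conv)
    thus ?thesis using euler_identity[OF h' assms(1), of w] by simp
  next
    case False
    have "fmul V (coord_fun x) (dL x h') w = 0" if "x \<in> A" for x
    proof (rule ccontr)
      assume "\<not> ?thesis"
      then obtain v where "w \<in> shuffles [x] v" "h' (x # v) \<noteq> 0" by (auto dest!: fmul_support simp: dL_def)
      thus False using False set_shuffles[of w "[x]" v] by (auto simp: h'_def split: if_splits)
    qed
    thus ?thesis using False by (simp add: h'_def)
  qed
  finally show ?case by (auto simp: h'_def algebra_simps)
qed

lemma finite_mset_eq: "finite {u. mset u = mset w}"
  by (rule finite_subset[OF _ finite_lists_length_le[of "set w" "length w"]])
    (auto dest: mset_eq_setD mset_eq_length)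

lemma taylor:
  fixes f :: "('v, 'k::field_char_0) series"
  assumes "is_function V B f"
  shows "lfsum (lists (coords B)) (\<lambda>u. f u / of_nat (fact (length u)) * monom V u w) = f w"
proof (cases "set w \<subseteq> coords B")
  case True
  \<comment> \<open>Only rearrangements of \<open>w\<close> contribute, so the finite alphabet
    \<open>set w\<close> suffices.\<close>
  let ?F = "{u. set u \<subseteq> set w \<and> length u = length w}"
  have "lfsum (lists (coords B)) (\<lambda>u. f u / of_nat (fact (length u)) * monom V u w)
     = (\<Sum>u\<in>?F. f u / of_nat (fact (length u)) * monom V u w)"
  proof (rule lfsum_eq_sum)
    show "finite ?F" using finite_lists_length_eq[of "set w" "length w"] by simp
    show "?F \<subseteq> lists (coords B)" using True by (auto simp: lists_eq_set)
    fix u assume "u \<notin> ?F"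
    hence "monom V u w = (0::'k)" using monom_support[of V u w] by (auto dest: mset_eq_setD mset_eq_length)
    thus "f u / of_nat (fact (length u)) * monom V u w = 0" by simp
  qed
  also have "\<dots> = (\<Sum>u\<in>?F. f u * monom V u w) / fact (length w)"
    unfolding sum_divide_distrib by (rule sum.cong) auto
  also have "\<dots> = f w"
    using taylor_homogeneous[OF _ is_function_gsym[OF assms], where A = "set w" and n = "length w" and w = w] by simp
  finally show ?thesis .
next
  case False
  have "lfsum (lists (coords B)) (\<lambda>u. f u / of_nat (fact (length u)) * monom V u w) = lfsum (lists (coords B)) (\<lambda>u. 0)"
  proof (rule lfsum_cong)
    fix u assume "u \<in> lists (coords B)"
    hence "mset u \<noteq> mset w" using False by (auto dest: mset_eq_setD)
    thus "f u / of_nat (fact (length u)) * monom V u w = 0" using monom_support[of V u w] by auto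
  qed
  thus ?thesis using False is_function_outside[OF assms] by simp
qed

text \<open>Allows a continuous map to be applied to the Taylor expansion term by term: a monomial
  is nonzero only at rearrangements of its own word, so summability is inherited from the finiteness
  clause of \<open>f\<close>.\<close>

lemma fam_taylor:
  fixes f :: "('v, 'k::field_char_0) series"
  assumes "is_function V B f"
  shows "fam V B (lists (coords B)) (\<lambda>u w. f u / of_nat (fact (length u)) * monom V u w)"
proof (rule famI)
  fix as m
  let ?F = "{(i, bs). i \<in> {()} \<and> length bs = m \<and> f (map Tc as @ map Chi bs) \<noteq> 0}"
  let ?G = "\<Union>(i, bs)\<in>?F. (\<lambda>u. (u, bs)) ` {u. mset u = mset (map Tc as @ map Chi bs)}"
  have "fam V B {()} (\<lambda>_. f)" using assms by (simp add: fam_singleton)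
  from fam_normal_finite[OF this, of m as] have "finite ?F" .
  hence fin: "finite ?G" by (intro finite_UN_I) (auto simp: finite_mset_eq simp del: mset_append)
  show "finite {(u, bs). u \<in> lists (coords B) \<and> length bs = m \<and>
      f u / of_nat (fact (length u)) * monom V u (map Tc as @ map Chi bs) \<noteq> 0}"
  proof (rule finite_subset[OF _ fin], rule subsetI)
    fix p assume p: "p \<in> {(u, bs). u \<in> lists (coords B) \<and> length bs = m \<and>
      f u / of_nat (fact (length u)) * monom V u (map Tc as @ map Chi bs) \<noteq> 0}"
    then obtain u bs where ub: "p = (u, bs)" "length bs = m" "f u \<noteq> 0"
      "monom V u (map Tc as @ map Chi bs) \<noteq> (0 :: 'k)" by auto
    hence u: "mset u = mset (map Tc as @ map Chi bs)" by (intro monom_support)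
    hence "f (map Tc as @ map Chi bs) \<noteq> 0"
      using ub gsym_permute[OF is_function_gsym[OF assms] u, of "[]"] by simp
    thus "p \<in> ?G" using u ub by (intro UN_I[of "((), bs)"]) auto
  qed
next
  fix u assume "u \<in> lists (coords B)"
  hence F: "is_function V B (monom V u :: ('v, 'k) series)" by (intro is_function_monom) (auto simp: lists_eq_set)
  thus "gsym V (\<lambda>w. f u / of_nat (fact (length u)) * monom V u w)"
    by (intro gsym_mult is_function_gsym)
  fix w assume "\<not> set w \<subseteq> coords B"
  thus "f u / of_nat (fact (length u)) * monom V u w = 0" using is_function_outside[OF F] by simp
qed


section \<open>Poisson homomorphisms\<close>

text \<open>The last clause is continuity. The first argument is the index type of the families for which
  it is required, since one cannot quantify over all types.\<close>

definition poisson_hom :: "'i itself \<Rightarrow> (int \<Rightarrow> 'w set) \<Rightarrow> 'w set \<Rightarrow> (int \<Rightarrow> 'v set) \<Rightarrow> 'v set \<Rightarrow>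
    (('w, 'k::field_char_0) series \<Rightarrow> ('v, 'k) series) \<Rightarrow> bool" where
  "poisson_hom _ V' B' V B \<phi> \<longleftrightarrow>
     (\<forall>f c. is_function V' B' f \<longrightarrow> \<phi> (\<lambda>w. c * f w) = (\<lambda>w. c * \<phi> f w)) \<and>
     (\<forall>f p. is_function V' B' f \<longrightarrow> has_degree V' p f \<longrightarrow> has_degree V p (\<phi> f)) \<and>
     (\<forall>f. is_function V' B' f \<longrightarrow> vanishes_on_L f \<longrightarrow> vanishes_on_L (\<phi> f)) \<and>
     (\<forall>f. is_function V' B' f \<longrightarrow> vanishes_on_PiL f \<longrightarrow> vanishes_on_PiL (\<phi> f)) \<and>
     \<phi> fone = fone \<and>
     (\<forall>f g. is_function V' B' f \<longrightarrow> is_function V' B' g \<longrightarrow> \<phi> (fmul V' f g) = fmul V (\<phi> f) (\<phi> g)) \<and>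
     (\<forall>f g. is_function V' B' f \<longrightarrow> is_function V' B' g \<longrightarrow> \<phi> (bracket V' B' f g) = bracket V B (\<phi> f) (\<phi> g)) \<and>
     (\<forall>(I :: 'i set) f. fam V' B' I f \<longrightarrow> fam V B I (\<lambda>i. \<phi> (f i)) \<and>
        \<phi> (\<lambda>w. lfsum I (\<lambda>i. f i w)) = (\<lambda>w. lfsum I (\<lambda>i. \<phi> (f i) w)))"

lemma poisson_hom_mult: "poisson_hom T V' B' V B \<phi> \<Longrightarrow> is_function V' B' f \<Longrightarrow> \<phi> (\<lambda>w. c * f w) = (\<lambda>w. c * \<phi> f w)"
  and poisson_hom_degree: "poisson_hom T V' B' V B \<phi> \<Longrightarrow> is_function V' B' f \<Longrightarrow> has_degree V' p f \<Longrightarrow> has_degree V p (\<phi> f)"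
  and poisson_hom_L: "poisson_hom T V' B' V B \<phi> \<Longrightarrow> is_function V' B' f \<Longrightarrow> vanishes_on_L f \<Longrightarrow> vanishes_on_L (\<phi> f)"
  and poisson_hom_PiL: "poisson_hom T V' B' V B \<phi> \<Longrightarrow> is_function V' B' f \<Longrightarrow> vanishes_on_PiL f \<Longrightarrow> vanishes_on_PiL (\<phi> f)"
  and poisson_hom_fone: "poisson_hom T V' B' V B \<phi> \<Longrightarrow> \<phi> fone = fone"
  and poisson_hom_fmul: "poisson_hom T V' B' V B \<phi> \<Longrightarrow> is_function V' B' f \<Longrightarrow> is_function V' B' g \<Longrightarrow> \<phi> (fmul V' f g) = fmul V (\<phi> f) (\<phi> g)"
  and poisson_hom_bracket: "poisson_hom T V' B' V B \<phi> \<Longrightarrow> is_function V' B' f \<Longrightarrow> is_function V' B' g \<Longrightarrow> \<phi> (bracket V' B' f g) = bracket V B (\<phi> f) (\<phi> g)"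
  by (auto simp: poisson_hom_def)

lemma poisson_hom_fam:
  fixes I :: "'i set"
  assumes "poisson_hom (TYPE('i)) V' B' V B \<phi>" "fam V' B' I f"
  shows "fam V B I (\<lambda>i. \<phi> (f i))" "\<phi> (\<lambda>w. lfsum I (\<lambda>i. f i w)) = (\<lambda>w. lfsum I (\<lambda>i. \<phi> (f i) w))"
  using assms unfolding poisson_hom_def by blast+

text \<open>Continuity is recorded for one index type only, in practice words; families indexed by
  coordinates or basis elements are covered by embedding these as one-letter words.\<close>

lemma poisson_hom_fam_inj:
  fixes r :: "'j \<Rightarrow> 'i" and J :: "'j set"
  assumes \<phi>: "poisson_hom (TYPE('i)) V' B' V B \<phi>" and f: "fam V' B' J f" and r: "inj r"
  shows "fam V B J (\<lambda>i. \<phi> (f i))" "\<phi> (\<lambda>w. lfsum J (\<lambda>i. f i w)) = (\<lambda>w. lfsum J (\<lambda>i. \<phi> (f i) w))"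
proof -
  have "fam V' B' (r ` J) (\<lambda>i. f (inv r i))"
    using f by (rule fam_reindex) (use r in \<open>auto simp: inj_on_def\<close>)
  note F = poisson_hom_fam[OF \<phi> this]
  have rJ: "inj_on r J" using r by (rule inj_on_subset) simp
  have "fam V B J (\<lambda>j. \<phi> (f (inv r (r j))))"
    by (rule fam_reindex[OF F(1) rJ]) simp
  thus "fam V B J (\<lambda>i. \<phi> (f i))" using r by simp
  show "\<phi> (\<lambda>w. lfsum J (\<lambda>i. f i w)) = (\<lambda>w. lfsum J (\<lambda>i. \<phi> (f i) w))"
    using F(2) r by (simp add: lfsum_reindex[OF rJ])
qed

text \<open>Continuity on a family with one member.\<close>

lemma poisson_hom_function:
  fixes \<phi> :: "('w, 'k::field_char_0) series \<Rightarrow> ('v, 'k) series"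
  assumes "poisson_hom (T :: 'i itself) V' B' V B \<phi>" "is_function V' B' f"
  shows "is_function V B (\<phi> f)"
proof -
  have "poisson_hom TYPE('i) V' B' V B \<phi>" using assms(1) unfolding poisson_hom_def by blast
  moreover have "fam V' B' {undefined :: 'i} (\<lambda>_. f)" using assms(2) by (simp add: fam_singleton)
  ultimately have "fam V B {undefined :: 'i} (\<lambda>_. \<phi> f)" by (rule poisson_hom_fam(1))
  thus ?thesis by (simp add: fam_singleton)
qed

lemma poisson_hom_comp:
  fixes \<phi> :: "('w, 'k::field_char_0) series \<Rightarrow> ('v, 'k) series" and \<psi> :: "('u, 'k) series \<Rightarrow> ('w, 'k) series"
  assumes "poisson_hom TYPE('i) V2 B2 V1 B1 \<phi>" "poisson_hom TYPE('i) V3 B3 V2 B2 \<psi>"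
  shows "poisson_hom TYPE('i) V3 B3 V1 B1 (\<lambda>f. \<phi> (\<psi> f))"
  unfolding poisson_hom_def
proof (intro conjI allI impI)
  note fn = poisson_hom_function[OF assms(2)]
  fix I :: "'i set" and f :: "'i \<Rightarrow> ('u, 'k) series" assume f: "fam V3 B3 I f"
  note \<psi> = poisson_hom_fam[OF assms(2) f]
  show "fam V1 B1 I (\<lambda>i. \<phi> (\<psi> (f i)))" by (rule poisson_hom_fam(1)[OF assms(1) \<psi>(1)])
  show "\<phi> (\<psi> (\<lambda>w. lfsum I (\<lambda>i. f i w))) = (\<lambda>w. lfsum I (\<lambda>i. \<phi> (\<psi> (f i)) w))"
    unfolding \<psi>(2) by (rule poisson_hom_fam(2)[OF assms(1) \<psi>(1)])
qed (use poisson_hom_function[OF assms(2)] in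
  \<open>auto simp: poisson_hom_mult[OF assms(1)] poisson_hom_mult[OF assms(2)] poisson_hom_fone[OF assms(1)]
    poisson_hom_fone[OF assms(2)] poisson_hom_fmul[OF assms(1)] poisson_hom_fmul[OF assms(2)]
    poisson_hom_bracket[OF assms(1)] poisson_hom_bracket[OF assms(2)]
    intro: poisson_hom_degree[OF assms(1)] poisson_hom_L[OF assms(1)] poisson_hom_PiL[OF assms(1)]
    poisson_hom_degree[OF assms(2)] poisson_hom_L[OF assms(2)] poisson_hom_PiL[OF assms(2)]\<close>)

lemma poisson_hom_id: "poisson_hom TYPE('i) V B V B (\<lambda>f. f)"
  by (simp add: poisson_hom_def)

lemma poisson_hom_monom:
  assumes \<phi>: "poisson_hom T V' B' V B \<phi>" and "set u \<subseteq> coords B'"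
  shows "\<phi> (monom V' u) = fprod V (map (\<lambda>x. \<phi> (coord_fun x)) u)"
  using assms(2)
  by (induction u)
    (auto simp: monom_simps fprod_def poisson_hom_fone[OF \<phi>] poisson_hom_fmul[OF \<phi>] is_function_coord_fun is_function_monom)

lemma poisson_hom_pullback:
  fixes \<phi> :: "('w, 'k::field_char_0) series \<Rightarrow> ('v, 'k) series"
  assumes \<phi>: "poisson_hom TYPE('w coord list) V' B' V B \<phi>" and f: "is_function V' B' f"
  shows "pullback V B' (\<lambda>x. \<phi> (coord_fun x)) f = \<phi> f"
proof -
  have "\<phi> (\<lambda>w. lfsum (lists (coords B')) (\<lambda>u. f u / of_nat (fact (length u)) * monom V' u w))
     = (\<lambda>w. lfsum (lists (coords B')) (\<lambda>u. \<phi> (\<lambda>w. f u / of_nat (fact (length u)) * monom V' u w) w))"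
    by (rule poisson_hom_fam(2)[OF \<phi> fam_taylor[OF f]])
  moreover have "(\<lambda>w. lfsum (lists (coords B')) (\<lambda>u. f u / of_nat (fact (length u)) * monom V' u w)) = f"
    by (rule ext) (rule taylor[OF f])
  moreover have "lfsum (lists (coords B')) (\<lambda>u. \<phi> (\<lambda>w. f u / of_nat (fact (length u)) * monom V' u w) w)
     = pullback V B' (\<lambda>x. \<phi> (coord_fun x)) f w" for w
    unfolding pullback_def
  proof (rule lfsum_cong)
    fix u assume "u \<in> lists (coords B')"
    hence u: "set u \<subseteq> coords B'" by (auto simp: lists_eq_set)
    show "\<phi> (\<lambda>w. f u / of_nat (fact (length u)) * monom V' u w) w
       = f u / of_nat (fact (length u)) * fprod V (map (\<lambda>x. \<phi> (coord_fun x)) u) w"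
      by (simp only: poisson_hom_mult[OF \<phi> is_function_monom[OF u]] poisson_hom_monom[OF \<phi> u])
  qed
  ultimately show ?thesis by simp
qed

lemma bracket_coord_left:
  assumes "x \<in> coords B" "is_function V B f"
  shows "bracket V B (coord_fun x) f = (\<lambda>w. eps x * dL (dual x) f w)"
proof
  fix w
  have "cterm V (coord_fun x) f z w = (if z = x then eps x * dL (dual x) f w else 0)" for z
    by (simp add: cterm_def dR_coord_fun fmul_fone)
  thus "bracket V B (coord_fun x) f w = eps x * dL (dual x) f w"
    using assms by (simp add: bracket_cterm is_function_coord_fun lfsum_single)
qed

lemma bracket_coord_right:
  assumes "x \<in> coords B" "is_function V B f"
  shows "bracket V B f (coord_fun x) = (\<lambda>w. eps (dual x) * dR (dual x) f w)"
proof
  fix w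
  have "cterm V f (coord_fun x) z w = (if z = dual x then eps (dual x) * dR (dual x) f w else 0)" for z
  proof (cases "z = dual x")
    case False
    hence "dual z \<noteq> x" by (metis dual_dual)
    thus ?thesis using False by (simp add: cterm_def dL_coord_fun)
  qed (simp add: cterm_def dL_coord_fun fmul_fone)
  thus "bracket V B f (coord_fun x) w = eps (dual x) * dR (dual x) f w"
    using assms by (simp add: bracket_cterm is_function_coord_fun lfsum_single del: eps_dual)
qed

text \<open>The bracket is expressed through the brackets with coordinates; a Poisson isomorphism therefore
  yields the same formula in the new coordinates, and this is the invariance of the symplectic form.\<close>

lemma cterm_coord:
  fixes f g :: "('v, 'k::field_char_0) series"
  assumes "is_function V B f" "is_function V B g" "z \<in> coords B"
  shows "cterm V f g z = (\<lambda>w. eps z * fmul V (bracket V B f (coord_fun (dual z))) (bracket V B (coord_fun z) g) w)"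
  using assms
    by (simp add: cterm_def bracket_coord_left bracket_coord_right fmul_mult_left fmul_mult_right)

lemma poisson_hom_bracket_coords:
  fixes \<phi> :: "('w, 'k::field_char_0) series \<Rightarrow> ('v, 'k) series"
  assumes \<phi>: "poisson_hom TYPE('w coord list) V' B' V B \<phi>"
    and f: "is_function V' B' f" and g: "is_function V' B' g"
  shows "bracket V B (\<phi> f) (\<phi> g) w = lfsum (coords B') (\<lambda>z. eps z *
     fmul V (bracket V B (\<phi> f) (\<phi> (coord_fun (dual z)))) (bracket V B (\<phi> (coord_fun z)) (\<phi> g)) w)"
    "finite {z \<in> coords B'. eps z *
     fmul V (bracket V B (\<phi> f) (\<phi> (coord_fun (dual z)))) (bracket V B (\<phi> (coord_fun z)) (\<phi> g)) w \<noteq> 0}"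
proof -
  have inj: "inj (\<lambda>x. [x] :: 'w coord list)" by (simp add: inj_on_def)
  note F = poisson_hom_fam_inj[OF \<phi> fam_cterm_single[OF f g] inj]
  have eq: "\<phi> (cterm V' f g z) w = eps z *
     fmul V (bracket V B (\<phi> f) (\<phi> (coord_fun (dual z)))) (bracket V B (\<phi> (coord_fun z)) (\<phi> g)) w"
    if "z \<in> coords B'" for z
  proof -
    have c: "is_function V' B' (coord_fun z)" "is_function V' B' (coord_fun (dual z))"
      using that by (auto intro: is_function_coord_fun)
    note b = is_function_bracket[OF f c(2)] is_function_bracket[OF c(1) g]
    show ?thesis
      by (simp only: cterm_coord[OF f g that] poisson_hom_mult[OF \<phi> is_function_fmul[OF b]]
          poisson_hom_fmul[OF \<phi> b] poisson_hom_bracket[OF \<phi> f c(2)] poisson_hom_bracket[OF \<phi> c(1) g])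
  qed
  have "bracket V B (\<phi> f) (\<phi> g) w = lfsum (coords B') (\<lambda>z. \<phi> (cterm V' f g z) w)"
    using poisson_hom_bracket[OF \<phi> f g, symmetric] unfolding bracket_cterm[OF f g] F(2) by simp
  also have "\<dots> = lfsum (coords B') (\<lambda>z. eps z *
     fmul V (bracket V B (\<phi> f) (\<phi> (coord_fun (dual z)))) (bracket V B (\<phi> (coord_fun z)) (\<phi> g)) w)"
    by (rule lfsum_cong) (rule eq)
  finally show "bracket V B (\<phi> f) (\<phi> g) w = lfsum (coords B') (\<lambda>z. eps z *
     fmul V (bracket V B (\<phi> f) (\<phi> (coord_fun (dual z)))) (bracket V B (\<phi> (coord_fun z)) (\<phi> g)) w)" .
  show "finite {z \<in> coords B'. eps z *
     fmul V (bracket V B (\<phi> f) (\<phi> (coord_fun (dual z)))) (bracket V B (\<phi> (coord_fun z)) (\<phi> g)) w \<noteq> 0}"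
    by (rule finite_subset[OF _ fam_pointwise[OF F(1), of w]]) (auto simp: eq)
qed

text \<open>The pullbacks of dual coordinates have degrees of sum 1. Under this condition the signs
  from exchanging factors and sides collapse to the sign in \<open>d_wedge_d\<close>.\<close>

lemma fmul_dL_dR_swap:
  assumes f: "gsym V f" "has_parity V p f" and g: "gsym V g" "has_parity V (1 - p) g"
  shows "fmul V (dL x g) (dR y f) w = ksign (cdeg V x) (cdeg V y) * fmul V (dL y f) (dR x g) w"
proof -
  note pf = has_parity_dL[OF f(2), of y] has_parity_dR[OF f(2), of y]
  note pg = has_parity_dL[OF g(2), of x] has_parity_dR[OF g(2), of x]
  have "dR y f = (\<lambda>w. ksign (cdeg V y) (p - cdeg V y) * dL y f w)"
    using dR_eq_dL[OF f(1), of y] tw_parity[OF pf(1)] by simp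
  moreover have "dL x g = (\<lambda>w. ksign (cdeg V x) (1 - p - cdeg V x) * dR x g w)"
    using dL_eq_dR[OF g(1), of x] tw_parity[OF pg(2)] by simp
  ultimately have "fmul V (dL x g) (dR y f) w = (ksign (1 - p - cdeg V x) (p - cdeg V y) *
     (ksign (cdeg V x) (1 - p - cdeg V x) * ksign (cdeg V y) (p - cdeg V y))) * fmul V (dL y f) (dR x g) w"
    using fmul_commute_parity[OF pg(1), of "dR y f"] tw_parity[OF pf(2), of "1 - p - cdeg V x"]
    by (simp add: fmul_mult_left fmul_mult_right)
  also have "ksign (1 - p - cdeg V x) (p - cdeg V y) *
     (ksign (cdeg V x) (1 - p - cdeg V x) * ksign (cdeg V y) (p - cdeg V y)) = ksign (cdeg V x) (cdeg V y)"
    by (auto simp: ksign_def)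
  finally show ?thesis .
qed

text \<open>Brackets with coordinates are derivatives. Hence the coordinate formula for the bracket,
  applied to preimages of \<open>coord_fun (dual x)\<close> and \<open>coord_fun (dual y)\<close>,
  contracts the derivatives of the \<open>\<phi> (coord_fun z)\<close> exactly as the pulled back
  2-form does. Surjectivity provides the preimages.\<close>

lemma pullback_omega_bracket:
  fixes \<phi> :: "('w, 'k::field_char_0) series \<Rightarrow> ('v, 'k) series"
  assumes \<phi>: "poisson_hom TYPE('w coord list) V' B' V B \<phi>"
    and surj: "\<And>f. is_function V B f \<Longrightarrow> \<exists>g. is_function V' B' g \<and> \<phi> g = f"
    and x: "x \<in> coords B" and y: "y \<in> coords B"
  shows "pullback_omega V B' (\<lambda>z. \<phi> (coord_fun z)) x y w
     = eps x * eps y * bracket V B (coord_fun (dual x)) (coord_fun (dual y)) w"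
proof -
  let ?F = "\<lambda>z. \<phi> (coord_fun z)"
  obtain f g where f: "is_function V' B' f" "\<phi> f = coord_fun (dual x)"
    and g: "is_function V' B' g" "\<phi> g = coord_fun (dual y)"
    using surj is_function_coord_fun x y dual_coords by metis
  have F: "is_function V B (?F z)" "has_degree V (cdeg V' z) (?F z)" if "z \<in> coords B'" for z
    using that poisson_hom_function[OF \<phi>] poisson_hom_degree[OF \<phi>]
    by (auto simp: is_function_coord_fun has_degree_coord_fun)
  have eq: "eps z * fmul V (bracket V B (\<phi> f) (?F (dual z))) (bracket V B (?F z) (\<phi> g)) w
     = - (eps x * eps y * (eps z * fmul V (dL x (?F (dual z))) (dR y (?F z)) w))" if "z \<in> coords B'" for z
    using that x y F[of z] F[of "dual z"]
    by (simp add: f g bracket_coord_left bracket_coord_right fmul_mult_left fmul_mult_right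
        fmul_uminus_left fmul_uminus_right mult.left_commute[of "eps z"] mult.assoc)
  have "bracket V B (coord_fun (dual x)) (coord_fun (dual y)) w
     = lfsum (coords B') (\<lambda>z. eps z * fmul V (bracket V B (\<phi> f) (?F (dual z))) (bracket V B (?F z) (\<phi> g)) w)"
    using poisson_hom_bracket_coords(1)[OF \<phi> f(1) g(1), of w] f g by simp
  also have "\<dots> = lfsum B' (\<lambda>b. eps x * eps y * d_wedge_d V (?F (Tc b)) (?F (Chi b)) x y w)"
    unfolding lfsum_coords[OF poisson_hom_bracket_coords(2)[OF \<phi> f(1) g(1)]]
  proof (rule lfsum_cong)
    fix b assume b: "b \<in> B'"
    have "fmul V (dL x (?F (Chi b))) (dR y (?F (Tc b))) w
       = ksign (cdeg V x) (cdeg V y) * fmul V (dL y (?F (Tc b))) (dR x (?F (Chi b))) w"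
    proof (rule fmul_dL_dR_swap)
      show "has_parity V (cdeg V' (Tc b)) (?F (Tc b))" "has_parity V (1 - cdeg V' (Tc b)) (?F (Chi b))"
        using F[of "Tc b"] F[of "Chi b"] b by (auto dest: has_degree_parity simp: add.commute)
    qed (rule is_function_gsym[OF F(1)], use b in simp)+
    thus "eps (Tc b) * fmul V (bracket V B (\<phi> f) (?F (dual (Tc b)))) (bracket V B (?F (Tc b)) (\<phi> g)) w +
       eps (Chi b) * fmul V (bracket V B (\<phi> f) (?F (dual (Chi b)))) (bracket V B (?F (Chi b)) (\<phi> g)) w
       = eps x * eps y * d_wedge_d V (?F (Tc b)) (?F (Chi b)) x y w"
      using eq[of "Tc b"] eq[of "Chi b"] b by (simp add: d_wedge_d_def algebra_simps)
  qed
  also have "\<dots> = eps x * eps y * pullback_omega V B' ?F x y w"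
    unfolding pullback_omega_def by (rule lfsum_cmult)
  finally have "eps x * eps y * bracket V B (coord_fun (dual x)) (coord_fun (dual y)) w
     = (eps x * eps x) * (eps y * eps y) * pullback_omega V B' ?F x y w" by (simp only: mult_ac)
  thus ?thesis by simp
qed

text \<open>The value found in \<open>pullback_omega_bracket\<close> does not involve \<phi>, so it
  may be compared with the identity map, for which the pullback is \<open>omega\<close>
  itself.\<close>

lemma poisson_iso_pullback_omega:
  fixes \<phi> :: "('w, 'k::field_char_0) series \<Rightarrow> ('v, 'k) series"
  assumes \<phi>: "poisson_hom TYPE('w coord list) V' B' V B \<phi>"
    and surj: "\<And>f. is_function V B f \<Longrightarrow> \<exists>g. is_function V' B' g \<and> \<phi> g = f"
    and "x \<in> coords B" "y \<in> coords B"
  shows "pullback_omega V B' (\<lambda>z. \<phi> (coord_fun z)) x y = omega V B x y"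
proof
  fix w
  have "(omega V B x y w :: 'k) = eps x * eps y * bracket V B (coord_fun (dual x)) (coord_fun (dual y)) w"
    unfolding omega_def by (rule pullback_omega_bracket[OF poisson_hom_id _ assms(3,4)]) auto
  thus "pullback_omega V B' (\<lambda>z. \<phi> (coord_fun z)) x y w = omega V B x y w"
    using pullback_omega_bracket[OF assms] by simp
qed

lemma poisson_hom_formal_map:
  fixes \<phi> :: "('w, 'k::field_char_0) series \<Rightarrow> ('v, 'k) series"
  assumes \<phi>: "poisson_hom TYPE('w coord list) V' B' V B \<phi>"
  shows "formal_map V B V' B' (\<lambda>z. \<phi> (coord_fun z))"
proof -
  have inj: "inj (\<lambda>b. [Tc b] :: 'w coord list)" by (simp add: inj_on_def)
  have "fam V B B' (\<lambda>b. \<phi> (coord_fun (Tc b)))"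
    by (rule poisson_hom_fam_inj(1)[OF \<phi> fam_coord_fun_Tc inj])
  from fam_normal_finite[OF this] show ?thesis
    unfolding formal_map_def
    using poisson_hom_function[OF \<phi>] poisson_hom_degree[OF \<phi>] poisson_hom_L[OF \<phi>] poisson_hom_PiL[OF \<phi>]
    by (auto simp: is_function_coord_fun has_degree_coord_fun vanishes_on_L_Tc vanishes_on_PiL_Chi)
qed

lemma lie1bi_isomorphicI:
  fixes \<phi> :: "('w, 'k::field_char_0) series \<Rightarrow> ('v, 'k) series"
  assumes \<phi>: "poisson_hom TYPE('w coord list) V' B' V B \<phi>" and \<psi>: "poisson_hom TYPE('v coord list) V B V' B' \<psi>"
    and \<phi>\<psi>: "\<And>f. is_function V B f \<Longrightarrow> \<phi> (\<psi> f) = f" and \<psi>\<phi>: "\<And>f. is_function V' B' f \<Longrightarrow> \<psi> (\<phi> f) = f"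
    and \<Gamma>: "is_function V B \<Gamma>" and \<Gamma>': "is_function V' B' \<Gamma>'" "\<phi> \<Gamma>' = \<Gamma>"
  shows "lie1bi_isomorphic V B \<Gamma> V' B' \<Gamma>'"
  unfolding lie1bi_isomorphic_def lie1bi_morphism_def
proof (intro exI conjI ballI)
  note fn = poisson_hom_function[OF \<phi>] poisson_hom_function[OF \<psi>]
  show "pullback_omega V B' (\<lambda>z. \<phi> (coord_fun z)) x y = omega V B x y" if "x \<in> coords B" "y \<in> coords B" for x y
    by (rule poisson_iso_pullback_omega[OF \<phi> _ that]) (use \<phi>\<psi> fn in blast)
  show "pullback_omega V' B (\<lambda>z. \<psi> (coord_fun z)) x y = omega V' B' x y" if "x \<in> coords B'" "y \<in> coords B'" for x y
    by (rule poisson_iso_pullback_omega[OF \<psi> _ that]) (use \<psi>\<phi> fn in blast)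
  show "pullback V B' (\<lambda>z. \<phi> (coord_fun z)) \<Gamma>' = \<Gamma>" "pullback V' B (\<lambda>z. \<psi> (coord_fun z)) \<Gamma> = \<Gamma>'"
    using poisson_hom_pullback[OF \<phi> \<Gamma>'(1)] poisson_hom_pullback[OF \<psi> \<Gamma>] \<psi>\<phi>[OF \<Gamma>'(1)] \<Gamma>'(2) by auto
  show "pullback V B' (\<lambda>z. \<phi> (coord_fun z)) (\<psi> (coord_fun x)) = coord_fun x" if "x \<in> coords B" for x
    using that fn \<phi>\<psi> by (simp add: poisson_hom_pullback[OF \<phi>] is_function_coord_fun)
  show "pullback V' B (\<lambda>z. \<psi> (coord_fun z)) (\<phi> (coord_fun y)) = coord_fun y" if "y \<in> coords B'" for y
    using that fn \<psi>\<phi> by (simp add: poisson_hom_pullback[OF \<psi>] is_function_coord_fun)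
qed (rule poisson_hom_formal_map[OF \<phi>] poisson_hom_formal_map[OF \<psi>])+


section \<open>Exponentials of Hamiltonian vector fields\<close>

text \<open>Membership in the p-th power of the ideal of the distinguished point.\<close>

definition starts :: "nat \<Rightarrow> ('v, 'k::zero) series \<Rightarrow> bool" where
  "starts p f \<longleftrightarrow> (\<forall>w. length w < p \<longrightarrow> f w = 0)"

lemma length_filter_nths_compl:
  "length (filter p (nths w S)) + length (filter p (nths w (- S))) = length (filter p w)"
proof (induction w arbitrary: S)
  case (Cons x w)
  have "{j. Suc j \<in> - S} = - {j. Suc j \<in> S}" by auto
  thus ?case using Cons.IH[of "{j. Suc j \<in> S}"] by (simp add: nths_Cons)
qed simp

lemma length_nths_compl: "length (nths w S) + length (nths w (- S)) = length w"
  using length_filter_nths_compl[of "\<lambda>_. True" w S] by simp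

lemma fmul_cong:
  assumes "\<And>u v. length u + length v = length w \<Longrightarrow> f u * g v = f' u * g' v"
  shows "fmul V f g w = fmul V f' g' w"
  unfolding fmul_def mult.assoc using assms length_nths_compl by (intro sum.cong) auto

text \<open>A contraction consumes one letter of each factor, so the two words entering a
  coefficient at \<open>w\<close> have total length \<open>length w + 2\<close>. All later estimates
  of orders rest on this.\<close>

lemma bracket_cong:
  assumes "\<And>z u v. z \<in> coords B \<Longrightarrow> length u + length v = length w \<Longrightarrow>
     f (u @ [z]) * g (dual z # v) = f' (u @ [z]) * g' (dual z # v)"
  shows "bracket V B f g w = bracket V B f' g' w"
proof -
  have "fmul V (dR z f) (dL (dual z) g) w = fmul V (dR z f') (dL (dual z) g') w" if "z \<in> coords B" for z
    by (rule fmul_cong) (use assms that in \<open>simp add: dR_def dL_def\<close>)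
  from this[of "Tc _"] this[of "Chi _"] show ?thesis
    unfolding bracket_def by (intro lfsum_cong) simp
qed

lemma starts_fmul:
  assumes "starts p f" "starts q g"
  shows "starts (p + q) (fmul V f g)"
  unfolding starts_def
proof (intro allI impI)
  fix w :: "'a coord list" assume w: "length w < p + q"
  have "fmul V f g w = fmul V (\<lambda>_. 0) g w"
  proof (rule fmul_cong)
    fix u v :: "'a coord list" assume "length u + length v = length w"
    hence "length u < p \<or> length v < q" using w by linarith
    thus "f u * g v = 0 * g v" using assms by (auto simp: starts_def)
  qed
  thus "fmul V f g w = 0" by simp
qed

lemma bracket_zero [simp]: "bracket V B (\<lambda>w. 0) g w = 0" "bracket V B f (\<lambda>w. 0) w = 0"
  using bracket_mult_left[of V B 0] bracket_mult_right[of V B f 0] by simp_all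

lemma starts_bracket:
  assumes "starts p f" "starts q g" "r + 2 \<le> p + q"
  shows "starts r (bracket V B f g)"
  unfolding starts_def
proof (intro allI impI)
  fix w :: "'a coord list" assume w: "length w < r"
  have "bracket V B f g w = bracket V B (\<lambda>_. 0) g w"
  proof (rule bracket_cong)
    fix z and u v :: "'a coord list" assume "length u + length v = length w"
    hence "length (u @ [z]) < p \<or> length (dual z # v) < q" using w assms(3) by auto
    thus "f (u @ [z]) * g (dual z # v) = 0 * g (dual z # v)" using assms by (auto simp: starts_def)
  qed
  thus "bracket V B f g w = 0" by simp
qed

lemma bracket_sum_right:
  assumes "finite A" "is_function V B f" "\<And>i. i \<in> A \<Longrightarrow> is_function V B (g i)"
  shows "bracket V B f (\<lambda>w. \<Sum>i\<in>A. g i w) w = (\<Sum>i\<in>A. bracket V B f (g i) w)"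
  using bracket_lfsum[OF assms(2) fam_finite_index[OF assms(1,3)]] assms(1) by (simp add: lfsum_finite)

lemma is_function_sum:
  assumes "finite A" "\<And>i. i \<in> A \<Longrightarrow> is_function V B (g i)"
  shows "is_function V B (\<lambda>w. \<Sum>i\<in>A. g i w)"
  using is_function_lfsum[OF fam_finite_index[OF assms]] assms(1) by (simp add: lfsum_finite)

lemma bracket_sum_left:
  assumes "finite A" "is_function V B f" "\<And>i. i \<in> A \<Longrightarrow> is_function V B (g i)"
  shows "bracket V B (\<lambda>w. \<Sum>i\<in>A. g i w) f w = (\<Sum>i\<in>A. bracket V B (g i) f w)"
  using assms(1,3)
proof (induction A rule: finite_induct)
  case (insert i A)
  thus ?case using assms(2)
    by (simp add: bracket_add_left is_function_sum)
qed simp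

text \<open>Degree 1 makes \<open>ad_S\<close> preserve degrees; order 3 makes it raise the order,
  as a bracket loses two letters; the vanishing conditions make the flow preserve both
  Lagrangians.\<close>

definition hamiltonian :: "(int \<Rightarrow> 'v set) \<Rightarrow> 'v set \<Rightarrow> ('v, 'k::field_char_0) series \<Rightarrow> bool" where
  "hamiltonian V B S \<longleftrightarrow> is_function V B S \<and> has_degree V 1 S \<and> starts 3 S \<and>
     vanishes_on_L S \<and> vanishes_on_PiL S"

text \<open>In each Taylor coefficient of \<open>exp(ad\<^sub>S) = \<Sum> ad\<^sub>S\<^sup>n / n!\<close> only finitely many terms occur, since
  \<open>ad\<^sub>S\<close> raises the polynomial order.\<close>

definition dpow :: "(int \<Rightarrow> 'v set) \<Rightarrow> 'v set \<Rightarrow> ('v, 'k::field_char_0) series \<Rightarrow> nat \<Rightarrow> ('v, 'k) series \<Rightarrow> ('v, 'k) series"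
  where "dpow V B S n f = (\<lambda>w. (bracket V B S ^^ n) f w / fact n)"

definition expad :: "(int \<Rightarrow> 'v set) \<Rightarrow> 'v set \<Rightarrow> ('v, 'k::field_char_0) series \<Rightarrow> ('v, 'k) series \<Rightarrow> ('v, 'k) series"
  where "expad V B S f = (\<lambda>w. \<Sum>n\<le>length w. dpow V B S n f w)"

lemma dpow_0 [simp]: "dpow V B S 0 f = f"
  by (simp add: dpow_def)

lemma bracket_dpow: "bracket V B S (dpow V B S n f) w = of_nat (Suc n) * dpow V B S (Suc n) f w"
proof -
  have "bracket V B S (dpow V B S n f) w = bracket V B S (\<lambda>w. inverse (fact n) * (bracket V B S ^^ n) f w) w"
    by (simp add: dpow_def divide_inverse mult.commute)
  thus ?thesis unfolding bracket_mult_right by (simp add: dpow_def field_simps del: of_nat_Suc)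
qed

lemma dpow_Suc: "dpow V B S (Suc n) f = (\<lambda>w. bracket V B S (dpow V B S n f) w / of_nat (Suc n))"
  by (rule ext) (simp add: bracket_dpow del: of_nat_Suc)

lemma fam_dpow:
  assumes "is_function V B S" "fam V B I f"
  shows "fam V B I (\<lambda>i. dpow V B S n (f i))"
    "dpow V B S n (\<lambda>w. lfsum I (\<lambda>i. f i w)) w = lfsum I (\<lambda>i. dpow V B S n (f i) w)"
proof -
  have "fam V B I (\<lambda>i. dpow V B S n (f i)) \<and>
    (\<forall>w. dpow V B S n (\<lambda>w. lfsum I (\<lambda>i. f i w)) w = lfsum I (\<lambda>i. dpow V B S n (f i) w))"
  proof (induction n)
    case (Suc n)
    have "dpow V B S n (\<lambda>w. lfsum I (\<lambda>i. f i w)) = (\<lambda>w. lfsum I (\<lambda>i. dpow V B S n (f i) w))"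
      using Suc by auto
    moreover have "fam V B I (\<lambda>i w. inverse (of_nat (Suc n)) * bracket V B S (dpow V B S n (f i)) w)"
      by (intro fam_mult fam_bracket) (use Suc assms in auto)
    ultimately show ?case
      using bracket_lfsum[OF assms(1) conjunct1[OF Suc]]
      by (simp add: dpow_Suc divide_inverse mult.commute lfsum_cmult del: of_nat_Suc)
  qed (use assms in simp)
  thus "fam V B I (\<lambda>i. dpow V B S n (f i))"
    "dpow V B S n (\<lambda>w. lfsum I (\<lambda>i. f i w)) w = lfsum I (\<lambda>i. dpow V B S n (f i) w)" by auto
qed

lemma is_function_dpow:
  assumes "is_function V B S" "is_function V B f"
  shows "is_function V B (dpow V B S n f)"
  using fam_dpow(1)[OF assms(1), of "{()}" "\<lambda>_. f" n] assms(2) by (simp add: fam_singleton)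

lemma dpow_mult: "dpow V B S n (\<lambda>w. c * f w) = (\<lambda>w. c * dpow V B S n f w)"
proof (induction n)
  case (Suc n)
  thus ?case by (simp add: dpow_Suc bracket_mult_right del: of_nat_Suc)
qed simp

lemma dpow_properties:
  assumes "hamiltonian V B S"
  shows "has_degree V p f \<Longrightarrow> has_degree V p (dpow V B S n f)"
    "vanishes_on_L f \<Longrightarrow> vanishes_on_L (dpow V B S n f)"
    "vanishes_on_PiL f \<Longrightarrow> vanishes_on_PiL (dpow V B S n f)"
    "starts q f \<Longrightarrow> starts (q + n) (dpow V B S n f)"
proof -
  have S: "has_degree V 1 S" "vanishes_on_L S" "vanishes_on_PiL S" "starts 3 S"
    using assms by (auto simp: hamiltonian_def)
  show "has_degree V p (dpow V B S n f)" if "has_degree V p f"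
  proof (induction n)
    case (Suc n)
    from has_degree_bracket[OF S(1) Suc, of B] show ?case by (simp add: dpow_Suc has_degree_def)
  qed (use that in simp)
  show "vanishes_on_L (dpow V B S n f)" if "vanishes_on_L f"
  proof (induction n)
    case (Suc n)
    from vanishes_on_L_bracket[OF S(2) Suc, of V B] show ?case by (simp add: dpow_Suc vanishes_on_L_def)
  qed (use that in simp)
  show "vanishes_on_PiL (dpow V B S n f)" if "vanishes_on_PiL f"
  proof (induction n)
    case (Suc n)
    from vanishes_on_PiL_bracket[OF S(3) Suc, of V B] show ?case by (simp add: dpow_Suc vanishes_on_PiL_def)
  qed (use that in simp)
  show "starts (q + n) (dpow V B S n f)" if "starts q f"
  proof (induction n)
    case (Suc n)
    from starts_bracket[OF S(4) Suc, of "q + Suc n" V B] show ?case by (simp add: dpow_Suc starts_def)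
  qed (use that in simp)
qed

lemma dpow_eq_0:
  assumes "hamiltonian V B S" "length w < n"
  shows "dpow V B S n f w = 0"
  using dpow_properties(4)[OF assms(1), of 0 f n] assms(2) by (simp add: starts_def)

lemma expad_eq:
  assumes "hamiltonian V B S" "length w \<le> N"
  shows "expad V B S f w = (\<Sum>n\<le>N. dpow V B S n f w)"
  unfolding expad_def
  by (rule sum.mono_neutral_left) (use assms dpow_eq_0[OF assms(1)] in auto)

text \<open>The Leibniz rule for divided powers, with an abstract product \<open>m\<close> so that
  it serves both the multiplication and the bracket.\<close>

lemma dpow_derivation:
  fixes m :: "('v, 'k::field_char_0) series \<Rightarrow> ('v, 'k) series \<Rightarrow> ('v, 'k) series"
  assumes S: "is_function V B S" and f: "is_function V B f" and g: "is_function V B g"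
    and m: "\<And>f g. is_function V B f \<Longrightarrow> is_function V B g \<Longrightarrow> is_function V B (m f g)"
    and der: "\<And>f g w. is_function V B f \<Longrightarrow> is_function V B g \<Longrightarrow>
       bracket V B S (m f g) w = m (bracket V B S f) g w + m f (bracket V B S g) w"
    and m1: "\<And>f g c w. m (\<lambda>w. c * f w) g w = c * m f g w" and m2: "\<And>f g c w. m f (\<lambda>w. c * g w) w = c * m f g w"
  shows "dpow V B S n (m f g) w = (\<Sum>k\<le>n. m (dpow V B S k f) (dpow V B S (n - k) g) w)"
proof (induction n arbitrary: w)
  case (Suc n)
  let ?d = "dpow V B S"
  let ?X = "\<lambda>j. m (?d j f) (?d (Suc n - j) g) w"
  have fn: "is_function V B (?d k f)" "is_function V B (?d k g)" for k
    by (auto intro: is_function_dpow S f g)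
  have "of_nat (Suc n) * ?d (Suc n) (m f g) w = bracket V B S (?d n (m f g)) w"
    by (rule bracket_dpow[symmetric])
  also have "?d n (m f g) = (\<lambda>w. \<Sum>k\<le>n. m (?d k f) (?d (n - k) g) w)"
    by (rule ext) (rule Suc.IH)
  also have "bracket V B S (\<lambda>w. \<Sum>k\<le>n. m (?d k f) (?d (n - k) g) w) w
      = (\<Sum>k\<le>n. bracket V B S (m (?d k f) (?d (n - k) g)) w)"
    by (rule bracket_sum_right) (auto intro: S m fn)
  also have "\<dots> = (\<Sum>k\<le>n. of_nat (Suc k) * ?X (Suc k)) + (\<Sum>k\<le>n. of_nat (Suc n - k) * ?X k)"
    unfolding sum.distrib[symmetric]
  proof (rule sum.cong)
    fix k assume "k \<in> {..n}"
    hence k: "Suc n - k = Suc (n - k)" by auto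
    have e: "bracket V B S (?d j h) = (\<lambda>w. of_nat (Suc j) * ?d (Suc j) h w)" for j h
      by (rule ext) (rule bracket_dpow)
    show "bracket V B S (m (?d k f) (?d (n - k) g)) w = of_nat (Suc k) * ?X (Suc k) + of_nat (Suc n - k) * ?X k"
      unfolding der[OF fn(1) fn(2)] e m1 m2 k by simp
  qed simp
  \<comment> \<open>Both sums may run up to \<open>Suc n\<close>, since the added terms have weight
    0; then the weights \<open>j\<close> and \<open>Suc n - j\<close> add up to
    \<open>Suc n\<close>.\<close>
  also have "(\<Sum>k\<le>n. of_nat (Suc k) * ?X (Suc k)) = (\<Sum>j\<le>Suc n. of_nat j * ?X j)"
    by (subst sum.atMost_Suc_shift[of "\<lambda>j. of_nat j * ?X j" n]) simp
  also have "(\<Sum>k\<le>n. of_nat (Suc n - k) * ?X k) = (\<Sum>j\<le>Suc n. of_nat (Suc n - j) * ?X j)"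
    by simp
  also have "(\<Sum>j\<le>Suc n. of_nat j * ?X j) + (\<Sum>j\<le>Suc n. of_nat (Suc n - j) * ?X j) = (\<Sum>j\<le>Suc n. of_nat (Suc n) * ?X j)"
    unfolding sum.distrib[symmetric]
    by (rule sum.cong) (auto simp: distrib_right[symmetric] of_nat_add[symmetric] simp del: of_nat_Suc of_nat_add)
  also have "\<dots> = of_nat (Suc n) * (\<Sum>j\<le>Suc n. ?X j)" by (simp only: sum_distrib_left)
  finally show ?case by (simp del: of_nat_Suc)
qed simp

text \<open>Turns a product of two truncated exponentials, a sum over a square, into a sum by total
  power; the part of the square above the antidiagonal will vanish for reasons of order.\<close>

lemma double_sum_truncate:
  fixes h :: "nat \<Rightarrow> nat \<Rightarrow> 'k::field"
  assumes "\<And>k l. k + l > N \<Longrightarrow> h k l = 0"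
  shows "(\<Sum>k\<le>N. \<Sum>l\<le>N. h k l) = (\<Sum>n\<le>N. \<Sum>k\<le>n. h k (n - k))"
proof -
  have "(\<Sum>n\<le>N. \<Sum>k\<le>n. h k (n - k)) = (\<Sum>(i, j)\<in>{(i, j). i + j \<le> N}. h i j)"
    by (rule sum.triangle_reindex_eq[symmetric])
  also have "\<dots> = (\<Sum>(i, j)\<in>{..N} \<times> {..N}. h i j)"
  proof (rule sum.mono_neutral_left)
    show "\<forall>p\<in>{..N} \<times> {..N} - {(i, j). i + j \<le> N}. (case p of (i, j) \<Rightarrow> h i j) = 0"
      by (auto intro!: assms)
  qed auto
  finally show ?thesis by (simp add: sum.cartesian_product)
qed

lemma fam_expad:
  assumes S: "hamiltonian V B S" and f: "fam V B I f"
  shows "fam V B I (\<lambda>i. expad V B S (f i))"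
    "expad V B S (\<lambda>w. lfsum I (\<lambda>i. f i w)) w = lfsum I (\<lambda>i. expad V B S (f i) w)"
proof -
  have fS: "is_function V B S" using S by (simp add: hamiltonian_def)
  note D = fam_dpow[OF fS f]
  show "fam V B I (\<lambda>i. expad V B S (f i))"
  proof (rule famI)
    fix as m
    let ?U = "\<Union>n\<le>length as + m. {(i, bs). i \<in> I \<and> length bs = m \<and> dpow V B S n (f i) (map Tc as @ map Chi bs) \<noteq> 0}"
    have "finite ?U" using fam_normal_finite[OF D(1)] by auto
    moreover have "{(i, bs). i \<in> I \<and> length bs = m \<and> expad V B S (f i) (map Tc as @ map Chi bs) \<noteq> 0} \<subseteq> ?U"
    proof clarify
      fix i bs assume i: "i \<in> I" and nz: "expad V B S (f i) (map Tc as @ map Chi bs) \<noteq> 0"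
      from nz obtain n where "n \<le> length (map Tc as @ map Chi bs)" "dpow V B S n (f i) (map Tc as @ map Chi bs) \<noteq> 0"
        unfolding expad_def by (metis atMost_iff sum.not_neutral_contains_not_neutral)
      thus "(i, bs) \<in> (\<Union>n\<le>length as + length bs.
          {(i, bs'). i \<in> I \<and> length bs' = length bs \<and> dpow V B S n (f i) (map Tc as @ map Chi bs') \<noteq> 0})"
        using i by auto
    qed
    ultimately show "finite {(i, bs). i \<in> I \<and> length bs = m \<and> expad V B S (f i) (map Tc as @ map Chi bs) \<noteq> 0}"
      by (rule finite_subset[rotated])
  next
    fix i assume i: "i \<in> I"
    show "gsym V (expad V B S (f i))"
    proof (rule gsymI)
      fix u x y w
      show "expad V B S (f i) (u @ x # y # w) = ksign (cdeg V x) (cdeg V y) * expad V B S (f i) (u @ y # x # w)"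
        unfolding expad_def sum_distrib_left
        by (rule sum.cong[OF _ gsymD[OF fam_gsym[OF D(1) i]]]) simp
    qed
    fix w assume "\<not> set w \<subseteq> coords B"
    thus "expad V B S (f i) w = 0" using fam_outside[OF D(1) i] by (simp add: expad_def)
  qed
  show "expad V B S (\<lambda>w. lfsum I (\<lambda>i. f i w)) w = lfsum I (\<lambda>i. expad V B S (f i) w)"
  proof -
    have "lfsum {..length w} (\<lambda>n. lfsum I (\<lambda>i. dpow V B S n (f i) w))
       = lfsum I (\<lambda>i. lfsum {..length w} (\<lambda>n. dpow V B S n (f i) w))"
    proof (rule lfsum_swap)
      have "finite (\<Union>n\<le>length w. Pair n ` {i \<in> I. dpow V B S n (f i) w \<noteq> 0})"
        using fam_pointwise[OF D(1)] by auto
      thus "finite {(n, i). n \<in> {..length w} \<and> i \<in> I \<and> dpow V B S n (f i) w \<noteq> 0}"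
        by (rule finite_subset[rotated]) auto
    qed
    thus ?thesis by (simp add: expad_def D(2) lfsum_finite)
  qed
qed

lemma expad_fmul:
  assumes S: "hamiltonian V B S" and f: "is_function V B f" and g: "is_function V B g"
  shows "expad V B S (fmul V f g) w = fmul V (expad V B S f) (expad V B S g) w"
proof -
  have S': "is_function V B S" "has_parity V 1 S" using S by (auto simp: hamiltonian_def has_degree_parity)
  let ?N = "length w" and ?d = "dpow V B S"
  have "fmul V (expad V B S f) (expad V B S g) w = fmul V (\<lambda>w. \<Sum>k\<le>?N. ?d k f w) (\<lambda>w. \<Sum>l\<le>?N. ?d l g w) w"
    by (rule fmul_cong) (simp add: expad_eq[OF S, of _ ?N])
  also have "\<dots> = (\<Sum>k\<le>?N. \<Sum>l\<le>?N. fmul V (?d k f) (?d l g) w)"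
    by (simp add: fmul_sum_left fmul_sum_right)
  also have "\<dots> = (\<Sum>n\<le>?N. \<Sum>k\<le>n. fmul V (?d k f) (?d (n - k) g) w)"
  proof (rule double_sum_truncate)
    fix k l assume "?N < k + l"
    moreover have "starts k (?d k f)" "starts l (?d l g)"
      using dpow_properties(4)[OF S, of 0] by (auto simp: starts_def)
    ultimately show "fmul V (?d k f) (?d l g) w = 0"
      using starts_fmul[of k "?d k f" l "?d l g" V] by (auto simp: starts_def)
  qed
  also have "\<dots> = (\<Sum>n\<le>?N. ?d n (fmul V f g) w)"
    by (intro sum.cong refl dpow_derivation[OF S'(1) f g, symmetric] is_function_fmul bracket_fmul[OF S']
        fmul_mult_left fmul_mult_right)
  finally show ?thesis by (simp add: expad_def)
qed

lemma expad_bracket: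
  assumes S: "hamiltonian V B S" and f: "is_function V B f" and g: "is_function V B g"
  shows "expad V B S (bracket V B f g) w = bracket V B (expad V B S f) (expad V B S g) w"
proof -
  have S': "is_function V B S" "has_parity V 1 S" using S by (auto simp: hamiltonian_def has_degree_parity)
  \<comment> \<open>The bracket loses two orders, so terms with \<open>k + l > length w + 2\<close>
    are the ones that vanish at \<open>w\<close>.\<close>
  let ?N = "length w + 2" and ?d = "dpow V B S"
  have fn: "is_function V B (?d k f)" "is_function V B (?d k g)" for k
    by (auto intro: is_function_dpow S' f g)
  have "bracket V B (expad V B S f) (expad V B S g) w = bracket V B (\<lambda>w. \<Sum>k\<le>?N. ?d k f w) (\<lambda>w. \<Sum>l\<le>?N. ?d l g w) w"
    by (rule bracket_cong) (simp add: expad_eq[OF S, of _ ?N] del: sum.atMost_Suc)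
  also have "\<dots> = (\<Sum>k\<le>?N. \<Sum>l\<le>?N. bracket V B (?d k f) (?d l g) w)"
    by (simp add: bracket_sum_left bracket_sum_right is_function_sum fn del: sum.atMost_Suc)
  also have "\<dots> = (\<Sum>n\<le>?N. \<Sum>k\<le>n. bracket V B (?d k f) (?d (n - k) g) w)"
  proof (rule double_sum_truncate)
    fix k l assume "?N < k + l"
    moreover have "starts k (?d k f)" "starts l (?d l g)"
      using dpow_properties(4)[OF S, of 0] by (auto simp: starts_def)
    ultimately show "bracket V B (?d k f) (?d l g) w = 0"
      using starts_bracket[of k "?d k f" l "?d l g" "k + l - 2" V B] by (auto simp: starts_def)
  qed
  also have "\<dots> = (\<Sum>n\<le>?N. ?d n (bracket V B f g) w)"
    by (intro sum.cong refl dpow_derivation[OF S'(1) f g, symmetric] is_function_bracket jacobi[OF S']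
        bracket_mult_left bracket_mult_right)
  also have "\<dots> = expad V B S (bracket V B f g) w"
    by (rule expad_eq[OF S, symmetric]) simp
  finally show ?thesis by simp
qed

lemma bracket_fone: "bracket V B f (fone :: ('v, 'k::field_char_0) series) w = 0"
proof -
  have "dL x (fone :: ('v, 'k) series) = (\<lambda>w. 0)" for x by (auto simp: dL_def fone_def)
  thus ?thesis by (simp add: bracket_def)
qed

lemma poisson_hom_expad:
  assumes S: "hamiltonian V B S"
  shows "poisson_hom TYPE('i) V B V B (expad V B S)"
  unfolding poisson_hom_def
proof (intro conjI allI impI)
  fix f :: "('a, 'b) series" and c :: 'b and p
  show "expad V B S (\<lambda>w. c * f w) = (\<lambda>w. c * expad V B S f w)"
    by (simp add: expad_def dpow_mult sum_distrib_left)
  show "has_degree V p (expad V B S f)" if "has_degree V p f"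
  proof (rule has_degreeI)
    fix w assume "expad V B S f w \<noteq> 0"
    then obtain n where "dpow V B S n f w \<noteq> 0"
      unfolding expad_def by (metis sum.not_neutral_contains_not_neutral)
    thus "wdeg V w = p" by (rule has_degreeD[OF dpow_properties(1)[OF S that]])
  qed
  show "vanishes_on_L (expad V B S f)" if "vanishes_on_L f"
    using dpow_properties(2)[OF S that] by (simp add: vanishes_on_L_def expad_def)
  show "vanishes_on_PiL (expad V B S f)" if "vanishes_on_PiL f"
    using dpow_properties(3)[OF S that] by (simp add: vanishes_on_PiL_def expad_def)
next
  show "expad V B S fone = fone"
  proof
    fix w
    have "dpow V B S n fone w = (if n = 0 then fone w else 0)" for n w
    proof (induction n arbitrary: w)
      case (Suc n)
      have "dpow V B S n fone = (\<lambda>w. (if n = 0 then 1 else 0) * fone w)" using Suc by auto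
      thus ?case by (simp add: dpow_Suc bracket_mult_right bracket_fone)
    qed simp
    thus "expad V B S fone w = fone w" by (simp add: expad_def)
  qed
next
  fix f g :: "('a, 'b) series" assume "is_function V B f" "is_function V B g"
  thus "expad V B S (fmul V f g) = fmul V (expad V B S f) (expad V B S g)"
    "expad V B S (bracket V B f g) = bracket V B (expad V B S f) (expad V B S g)"
    by (auto simp: expad_fmul[OF S] expad_bracket[OF S])
next
  fix I :: "'i set" and f :: "'i \<Rightarrow> ('a, 'b) series" assume "fam V B I f"
  from fam_expad[OF S this] show "fam V B I (\<lambda>i. expad V B S (f i))"
    "expad V B S (\<lambda>w. lfsum I (\<lambda>i. f i w)) = (\<lambda>w. lfsum I (\<lambda>i. expad V B S (f i) w))" by auto
qed

definition agree :: "nat \<Rightarrow> ('v, 'k) series \<Rightarrow> ('v, 'k) series \<Rightarrow> bool" where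
  "agree n f g \<longleftrightarrow> (\<forall>w. length w \<le> n \<longrightarrow> f w = g w)"

text \<open>With \<open>S\<close> at least cubic, a coefficient of \<open>ad_S f\<close> at
  \<open>w\<close> reads \<open>f\<close> only on words shorter than \<open>w\<close>.\<close>

lemma agree_bracket_right:
  assumes "starts 3 S" "agree n f g"
  shows "agree n (bracket V B S f) (bracket V B S g)"
  unfolding agree_def
proof (intro allI impI, rule bracket_cong)
  fix w z and u v :: "'a coord list" assume *: "length w \<le> n" "length u + length v = length w"
  show "S (u @ [z]) * f (dual z # v) = S (u @ [z]) * g (dual z # v)"
  proof (cases "length u < 2")
    case True
    thus ?thesis using assms by (simp add: starts_def)
  next
    case False
    thus ?thesis using assms * by (simp add: agree_def)
  qed
qed

lemma agree_dpow_right: "starts 3 S \<Longrightarrow> agree n f g \<Longrightarrow> agree n (dpow V B S k f) (dpow V B S k g)"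
proof (induction k)
  case (Suc k)
  from agree_bracket_right[OF Suc.prems(1) Suc.IH[OF Suc.prems], of V B] show ?case
    by (simp add: agree_def dpow_Suc)
qed simp

lemma agree_expad_right: "starts 3 S \<Longrightarrow> agree n f g \<Longrightarrow> agree n (expad V B S f) (expad V B S g)"
  using agree_dpow_right[of S n f g V B] by (auto simp: agree_def expad_def)

lemma hamiltonian_uminus:
  assumes "hamiltonian V B S"
  shows "hamiltonian V B (\<lambda>w. - S w)"
  using assms is_function_mult[of V B S "-1"]
  by (auto simp: hamiltonian_def has_degree_def starts_def vanishes_on_L_def vanishes_on_PiL_def)

lemma bracket_uminus_left: "bracket V B (\<lambda>w. - f w) g w = - bracket V B f g w"
  using bracket_mult_left[of V B "-1" f g w] by simp

lemma dpow_uminus: "dpow V B (\<lambda>w. - S w) n f w = (- 1) ^ n * dpow V B S n f w"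
proof (induction n arbitrary: w)
  case (Suc n)
  have "dpow V B (\<lambda>w. - S w) n f = (\<lambda>w. (- 1) ^ n * dpow V B S n f w)" using Suc by auto
  thus ?case by (simp add: dpow_Suc bracket_uminus_left bracket_mult_right del: of_nat_Suc)
qed simp

lemma dpow_dpow: "dpow V B S k (dpow V B S l f) w = of_nat ((k + l) choose k) * dpow V B S (k + l) f w"
proof -
  have "(bracket V B S ^^ k) (dpow V B S l f) = (\<lambda>w. (bracket V B S ^^ (k + l)) f w / fact l)"
  proof (induction k)
    case (Suc k)
    have "(bracket V B S ^^ Suc k) (dpow V B S l f) = bracket V B S (\<lambda>w. inverse (fact l) * (bracket V B S ^^ (k + l)) f w)"
      using Suc by (simp add: divide_inverse mult.commute)
    also have "\<dots> = (\<lambda>w. inverse (fact l) * (bracket V B S ^^ (Suc k + l)) f w)"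
      by (rule ext) (simp add: bracket_mult_right)
    finally show ?case by (simp add: divide_inverse mult.commute)
  qed (simp add: dpow_def)
  thus ?thesis by (simp add: dpow_def[of V B S k] dpow_def[of V B S "k + l"] binomial_fact)
qed

text \<open>The part of total power n is \<open>dpow n\<close> times an alternating sum of binomial
  coefficients, which is 0 for positive n. At a given word both exponentials may be cut off at its
  length.\<close>

lemma expad_uminus_expad:
  fixes S f :: "('v, 'k::field_char_0) series"
  assumes S: "hamiltonian V B S" and f: "is_function V B f"
  shows "expad V B (\<lambda>w. - S w) (expad V B S f) = f"
proof
  fix w :: "'v coord list"
  let ?N = "length w" and ?d = "dpow V B S" and ?e = "dpow V B (\<lambda>w. - S w)"
  note S' = hamiltonian_uminus[OF S]
  have fS: "is_function V B (\<lambda>w. - S w)" "is_function V B S" "starts 3 (\<lambda>w. - S w)"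
    using S S' by (auto simp: hamiltonian_def)
  have "agree ?N (expad V B S f) (\<lambda>w. \<Sum>l\<le>?N. ?d l f w)"
    unfolding agree_def using expad_eq[OF S] by blast
  hence "expad V B (\<lambda>w. - S w) (expad V B S f) w = expad V B (\<lambda>w. - S w) (\<lambda>w. \<Sum>l\<le>?N. ?d l f w) w"
    using agree_expad_right[OF fS(3)] by (auto simp: agree_def)
  also have "\<dots> = (\<Sum>l\<le>?N. expad V B (\<lambda>w. - S w) (?d l f) w)"
    using fam_expad(2)[OF S' fam_finite_index[of "{..?N}" V B "\<lambda>l. ?d l f"]] is_function_dpow[OF fS(2) f]
    by (simp add: lfsum_finite)
  also have "\<dots> = (\<Sum>l\<le>?N. \<Sum>k\<le>?N. ?e k (?d l f) w)"
    by (simp add: expad_def)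
  also have "\<dots> = (\<Sum>n\<le>?N. \<Sum>l\<le>n. ?e (n - l) (?d l f) w)"
  proof (rule double_sum_truncate)
    fix l k assume "?N < l + k"
    thus "?e k (?d l f) w = 0" by (simp add: dpow_uminus dpow_dpow dpow_eq_0[OF S] add.commute)
  qed
  also have "\<dots> = (\<Sum>n\<le>?N. if n = 0 then f w else 0)"
  proof (rule sum.cong)
    fix n
    have "(\<Sum>l\<le>n. ?e (n - l) (?d l f) w) = (\<Sum>l\<le>n. (- 1) ^ (n - l) * of_nat (n choose (n - l)) * ?d n f w)"
      by (rule sum.cong) (simp_all add: dpow_uminus dpow_dpow)
    also have "\<dots> = (\<Sum>l\<le>n. (- 1) ^ (n - l) * of_nat (n choose (n - l))) * ?d n f w"
      by (simp add: sum_distrib_right)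
    also have "(\<Sum>l\<le>n. (- 1) ^ (n - l) * of_nat (n choose (n - l)) :: 'k) = (\<Sum>l\<le>n. (- 1) ^ l * of_nat (n choose l))"
      by (rule sum.reindex_bij_witness[of _ "\<lambda>l. n - l" "\<lambda>l. n - l"]) auto
    also have "\<dots> = (if n = 0 then 1 else 0)"
      using choose_alternating_sum[of n, where 'a = 'k] by auto
    finally show "(\<Sum>l\<le>n. ?e (n - l) (?d l f) w) = (if n = 0 then f w else 0)" by auto
  qed simp
  also have "\<dots> = f w" by simp
  finally show "expad V B (\<lambda>w. - S w) (expad V B S f) w = f w" .
qed

lemma expad_expad_uminus:
  assumes "hamiltonian V B S" "is_function V B f"
  shows "expad V B S (expad V B (\<lambda>w. - S w) f) = f"
  using expad_uminus_expad[OF hamiltonian_uminus[OF assms(1)] assms(2)] by simp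


section \<open>Linear changes of coordinates\<close>

text \<open>Dual coordinates transform contragrediently, hence the transposed second matrix on the
  \<chi>-block. The zero blocks off the diagonal keep both Lagrangians.\<close>

fun mat :: "('v \<Rightarrow> 'w \<Rightarrow> 'k) \<Rightarrow> ('w \<Rightarrow> 'v \<Rightarrow> 'k) \<Rightarrow> 'v coord \<Rightarrow> 'w coord \<Rightarrow> 'k::field_char_0" where
  "mat P Q (Tc a) (Tc b) = P a b"
| "mat P Q (Chi a) (Chi b) = Q b a"
| "mat P Q _ _ = 0"

text \<open>The entries of the tensor powers of \<open>mat\<close>.\<close>

fun matw :: "('v \<Rightarrow> 'w \<Rightarrow> 'k) \<Rightarrow> ('w \<Rightarrow> 'v \<Rightarrow> 'k) \<Rightarrow> 'v coord list \<Rightarrow> 'w coord list \<Rightarrow> 'k::field_char_0" where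
  "matw P Q [] [] = 1"
| "matw P Q (x # w) (y # u) = mat P Q x y * matw P Q w u"
| "matw P Q _ _ = 0"

text \<open>The substitution \<open>t\<^sup>b = \<Sum>\<^sub>a P a b t\<^sup>a\<close>, \<open>\<chi>\<^sub>b = \<Sum>\<^sub>a Q b a \<chi>\<^sub>a\<close>.\<close>

definition lin :: "('v \<Rightarrow> 'w \<Rightarrow> 'k) \<Rightarrow> ('w \<Rightarrow> 'v \<Rightarrow> 'k) \<Rightarrow> 'w set \<Rightarrow> ('w, 'k::field_char_0) series \<Rightarrow> ('v, 'k) series" where
  "lin P Q B' f = (\<lambda>w. lfsum (lists (coords B')) (\<lambda>u. matw P Q w u * f u))"

lemma finite_list_all2:
  assumes "\<And>a. finite {b. R a b}"
  shows "finite {bs. list_all2 R as bs}"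
proof (induction as)
  case (Cons a as)
  have "{bs. list_all2 R (a # as) bs} \<subseteq> (\<lambda>(b, bs). b # bs) ` ({b. R a b} \<times> {bs. list_all2 R as bs})"
    by (auto simp: list_all2_Cons1)
  thus ?case using Cons assms by (meson finite_SigmaI finite_imageI finite_subset)
qed simp

lemma shuffles_tcs_chs: "w \<in> shuffles (map Tc (tcs w)) (map Chi (chs w))"
  by (induction w rule: tcs.induct) (auto intro: Cons_in_shuffles_leftI Cons_in_shuffles_rightI)

lemma finite_fmul_left:
  assumes "\<And>v. finite {i \<in> I. f i v \<noteq> 0}"
  shows "finite {i \<in> I. fmul V (f i) g w \<noteq> 0}"
proof (rule finite_subset)
  show "{i \<in> I. fmul V (f i) g w \<noteq> 0} \<subseteq> (\<Union>S\<in>Pow {..<length w}. {i \<in> I. f i (nths w S) \<noteq> 0})"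
  proof clarify
    fix i assume "i \<in> I" and nz: "fmul V (f i) g w \<noteq> 0"
    then obtain S where "S \<in> Pow {..<length w}" "f i (nths w S) \<noteq> 0"
      unfolding fmul_def by (metis (no_types, lifting) mult_zero_left mult_zero_right sum.neutral)
    thus "i \<in> (\<Union>S\<in>Pow {..<length w}. {i \<in> I. f i (nths w S) \<noteq> 0})" using \<open>i \<in> I\<close> by blast
  qed
qed (use assms in auto)

lemma finite_fmul_right:
  assumes "\<And>v. finite {i \<in> I. g i v \<noteq> 0}"
  shows "finite {i \<in> I. fmul V f (g i) w \<noteq> 0}"
proof (rule finite_subset)
  show "{i \<in> I. fmul V f (g i) w \<noteq> 0} \<subseteq> (\<Union>S\<in>Pow {..<length w}. {i \<in> I. g i (nths w (- S)) \<noteq> 0})"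
  proof clarify
    fix i assume "i \<in> I" and nz: "fmul V f (g i) w \<noteq> 0"
    then obtain S where "S \<in> Pow {..<length w}" "g i (nths w (- S)) \<noteq> 0"
      unfolding fmul_def by (metis (no_types, lifting) mult_zero_right sum.neutral)
    thus "i \<in> (\<Union>S\<in>Pow {..<length w}. {i \<in> I. g i (nths w (- S)) \<noteq> 0})" using \<open>i \<in> I\<close> by blast
  qed
qed (use assms in auto)

text \<open>Each basis is expanded in the other by finite sums, so the rows of \<open>P\<close> and
  \<open>Q\<close> are finite. Their columns may be infinite, and this governs the finiteness
  arguments below.\<close>

locale base_change =
  fixes V :: "int \<Rightarrow> 'v set" and B :: "'v set" and V' :: "int \<Rightarrow> 'w set" and B' :: "'w set"
    and P :: "'v \<Rightarrow> 'w \<Rightarrow> 'k::field_char_0" and Q :: "'w \<Rightarrow> 'v \<Rightarrow> 'k"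
  assumes P_support: "\<And>a b. P a b \<noteq> 0 \<Longrightarrow> a \<in> B \<and> b \<in> B' \<and> vdeg V a = vdeg V' b"
    and Q_support: "\<And>a b. Q b a \<noteq> 0 \<Longrightarrow> a \<in> B \<and> b \<in> B' \<and> vdeg V a = vdeg V' b"
    and P_finite: "\<And>a. finite {b. P a b \<noteq> 0}" and Q_finite: "\<And>b. finite {a. Q b a \<noteq> 0}"
    and PQ: "\<And>a c. a \<in> B \<Longrightarrow> c \<in> B \<Longrightarrow> lfsum B' (\<lambda>b. P a b * Q b c) = (if a = c then 1 else 0)"
    and QP: "\<And>b c. b \<in> B' \<Longrightarrow> c \<in> B' \<Longrightarrow> lfsum B (\<lambda>a. Q b a * P a c) = (if b = c then 1 else 0)"
begin

abbreviation "M \<equiv> mat P Q"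
abbreviation "W \<equiv> matw P Q"
abbreviation "\<phi> \<equiv> lin P Q B'"

lemma inverse: "base_change V' B' V B Q P"
  by unfold_locales (use P_support Q_support P_finite Q_finite PQ QP in auto)

lemma M_support: "M x y \<noteq> 0 \<Longrightarrow> x \<in> coords B \<and> y \<in> coords B' \<and> cdeg V x = cdeg V' y"
  using P_support Q_support by (cases "(P, Q, x, y)" rule: mat.cases) auto

lemma W_support: "W w u \<noteq> 0 \<Longrightarrow> set w \<subseteq> coords B \<and> set u \<subseteq> coords B' \<and> wdeg V w = wdeg V' u \<and> length w = length u"
  by (induction w u rule: list_induct2') (auto dest: M_support)

lemma W_tcs_chs: "W w u \<noteq> 0 \<Longrightarrow> list_all2 (\<lambda>a b. P a b \<noteq> 0) (tcs w) (tcs u) \<and> list_all2 (\<lambda>b a. Q a b \<noteq> 0) (chs w) (chs u)"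
proof (induction P Q w u rule: matw.induct)
  case (2 P Q x w y u)
  thus ?case by (cases "(P, Q, x, y)" rule: mat.cases) auto
qed auto

lemma W_support_normal:
  assumes "W (map Tc as @ map Chi bs) u \<noteq> 0"
  shows "\<exists>as' bs'. u = map Tc as' @ map Chi bs' \<and> list_all2 (\<lambda>a b. P a b \<noteq> 0) as as' \<and>
    list_all2 (\<lambda>b a. Q a b \<noteq> 0) bs bs'"
  using assms
proof (induction as arbitrary: u)
  case Nil
  thus ?case
  proof (induction bs arbitrary: u)
    case Nil
    thus ?case by (cases u) auto
  next
    case (Cons b bs)
    then obtain y u' where u: "u = y # u'" by (cases u) auto
    with Cons.prems obtain b' where y: "y = Chi b'" "Q b' b \<noteq> 0" by (cases y) auto
    from Cons.prems u Cons.IH[of u'] obtain bs' where "u' = map Chi bs'" "list_all2 (\<lambda>b a. Q a b \<noteq> 0) bs bs'" by auto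
    thus ?case using u y by (intro exI[of _ "[]"] exI[of _ "b' # bs'"]) auto
  qed
next
  case (Cons a as)
  then obtain y u' where u: "u = y # u'" by (cases u) auto
  with Cons.prems obtain a' where y: "y = Tc a'" "P a a' \<noteq> 0" by (cases y) auto
  from Cons.prems u Cons.IH[of u'] obtain as' bs' where "u' = map Tc as' @ map Chi bs'"
    "list_all2 (\<lambda>a b. P a b \<noteq> 0) as as'" "list_all2 (\<lambda>b a. Q a b \<noteq> 0) bs bs'" by auto
  thus ?case using u y by (intro exI[of _ "a' # as'"] exI[of _ bs']) auto
qed

text \<open>The inputs of \<open>u\<close> lie in finite rows of \<open>P\<close>. The outputs of
  \<open>u\<close> range over columns of \<open>Q\<close>, which may be infinite; here the
  finiteness clause of the family takes over.\<close>

lemma finite_support: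
  assumes f: "fam V' B' I f"
  shows "finite {(i, u). i \<in> I \<and> u \<in> lists (coords B') \<and> W w u * f i u \<noteq> 0}"
proof (rule finite_subset)
  let ?G = "\<lambda>as. {(i, bs). i \<in> I \<and> length bs = length (chs w) \<and> f i (map Tc as @ map Chi bs) \<noteq> 0}"
  let ?U = "\<Union>as\<in>{as. list_all2 (\<lambda>a b. P a b \<noteq> 0) (tcs w) as}. \<Union>(i, bs)\<in>?G as. Pair i ` shuffles (map Tc as) (map Chi bs)"
  show "finite ?U"
    using finite_list_all2[where R = "\<lambda>a b. P a b \<noteq> 0", OF P_finite] fam_normal_finite[OF f] by (intro finite_UN_I) (auto split: prod.splits)
  show "{(i, u). i \<in> I \<and> u \<in> lists (coords B') \<and> W w u * f i u \<noteq> 0} \<subseteq> ?U"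
  proof clarify
    fix i u assume i: "i \<in> I" and nz: "W w u * f i u \<noteq> 0"
    hence W: "list_all2 (\<lambda>a b. P a b \<noteq> 0) (tcs w) (tcs u)" "length (chs u) = length (chs w)"
      using W_tcs_chs[of w u] by (auto dest: list_all2_lengthD)
    have "f i (map Tc (tcs u) @ map Chi (chs u)) \<noteq> 0"
      using nz gsym_tcs_chs[OF fam_gsym[OF f i], of u] by auto
    thus "(i, u) \<in> ?U" using W i shuffles_tcs_chs[of u]
      by (intro UN_I[of "tcs u"] UN_I[of "(i, chs u)"]) auto
  qed
qed

lemma finite_support1:
  assumes "is_function V' B' f"
  shows "finite {u \<in> lists (coords B'). W w u * f u \<noteq> 0}"
proof -
  have "fam V' B' {()} (\<lambda>_. f)" using assms by (simp add: fam_singleton)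
  from finite_imageI[OF finite_support[OF this, of w], of snd] show ?thesis
    by (rule finite_subset[rotated]) force
qed

lemma phi_nonzero: "\<phi> f w \<noteq> 0 \<Longrightarrow> \<exists>u. W w u \<noteq> 0 \<and> f u \<noteq> 0"
  unfolding lin_def by (auto dest!: lfsum_nonzeroD)

lemma phi_mult: "\<phi> (\<lambda>w. c * f w) = (\<lambda>w. c * \<phi> f w)"
  by (simp add: lin_def lfsum_cmult[symmetric] mult.left_commute)

lemma phi_tw: "\<phi> (tw V' p f) = tw V p (\<phi> f)"
proof
  fix w
  have "matw P Q w u * (ksign p (wdeg V' u) * f u) = ksign p (wdeg V w) * (matw P Q w u * f u)" for u
    using W_support[of w u] by (cases "W w u = 0") auto
  thus "\<phi> (tw V' p f) w = tw V p (\<phi> f) w"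
    by (simp only: lin_def tw_def lfsum_cmult)
qed

lemma phi_lfsum:
  assumes f: "fam V' B' I f"
  shows "\<phi> (\<lambda>w. lfsum I (\<lambda>i. f i w)) w = lfsum I (\<lambda>i. \<phi> (f i) w)"
proof -
  have "lfsum I (\<lambda>i. lfsum (lists (coords B')) (\<lambda>u. W w u * f i u)) = lfsum (lists (coords B')) (\<lambda>u. lfsum I (\<lambda>i. W w u * f i u))"
    by (rule lfsum_swap[OF finite_support[OF f]])
  thus ?thesis by (simp add: lin_def lfsum_cmult)
qed

lemma finite_phi_Cons:
  assumes f: "is_function V' B' f"
  shows "finite {y \<in> coords B'. M x y * \<phi> (dL y f) w \<noteq> 0}"
proof (rule finite_subset)
  show "{y \<in> coords B'. M x y * \<phi> (dL y f) w \<noteq> 0} \<subseteq> hd ` {u \<in> lists (coords B'). W (x # w) u * f u \<noteq> 0}"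
  proof clarify
    fix y assume y: "y \<in> coords B'" "M x y * \<phi> (dL y f) w \<noteq> 0"
    then obtain u where "W w u \<noteq> 0" "f (y # u) \<noteq> 0" using phi_nonzero[of "dL y f" w] by (auto simp: dL_def)
    thus "y \<in> hd ` {u \<in> lists (coords B'). W (x # w) u * f u \<noteq> 0}"
      using y W_support[of w u] by (intro rev_image_eqI[of "y # u"]) (auto simp: lists_eq_set)
  qed
  show "finite (hd ` {u \<in> lists (coords B'). W (x # w) u * f u \<noteq> 0})"
    using finite_support1[OF f] by (rule finite_imageI)
qed

lemma phi_Cons:
  assumes f: "is_function V' B' f"
  shows "\<phi> f (x # w) = lfsum (coords B') (\<lambda>y. M x y * \<phi> (dL y f) w)"
proof -
  let ?L = "lists (coords B')" and ?c = "\<lambda>(y, u). y # u"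
  have "\<phi> f (x # w) = lfsum (?c ` (coords B' \<times> ?L)) (\<lambda>u. W (x # w) u * f u)"
    unfolding lin_def
  proof (rule lfsum_superset)
    fix u assume u: "u \<in> ?L" "u \<notin> ?c ` (coords B' \<times> ?L)"
    have "u = []" using u by (cases u) auto
    thus "W (x # w) u * f u = 0" by simp
  qed auto
  also have "\<dots> = lfsum (coords B' \<times> ?L) (\<lambda>(y, u). M x y * (W w u * f (y # u)))"
    by (subst lfsum_reindex) (auto simp: inj_on_def case_prod_unfold mult.assoc)
  also have "\<dots> = lfsum (coords B') (\<lambda>y. lfsum ?L (\<lambda>u. M x y * (W w u * f (y # u))))"
  proof (rule lfsum_Times[symmetric])
    have "finite ((\<lambda>u. (hd u, tl u)) ` {u \<in> ?L. W (x # w) u * f u \<noteq> 0})"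
      using finite_support1[OF f] by (rule finite_imageI)
    thus "finite {(y, u). y \<in> coords B' \<and> u \<in> ?L \<and> M x y * (W w u * f (y # u)) \<noteq> 0}"
    proof (rule finite_subset[rotated], intro subsetI)
      fix p assume "p \<in> {(y, u). y \<in> coords B' \<and> u \<in> ?L \<and> M x y * (W w u * f (y # u)) \<noteq> 0}"
      thus "p \<in> (\<lambda>u. (hd u, tl u)) ` {u \<in> ?L. W (x # w) u * f u \<noteq> 0}"
        by (intro rev_image_eqI[of "fst p # snd p"]) auto
    qed
  qed
  finally show ?thesis by (simp add: lfsum_cmult lin_def dL_def)
qed

lemma gsym_phi:
  assumes "is_function V' B' f"
  shows "gsym V (\<phi> f)"
proof (rule gsymI)
  fix p x y w
  show "\<phi> f (p @ x # y # w) = ksign (cdeg V x) (cdeg V y) * \<phi> f (p @ y # x # w)"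
    using assms
  proof (induction p arbitrary: f)
    case Nil
    let ?h = "\<lambda>x' y'. M x x' * (M y y' * \<phi> (dL y' (dL x' f)) w)"
    have fin: "finite {(x', y'). x' \<in> coords B' \<and> y' \<in> coords B' \<and> ?h x' y' \<noteq> 0}"
    proof (rule finite_subset)
      show "finite ((\<lambda>u. (u ! 0, u ! 1)) ` {u \<in> lists (coords B'). W (x # y # w) u * f u \<noteq> 0})"
        using finite_support1[OF Nil] by (rule finite_imageI)
      show "{(x', y'). x' \<in> coords B' \<and> y' \<in> coords B' \<and> ?h x' y' \<noteq> 0}
          \<subseteq> (\<lambda>u. (u ! 0, u ! 1)) ` {u \<in> lists (coords B'). W (x # y # w) u * f u \<noteq> 0}"
      proof clarify
        fix x' y' assume *: "x' \<in> coords B'" "y' \<in> coords B'" "?h x' y' \<noteq> 0"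
        then obtain u where "W w u \<noteq> 0" "f (x' # y' # u) \<noteq> 0"
          using phi_nonzero[of "dL y' (dL x' f)" w] by (auto simp: dL_def)
        thus "(x', y') \<in> (\<lambda>u. (u ! 0, u ! 1)) ` {u \<in> lists (coords B'). W (x # y # w) u * f u \<noteq> 0}"
          using * W_support[of w u] by (intro rev_image_eqI[of "x' # y' # u"]) (auto simp: lists_eq_set)
      qed
    qed
    have "\<phi> f (x # y # w) = lfsum (coords B') (\<lambda>x'. lfsum (coords B') (?h x'))"
      by (simp add: phi_Cons[OF Nil] phi_Cons[OF is_function_dL[OF Nil]] lfsum_cmult)
    also have "\<dots> = lfsum (coords B') (\<lambda>y'. lfsum (coords B') (\<lambda>x'. ?h x' y'))"
      by (rule lfsum_swap[OF fin])
    also have "\<dots> = lfsum (coords B') (\<lambda>y'. lfsum (coords B') (\<lambda>x'. ksign (cdeg V x) (cdeg V y) * (M y y' * (M x x' * \<phi> (dL x' (dL y' f)) w))))"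
    proof (intro lfsum_cong)
      fix x' y'
      have "dL y' (dL x' f) = (\<lambda>w. ksign (cdeg V' y') (cdeg V' x') * dL x' (dL y' f) w)"
        by (rule dL_dL[OF is_function_gsym[OF Nil]])
      hence "\<phi> (dL y' (dL x' f)) w = ksign (cdeg V' y') (cdeg V' x') * \<phi> (dL x' (dL y' f)) w"
        by (simp only: phi_mult)
      thus "?h x' y' = ksign (cdeg V x) (cdeg V y) * (M y y' * (M x x' * \<phi> (dL x' (dL y' f)) w))"
        using M_support[of x x'] M_support[of y y']
        by (cases "M x x' = 0 \<or> M y y' = 0") (auto simp: ksign_commute)
    qed
    also have "\<dots> = ksign (cdeg V x) (cdeg V y) * \<phi> f (y # x # w)"
      by (simp add: phi_Cons[OF Nil] phi_Cons[OF is_function_dL[OF Nil]] lfsum_cmult)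
    finally show ?case by simp
  next
    case (Cons a p)
    have "\<phi> f (a # p @ x # y # w) = lfsum (coords B') (\<lambda>b. M a b * \<phi> (dL b f) (p @ x # y # w))"
      by (rule phi_Cons[OF Cons.prems])
    also have "\<dots> = lfsum (coords B') (\<lambda>b. ksign (cdeg V x) (cdeg V y) * (M a b * \<phi> (dL b f) (p @ y # x # w)))"
      using Cons.IH[OF is_function_dL[OF Cons.prems]] by (intro lfsum_cong) simp
    also have "\<dots> = ksign (cdeg V x) (cdeg V y) * \<phi> f (a # p @ y # x # w)"
      by (simp add: lfsum_cmult phi_Cons[OF Cons.prems])
    finally show ?case by simp
  qed
qed

text \<open>Finitely many new inputs from the rows of \<open>P\<close>, for these finitely many
  members and outputs by the finiteness clause, and for each of those finitely many old outputs from
  the rows of \<open>Q\<close>.\<close>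

lemma fam_phi:
  assumes f: "fam V' B' I f"
  shows "fam V B I (\<lambda>i. \<phi> (f i))"
proof (rule famI)
  fix as m
  let ?A = "{as'. list_all2 (\<lambda>a b. P a b \<noteq> 0) as as'}"
  let ?F = "\<lambda>as'. {(i, bs'). i \<in> I \<and> length bs' = m \<and> f i (map Tc as' @ map Chi bs') \<noteq> 0}"
  let ?U = "\<Union>as'\<in>?A. \<Union>(i, bs')\<in>?F as'. Pair i ` {bs. list_all2 (\<lambda>a b. Q a b \<noteq> 0) bs' bs}"
  have "finite ?U"
    using finite_list_all2[where R = "\<lambda>a b. P a b \<noteq> 0", OF P_finite] fam_normal_finite[OF f] finite_list_all2[where R = "\<lambda>b a. Q b a \<noteq> 0", OF Q_finite]
    by (intro finite_UN_I) (auto split: prod.splits)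
  moreover have "{(i, bs). i \<in> I \<and> length bs = m \<and> \<phi> (f i) (map Tc as @ map Chi bs) \<noteq> 0} \<subseteq> ?U"
  proof clarify
    fix i bs assume i: "i \<in> I" and m: "m = length bs" and "\<phi> (f i) (map Tc as @ map Chi bs) \<noteq> 0"
    then obtain u where u: "W (map Tc as @ map Chi bs) u \<noteq> 0" "f i u \<noteq> 0" using phi_nonzero by blast
    obtain as' bs' where *: "u = map Tc as' @ map Chi bs'" "list_all2 (\<lambda>a b. P a b \<noteq> 0) as as'"
      "list_all2 (\<lambda>b a. Q a b \<noteq> 0) bs bs'" using W_support_normal[OF u(1)] by blast
    have "list_all2 (\<lambda>a b. Q a b \<noteq> 0) bs' bs" "length bs' = length bs"
      using *(3) by (auto simp: list_all2_conv_all_nth)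
    thus "(i, bs) \<in> (\<Union>as'\<in>?A. \<Union>(i, bs')\<in>{(i, bs'). i \<in> I \<and> length bs' = length bs \<and> f i (map Tc as' @ map Chi bs') \<noteq> 0}.
        Pair i ` {bs. list_all2 (\<lambda>a b. Q a b \<noteq> 0) bs' bs})"
      using * u i by (intro UN_I[of as'] UN_I[of "(i, bs')"]) auto
  qed
  ultimately show "finite {(i, bs). i \<in> I \<and> length bs = m \<and> \<phi> (f i) (map Tc as @ map Chi bs) \<noteq> 0}"
    by (rule finite_subset[rotated])
next
  fix i w assume "i \<in> I" "\<not> set w \<subseteq> coords B"
  thus "\<phi> (f i) w = 0" using phi_nonzero[of "f i" w] W_support[of w] by blast
qed (use gsym_phi fam_is_function[OF f] in blast)

lemma is_function_phi: "is_function V' B' f \<Longrightarrow> is_function V B (\<phi> f)"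
  using fam_phi[of "{()}" "\<lambda>_. f"] by (simp add: fam_singleton)

lemma phi_add:
  assumes "is_function V' B' f" "is_function V' B' g"
  shows "\<phi> (\<lambda>w. f w + g w) w = \<phi> f w + \<phi> g w"
  by (simp only: lin_def distrib_left lfsum_add[OF finite_support1[OF assms(1)] finite_support1[OF assms(2)]])

lemma phi_fmul:
  assumes "is_function V' B' f" "is_function V' B' g"
  shows "\<phi> (fmul V' f g) w = fmul V (\<phi> f) (\<phi> g) w"
  using assms
proof (induction w arbitrary: f g)
  case Nil
  have "\<phi> h [] = h []" for h :: "('w, 'k) series"
  proof -
    have "W [] u * h u = (if u = [] then h [] else 0)" for u by (cases u) auto
    thus ?thesis by (simp add: lin_def lfsum_single)
  qed
  thus ?case by simp
next
  case (Cons x w)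
  note f = Cons.prems(1) and g = Cons.prems(2)
  have "\<phi> (fmul V' f g) (x # w) = lfsum (coords B') (\<lambda>y. M x y * \<phi> (dL y (fmul V' f g)) w)"
    by (rule phi_Cons[OF is_function_fmul[OF f g]])
  also have "\<dots> = lfsum (coords B') (\<lambda>y. fmul V (\<lambda>v. M x y * \<phi> (dL y f) v) (\<phi> g) w
      + fmul V (tw V (cdeg V x) (\<phi> f)) (\<lambda>v. M x y * \<phi> (dL y g) v) w)"
  proof (rule lfsum_cong)
    fix y
    have "\<phi> (dL y (fmul V' f g)) w = fmul V (\<phi> (dL y f)) (\<phi> g) w + fmul V (tw V (cdeg V' y) (\<phi> f)) (\<phi> (dL y g)) w"
      using f g by (simp add: dL_fmul phi_add is_function_fmul is_function_dL is_function_tw Cons.IH phi_tw)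
    thus "M x y * \<phi> (dL y (fmul V' f g)) w = fmul V (\<lambda>v. M x y * \<phi> (dL y f) v) (\<phi> g) w
      + fmul V (tw V (cdeg V x) (\<phi> f)) (\<lambda>v. M x y * \<phi> (dL y g) v) w"
      using M_support[of x y] by (cases "M x y = 0") (auto simp: fmul_mult_left fmul_mult_right distrib_left)
  qed
  also have "\<dots> = fmul V (\<lambda>v. lfsum (coords B') (\<lambda>y. M x y * \<phi> (dL y f) v)) (\<phi> g) w
      + fmul V (tw V (cdeg V x) (\<phi> f)) (\<lambda>v. lfsum (coords B') (\<lambda>y. M x y * \<phi> (dL y g) v)) w"
    by (simp only: lfsum_add[OF finite_fmul_left[OF finite_phi_Cons[OF f]] finite_fmul_right[OF finite_phi_Cons[OF g]]]
        fmul_lfsum_left[OF finite_phi_Cons[OF f]] fmul_lfsum_right[OF finite_phi_Cons[OF g]])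
  also have "\<dots> = fmul V (\<phi> f) (\<phi> g) (x # w)"
    by (simp add: fmul_Cons phi_Cons[OF f, symmetric] phi_Cons[OF g, symmetric] dL_def[of x "\<phi> f"] dL_def[of x "\<phi> g"])
  finally show ?case .
qed

lemma dL_phi: "is_function V' B' f \<Longrightarrow> dL x (\<phi> f) = (\<lambda>w. lfsum (coords B') (\<lambda>y. M x y * \<phi> (dL y f) w))"
  by (rule ext) (simp add: dL_def[of x] phi_Cons)

lemma dR_phi:
  assumes f: "is_function V' B' f"
  shows "dR x (\<phi> f) = (\<lambda>w. lfsum (coords B') (\<lambda>y. M x y * \<phi> (dR y f) w))"
proof
  fix w
  have "dR x (\<phi> f) w = ksign (cdeg V x) (wdeg V w) * lfsum (coords B') (\<lambda>y. M x y * \<phi> (dL y f) w)"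
    by (simp add: dR_eq_dL[OF gsym_phi[OF f]] dL_phi[OF f] tw_def)
  also have "\<dots> = lfsum (coords B') (\<lambda>y. ksign (cdeg V x) (wdeg V w) * (M x y * \<phi> (dL y f) w))"
    by (rule lfsum_cmult[symmetric])
  also have "\<dots> = lfsum (coords B') (\<lambda>y. M x y * \<phi> (dR y f) w)"
  proof (rule lfsum_cong)
    fix y
    show "ksign (cdeg V x) (wdeg V w) * (M x y * \<phi> (dL y f) w) = M x y * \<phi> (dR y f) w"
      using M_support[of x y]
      by (cases "M x y = 0") (auto simp: dR_eq_dL[OF is_function_gsym[OF f]] phi_tw, simp add: tw_def)
  qed
  finally show "dR x (\<phi> f) w = lfsum (coords B') (\<lambda>y. M x y * \<phi> (dR y f) w)" .
qed

lemma lfsum_M_Tc: "lfsum (coords B') (\<lambda>y. M (Tc a) y * h y) = lfsum B' (\<lambda>b. P a b * h (Tc b))"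
proof -
  have "lfsum (coords B') (\<lambda>y. M (Tc a) y * h y) = lfsum (Tc ` B') (\<lambda>y. M (Tc a) y * h y)"
    by (rule lfsum_superset) (auto simp: coords_def)
  thus ?thesis by (simp add: lfsum_reindex inj_on_def)
qed

lemma lfsum_M_Chi: "lfsum (coords B') (\<lambda>y. M (Chi a) y * h y) = lfsum B' (\<lambda>b. Q b a * h (Chi b))"
proof -
  have "lfsum (coords B') (\<lambda>y. M (Chi a) y * h y) = lfsum (Chi ` B') (\<lambda>y. M (Chi a) y * h y)"
    by (rule lfsum_superset) (auto simp: coords_def)
  thus ?thesis by (simp add: lfsum_reindex inj_on_def)
qed

text \<open>The contraction \<open>\<Sum>\<^sub>a P a b Q c a = \<delta>\<close> may be carried out inside infinite sums if \<open>X b c\<close> is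
  nonzero for finitely many \<open>c\<close> only.\<close>

lemma contraction:
  assumes F: "finite F" "F \<subseteq> B'" "\<And>b c. b \<in> B' \<Longrightarrow> c \<in> B' \<Longrightarrow> c \<notin> F \<Longrightarrow> X b c = 0"
  shows "lfsum B (\<lambda>a. lfsum B' (\<lambda>b. lfsum B' (\<lambda>c. P a b * (Q c a * X b c)))) = lfsum B' (\<lambda>c. X c c)"
    "finite {a \<in> B. lfsum B' (\<lambda>b. lfsum B' (\<lambda>c. P a b * (Q c a * X b c))) \<noteq> 0}"
proof -
  \<comment> \<open>Starting from the finite set of \<open>c\<close>, the rows of \<open>Q\<close>
    bound \<open>a\<close>, and then the rows of \<open>P\<close> bound \<open>b\<close>; no column
    is used.\<close>
  define A where "A = (\<Union>c\<in>F. {a. Q c a \<noteq> 0})"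
  define D where "D = F \<union> (\<Union>a\<in>A. {b. P a b \<noteq> 0})"
  have A: "finite A" "A \<subseteq> B" and D: "finite D" "D \<subseteq> B'" "F \<subseteq> D"
    using F Q_finite P_finite Q_support P_support by (auto simp: A_def D_def)
  have c: "lfsum B' (\<lambda>c. P a b * (Q c a * X b c)) = (\<Sum>c\<in>F. P a b * (Q c a * X b c))" if "b \<in> B'" for a b
    using that by (intro lfsum_eq_sum F(1,2)) (auto simp: F(3))
  have b: "lfsum B' (\<lambda>b. lfsum B' (\<lambda>c. P a b * (Q c a * X b c))) = (if a \<in> A then \<Sum>b\<in>D. \<Sum>c\<in>F. P a b * (Q c a * X b c) else 0)" for a
  proof (cases "a \<in> A")
    case True
    have "lfsum B' (\<lambda>b. lfsum B' (\<lambda>c. P a b * (Q c a * X b c))) = lfsum B' (\<lambda>b. \<Sum>c\<in>F. P a b * (Q c a * X b c))"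
      by (rule lfsum_cong) (rule c)
    also have "\<dots> = (\<Sum>b\<in>D. \<Sum>c\<in>F. P a b * (Q c a * X b c))"
      by (rule lfsum_eq_sum[OF D(1,2)]) (use True in \<open>auto simp: D_def intro!: sum.neutral\<close>)
    finally show ?thesis using True by simp
  next
    case False
    have "lfsum B' (\<lambda>b. lfsum B' (\<lambda>c. P a b * (Q c a * X b c))) = lfsum B' (\<lambda>b. 0)"
      by (rule lfsum_cong) (use False in \<open>auto simp: c A_def intro!: sum.neutral\<close>)
    thus ?thesis using False by simp
  qed
  show "finite {a \<in> B. lfsum B' (\<lambda>b. lfsum B' (\<lambda>c. P a b * (Q c a * X b c))) \<noteq> 0}"
    by (rule finite_subset[OF _ A(1)]) (auto simp: b split: if_splits)
  have QP': "(\<Sum>a\<in>A. Q c a * P a b) = (if c = b then 1 else 0)" if "c \<in> F" "b \<in> B'" for b c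
    using QP[of c b] that F(2) lfsum_eq_sum[OF A, of "\<lambda>a. Q c a * P a b"] by (auto simp: A_def)
  have "lfsum B (\<lambda>a. lfsum B' (\<lambda>b. lfsum B' (\<lambda>c. P a b * (Q c a * X b c))))
     = (\<Sum>a\<in>A. \<Sum>b\<in>D. \<Sum>c\<in>F. P a b * (Q c a * X b c))"
    unfolding b by (subst lfsum_eq_sum[OF A]) auto
  also have "\<dots> = (\<Sum>b\<in>D. \<Sum>a\<in>A. \<Sum>c\<in>F. P a b * (Q c a * X b c))" by (rule sum.swap)
  also have "\<dots> = (\<Sum>b\<in>D. \<Sum>c\<in>F. \<Sum>a\<in>A. P a b * (Q c a * X b c))"
    by (rule sum.cong[OF refl]) (rule sum.swap)
  also have "\<dots> = (\<Sum>b\<in>D. \<Sum>c\<in>F. if c = b then X b c else 0)"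
  proof (intro sum.cong refl)
    fix b c assume "b \<in> D" "c \<in> F"
    have "(\<Sum>a\<in>A. P a b * (Q c a * X b c)) = (\<Sum>a\<in>A. Q c a * P a b) * X b c"
      unfolding sum_distrib_right by (rule sum.cong) (simp_all add: mult_ac)
    thus "(\<Sum>a\<in>A. P a b * (Q c a * X b c)) = (if c = b then X b c else 0)"
      using QP'[OF \<open>c \<in> F\<close>, of b] \<open>b \<in> D\<close> D(2) by auto
  qed
  also have "\<dots> = (\<Sum>c\<in>F. \<Sum>b\<in>D. if b = c then X b c else 0)"
    by (subst sum.swap) (simp add: eq_commute)
  also have "\<dots> = (\<Sum>c\<in>F. X c c)"
    by (rule sum.cong[OF refl]) (use D in \<open>auto simp: sum.delta\<close>)
  also have "\<dots> = lfsum B' (\<lambda>c. X c c)"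
    by (rule lfsum_eq_sum[OF F(1,2), symmetric]) (auto simp: F(3))
  finally show "lfsum B (\<lambda>a. lfsum B' (\<lambda>b. lfsum B' (\<lambda>c. P a b * (Q c a * X b c)))) = lfsum B' (\<lambda>c. X c c)" .
qed

lemma finite_phi_family:
  assumes "fam V' B' B' g"
  shows "finite {c \<in> B'. \<exists>S\<in>Pow {..<length w}. \<phi> (g c) (nths w S) \<noteq> 0 \<or> \<phi> (g c) (nths w (- S)) \<noteq> 0}"
proof (rule finite_subset)
  let ?U = "\<Union>S\<in>Pow {..<length w}. {c \<in> B'. \<phi> (g c) (nths w S) \<noteq> 0} \<union> {c \<in> B'. \<phi> (g c) (nths w (- S)) \<noteq> 0}"
  show "finite ?U" using fam_pointwise[OF fam_phi[OF assms]] by auto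
qed auto

text \<open>In both halves of the bracket the index \<open>c\<close> belongs to a derivative by
  \<chi>, so that only finitely many \<open>c\<close> contribute and \<open>contraction\<close>
  applies: \<open>QP\<close> collapses the double sum over the new basis to its diagonal.\<close>

lemma phi_bracket:
  assumes f: "is_function V' B' f" and g: "is_function V' B' g"
  shows "\<phi> (bracket V' B' f g) w = bracket V B (\<phi> f) (\<phi> g) w"
proof -
  let ?X = "\<lambda>b c. fmul V (\<phi> (dR (Tc b) f)) (\<phi> (dL (Chi c) g)) w"
  let ?Y = "\<lambda>b c. fmul V (\<phi> (dR (Chi c) f)) (\<phi> (dL (Tc b) g)) w"
  have gC: "fam V' B' B' (\<lambda>c. dL (Chi c) g)"
    using fam_reindex[OF fam_dL_Chi[of V' B' "{()}" "\<lambda>_. g"], of "Pair ()" B'] g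
    by (auto simp: fam_singleton inj_on_def)
  have fC: "fam V' B' B' (\<lambda>c. dR (Chi c) f)"
    using fam_reindex[OF fam_dR_Chi[of V' B' "{()}" "\<lambda>_. f"], of "Pair ()" B'] f
    by (auto simp: fam_singleton inj_on_def)
  have P0: "finite {b \<in> B'. P a b * h b \<noteq> 0}" for a h
    by (rule finite_subset[OF _ P_finite[of a]]) auto
  have QC: "finite {c \<in> B'. Q c a * \<phi> (g' c) v \<noteq> 0}" if "fam V' B' B' g'" for a g' v
    by (rule finite_subset[OF _ fam_pointwise[OF fam_phi[OF that], of v]]) auto
  have T: "fmul V (dR (Tc a) (\<phi> f)) (dL (Chi a) (\<phi> g)) w
     = lfsum B' (\<lambda>b. lfsum B' (\<lambda>c. P a b * (Q c a * ?X b c)))" for a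
    unfolding dR_phi[OF f] dL_phi[OF g] lfsum_M_Tc lfsum_M_Chi
    by (subst fmul_lfsum_left[OF P0], subst fmul_lfsum_right[OF QC[OF gC]])
      (simp add: fmul_mult_left fmul_mult_right lfsum_cmult mult.left_commute)
  have C: "fmul V (dR (Chi a) (\<phi> f)) (dL (Tc a) (\<phi> g)) w
     = lfsum B' (\<lambda>b. lfsum B' (\<lambda>c. P a b * (Q c a * ?Y b c)))" for a
    unfolding dR_phi[OF f] dL_phi[OF g] lfsum_M_Tc lfsum_M_Chi
    by (subst fmul_lfsum_right[OF P0], subst fmul_lfsum_left[OF QC[OF fC]])
      (simp add: fmul_mult_left fmul_mult_right lfsum_cmult mult.left_commute)
  have X0: "?X b c = 0" if "c \<in> B'" "c \<notin> {c \<in> B'. \<exists>S\<in>Pow {..<length w}. \<phi> (dL (Chi c) g) (nths w S) \<noteq> 0 \<or> \<phi> (dL (Chi c) g) (nths w (- S)) \<noteq> 0}" for b c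
    unfolding fmul_def by (rule sum.neutral) (use that in auto)
  have Y0: "?Y b c = 0" if "c \<in> B'" "c \<notin> {c \<in> B'. \<exists>S\<in>Pow {..<length w}. \<phi> (dR (Chi c) f) (nths w S) \<noteq> 0 \<or> \<phi> (dR (Chi c) f) (nths w (- S)) \<noteq> 0}" for b c
    unfolding fmul_def by (rule sum.neutral) (use that in auto)
  note cX = contraction[OF finite_phi_family[OF gC, of w] _ X0]
  note cY = contraction[OF finite_phi_family[OF fC, of w] _ Y0]
  have "bracket V B (\<phi> f) (\<phi> g) w = lfsum B' (\<lambda>c. ?X c c) - lfsum B' (\<lambda>c. ?Y c c)"
    unfolding bracket_def T C by (subst lfsum_diff) (use cX cY in auto)
  also have "\<dots> = lfsum B' (\<lambda>c. ?X c c - ?Y c c)"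
  proof (rule lfsum_diff[symmetric])
    show "finite {c \<in> B'. ?X c c \<noteq> 0}"
      by (rule finite_subset[OF _ finite_phi_family[OF gC, of w]]) (use X0 in blast)
    show "finite {c \<in> B'. ?Y c c \<noteq> 0}"
      by (rule finite_subset[OF _ finite_phi_family[OF fC, of w]]) (use Y0 in blast)
  qed
  also have "\<dots> = lfsum B' (\<lambda>c. \<phi> (cterm V' f g (Tc c)) w + \<phi> (cterm V' f g (Chi c)) w)"
  proof (rule lfsum_cong)
    fix c
    have "\<phi> (cterm V' f g z) w = eps z * fmul V (\<phi> (dR z f)) (\<phi> (dL (dual z) g)) w" for z
      unfolding cterm_def phi_mult using f g by (simp add: phi_fmul is_function_dR is_function_dL)
    thus "?X c c - ?Y c c = \<phi> (cterm V' f g (Tc c)) w + \<phi> (cterm V' f g (Chi c)) w" by simp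
  qed
  also have "\<dots> = lfsum (coords B') (\<lambda>z. \<phi> (cterm V' f g z) w)"
    by (rule lfsum_coords[symmetric]) (rule fam_pointwise[OF fam_phi[OF fam_cterm_single[OF f g]]])
  also have "\<dots> = \<phi> (bracket V' B' f g) w"
    unfolding bracket_cterm[OF f g] by (rule phi_lfsum[OF fam_cterm_single[OF f g], symmetric])
  finally show ?thesis by simp
qed

lemma poisson_hom_phi: "poisson_hom TYPE('i) V' B' V B \<phi>"
  unfolding poisson_hom_def
proof (intro conjI allI impI)
  fix f :: "('w, 'k) series" and c :: 'k and p
  show "\<phi> (\<lambda>w. c * f w) = (\<lambda>w. c * \<phi> f w)" by (rule phi_mult)
  show "has_degree V p (\<phi> f)" if "has_degree V' p f"
  proof (rule has_degreeI)
    fix w assume "\<phi> f w \<noteq> 0"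
    then obtain u where "W w u \<noteq> 0" "f u \<noteq> 0" using phi_nonzero by blast
    thus "wdeg V w = p" using W_support[of w u] has_degreeD[OF that, of u] by simp
  qed
  show "vanishes_on_L (\<phi> f)" if "vanishes_on_L f"
    unfolding vanishes_on_L_def
  proof (rule allI, rule ccontr)
    fix bs assume "\<phi> f (map Chi bs) \<noteq> 0"
    then obtain u where "W (map Tc [] @ map Chi bs) u \<noteq> 0" "f u \<noteq> 0" using phi_nonzero by auto
    thus False using W_support_normal[of "[]" bs u] that by (auto simp: vanishes_on_L_def)
  qed
  show "vanishes_on_PiL (\<phi> f)" if "vanishes_on_PiL f"
    unfolding vanishes_on_PiL_def
  proof (rule allI, rule ccontr)
    fix as assume "\<phi> f (map Tc as) \<noteq> 0"
    then obtain u where "W (map Tc as @ map Chi []) u \<noteq> 0" "f u \<noteq> 0" using phi_nonzero by auto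
    thus False using W_support_normal[of as "[]" u] that by (auto simp: vanishes_on_PiL_def)
  qed
next
  show "\<phi> fone = fone"
  proof
    fix w
    have "W w u * fone u = (if u = [] then fone w else 0)" for u
      by (cases w; cases u) (auto simp: fone_def)
    thus "\<phi> fone w = fone w" by (simp add: lin_def lfsum_single)
  qed
next
  fix f g :: "('w, 'k) series" assume "is_function V' B' f" "is_function V' B' g"
  thus "\<phi> (fmul V' f g) = fmul V (\<phi> f) (\<phi> g)" "\<phi> (bracket V' B' f g) = bracket V B (\<phi> f) (\<phi> g)"
    by (auto simp: phi_fmul phi_bracket)
next
  fix I :: "'i set" and f :: "'i \<Rightarrow> ('w, 'k) series" assume "fam V' B' I f"
  thus "fam V B I (\<lambda>i. \<phi> (f i))" "\<phi> (\<lambda>w. lfsum I (\<lambda>i. f i w)) = (\<lambda>w. lfsum I (\<lambda>i. \<phi> (f i) w))"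
    by (auto simp: fam_phi phi_lfsum)
qed

lemma phi_single: "is_function V' B' f \<Longrightarrow> \<phi> f [x] = lfsum (coords B') (\<lambda>y. M x y * f [y])"
proof -
  assume f: "is_function V' B' f"
  have "W [] u * h u = (if u = [] then h [] else 0)" for u and h :: "('w, 'k) series" by (cases u) auto
  hence "\<phi> h [] = h []" for h :: "('w, 'k) series" by (simp add: lin_def lfsum_single)
  thus ?thesis by (simp add: phi_Cons[OF f] dL_def)
qed

lemma phi_length:
  assumes "\<And>u. f u \<noteq> 0 \<Longrightarrow> length u = n" "\<phi> f w \<noteq> 0"
  shows "length w = n"
  using phi_nonzero[OF assms(2)] assms(1) W_support[of w] by auto

end

text \<open>On linear functions the two substitutions compose to a product of the matrices
  \<open>P\<close> and \<open>Q\<close>.\<close>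

lemma (in base_change) phi_inverse_coord:
  assumes "y \<in> coords B'"
  shows "lin Q P B (\<phi> (coord_fun y)) = coord_fun y"
proof
  fix w
  interpret inv: base_change V' B' V B Q P by (rule inverse)
  note F = is_function_coord_fun[OF assms, of V', where 'k = 'k]
  have l1: "length w = 1" if "\<phi> (coord_fun y) w \<noteq> 0" for w
    by (rule phi_length[OF _ that]) simp
  show "lin Q P B (\<phi> (coord_fun y)) w = coord_fun y w"
  proof (cases "length w = 1")
    case False
    thus ?thesis using inv.phi_length[of "\<phi> (coord_fun y)" 1 w] l1 by (auto simp: coord_fun_def)
  next
    case True
    then obtain z where w: "w = [z]" by (auto simp: length_Suc_conv)
    have F': "is_function V B (\<phi> (coord_fun y))" by (rule is_function_phi[OF F])
    have s: "\<phi> (coord_fun y) [x] = M x y" for x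
    proof -
      have "M x y' * coord_fun y [y'] = (if y' = y then M x y else 0)" for y'
        by (auto simp: coord_fun_def)
      thus ?thesis using assms by (simp add: phi_single[OF F] lfsum_single)
    qed
    show ?thesis
    proof (cases "z \<in> coords B'")
      case False
      thus ?thesis using is_function_outside[OF inv.is_function_phi[OF F'], of w] assms w by (auto simp: coord_fun_def)
    next
      case True
      show ?thesis
      proof (cases z)
        case (Tc c)
        have "lin Q P B (\<phi> (coord_fun y)) [Tc c] = lfsum B (\<lambda>a. Q c a * M (Tc a) y)"
          by (simp add: inv.phi_single[OF F'] inv.lfsum_M_Tc s)
        thus ?thesis using True assms QP[of c] Tc w
          by (cases y) (auto simp: coord_fun_def)
      next
        case (Chi c)
        have "lin Q P B (\<phi> (coord_fun y)) [Chi c] = lfsum B (\<lambda>a. M (Chi a) y * P a c)"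
          by (simp add: inv.phi_single[OF F'] inv.lfsum_M_Chi s) (simp add: mult.commute)
        thus ?thesis using True assms QP[of _ c] Chi w
          by (cases y) (auto simp: coord_fun_def)
      qed
    qed
  qed
qed

lemma pullback_cong:
  assumes "\<And>x. x \<in> coords B' \<Longrightarrow> F x = G x"
  shows "pullback V B' F f = pullback V B' G f"
proof -
  have eq: "map F u = map G u" if "u \<in> lists (coords B')" for u
    using that assms by (induction u) auto
  show ?thesis unfolding pullback_def by (intro ext lfsum_cong) (simp only: eq)
qed

text \<open>The composite is a Poisson homomorphism, hence the pullback along its values on
  coordinates, and there it is the identity.\<close>

lemma (in base_change) phi_inverse:
  assumes f: "is_function V' B' f"
  shows "lin Q P B (\<phi> f) = f"
proof -
  interpret inv: base_change V' B' V B Q P by (rule inverse)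
  have "lin Q P B (\<phi> f) = pullback V' B' (\<lambda>x. lin Q P B (\<phi> (coord_fun x))) f"
    by (rule poisson_hom_pullback[OF poisson_hom_comp[OF inv.poisson_hom_phi poisson_hom_phi] f, symmetric])
  also have "\<dots> = pullback V' B' coord_fun f"
    by (rule pullback_cong) (rule phi_inverse_coord)
  also have "\<dots> = f" by (rule poisson_hom_pullback[OF poisson_hom_id f])
  finally show ?thesis .
qed


section \<open>The contracting homotopy\<close>

text \<open>The derivation \<open>\<Sum> \<kappa> x x \<partial>/\<partial>(\<rho> x)\<close>.\<close>

definition subst_op :: "(int \<Rightarrow> 'v set) \<Rightarrow> 'v coord set \<Rightarrow> ('v coord \<Rightarrow> 'v coord) \<Rightarrow> ('v coord \<Rightarrow> 'k::field_char_0) \<Rightarrow>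
    ('v, 'k) series \<Rightarrow> ('v, 'k) series" where
  "subst_op V X \<rho> \<kappa> f = (\<lambda>w. lfsum X (\<lambda>x. \<kappa> x * fmul V (coord_fun x) (dL (\<rho> x) f) w))"

lemma fmul_cong_set:
  assumes "\<And>u. set u \<subseteq> set w \<Longrightarrow> f u = f' u" "\<And>v. set v \<subseteq> set w \<Longrightarrow> g v = g' v"
  shows "fmul V f g w = fmul V f' g' w"
  unfolding fmul_def using assms by (intro sum.cong) (auto simp: set_nths_subset)

lemma fmul_coord_outside: "x \<notin> set w \<Longrightarrow> fmul V (coord_fun x) f w = 0"
  using fmul_support[of V "coord_fun x" f w] set_shuffles by fastforce

lemma subst_op_finite:
  assumes "finite A" "A \<subseteq> X" "X \<inter> set w \<subseteq> A"
  shows "subst_op V X \<rho> \<kappa> f w = (\<Sum>x\<in>A. \<kappa> x * fmul V (coord_fun x) (dL (\<rho> x) f) w)"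
  unfolding subst_op_def
proof (rule lfsum_eq_sum[OF assms(1,2)])
  fix x assume "x \<in> X" "x \<notin> A"
  hence "x \<notin> set w" using assms(3) by blast
  thus "\<kappa> x * fmul V (coord_fun x) (dL (\<rho> x) f) w = 0" by (simp add: fmul_coord_outside)
qed

lemma finite_subst_op: "finite {x \<in> X. \<kappa> x * fmul V (coord_fun x) (g x) w \<noteq> 0}"
proof (rule finite_subset)
  show "{x \<in> X. \<kappa> x * fmul V (coord_fun x) (g x) w \<noteq> 0} \<subseteq> set w"
    by (auto intro: ccontr simp: fmul_coord_outside)
qed simp

lemma fmul_mult_right_fun: "fmul V f (\<lambda>w. c * g w) = (\<lambda>w. c * fmul V f g w)"
  by (rule ext) (rule fmul_mult_right)

lemma fmul_coord_commute:
  fixes g :: "('v, 'k::field_char_0) series"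
  shows "fmul V (coord_fun y) (fmul V (coord_fun x) g) = (\<lambda>w. ksign (cdeg V y) (cdeg V x) * fmul V (coord_fun x) (fmul V (coord_fun y) g) w)"
proof -
  have "fmul V (coord_fun y) (coord_fun x) = (\<lambda>w. ksign (cdeg V y) (cdeg V x) * fmul V (coord_fun x) (coord_fun y) w :: 'k)"
    by (rule ext) (simp add: fmul_commute_parity[OF has_degree_parity[OF has_degree_coord_fun], of V y "coord_fun x"]
        tw_coord_fun fmul_mult_left)
  hence "fmul V (fmul V (coord_fun y) (coord_fun x)) g = fmul V (\<lambda>w. ksign (cdeg V y) (cdeg V x) * fmul V (coord_fun x) (coord_fun y) w) g"
    by simp
  thus ?thesis by (auto simp: fmul_assoc fmul_mult_left)
qed

text \<open>The graded commutator of two odd derivations is again a derivation. Here it is the Euler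
  operator of the coordinates in \<open>X\<close> and \<open>X'\<close>: the terms with two
  derivatives, \<open>Z\<close>, cancel, and those in which one operator differentiates the
  coordinate inserted by the other remain.\<close>

lemma subst_op_homotopy:
  fixes f :: "('v, 'k::field_char_0) series"
  assumes f: "gsym V f"
    and \<rho>: "\<And>x. x \<in> X \<Longrightarrow> \<rho> x \<in> X' \<and> \<rho>' (\<rho> x) = x" "\<And>y. y \<in> X' \<Longrightarrow> \<rho>' y \<in> X \<and> \<rho> (\<rho>' y) = y"
    and disj: "X \<inter> X' = {}"
    and odd: "\<And>x. x \<in> X \<Longrightarrow> odd (cdeg V (\<rho> x) - cdeg V x)"
    and \<kappa>: "\<And>x. x \<in> X \<Longrightarrow> \<kappa> x * \<kappa> x = 1" and \<kappa>': "\<And>y. \<kappa>' y = \<kappa> (\<rho>' y)"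
  shows "subst_op V X \<rho> \<kappa> (subst_op V X' \<rho>' \<kappa>' f) w + subst_op V X' \<rho>' \<kappa>' (subst_op V X \<rho> \<kappa> f) w
     = of_nat (length (filter (\<lambda>x. x \<in> X \<union> X') w)) * f w"
proof -
  \<comment> \<open>\<open>A\<close> and \<open>A'\<close> are finite, correspond under the pairing
    and contain all letters of \<open>w\<close> from \<open>X\<close> and \<open>X'\<close>; the
    infinite sums reduce to them.\<close>
  define A where "A = (X \<inter> set w) \<union> \<rho>' ` (X' \<inter> set w)"
  define A' where "A' = (X' \<inter> set w) \<union> \<rho> ` (X \<inter> set w)"
  have A: "finite A" "A \<subseteq> X" "X \<inter> set w \<subseteq> A" and A': "finite A'" "A' \<subseteq> X'" "X' \<inter> set w \<subseteq> A'"
    using \<rho> by (auto simp: A_def A'_def)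
  have \<rho>A: "\<rho> x \<in> A'" if "x \<in> A" for x using that \<rho> by (auto simp: A_def A'_def)
  have \<rho>A': "\<rho>' y \<in> A" if "y \<in> A'" for y using that \<rho> by (auto simp: A_def A'_def)
  let ?x = "coord_fun :: 'v coord \<Rightarrow> ('v, 'k) series"
  define Z where "Z x y = \<kappa> x * \<kappa>' y * ksign (cdeg V (\<rho> x)) (cdeg V y) *
     fmul V (?x x) (fmul V (?x y) (dL (\<rho> x) (dL (\<rho>' y) f))) w" for x y
  have D: "dL z (fmul V (?x y) g) = (\<lambda>w. (if z = y then g w else 0) + ksign (cdeg V z) (cdeg V y) * fmul V (?x y) (dL z g) w)" for z y g
    by (auto simp: dL_fmul dL_coord_fun tw_coord_fun fmul_fone fmul_mult_left)
  have "subst_op V X \<rho> \<kappa> (subst_op V X' \<rho>' \<kappa>' f) w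
     = (\<Sum>x\<in>A. \<kappa> x * fmul V (?x x) (dL (\<rho> x) (subst_op V X' \<rho>' \<kappa>' f)) w)"
    by (rule subst_op_finite[OF A])
  also have "\<dots> = (\<Sum>x\<in>A. \<kappa> x * fmul V (?x x) (\<lambda>w. \<Sum>y\<in>A'. \<kappa>' y * dL (\<rho> x) (fmul V (?x y) (dL (\<rho>' y) f)) w) w)"
  proof (rule sum.cong[OF refl], rule arg_cong[of _ _ "\<lambda>t. _ * t"], rule fmul_cong_set)
    fix x v assume "x \<in> A" "set v \<subseteq> set w"
    hence "X' \<inter> set (\<rho> x # v) \<subseteq> A'" using \<rho>A A'(3) by auto
    thus "dL (\<rho> x) (subst_op V X' \<rho>' \<kappa>' f) v = (\<Sum>y\<in>A'. \<kappa>' y * dL (\<rho> x) (fmul V (?x y) (dL (\<rho>' y) f)) v)"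
      using subst_op_finite[OF A'(1,2), of "\<rho> x # v"] by (simp add: dL_def[of "\<rho> x"])
  qed simp
  also have "\<dots> = (\<Sum>x\<in>A. \<Sum>y\<in>A'. \<kappa> x * \<kappa>' y * fmul V (?x x) (dL (\<rho> x) (fmul V (?x y) (dL (\<rho>' y) f))) w)"
    by (simp add: fmul_sum_right A'(1) fmul_mult_right sum_distrib_left mult.assoc)
  also have "\<dots> = (\<Sum>x\<in>A. \<Sum>y\<in>A'. (if y = \<rho> x then fmul V (?x x) (dL x f) w else 0) + Z x y)"
  proof (intro sum.cong refl)
    fix x y assume "x \<in> A" "y \<in> A'"
    hence "\<kappa> x * \<kappa>' (\<rho> x) = 1" "\<rho>' (\<rho> x) = x" using A(2) \<rho>(1) \<kappa> \<kappa>' by auto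
    thus "\<kappa> x * \<kappa>' y * fmul V (?x x) (dL (\<rho> x) (fmul V (?x y) (dL (\<rho>' y) f))) w
       = (if y = \<rho> x then fmul V (?x x) (dL x f) w else 0) + Z x y"
      by (auto simp: D Z_def fmul_add_right fmul_mult_right distrib_left mult.assoc)
  qed
  also have "\<dots> = (\<Sum>x\<in>A. fmul V (?x x) (dL x f) w) + (\<Sum>x\<in>A. \<Sum>y\<in>A'. Z x y)"
    using \<rho>A A'(1) by (simp add: sum.distrib)
  finally have 1: "subst_op V X \<rho> \<kappa> (subst_op V X' \<rho>' \<kappa>' f) w
     = (\<Sum>x\<in>A. fmul V (?x x) (dL x f) w) + (\<Sum>x\<in>A. \<Sum>y\<in>A'. Z x y)" .
  have "subst_op V X' \<rho>' \<kappa>' (subst_op V X \<rho> \<kappa> f) w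
     = (\<Sum>y\<in>A'. \<kappa>' y * fmul V (?x y) (dL (\<rho>' y) (subst_op V X \<rho> \<kappa> f)) w)"
    by (rule subst_op_finite[OF A'])
  also have "\<dots> = (\<Sum>y\<in>A'. \<kappa>' y * fmul V (?x y) (\<lambda>w. \<Sum>x\<in>A. \<kappa> x * dL (\<rho>' y) (fmul V (?x x) (dL (\<rho> x) f)) w) w)"
  proof (rule sum.cong[OF refl], rule arg_cong[of _ _ "\<lambda>t. _ * t"], rule fmul_cong_set)
    fix y v assume "y \<in> A'" "set v \<subseteq> set w"
    hence "X \<inter> set (\<rho>' y # v) \<subseteq> A" using \<rho>A' A(3) by auto
    thus "dL (\<rho>' y) (subst_op V X \<rho> \<kappa> f) v = (\<Sum>x\<in>A. \<kappa> x * dL (\<rho>' y) (fmul V (?x x) (dL (\<rho> x) f)) v)"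
      using subst_op_finite[OF A(1,2), of "\<rho>' y # v"] by (simp add: dL_def[of "\<rho>' y"])
  qed simp
  also have "\<dots> = (\<Sum>y\<in>A'. \<Sum>x\<in>A. \<kappa> x * \<kappa>' y * fmul V (?x y) (dL (\<rho>' y) (fmul V (?x x) (dL (\<rho> x) f))) w)"
    by (simp add: fmul_sum_right A(1) fmul_mult_right sum_distrib_left mult.assoc mult.left_commute)
  also have "\<dots> = (\<Sum>y\<in>A'. \<Sum>x\<in>A. (if x = \<rho>' y then fmul V (?x y) (dL y f) w else 0) - Z x y)"
  proof (intro sum.cong refl)
    fix x y assume xy: "y \<in> A'" "x \<in> A"
    have \<kappa>1: "\<kappa> (\<rho>' y) * \<kappa>' y = 1" "\<rho> (\<rho>' y) = y" using xy A'(2) \<rho>(2) \<kappa> \<kappa>' by auto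
    have od: "odd (cdeg V (\<rho> x) - cdeg V x)" "odd (cdeg V y - cdeg V (\<rho>' y))"
      using odd[of x] odd[of "\<rho>' y"] xy A A' \<rho> by auto
    have dd: "dL (\<rho>' y) (dL (\<rho> x) f) = (\<lambda>w. ksign (cdeg V (\<rho>' y)) (cdeg V (\<rho> x)) * dL (\<rho> x) (dL (\<rho>' y) f) w)"
      by (rule dL_dL[OF f])
    \<comment> \<open>Paired coordinates have opposite parities, which makes the terms with two
      derivatives opposite in the two orders.\<close>
    have sg: "ksign (cdeg V (\<rho>' y)) (cdeg V x) * (ksign (cdeg V y) (cdeg V x) * ksign (cdeg V (\<rho>' y)) (cdeg V (\<rho> x)))
       = - (ksign (cdeg V (\<rho> x)) (cdeg V y) :: 'k)"
      using od by (auto simp: ksign_def)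
    have "ksign (cdeg V (\<rho>' y)) (cdeg V x) * fmul V (?x y) (fmul V (?x x) (dL (\<rho>' y) (dL (\<rho> x) f))) w
       = (ksign (cdeg V (\<rho>' y)) (cdeg V x) * (ksign (cdeg V y) (cdeg V x) * ksign (cdeg V (\<rho>' y)) (cdeg V (\<rho> x)))) *
         fmul V (?x x) (fmul V (?x y) (dL (\<rho> x) (dL (\<rho>' y) f))) w"
      unfolding fmul_coord_commute[of V y x] dd by (simp add: fmul_mult_right_fun mult.assoc)
    hence "ksign (cdeg V (\<rho>' y)) (cdeg V x) * fmul V (?x y) (fmul V (?x x) (dL (\<rho>' y) (dL (\<rho> x) f))) w
       = - (ksign (cdeg V (\<rho> x)) (cdeg V y) * fmul V (?x x) (fmul V (?x y) (dL (\<rho> x) (dL (\<rho>' y) f))) w)"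
      unfolding sg by simp
    hence "\<kappa> x * \<kappa>' y * (ksign (cdeg V (\<rho>' y)) (cdeg V x) * fmul V (?x y) (fmul V (?x x) (dL (\<rho>' y) (dL (\<rho> x) f))) w) = - Z x y"
      by (simp add: Z_def mult.assoc)
    moreover have "fmul V (?x y) (dL (\<rho>' y) (fmul V (?x x) (dL (\<rho> x) f))) w = (if x = \<rho>' y then fmul V (?x y) (dL y f) w else 0)
       + ksign (cdeg V (\<rho>' y)) (cdeg V x) * fmul V (?x y) (fmul V (?x x) (dL (\<rho>' y) (dL (\<rho> x) f))) w"
      using \<kappa>1(2) by (auto simp: D fmul_add_right fmul_mult_right)
    moreover have "\<kappa> x * \<kappa>' y * (if x = \<rho>' y then fmul V (?x y) (dL y f) w else 0) = (if x = \<rho>' y then fmul V (?x y) (dL y f) w else 0)"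
      using \<kappa>1(1) by auto
    ultimately show "\<kappa> x * \<kappa>' y * fmul V (?x y) (dL (\<rho>' y) (fmul V (?x x) (dL (\<rho> x) f))) w
       = (if x = \<rho>' y then fmul V (?x y) (dL y f) w else 0) - Z x y"
      by (simp only: distrib_left) simp
  qed
  also have "\<dots> = (\<Sum>y\<in>A'. fmul V (?x y) (dL y f) w) - (\<Sum>y\<in>A'. \<Sum>x\<in>A. Z x y)"
    using \<rho>A' A(1) by (simp add: sum_subtractf)
  finally have 2: "subst_op V X' \<rho>' \<kappa>' (subst_op V X \<rho> \<kappa> f) w
     = (\<Sum>y\<in>A'. fmul V (?x y) (dL y f) w) - (\<Sum>y\<in>A'. \<Sum>x\<in>A. Z x y)" .
  have 3: "(\<Sum>y\<in>A'. \<Sum>x\<in>A. Z x y) = (\<Sum>x\<in>A. \<Sum>y\<in>A'. Z x y)" by (rule sum.swap)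
  have "(\<Sum>x\<in>A. fmul V (?x x) (dL x f) w) + (\<Sum>y\<in>A'. fmul V (?x y) (dL y f) w)
     = (\<Sum>x\<in>A \<union> A'. fmul V (?x x) (dL x f) w)"
    using A A' disj by (intro sum.union_disjoint[symmetric]) auto
  also have "\<dots> = of_nat (length (filter (\<lambda>x. x \<in> A \<union> A') w)) * f w"
    using A A' by (intro euler_identity[OF f]) auto
  also have "filter (\<lambda>x. x \<in> A \<union> A') w = filter (\<lambda>x. x \<in> X \<union> X') w"
    by (rule filter_cong) (use A A' in auto)
  finally show ?thesis using 1 2 3 by simp
qed

text \<open>As \<rho> respects the type of a coordinate, each half has a summable factor: on the
  t-part these are the coordinates themselves, on the \<chi>-part the derivatives.\<close>

lemma is_function_subst_op:
  assumes f: "is_function V B f" and X: "X \<subseteq> coords B" "inj_on \<rho> X"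
    and \<rho>T: "\<And>b. Tc b \<in> X \<Longrightarrow> \<rho> (Tc b) \<in> Tc ` B" and \<rho>C: "\<And>b. Chi b \<in> X \<Longrightarrow> \<rho> (Chi b) \<in> Chi ` B"
  shows "is_function V B (subst_op V X \<rho> \<kappa> f)"
proof -
  let ?t = "\<lambda>x. fmul V (coord_fun x) (dL (\<rho> x) f)"
  let ?XT = "{b. Tc b \<in> X}" and ?XC = "{b. Chi b \<in> X}"
  have "fam V B ?XT (\<lambda>b. coord_fun (Tc b))"
    by (rule fam_mono[OF fam_coord_fun_Tc]) (use X in auto)
  hence "fam V B (Sigma ?XT (\<lambda>_. {()})) (\<lambda>(b, i). fmul V (coord_fun (Tc b)) (dL (\<rho> (Tc b)) f))"
    by (rule fam_fmul_right) (use f in \<open>auto simp: fam_singleton is_function_dL\<close>)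
  hence "fam V B (X \<inter> range Tc) (\<lambda>x. (\<lambda>(b, i). fmul V (coord_fun (Tc b)) (dL (\<rho> (Tc b)) f)) (case x of Tc b \<Rightarrow> b, ()))"
    by (rule fam_reindex) (auto simp: inj_on_def)
  hence T: "fam V B (X \<inter> range Tc) ?t" by (rule fam_cong) auto
  have "fam V B ({()} \<times> B) (\<lambda>(i, b). dL (Chi b) f)"
    by (rule fam_dL_Chi) (use f in \<open>simp add: fam_singleton\<close>)
  hence "fam V B ?XC (\<lambda>b. (\<lambda>(i, b). dL (Chi b) f) ((), case \<rho> (Chi b) of Chi c \<Rightarrow> c))"
  proof (rule fam_reindex)
    show "inj_on (\<lambda>b. ((), case \<rho> (Chi b) of Chi c \<Rightarrow> c)) ?XC"
    proof (rule inj_onI)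
      fix a b assume ab: "a \<in> ?XC" "b \<in> ?XC"
        "((), case \<rho> (Chi a) of Chi c \<Rightarrow> c) = ((), case \<rho> (Chi b) of Chi c \<Rightarrow> c)"
      hence "\<rho> (Chi a) = \<rho> (Chi b)" using \<rho>C[of a] \<rho>C[of b] by auto
      thus "a = b" using X(2) ab by (auto dest: inj_onD)
    qed
  qed (use \<rho>C in force)
  hence "fam V B ?XC (\<lambda>b. dL (\<rho> (Chi b)) f)" by (rule fam_cong) (use \<rho>C in force)
  hence "fam V B (Sigma ?XC (\<lambda>_. {()})) (\<lambda>(b, i). fmul V (coord_fun (Chi b)) (dL (\<rho> (Chi b)) f))"
    by (rule fam_fmul_left) (use X in \<open>auto simp: fam_singleton intro!: is_function_coord_fun\<close>)
  hence "fam V B (X \<inter> range Chi) (\<lambda>x. (\<lambda>(b, i). fmul V (coord_fun (Chi b)) (dL (\<rho> (Chi b)) f)) (case x of Chi b \<Rightarrow> b, ()))"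
    by (rule fam_reindex) (auto simp: inj_on_def)
  hence C: "fam V B (X \<inter> range Chi) ?t" by (rule fam_cong) auto
  have "fam V B ((X \<inter> range Tc) \<union> (X \<inter> range Chi)) ?t" by (rule fam_Un[OF T C])
  moreover have "(X \<inter> range Tc) \<union> (X \<inter> range Chi) = X"
    by (auto) (metis coord.exhaust rangeI)
  ultimately have "fam V B X ?t" by simp
  hence "fam V B X (\<lambda>x w. \<kappa> x * ?t x w)" by (rule fam_mult)
  from is_function_lfsum[OF this] show ?thesis by (simp add: subst_op_def)
qed

lemma subst_op_support:
  assumes "subst_op V X \<rho> \<kappa> f w \<noteq> 0"
  shows "\<exists>x\<in>X. \<exists>v. w \<in> shuffles [x] v \<and> f (\<rho> x # v) \<noteq> 0"
  using assms unfolding subst_op_def by (force dest!: lfsum_nonzeroD fmul_support simp: dL_def)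

lemma subst_op_zero: "subst_op V X \<rho> \<kappa> (\<lambda>w. 0) w = 0"
  by (simp add: subst_op_def dL_def)

text \<open>The operator replaces one counted letter by another, so it commutes with division by the
  count.\<close>

lemma subst_op_count:
  assumes "\<And>x. x \<in> X \<Longrightarrow> p x \<and> p (\<rho> x)"
  shows "subst_op V X \<rho> \<kappa> (\<lambda>w. f w / of_nat (length (filter p w))) w
     = subst_op V X \<rho> \<kappa> f w / of_nat (length (filter p w))"
proof -
  have "fmul V (coord_fun x) (dL (\<rho> x) (\<lambda>w. f w / of_nat (length (filter p w)))) w
     = inverse (of_nat (length (filter p w))) * fmul V (coord_fun x) (dL (\<rho> x) f) w" if "x \<in> X" for x
    unfolding fmul_def sum_distrib_left
  proof (rule sum.cong[OF refl])
    fix S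
    show "shuffle_sign V w S * coord_fun x (nths w S) * dL (\<rho> x) (\<lambda>w. f w / of_nat (length (filter p w))) (nths w (- S))
       = inverse (of_nat (length (filter p w))) * (shuffle_sign V w S * coord_fun x (nths w S) * dL (\<rho> x) f (nths w (- S)))"
    proof (cases "nths w S = [x]")
      case True
      hence "length (filter p (\<rho> x # nths w (- S))) = length (filter p w)"
        using length_filter_nths_compl[of p w S] assms[OF that] by simp
      thus ?thesis by (simp add: dL_def divide_inverse del: filter.simps)
    qed (simp add: coord_fun_def)
  qed
  hence "subst_op V X \<rho> \<kappa> (\<lambda>w. f w / of_nat (length (filter p w))) w
     = lfsum X (\<lambda>x. inverse (of_nat (length (filter p w))) * (\<kappa> x * fmul V (coord_fun x) (dL (\<rho> x) f) w))"
    unfolding subst_op_def by (intro lfsum_cong) simp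
  thus ?thesis by (simp add: lfsum_cmult subst_op_def divide_inverse mult.commute)
qed

lemma is_function_scale:
  assumes f: "is_function V B f" and c: "\<And>u v. mset u = mset v \<Longrightarrow> c u = c v"
  shows "is_function V B (\<lambda>w. c w * f w)"
proof -
  have "fam V B {()} (\<lambda>_ w. c w * f w)"
  proof (rule fam_subset[where f = "\<lambda>_. f" and I = "{()}"])
    show "gsym V (\<lambda>w. c w * f w)"
    proof (rule gsymI)
      fix u x y w
      have "c (u @ x # y # w) = c (u @ y # x # w)" by (rule c) simp
      thus "c (u @ x # y # w) * f (u @ x # y # w) = ksign (cdeg V x) (cdeg V y) * (c (u @ y # x # w) * f (u @ y # x # w))"
        using gsymD[OF is_function_gsym[OF f], of u x y w] by simp
    qed
  qed (use f in \<open>auto simp: fam_singleton\<close>)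
  thus ?thesis by (simp add: fam_singleton)
qed

text \<open>All clauses of \<open>is_function\<close> compare words of one length only; this carries
  them over to a limit taken order by order.\<close>

lemma is_function_locally:
  fixes f :: "('v, 'k::field_char_0) series"
  assumes "\<And>n. \<exists>g. is_function V B g \<and> (\<forall>w. length w = n \<longrightarrow> f w = g w)"
  shows "is_function V B f"
proof -
  obtain g where g: "\<And>n. is_function V B (g n)" "\<And>w. f w = g (length w) w" using assms by metis
  have "fam V B {()} (\<lambda>_. f)"
  proof (rule famI)
    show "gsym V f"
    proof (rule gsymI)
      fix u x y w
      show "f (u @ x # y # w) = ksign (cdeg V x) (cdeg V y) * f (u @ y # x # w)"
        using gsymD[OF is_function_gsym[OF g(1)], of "length (u @ x # y # w)" u x y w] by (simp add: g(2))
    qed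
    fix w show "\<not> set w \<subseteq> coords B \<Longrightarrow> f w = 0" using is_function_outside[OF g(1)] by (simp add: g(2))
  next
    fix as :: "'v list" and m
    have "fam V B {()} (\<lambda>_. g (length as + m))" using g(1) by (simp add: fam_singleton)
    from fam_normal_finite[OF this, of m as]
    show "finite {(i, bs). i \<in> {()} \<and> length bs = m \<and> f (map Tc as @ map Chi bs) \<noteq> 0}"
      by (rule finite_subset[rotated]) (auto simp: g(2))
  qed
  thus ?thesis by (simp add: fam_singleton)
qed


section \<open>The quadratic part in an adapted basis\<close>

text \<open>\<open>B\<close> is the disjoint union of \<open>W\<close>, \<open>\<delta> ` W\<close> and a rest; the differential maps \<open>a \<in> W\<close> to \<open>\<delta> a\<close> and all
  other basis elements to zero.\<close>

locale splitting =
  fixes V :: "int \<Rightarrow> 'v set" and B :: "'v set" and W :: "'v set" and \<delta> :: "'v \<Rightarrow> 'v"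
    and \<Gamma> :: "('v, 'k::field_char_0) series"
  assumes W: "W \<subseteq> B" "\<delta> ` W \<subseteq> B" "W \<inter> \<delta> ` W = {}" "inj_on \<delta> W"
    and deg: "\<And>a. a \<in> W \<Longrightarrow> vdeg V (\<delta> a) = vdeg V a + 1"
    and \<Gamma>: "is_function V B \<Gamma>" "has_degree V 2 \<Gamma>" "vanishes_on_L \<Gamma>" "vanishes_on_PiL \<Gamma>"
      "bracket V B \<Gamma> \<Gamma> = (\<lambda>w. 0)"
    and \<Gamma>_quadratic: "\<And>a b. a \<in> B \<Longrightarrow> b \<in> B \<Longrightarrow> \<Gamma> [Tc a, Chi b] = (if a \<in> W \<and> b = \<delta> a then 1 else 0)"
begin

definition \<delta>' where "\<delta>' = inv_into W \<delta>"

lemma \<delta>': "a \<in> W \<Longrightarrow> \<delta>' (\<delta> a) = a" "b \<in> \<delta> ` W \<Longrightarrow> \<delta>' b \<in> W \<and> \<delta> (\<delta>' b) = b"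
  using W(4) by (auto simp: \<delta>'_def)

text \<open>The quadratic part of \<Gamma> in the adapted basis; the second clause is forced by
  graded symmetry.\<close>

definition quad :: "('v, 'k) series" where
  "quad w = (case w of [Tc a, Chi b] \<Rightarrow> if a \<in> W \<and> b = \<delta> a then 1 else 0
     | [Chi b, Tc a] \<Rightarrow> if a \<in> W \<and> b = \<delta> a then ksign (cdeg V (Chi b)) (cdeg V (Tc a)) else 0 | _ \<Rightarrow> 0)"

text \<open>The bracket with \<open>quad\<close> sends the coordinate t of \<open>\<delta> a\<close>
  to that of \<open>a\<close>, and \<chi> of \<open>a\<close> to that of \<open>\<delta> a\<close>,
  up to sign. \<open>X\<close> contains the coordinates that appear, \<open>X'\<close> those that
  are replaced.\<close>

definition "X = Tc ` W \<union> Chi ` \<delta> ` W"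
definition "X' = Tc ` \<delta> ` W \<union> Chi ` W"

fun \<rho> where "\<rho> (Tc a) = Tc (\<delta> a)" | "\<rho> (Chi b) = Chi (\<delta>' b)"
fun \<rho>' where "\<rho>' (Tc b) = Tc (\<delta>' b)" | "\<rho>' (Chi a) = Chi (\<delta> a)"
text \<open>Signs dictated by \<open>bracket_quad\<close>. They are their own inverses, so the
  homotopy uses the same ones.\<close>

fun \<kappa> :: "'v coord \<Rightarrow> 'k" where "\<kappa> (Tc a) = - 1" | "\<kappa> (Chi b) = ksign (cdeg V (Chi b)) (cdeg V (Tc (\<delta>' b)))"

abbreviation "D \<equiv> subst_op V X \<rho> \<kappa>"
abbreviation "hom \<equiv> subst_op V X' \<rho>' (\<lambda>y. \<kappa> (\<rho>' y))"
abbreviation "cont x \<equiv> x \<in> X \<union> X'"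
abbreviation "N w \<equiv> length (filter cont w)"

lemma WB: "a \<in> W \<Longrightarrow> a \<in> B" "a \<in> W \<Longrightarrow> \<delta> a \<in> B"
  using W by auto

lemma X_coords: "X \<subseteq> coords B" "X' \<subseteq> coords B"
  using W by (auto simp: X_def X'_def)

lemma \<rho>: "x \<in> X \<Longrightarrow> \<rho> x \<in> X' \<and> \<rho>' (\<rho> x) = x" "y \<in> X' \<Longrightarrow> \<rho>' y \<in> X \<and> \<rho> (\<rho>' y) = y"
  using \<delta>' by (auto simp: X_def X'_def)

lemma homotopy: "gsym V (f :: ('v, 'k) series) \<Longrightarrow> D (hom f) w + hom (D f) w = of_nat (N w) * f w"
proof (rule subst_op_homotopy)
  show "X \<inter> X' = {}" using W by (auto simp: X_def X'_def)
  show "odd (cdeg V (\<rho> x) - cdeg V x)" if "x \<in> X" for x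
    using that deg \<delta>' by (auto simp: X_def)
  show "\<kappa> x * \<kappa> x = 1" for x by (cases x) auto
qed (use \<rho> in auto)

lemma quad_nonzero: "quad w \<noteq> 0 \<Longrightarrow> \<exists>a\<in>W. w = [Tc a, Chi (\<delta> a)] \<or> w = [Chi (\<delta> a), Tc a]"
  by (auto simp: quad_def split: list.splits coord.splits if_splits)

lemma quad_simps: "quad [Tc a, Chi b] = (if a \<in> W \<and> b = \<delta> a then 1 else 0)"
  "quad [Chi b, Tc a] = (if a \<in> W \<and> b = \<delta> a then ksign (cdeg V (Chi b)) (cdeg V (Tc a)) else 0)"
  "quad [Tc a, Tc b] = 0" "quad [Chi a, Chi b] = 0"
  by (simp_all add: quad_def)

lemma is_function_quad: "is_function V B quad"
proof -
  have "fam V B {()} (\<lambda>_. quad :: ('v, 'k) series)"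
  proof (rule famI)
    fix as m
    have "{(i, bs). i \<in> {()} \<and> length bs = m \<and> (quad (map Tc as @ map Chi bs) :: 'k) \<noteq> 0} \<subseteq> {((), [\<delta> (hd as)])}"
      by (auto dest!: quad_nonzero simp: append_eq_Cons_conv Cons_eq_append_conv)
    thus "finite {(i, bs). i \<in> {()} \<and> length bs = m \<and> (quad (map Tc as @ map Chi bs) :: 'k) \<noteq> 0}"
      by (rule finite_subset) simp
  next
    show "gsym V (quad :: ('v, 'k) series)"
    proof (rule gsymI)
      fix u x y w
      show "(quad (u @ x # y # w) :: 'k) = ksign (cdeg V x) (cdeg V y) * quad (u @ y # x # w)"
      proof (cases "length (u @ w) = 0")
        case True
        thus ?thesis by (cases x; cases y) (auto simp: quad_simps ksign_commute)
      next
        case False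
        hence "quad (u @ x # y # w) = (0 :: 'k)" "quad (u @ y # x # w) = (0 :: 'k)"
          using quad_nonzero[of "u @ x # y # w"] quad_nonzero[of "u @ y # x # w"] by (auto simp: append_eq_Cons_conv)
        thus ?thesis by simp
      qed
    qed
    fix w assume "\<not> set w \<subseteq> coords B"
    thus "quad w = 0" using WB by (intro ccontr[of "quad w = 0"]) (auto dest!: quad_nonzero)
  qed
  thus ?thesis by (simp add: fam_singleton)
qed

lemma quad_degree: "has_degree V 2 quad"
  by (rule has_degreeI) (use deg in \<open>auto dest!: quad_nonzero\<close>)

lemma quad_length: "length w \<noteq> 2 \<Longrightarrow> quad w = 0"
  by (rule ccontr, drule quad_nonzero) auto

lemma quad_vanishes: "vanishes_on_L quad" "vanishes_on_PiL quad"
proof -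
  have "quad (map Chi bs) = 0" "quad (map Tc bs) = 0" for bs
    by (rule ccontr, drule quad_nonzero, force simp: map_eq_Cons_conv)+
  thus "vanishes_on_L quad" "vanishes_on_PiL quad" by (simp_all add: vanishes_on_L_def vanishes_on_PiL_def)
qed

lemma bracket_quad: "bracket V B quad f = D f"
proof
  fix w
  let ?c = "\<lambda>x. fmul V (coord_fun x)"
  have R1: "dR (Chi b) quad = (if b \<in> \<delta> ` W then coord_fun (Tc (\<delta>' b)) else (\<lambda>w. 0))" for b
  proof
    fix w show "dR (Chi b) quad w = (if b \<in> \<delta> ` W then coord_fun (Tc (\<delta>' b)) else (\<lambda>w. 0)) w"
    proof (cases "\<exists>a. w = [Tc a]")
      case True
      then obtain a where "w = [Tc a]" by blast
      thus ?thesis using \<delta>' by (auto simp: dR_def quad_simps coord_fun_def)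
    next
      case False
      thus ?thesis using quad_nonzero[of "w @ [Chi b]"] by (auto simp: dR_def coord_fun_def append_eq_Cons_conv)
    qed
  qed
  have R2: "dR (Tc a) quad = (if a \<in> W then (\<lambda>w. ksign (cdeg V (Chi (\<delta> a))) (cdeg V (Tc a)) * coord_fun (Chi (\<delta> a)) w) else (\<lambda>w. 0))" for a
  proof
    fix w show "dR (Tc a) quad w = (if a \<in> W then (\<lambda>w. ksign (cdeg V (Chi (\<delta> a))) (cdeg V (Tc a)) * coord_fun (Chi (\<delta> a)) w) else (\<lambda>w. 0)) w"
    proof (cases "\<exists>b. w = [Chi b]")
      case True
      then obtain b where "w = [Chi b]" by blast
      thus ?thesis by (auto simp: dR_def quad_simps coord_fun_def)
    next
      case False
      thus ?thesis using quad_nonzero[of "w @ [Tc a]"] by (auto simp: dR_def coord_fun_def append_eq_Cons_conv)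
    qed
  qed
  let ?h1 = "\<lambda>a. ksign (cdeg V (Chi (\<delta> a))) (cdeg V (Tc a)) * ?c (Chi (\<delta> a)) (dL (Chi a) f) w"
  let ?h2 = "\<lambda>b. ?c (Tc (\<delta>' b)) (dL (Tc b) f) w"
  have f1: "finite {a \<in> W. ?h1 a \<noteq> 0}"
  proof (rule finite_subset)
    show "{a \<in> W. ?h1 a \<noteq> 0} \<subseteq> (\<lambda>x. case x of Chi b \<Rightarrow> \<delta>' b | Tc a \<Rightarrow> a) ` set w"
    proof clarify
      fix a assume a: "a \<in> W" "?h1 a \<noteq> 0"
      hence "Chi (\<delta> a) \<in> set w" using fmul_coord_outside by force
      thus "a \<in> (\<lambda>x. case x of Chi b \<Rightarrow> \<delta>' b | Tc a \<Rightarrow> a) ` set w"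
        using \<delta>'(1)[OF a(1)] by (intro rev_image_eqI[of "Chi (\<delta> a)"]) auto
    qed
  qed simp
  have f2: "finite {b \<in> \<delta> ` W. ?h2 b \<noteq> 0}"
  proof (rule finite_subset)
    show "{b \<in> \<delta> ` W. ?h2 b \<noteq> 0} \<subseteq> (\<lambda>x. case x of Tc a \<Rightarrow> \<delta> a | Chi a \<Rightarrow> a) ` set w"
    proof clarify
      fix a assume a: "a \<in> W" "?h2 (\<delta> a) \<noteq> 0"
      hence "Tc a \<in> set w" using fmul_coord_outside[of "Tc a" w] \<delta>'(1)[OF a(1)] by force
      thus "\<delta> a \<in> (\<lambda>x. case x of Tc a \<Rightarrow> \<delta> a | Chi a \<Rightarrow> a) ` set w"
        by (intro rev_image_eqI[of "Tc a"]) auto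
    qed
  qed simp
  have "bracket V B quad f w = lfsum B (\<lambda>b. (if b \<in> W then ?h1 b else 0) - (if b \<in> \<delta> ` W then ?h2 b else 0))"
    unfolding bracket_def R1 R2 by (rule lfsum_cong) (simp add: fmul_mult_left)
  also have "\<dots> = lfsum B (\<lambda>b. if b \<in> W then ?h1 b else 0) - lfsum B (\<lambda>b. if b \<in> \<delta> ` W then ?h2 b else 0)"
    by (rule lfsum_diff; rule finite_subset[OF _ f1] finite_subset[OF _ f2]; auto split: if_splits)
  also have "lfsum B (\<lambda>b. if b \<in> W then ?h1 b else 0) = lfsum W ?h1"
    by (subst lfsum_superset[OF W(1)]) (auto intro: lfsum_cong)
  also have "lfsum B (\<lambda>b. if b \<in> \<delta> ` W then ?h2 b else 0) = lfsum (\<delta> ` W) ?h2"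
    by (subst lfsum_superset[OF W(2)]) (auto intro: lfsum_cong)
  also have "lfsum (\<delta> ` W) ?h2 = - lfsum (Tc ` W) (\<lambda>x. \<kappa> x * ?c x (dL (\<rho> x) f) w)"
    by (simp add: lfsum_reindex W inj_on_def[of Tc] lfsum_uminus[symmetric] \<delta>'(1) cong: lfsum_cong)
  also have "lfsum W ?h1 = lfsum (Chi ` \<delta> ` W) (\<lambda>x. \<kappa> x * ?c x (dL (\<rho> x) f) w)"
    by (simp add: lfsum_reindex W inj_on_def[of Chi] \<delta>'(1) cong: lfsum_cong)
  also have "lfsum (Chi ` \<delta> ` W) (\<lambda>x. \<kappa> x * ?c x (dL (\<rho> x) f) w) - - lfsum (Tc ` W) (\<lambda>x. \<kappa> x * ?c x (dL (\<rho> x) f) w)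
     = D f w"
    unfolding subst_op_def X_def using finite_subst_op
    by (subst lfsum_Un) (auto simp: add.commute)
  finally show "bracket V B quad f w = D f w" .
qed

lemma is_function_hom: "is_function V B f \<Longrightarrow> is_function V B (hom f)"
proof (rule is_function_subst_op)
  show "inj_on \<rho>' X'" using \<rho> by (metis inj_onI)
qed (use X_coords W \<delta>' in \<open>auto simp: X'_def\<close>)

text \<open>The homotopy exchanges a letter for one of the same type and of degree one lower.
  Applied to a function of degree 2 it therefore yields an admissible contribution to the
  Hamiltonian.\<close>

lemma hom_properties:
  shows "has_degree V p f \<Longrightarrow> has_degree V (p - 1) (hom f)"
    "vanishes_on_L f \<Longrightarrow> vanishes_on_L (hom f)"
    "vanishes_on_PiL f \<Longrightarrow> vanishes_on_PiL (hom f)"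
    "starts n f \<Longrightarrow> starts n (hom f)"
proof -
  have *: "\<exists>x\<in>X'. \<exists>v. w \<in> shuffles [x] v \<and> f (\<rho>' x # v) \<noteq> 0" if "hom f w \<noteq> 0" for w and f :: "('v, 'k) series"
    using subst_op_support[OF that] .
  show "has_degree V (p - 1) (hom f)" if f: "has_degree V p f"
  proof (rule has_degreeI)
    fix w assume "hom f w \<noteq> 0"
    then obtain x v where x: "x \<in> X'" "w \<in> shuffles [x] v" "f (\<rho>' x # v) \<noteq> 0" using * by blast
    have "mset w = mset (x # v)" using mset_shuffles[OF x(2)] by simp
    hence "wdeg V w = cdeg V x + wdeg V v" unfolding wdeg_def by (metis list.simps(9) mset_map sum_list.Cons sum_mset_sum_list)
    moreover have "cdeg V (\<rho>' x) + wdeg V v = p" using has_degreeD[OF f x(3)] by simp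
    moreover have "cdeg V (\<rho>' x) = cdeg V x + 1" using x(1) deg \<delta>' by (auto simp: X'_def)
    ultimately show "wdeg V w = p - 1" by simp
  qed
  show "vanishes_on_L (hom f)" if f: "vanishes_on_L f"
    unfolding vanishes_on_L_def
  proof (rule allI, rule ccontr)
    fix bs assume "hom f (map Chi bs) \<noteq> 0"
    then obtain x v where x: "map Chi bs \<in> shuffles [x] v" "f (\<rho>' x # v) \<noteq> 0" using * by blast
    obtain us vs where us: "[x] = map Chi us" "v = map Chi vs" using map_shuffles_cases[OF x(1)] by (elim exE conjE) (rule that)
    hence "\<rho>' x # v = map Chi (\<delta> (hd us) # vs)" by auto
    thus False using f x(2) unfolding vanishes_on_L_def by metis
  qed
  show "vanishes_on_PiL (hom f)" if f: "vanishes_on_PiL f"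
    unfolding vanishes_on_PiL_def
  proof (rule allI, rule ccontr)
    fix bs assume "hom f (map Tc bs) \<noteq> 0"
    then obtain x v where x: "map Tc bs \<in> shuffles [x] v" "f (\<rho>' x # v) \<noteq> 0" using * by blast
    obtain us vs where us: "[x] = map Tc us" "v = map Tc vs" using map_shuffles_cases[OF x(1)] by (elim exE conjE) (rule that)
    hence "\<rho>' x # v = map Tc (\<delta>' (hd us) # vs)" by auto
    thus False using f x(2) unfolding vanishes_on_PiL_def by metis
  qed
  show "starts n (hom f)" if f: "starts n f"
    unfolding starts_def
  proof (intro allI impI, rule ccontr)
    fix w assume w: "length w < n" "hom f w \<noteq> 0"
    then obtain x v where x: "w \<in> shuffles [x] v" "f (\<rho>' x # v) \<noteq> 0" using * by blast
    thus False using f w(1) length_shuffles[OF x(1)] by (simp add: starts_def)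
  qed
qed

end


section \<open>Normal form, order by order\<close>

lemma starts_mono: "starts p f \<Longrightarrow> q \<le> p \<Longrightarrow> starts q f"
  by (auto simp: starts_def)

lemma starts_3_2: "starts 3 f \<Longrightarrow> starts 2 f"
  by (simp add: starts_def)

lemma starts_add:
  fixes f g :: "('v, 'k::field_char_0) series"
  shows "starts p f \<Longrightarrow> starts p g \<Longrightarrow> starts p (\<lambda>w. f w + g w)"
  by (auto simp: starts_def)

text \<open>Without constant and linear terms, both words entering a coefficient of order n have
  length at most n: a longer one would be paired with a single letter.\<close>

lemma agree_bracket:
  assumes "agree n f f'" "agree n g g'" "starts 2 f" "starts 2 f'" "starts 2 g" "starts 2 g'"
  shows "agree n (bracket V B f g) (bracket V B f' g')"
  unfolding agree_def
proof (intro allI impI, rule bracket_cong)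
  fix w z and u v :: "'a coord list" assume w: "length w \<le> n" "length u + length v = length w"
  show "f (u @ [z]) * g (dual z # v) = f' (u @ [z]) * g' (dual z # v)"
  proof (cases "u = [] \<or> v = []")
    case True
    thus ?thesis using assms(3-6) by (auto simp: starts_def)
  next
    case False
    hence "length (u @ [z]) \<le> n" "length (dual z # v) \<le> n"
      using w by (auto simp: Suc_le_eq neq_Nil_conv)
    thus ?thesis using assms(1,2) by (simp add: agree_def)
  qed
qed

lemma starts_hamiltonian_bracket:
  assumes "starts 3 S" "starts p f"
  shows "starts (Suc p) (bracket V B S f)"
  by (rule starts_bracket[OF assms]) simp

lemma agree_expad:
  assumes S: "hamiltonian V B S" and S': "hamiltonian V B S'" and "agree n S S'"
    and f: "agree n f f'" "starts 2 f" "starts 2 f'"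
  shows "agree n (expad V B S f) (expad V B S' f')"
proof -
  have s3: "starts 3 S" "starts 3 S'" using S S' by (auto simp: hamiltonian_def)
  have "agree n (dpow V B S k f) (dpow V B S' k f')" for k
  proof (induction k)
    case (Suc k)
    have "starts 2 (dpow V B S k f)" "starts 2 (dpow V B S' k f')"
      using starts_mono[OF dpow_properties(4)[OF S f(2)]] starts_mono[OF dpow_properties(4)[OF S' f(3)]] by auto
    hence "agree n (bracket V B S (dpow V B S k f)) (bracket V B S' (dpow V B S' k f'))"
      using s3 assms(3) Suc by (intro agree_bracket) (auto intro: starts_mono)
    thus ?case by (simp add: agree_def dpow_Suc)
  qed (use f in simp)
  thus ?thesis by (auto simp: agree_def expad_def)
qed

text \<open>Linearisation of the flow in its lowest affected order: changes of order n + 1 enter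
  through \<open>r\<close> and a single bracket with \<open>s\<close>. Every further bracket with an
  at least cubic function pushes them to higher order.\<close>

lemma expad_perturb:
  fixes S s f r :: "('v, 'k::field_char_0) series"
  assumes S: "hamiltonian V B S" and T: "hamiltonian V B (\<lambda>w. S w + s w)"
    and s: "is_function V B s" "starts (Suc n) s" and n: "2 \<le> n"
    and f: "is_function V B f" "starts 2 f" and r: "is_function V B r" "starts (Suc n) r"
    and w: "length w \<le> Suc n"
  shows "expad V B (\<lambda>w. S w + s w) (\<lambda>w. f w + r w) w = expad V B S f w + r w + bracket V B s f w"
proof -
  let ?T = "\<lambda>w. S w + s w" and ?f = "\<lambda>w. f w + r w"
  have S3: "starts 3 S" "starts 3 ?T" "is_function V B S" "is_function V B ?T"
    using S T by (auto simp: hamiltonian_def)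
  have fS: "is_function V B (dpow V B S k f)" for k by (rule is_function_dpow[OF S3(3) f(1)])
  have add: "bracket V B ?T g w = bracket V B S g w + bracket V B s g w" if "is_function V B g" for g w
    by (rule bracket_add_left[OF S3(3) s(1) that])
  \<comment> \<open>The correction to the power \<open>Suc k\<close> up to order
    \<open>Suc n\<close>; only the first power receives one.\<close>
  define b where "b k = (\<lambda>w. if k = 0 then bracket V B s f w else 0)" for k :: nat
  have bs: "starts (Suc n) (bracket V B s f)" by (rule starts_bracket[OF s(2) f(2)]) simp
  have b: "is_function V B (b k)" "starts (Suc n) (b k)" for k
    using bs is_function_bracket[OF s(1) f(1)] by (cases "k = 0"; simp add: b_def is_function_zero starts_def)+
  have "agree (Suc n) (dpow V B ?T (Suc k) ?f) (\<lambda>w. dpow V B S (Suc k) f w + b k w)" for k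
  proof (induction k)
    case 0
    have "starts (Suc (Suc n)) (bracket V B S r)" by (rule starts_hamiltonian_bracket[OF S3(1) r(2)])
    moreover have "starts (Suc (Suc n)) (bracket V B s r)" by (rule starts_bracket[OF s(2) r(2)]) (use n in simp)
    ultimately show ?case
      using f r s S3 by (auto simp: agree_def dpow_Suc b_def bracket_add_right add starts_def)
  next
    case (Suc k)
    have "agree (Suc n) (bracket V B ?T (dpow V B ?T (Suc k) ?f)) (bracket V B ?T (\<lambda>w. dpow V B S (Suc k) f w + b k w))"
      by (rule agree_bracket_right[OF S3(2) Suc])
    moreover have "bracket V B ?T (\<lambda>w. dpow V B S (Suc k) f w + b k w) v = bracket V B S (dpow V B S (Suc k) f) v"
      if v: "length v \<le> Suc n" for v
    proof -
      have "starts (Suc (Suc n)) (bracket V B ?T (b k))"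
        by (rule starts_hamiltonian_bracket[OF S3(2) b(2)])
      moreover have "starts (Suc (Suc n)) (bracket V B s (dpow V B S (Suc k) f))"
        by (rule starts_bracket[OF s(2) dpow_properties(4)[OF S f(2)]]) simp
      ultimately show ?thesis using v
        by (simp add: bracket_add_right[OF S3(4) fS b(1)] add[OF fS] starts_def del: bracket_dpow)
    qed
    ultimately show ?case
      unfolding dpow_Suc[of _ _ _ "Suc k"] by (simp add: agree_def b_def del: of_nat_Suc)
  qed
  hence D: "dpow V B ?T (Suc k) ?f w = dpow V B S (Suc k) f w + b k w" for k
    using w by (simp add: agree_def)
  have "expad V B ?T ?f w = (\<Sum>k\<le>Suc n. dpow V B ?T k ?f w)" by (rule expad_eq[OF T w])
  also have "\<dots> = ?f w + (\<Sum>k\<le>n. dpow V B ?T (Suc k) ?f w)" by (simp add: sum.atMost_Suc_shift del: sum.atMost_Suc)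
  also have "\<dots> = (f w + (\<Sum>k\<le>n. dpow V B S (Suc k) f w)) + r w + (\<Sum>k\<le>n. b k w)"
    by (simp add: D sum.distrib)
  also have "f w + (\<Sum>k\<le>n. dpow V B S (Suc k) f w) = (\<Sum>k\<le>Suc n. dpow V B S k f w)"
    by (simp add: sum.atMost_Suc_shift del: sum.atMost_Suc)
  also have "\<dots> = expad V B S f w" by (rule expad_eq[OF S w, symmetric])
  also have "(\<Sum>k\<le>n. b k w) = bracket V B s f w" by (simp add: b_def)
  finally show ?thesis .
qed

lemma has_degree_add: "has_degree V p f \<Longrightarrow> has_degree V p g \<Longrightarrow> has_degree V p (\<lambda>w. f w + g w)"
  unfolding has_degree_def by (metis add.right_neutral)

lemma vanishes_add:
  "vanishes_on_L f \<Longrightarrow> vanishes_on_L g \<Longrightarrow> vanishes_on_L (\<lambda>w. f w + g w)"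
  "vanishes_on_PiL f \<Longrightarrow> vanishes_on_PiL g \<Longrightarrow> vanishes_on_PiL (\<lambda>w. f w + g w)"
  by (auto simp: vanishes_on_L_def vanishes_on_PiL_def)

lemma expad_start:
  assumes "hamiltonian V B S" "starts p f" "length w \<le> p"
  shows "expad V B S f w = f w"
proof -
  have "dpow V B S n f w = 0" if "n \<noteq> 0" for n
    using dpow_properties(4)[OF assms(1,2), of n] assms(3) that by (simp add: starts_def)
  hence "expad V B S f w = (\<Sum>n\<le>length w. if n = 0 then f w else 0)"
    unfolding expad_def by (intro sum.cong) auto
  thus ?thesis by simp
qed

context splitting
begin

text \<open>These are the candidates for the minimal structure, without the master equation, which
  is derived once the normal form is complete.\<close>

definition remainder :: "('v, 'k) series \<Rightarrow> bool" where
  "remainder \<gamma> \<longleftrightarrow> is_function V B \<gamma> \<and> has_degree V 2 \<gamma> \<and> starts 3 \<gamma> \<and>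
     vanishes_on_L \<gamma> \<and> vanishes_on_PiL \<gamma> \<and> (\<forall>w. \<gamma> w \<noteq> 0 \<longrightarrow> filter cont w = [])"

lemma \<Gamma>_short: "length w \<le> 2 \<Longrightarrow> \<Gamma> w = quad w"
proof -
  assume w: "length w \<le> 2"
  have L: "\<Gamma> (map Chi bs) = 0" "\<Gamma> (map Tc bs) = 0" for bs
    using \<Gamma> by (auto simp: vanishes_on_L_def vanishes_on_PiL_def)
  have Q: "\<Gamma> [Tc a, Chi b] = quad [Tc a, Chi b]" for a b
  proof (cases "a \<in> B \<and> b \<in> B")
    case False
    hence "\<Gamma> [Tc a, Chi b] = 0" by (intro is_function_outside[OF \<Gamma>(1)]) auto
    thus ?thesis using False WB by (auto simp: quad_simps)
  qed (simp add: quad_simps \<Gamma>_quadratic)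
  have G: "\<Gamma> [Chi b, Tc a] = ksign (cdeg V (Chi b)) (cdeg V (Tc a)) * \<Gamma> [Tc a, Chi b]" for a b
    using gsymD[OF is_function_gsym[OF \<Gamma>(1)], of "[]" "Chi b" "Tc a" "[]"] by simp
  consider "w = []" | x where "w = [x]" | x y where "w = [x, y]"
    using w by (cases w rule: remdups_adj.cases) auto
  thus ?thesis
  proof cases
    case 1
    thus ?thesis using L(1)[of "[]"] quad_length[of "[]"] by simp
  next
    case 2
    thus ?thesis using L(1)[of "[a]" for a] L(2)[of "[a]" for a] quad_length[of w] by (cases x) auto
  next
    case (3 x y)
    thus ?thesis using L(1)[of "[a, b]" for a b] L(2)[of "[a, b]" for a b]
      by (cases x; cases y) (auto simp: quad_simps Q G)
  qed
qed

lemma starts_quad: "starts 2 quad"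
  by (auto simp: starts_def intro: quad_length)

lemma starts_\<Gamma>: "starts 2 \<Gamma>"
  unfolding starts_def using \<Gamma>_short quad_length by simp

text \<open>The bracket of quadratic functions is quadratic, and in order two it is the bracket of
  \<Gamma> with itself.\<close>

lemma bracket_quad_quad: "bracket V B quad quad w = 0"
proof (cases "length w = 2")
  case True
  have "agree 2 (bracket V B quad quad) (bracket V B \<Gamma> \<Gamma>)"
    by (intro agree_bracket starts_quad starts_\<Gamma>) (auto simp: agree_def \<Gamma>_short)
  thus ?thesis using True by (simp add: agree_def \<Gamma>(5))
next
  case False
  have "bracket V B quad quad w = bracket V B (\<lambda>_. 0) quad w"
  proof (rule bracket_cong)
    fix z and u v :: "'v coord list" assume "length u + length v = length w"
    hence "length (u @ [z]) \<noteq> 2 \<or> length (dual z # v) \<noteq> 2" using False by auto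
    thus "quad (u @ [z]) * quad (dual z # v) = 0 * quad (dual z # v)"
      using quad_length[of "u @ [z]"] quad_length[of "dual z # v"] by auto
  qed
  thus ?thesis by simp
qed

text \<open>\<open>D\<close> differentiates only by contractible coordinates, on which \<gamma> does
  not depend.\<close>

lemma bracket_quad_remainder:
  assumes "remainder \<gamma>"
  shows "bracket V B quad \<gamma> w = 0" "bracket V B \<gamma> quad w = 0"
proof -
  show 1: "bracket V B quad \<gamma> w = 0" for w
  proof (rule ccontr)
    assume "bracket V B quad \<gamma> w \<noteq> 0"
    then obtain x v where "x \<in> X" "\<gamma> (\<rho> x # v) \<noteq> 0"
      using subst_op_support[of V X \<rho> \<kappa> \<gamma> w] by (auto simp: bracket_quad)
    thus False using assms \<rho>(1)[of x] by (auto simp: remainder_def)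
  qed
  have "has_parity V 2 quad" "has_parity V 2 \<gamma>"
    using quad_degree assms by (auto simp: remainder_def has_degree_parity)
  thus "bracket V B \<gamma> quad w = 0"
    using bracket_commute[OF _ _ is_function_quad, of \<gamma> 2 2 w] 1 assms by (simp add: remainder_def)
qed

lemma bracket_remainder_support:
  assumes "remainder \<gamma>" "bracket V B \<gamma> \<gamma> w \<noteq> 0"
  shows "filter cont w = []"
proof -
  obtain z u v where *: "w \<in> shuffles u v" "\<gamma> (u @ [z]) \<noteq> 0" "\<gamma> (dual z # v) \<noteq> 0"
    using bracket_support[OF assms(2)] by blast
  hence "filter cont (u @ [z]) = []" "filter cont (dual z # v) = []"
    using assms(1) unfolding remainder_def by blast+
  hence "\<forall>x\<in>set u \<union> set v. \<not> cont x" by (auto simp: filter_empty_conv split: if_splits)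
  thus ?thesis using set_shuffles[OF *(1)] by (simp add: filter_empty_conv)
qed

definition approx :: "nat \<Rightarrow> ('v, 'k) series \<Rightarrow> ('v, 'k) series \<Rightarrow> bool" where
  "approx n S \<gamma> \<longleftrightarrow> hamiltonian V B S \<and> remainder \<gamma> \<and> agree n (expad V B S (\<lambda>w. quad w + \<gamma> w)) \<Gamma>"

lemma bracket_total:
  assumes "remainder \<gamma>"
  shows "bracket V B (\<lambda>w. quad w + \<gamma> w) (\<lambda>w. quad w + \<gamma> w) = bracket V B \<gamma> \<gamma>"
proof
  fix w
  have "is_function V B \<gamma>" using assms by (simp add: remainder_def)
  thus "bracket V B (\<lambda>w. quad w + \<gamma> w) (\<lambda>w. quad w + \<gamma> w) w = bracket V B \<gamma> \<gamma> w"
    by (simp add: bracket_add_left bracket_add_right is_function_add is_function_quad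
        bracket_quad_quad bracket_quad_remainder[OF assms])
qed

text \<open>The obstruction to extending an approximate normal form by one order is closed, by the master
  equation.\<close>

lemma obstruction_closed:
  assumes ap: "approx n S \<gamma>" and n: "2 \<le> n"
    and R: "R = (\<lambda>w. if length w = Suc n then \<Gamma> w - expad V B S (\<lambda>w. quad w + \<gamma> w) w else 0)"
    and fR: "is_function V B R" "has_degree V 2 R"
  shows "D R w = 0"
proof (cases "length w = Suc n \<and> filter cont w \<noteq> []")
  \<comment> \<open>\<open>D\<close> preserves lengths and leaves a letter of \<open>X\<close>
    behind, so only the words of the other case can have a nonzero coefficient.\<close>
  case False
  show ?thesis
  proof (rule ccontr)
    assume "D R w \<noteq> 0"
    then obtain x v where x: "x \<in> X" "w \<in> shuffles [x] v" "R (\<rho> x # v) \<noteq> 0" using subst_op_support by blast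
    hence "length v = n" unfolding R by (auto split: if_splits)
    moreover have "x \<in> set w" using set_shuffles[OF x(2)] by simp
    ultimately show False using False length_shuffles[OF x(2)] x(1) by (auto simp: filter_empty_conv)
  qed
next
  case True
  define Y where "Y = expad V B S (\<lambda>w. quad w + \<gamma> w)"
  define G where "G = bracket V B \<gamma> \<gamma>"
  have S: "hamiltonian V B S" and \<gamma>: "remainder \<gamma>" and agY: "agree n Y \<Gamma>"
    using ap by (auto simp: approx_def Y_def)
  have f\<gamma>: "is_function V B \<gamma>" "starts 3 \<gamma>" using \<gamma> by (auto simp: remainder_def)
  have f: "is_function V B (\<lambda>w. quad w + \<gamma> w)" "starts 2 (\<lambda>w. quad w + \<gamma> w)" "has_degree V 2 (\<lambda>w. quad w + \<gamma> w)"
    using \<gamma> by (auto simp: remainder_def intro: is_function_add is_function_quad starts_add starts_quad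
        starts_3_2 has_degree_add quad_degree)
  note hom = poisson_hom_expad[OF S, where 'i = unit]
  have Y: "is_function V B Y" "has_degree V 2 Y" "starts 2 Y"
    unfolding Y_def using poisson_hom_function[OF hom f(1)] poisson_hom_degree[OF hom f(1,3)] f(2) expad_start[OF S f(2)]
    by (auto simp: starts_def)
  have YY: "bracket V B Y Y = expad V B S G"
    unfolding Y_def G_def bracket_total[OF \<gamma>, symmetric] by (rule poisson_hom_bracket[OF hom f(1) f(1), symmetric])
  have fG: "is_function V B G" unfolding G_def by (rule is_function_bracket[OF f\<gamma>(1) f\<gamma>(1)])
  have "agree n (bracket V B Y Y) (bracket V B \<Gamma> \<Gamma>)"
    by (rule agree_bracket[OF agY agY Y(3) starts_\<Gamma> Y(3) starts_\<Gamma>])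
  hence "agree n (expad V B S G) (\<lambda>w. 0)" by (simp add: YY \<Gamma>(5))
  moreover have "starts 3 (\<lambda>w. - S w)" using S by (simp add: hamiltonian_def starts_def)
  \<comment> \<open>The flow is invertible and respects agreement up to order n, so \<open>G\<close>
    itself has no terms up to order n; its lowest part is then unaffected by the flow.\<close>
  ultimately have "agree n (expad V B (\<lambda>w. - S w) (expad V B S G)) (expad V B (\<lambda>w. - S w) (\<lambda>w. 0))"
    by (intro agree_expad_right)
  moreover have "expad V B (\<lambda>w. - S w) (\<lambda>w. 0) = (\<lambda>w. 0)"
    using poisson_hom_mult[OF poisson_hom_expad[OF hamiltonian_uminus[OF S]] f(1), of 0] by simp
  ultimately have "starts (Suc n) G"
    by (simp add: expad_uminus_expad[OF S fG] agree_def starts_def less_Suc_eq_le)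
  hence YG: "bracket V B Y Y w = G w" using True expad_start[OF S, of "Suc n" G w] by (simp add: YY)
  have Rs: "starts (Suc n) R" by (simp add: R starts_def)
  have agR: "agree (Suc n) \<Gamma> (\<lambda>w. Y w + R w)"
    using agY by (auto simp: agree_def R Y_def le_Suc_eq)
  have "agree (Suc n) (bracket V B \<Gamma> \<Gamma>) (bracket V B (\<lambda>w. Y w + R w) (\<lambda>w. Y w + R w))"
    using starts_add[OF Y(3) starts_mono[OF Rs]] n by (intro agree_bracket agR starts_\<Gamma>) auto
  hence "0 = bracket V B (\<lambda>w. Y w + R w) (\<lambda>w. Y w + R w) w"
    using True by (simp add: agree_def \<Gamma>(5))
  also have "\<dots> = bracket V B Y Y w + bracket V B R Y w + bracket V B Y R w + bracket V B R R w"
    using Y(1) fR(1) by (simp add: bracket_add_left bracket_add_right is_function_add)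
  also have "bracket V B R R w = 0"
    using starts_bracket[OF Rs Rs, of "Suc (Suc n)" V B] n True by (simp add: starts_def)
  also have "bracket V B R Y w = bracket V B Y R w"
    using bracket_commute[OF fR(1) _ Y(1), of 2 2 w] fR(2) Y(2) by (simp add: has_degree_parity)
  \<comment> \<open>\<open>R\<close> is homogeneous of order n + 1, so in this order it is paired
    with the quadratic part of \<open>Y\<close> only.\<close>
  also have "bracket V B Y R w = bracket V B quad R w"
  proof (rule bracket_cong)
    fix z and u v :: "'v coord list" assume uv: "length u + length v = length w"
    show "Y (u @ [z]) * R (dual z # v) = quad (u @ [z]) * R (dual z # v)"
    proof (cases "R (dual z # v) = 0")
      case False
      hence "length (u @ [z]) = 2" using uv True by (auto simp: R split: if_splits)
      thus ?thesis using agY n \<Gamma>_short[of "u @ [z]"] by (simp add: agree_def)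
    qed simp
  qed
  \<comment> \<open>Here the two contributions separate: \<open>G\<close> contains no contractible
    coordinate, whereas \<open>w\<close> does.\<close>
  also have "bracket V B Y Y w = 0"
    using YG bracket_remainder_support[OF \<gamma>, of w] True by (auto simp: G_def)
  finally have "2 * bracket V B quad R w = 0" by simp
  thus ?thesis by (simp add: bracket_quad)
qed

lemma approx_step:
  assumes ap: "approx n S \<gamma>" and n: "2 \<le> n"
  shows "\<exists>S' \<gamma>'. approx (Suc n) S' \<gamma>' \<and> agree n S S' \<and> agree n \<gamma> \<gamma>'"
proof -
  define Y where "Y = expad V B S (\<lambda>w. quad w + \<gamma> w)"
  define R where "R = (\<lambda>w. if length w = Suc n then \<Gamma> w - Y w else 0)"
  define r where "r = (\<lambda>w. if filter cont w = [] then R w else 0)"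
  \<comment> \<open>Where \<open>N w = 0\<close> the quotient is 0, so division also removes the
    part of \<open>R\<close> that is handed to \<open>r\<close>.\<close>
  define R' where "R' = (\<lambda>w. R w / of_nat (N w))"
  \<comment> \<open>The sign gives \<open>{s \<bullet> quad} = D (hom R')\<close>, since the bracket
    is antisymmetric in degrees 1 and 2.\<close>
  define s where "s = (\<lambda>w. - 1 * hom R' w)"
  have S: "hamiltonian V B S" and \<gamma>: "remainder \<gamma>" and agY: "agree n Y \<Gamma>"
    using ap by (auto simp: approx_def Y_def)
  have S': "is_function V B S" "has_degree V 1 S" "starts 3 S" "vanishes_on_L S" "vanishes_on_PiL S"
    using S by (auto simp: hamiltonian_def)
  have \<gamma>': "is_function V B \<gamma>" "has_degree V 2 \<gamma>" "starts 3 \<gamma>" "vanishes_on_L \<gamma>" "vanishes_on_PiL \<gamma>"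
    "\<And>w. \<gamma> w \<noteq> 0 \<Longrightarrow> filter cont w = []"
    using \<gamma> by (auto simp: remainder_def)
  let ?f = "\<lambda>w. quad w + \<gamma> w"
  have f: "is_function V B ?f" "starts 2 ?f" "has_degree V 2 ?f" "vanishes_on_L ?f" "vanishes_on_PiL ?f"
    using \<gamma>' by (auto intro: is_function_add is_function_quad starts_add starts_quad
        starts_3_2 has_degree_add quad_degree vanishes_add quad_vanishes)
  note hm = poisson_hom_expad[OF S, where 'i = unit]
  have Y: "is_function V B Y" "has_degree V 2 Y" "vanishes_on_L Y" "vanishes_on_PiL Y"
    unfolding Y_def using f poisson_hom_function[OF hm] poisson_hom_degree[OF hm] poisson_hom_L[OF hm] poisson_hom_PiL[OF hm]
    by auto
  have "is_function V B (\<lambda>w. \<Gamma> w + - 1 * Y w)"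
    by (intro is_function_add is_function_mult \<Gamma> Y)
  hence "is_function V B (\<lambda>w. (if length w = Suc n then 1 else 0) * (\<Gamma> w + - 1 * Y w))"
    by (rule is_function_scale) (auto dest: mset_eq_length)
  moreover have "(\<lambda>w. (if length w = Suc n then 1 else 0) * (\<Gamma> w + - 1 * Y w)) = R"
    by (auto simp: R_def)
  ultimately have R: "is_function V B R" by simp
  have R2: "has_degree V 2 R"
  proof (rule has_degreeI)
    fix w assume "R w \<noteq> 0"
    hence "\<Gamma> w \<noteq> 0 \<or> Y w \<noteq> 0" by (auto simp: R_def split: if_splits)
    thus "wdeg V w = 2" using has_degreeD[OF \<Gamma>(2)] has_degreeD[OF Y(2)] by blast
  qed
  have "vanishes_on_L R" "vanishes_on_PiL R" "starts (Suc n) R"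
    using \<Gamma> Y unfolding R_def vanishes_on_L_def vanishes_on_PiL_def starts_def by auto
  note R2 = R2 this
  have "is_function V B (\<lambda>w. (if filter cont w = [] then 1 else 0) * R w)"
    by (rule is_function_scale[OF R]) (metis filter_empty_conv set_mset_mset)
  moreover have "(\<lambda>w. (if filter cont w = [] then 1 else 0) * R w) = r" by (auto simp: r_def)
  ultimately have r: "is_function V B r" by simp
  have r2: "has_degree V 2 r" "vanishes_on_L r" "vanishes_on_PiL r" "starts (Suc n) r"
    using R2 unfolding r_def has_degree_def vanishes_on_L_def vanishes_on_PiL_def starts_def by auto
  have "is_function V B (\<lambda>w. inverse (of_nat (N w)) * R w)"
    by (rule is_function_scale[OF R]) (metis mset_filter size_mset)
  hence R': "is_function V B R'" by (simp add: R'_def divide_inverse mult.commute)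
  have R2': "has_degree V 2 R'" "vanishes_on_L R'" "vanishes_on_PiL R'" "starts (Suc n) R'"
    using R2 unfolding R'_def has_degree_def vanishes_on_L_def vanishes_on_PiL_def starts_def by auto
  have s: "is_function V B s" unfolding s_def by (intro is_function_mult is_function_hom R')
  have s2: "has_degree V 1 s" "vanishes_on_L s" "vanishes_on_PiL s" "starts (Suc n) s"
    using hom_properties(1)[OF R2'(1)] hom_properties(2)[OF R2'(2)] hom_properties(3)[OF R2'(3)] hom_properties(4)[OF R2'(4)]
    unfolding s_def has_degree_def vanishes_on_L_def vanishes_on_PiL_def starts_def by auto
  have DR: "D R v = 0" for v
    by (rule obstruction_closed[OF ap n R_def[unfolded Y_def] R R2(1)])
  have "D R' v = 0" for v
    using subst_op_count[of X cont \<rho> V \<kappa> R v] \<rho>(1) DR unfolding R'_def by auto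
  hence "D R' = (\<lambda>w. 0)" by auto
  hence Dh: "D (hom R') w = of_nat (N w) * R' w" for w
    using homotopy[OF is_function_gsym[OF R'], of w] by (simp add: subst_op_zero)
  \<comment> \<open>As \<open>D R'\<close> vanishes, the homotopy formula gives
    \<open>D (hom R') = N R'\<close>. This is \<open>R\<close> where \<open>N\<close> is nonzero and
    0 where \<open>r\<close> equals \<open>R\<close>.\<close>
  have split: "R w = r w + D (hom R') w" for w
    unfolding Dh by (auto simp: r_def R'_def)
  have T: "hamiltonian V B (\<lambda>w. S w + s w)"
    unfolding hamiltonian_def using S' s s2 starts_mono[OF s2(4), of 3] n
    by (auto intro: is_function_add has_degree_add vanishes_add starts_add)
  have "remainder (\<lambda>w. \<gamma> w + r w)"
    unfolding remainder_def using \<gamma>' r r2 starts_mono[OF r2(4), of 3] n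
    by (auto intro: is_function_add has_degree_add vanishes_add starts_add)
      (auto simp: r_def split: if_splits)
  moreover have "agree (Suc n) (expad V B (\<lambda>w. S w + s w) (\<lambda>w. quad w + (\<gamma> w + r w))) \<Gamma>"
    unfolding agree_def
  proof (intro allI impI)
    fix w :: "'v coord list" assume w: "length w \<le> Suc n"
    have "bracket V B s ?f w = bracket V B s quad w"
    proof -
      have "starts (Suc (Suc n)) (bracket V B s \<gamma>)"
        by (rule starts_bracket[OF s2(4) \<gamma>'(3)]) simp
      thus ?thesis using w by (simp add: bracket_add_right[OF s is_function_quad \<gamma>'(1)] starts_def)
    qed
    also have "\<dots> = - bracket V B quad s w"
      using bracket_commute[OF s _ is_function_quad, of 1 2 w] s2(1) quad_degree by (simp add: has_degree_parity)
    also have "bracket V B quad s w = - D (hom R') w"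
      unfolding s_def bracket_mult_right by (simp add: bracket_quad)
    finally have "bracket V B s ?f w = D (hom R') w" by simp
    hence "expad V B (\<lambda>w. S w + s w) (\<lambda>w. ?f w + r w) w = Y w + R w"
      unfolding Y_def using expad_perturb[OF S T s s2(4) n f(1,2) r r2(4) w] split[of w] by simp
    also have "\<dots> = \<Gamma> w" using w agY by (auto simp: R_def agree_def le_Suc_eq)
    finally show "expad V B (\<lambda>w. S w + s w) (\<lambda>w. quad w + (\<gamma> w + r w)) w = \<Gamma> w" by (simp add: add.assoc)
  qed
  ultimately have "approx (Suc n) (\<lambda>w. S w + s w) (\<lambda>w. \<gamma> w + r w)" using T by (simp add: approx_def)
  moreover have "agree n S (\<lambda>w. S w + s w)" "agree n \<gamma> (\<lambda>w. \<gamma> w + r w)"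
    using s2(4) r2(4) by (auto simp: agree_def starts_def)
  ultimately show ?thesis by blast
qed

lemma approx_base: "approx 2 (\<lambda>w. 0) (\<lambda>w. 0)"
proof -
  have z: "hamiltonian V B (\<lambda>w. 0)"
    by (simp add: hamiltonian_def is_function_zero has_degree_def starts_def vanishes_on_L_def vanishes_on_PiL_def)
  have "agree 2 (expad V B (\<lambda>w. 0) quad) \<Gamma>"
    using expad_start[OF z starts_quad] \<Gamma>_short by (auto simp: agree_def)
  thus ?thesis using z
    by (simp add: approx_def remainder_def is_function_zero has_degree_def starts_def vanishes_on_L_def vanishes_on_PiL_def)
qed

theorem normal_form: "\<exists>S \<gamma>. hamiltonian V B S \<and> remainder \<gamma> \<and> expad V B S (\<lambda>w. quad w + \<gamma> w) = \<Gamma>"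
proof -
  \<comment> \<open>The index is shifted by two because the quadratic part already provides
    agreement up to order 2.\<close>
  have "\<exists>F. \<forall>n. (\<lambda>n (S, \<gamma>). approx (n + 2) S \<gamma>) n (F n) \<and>
      (\<lambda>n (S, \<gamma>) (S', \<gamma>'). agree (n + 2) S S' \<and> agree (n + 2) \<gamma> \<gamma>') n (F n) (F (Suc n))"
  proof (rule dependent_nat_choice)
    show "\<exists>x. (\<lambda>(S, \<gamma>). approx (0 + 2) S \<gamma>) x"
      using approx_base by (intro exI[of _ "(\<lambda>w. 0, \<lambda>w. 0)"]) (simp add: numeral_2_eq_2)
    fix x n assume "(\<lambda>(S, \<gamma>). approx (n + 2) S \<gamma>) x"
    thus "\<exists>y. (\<lambda>(S, \<gamma>). approx (Suc n + 2) S \<gamma>) y \<and> (\<lambda>(S, \<gamma>) (S', \<gamma>'). agree (n + 2) S S' \<and> agree (n + 2) \<gamma> \<gamma>') x y"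
      using approx_step[of "n + 2" "fst x" "snd x"] by (auto simp: case_prod_beta)
  qed
  then obtain F where F: "\<And>n. approx (n + 2) (fst (F n)) (snd (F n))"
    "\<And>n. agree (n + 2) (fst (F n)) (fst (F (Suc n))) \<and> agree (n + 2) (snd (F n)) (snd (F (Suc n)))"
    by (auto simp: case_prod_beta)
  have chain: "agree (m + 2) (fst (F m)) (fst (F n)) \<and> agree (m + 2) (snd (F m)) (snd (F n))" if "m \<le> n" for m n
    using that
  proof (induction n rule: dec_induct)
    case (step n)
    thus ?case using F(2)[of n] by (auto simp: agree_def)
  qed (simp add: agree_def)
  \<comment> \<open>The coefficient at \<open>w\<close> no longer changes from the index
    \<open>length w\<close> on, so the limit can be read off there.\<close>
  define S where "S = (\<lambda>w. fst (F (length w)) w)"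
  define \<gamma> where "\<gamma> = (\<lambda>w. snd (F (length w)) w)"
  have agS: "agree n S (fst (F n))" "agree n \<gamma> (snd (F n))" for n
  proof -
    have "fst (F (length w)) w = fst (F n) w \<and> snd (F (length w)) w = snd (F n) w" if "length w \<le> n" for w :: "'v coord list"
      using chain[OF that] by (simp add: agree_def)
    thus "agree n S (fst (F n))" "agree n \<gamma> (snd (F n))" by (simp_all add: agree_def S_def \<gamma>_def)
  qed
  have h: "hamiltonian V B (fst (F n))" "remainder (snd (F n))" for n
    using F(1)[of n] by (auto simp: approx_def)
  have "is_function V B S"
  proof (rule is_function_locally)
    fix n
    show "\<exists>g. is_function V B g \<and> (\<forall>w. length w = n \<longrightarrow> S w = g w)"
      using h(1)[of n] by (intro exI[of _ "fst (F n)"]) (auto simp: hamiltonian_def S_def)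
  qed
  moreover have "has_degree V 1 S"
    using h(1) by (intro has_degreeI) (auto simp: hamiltonian_def S_def intro: has_degreeD)
  moreover have "starts 3 S" "vanishes_on_L S" "vanishes_on_PiL S"
    using h(1) by (simp_all add: hamiltonian_def S_def starts_def vanishes_on_L_def vanishes_on_PiL_def)
  ultimately have S: "hamiltonian V B S" by (simp add: hamiltonian_def)
  have "is_function V B \<gamma>"
  proof (rule is_function_locally)
    fix n
    show "\<exists>g. is_function V B g \<and> (\<forall>w. length w = n \<longrightarrow> \<gamma> w = g w)"
      using h(2)[of n] by (intro exI[of _ "snd (F n)"]) (auto simp: remainder_def \<gamma>_def)
  qed
  moreover have "has_degree V 2 \<gamma>"
    using h(2) by (intro has_degreeI) (auto simp: remainder_def \<gamma>_def intro: has_degreeD)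
  moreover have "starts 3 \<gamma>" "vanishes_on_L \<gamma>" "vanishes_on_PiL \<gamma>"
    using h(2) by (simp_all add: remainder_def \<gamma>_def starts_def vanishes_on_L_def vanishes_on_PiL_def)
  moreover have "filter cont w = []" if "\<gamma> w \<noteq> 0" for w
    using h(2)[of "length w"] that unfolding remainder_def \<gamma>_def by blast
  ultimately have \<gamma>: "remainder \<gamma>" unfolding remainder_def by blast
  have st: "starts 2 (\<lambda>w. quad w + \<gamma> w)" if "remainder \<gamma>" for \<gamma>
    using that starts_quad by (auto simp: remainder_def starts_def)
  have "expad V B S (\<lambda>w. quad w + \<gamma> w) w = \<Gamma> w" for w
  proof -
    let ?n = "length w"
    have "agree ?n (expad V B S (\<lambda>w. quad w + \<gamma> w)) (expad V B (fst (F ?n)) (\<lambda>w. quad w + snd (F ?n) w))"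
      by (rule agree_expad[OF S h(1) agS(1)]) (use agS(2)[of ?n] st \<gamma> h(2) in \<open>auto simp: agree_def\<close>)
    moreover have "agree (?n + 2) (expad V B (fst (F ?n)) (\<lambda>w. quad w + snd (F ?n) w)) \<Gamma>"
      using F(1)[of ?n] by (simp add: approx_def)
    ultimately show ?thesis by (simp add: agree_def)
  qed
  thus ?thesis using S \<gamma> by blast
qed

end


section \<open>Splitting a complex\<close>

lemma (in vector_space) independent_UN:
  assumes ind: "\<And>i. independent (A i)"
    and direct: "\<And>J v. finite J \<Longrightarrow> (\<And>j. j \<in> J \<Longrightarrow> v j \<in> span (A j)) \<Longrightarrow> (\<Sum>j\<in>J. v j) = 0 \<Longrightarrow> (\<forall>j\<in>J. v j = 0)"
  shows "independent (\<Union>i. A i)"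
  unfolding independent_explicit_finite_subsets
proof (intro allI impI ballI)
  fix S u x assume S: "S \<subseteq> (\<Union>i. A i)" "finite S" and sum0: "(\<Sum>v\<in>S. scale (u v) v) = 0" and x: "x \<in> S"
  \<comment> \<open>One index is chosen for each vector, so a vector is counted once even if it lies
    in several of the sets.\<close>
  obtain k where k: "\<And>v. v \<in> S \<Longrightarrow> v \<in> A (k v)" using S(1) by (metis UN_E subsetD)
  let ?S = "\<lambda>j. {v \<in> S. k v = j}"
  have "(\<Sum>j\<in>k ` S. \<Sum>v\<in>?S j. scale (u v) v) = 0"
    using sum.image_gen[OF S(2), of "\<lambda>v. scale (u v) v" k] sum0 by simp
  moreover have "(\<Sum>v\<in>?S j. scale (u v) v) \<in> span (A j)" for j
    by (intro span_sum span_scale span_base) (use k in auto)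
  ultimately have "\<forall>j\<in>k ` S. (\<Sum>v\<in>?S j. scale (u v) v) = 0"
    by (intro direct finite_imageI S(2))
  hence "(\<Sum>v\<in>?S (k x). scale (u v) v) = 0" using x by blast
  moreover have "?S j \<subseteq> A j" for j using k by auto
  moreover have "finite (?S (k x))" using S(2) by simp
  ultimately show "u x = 0"
    using ind[of "k x"] x unfolding independent_explicit_finite_subsets by blast
qed

lemma (in vector_space) span_disjoint:
  assumes ind: "independent (A \<union> C)" and disj: "A \<inter> C = {}" and v: "v \<in> span A" "v \<in> span C"
  shows "v = 0"
proof -
  have "representation (A \<union> C) v = representation A v" "representation (A \<union> C) v = representation C v"
    using representation_extend[OF ind v(1) Un_upper1] representation_extend[OF ind v(2) Un_upper2] by auto
  hence "representation (A \<union> C) v b = 0" for b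
    using representation_ne_zero[of A v b] representation_ne_zero[of C v b] disj by fastforce
  moreover have "v \<in> span (A \<union> C)" using v(1) span_mono[of A "A \<union> C"] by auto
  ultimately show ?thesis using sum_nonzero_representation_eq[OF ind, of v] by simp
qed

lemma (in vector_space) independent_Un:
  assumes "independent A" "independent C" and disj: "\<And>v. v \<in> span A \<Longrightarrow> v \<in> span C \<Longrightarrow> v = 0"
  shows "independent (A \<union> C)"
proof -
  have "independent (\<Union>b. if b then A else C)"
  proof (rule independent_UN)
    fix J :: "bool set" and v
    assume J: "\<And>j. j \<in> J \<Longrightarrow> v j \<in> span (if j then A else C)" "(\<Sum>j\<in>J. v j) = 0"
    show "\<forall>j\<in>J. v j = 0"
    proof (cases "J = UNIV")
      case True
      hence v: "v True \<in> span A" "v False \<in> span C" "v True + v False = 0"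
        using J(1)[of True] J(1)[of False] J(2) by (auto simp: UNIV_bool add.commute)
      hence "v True = - v False" by (simp add: eq_neg_iff_add_eq_0)
      hence "v True \<in> span C" using v(2) span_neg by simp
      hence "v True = 0" by (rule disj[OF v(1)])
      thus ?thesis using v(3) by (metis (full_types) add_0)
    next
      case False
      then obtain b where "b \<notin> J" by blast
      have "J \<subseteq> {\<not> b}"
      proof
        fix x assume "x \<in> J"
        hence "x \<noteq> b" using \<open>b \<notin> J\<close> by blast
        thus "x \<in> {\<not> b}" by (cases x; cases b) simp_all
      qed
      hence "J = {} \<or> J = {\<not> b}" by auto
      thus ?thesis using J(2) by auto
    qed
  qed (use assms in auto)
  moreover have "(\<Union>b. if b then A else C) = A \<union> C" by (auto split: if_splits)
  ultimately show ?thesis by simp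
qed

lemma graded_space_direct:
  "graded_space scale V \<Longrightarrow> finite I \<Longrightarrow> (\<And>i. i \<in> I \<Longrightarrow> v i \<in> V i) \<Longrightarrow> (\<Sum>i\<in>I. v i) = 0 \<Longrightarrow> i \<in> I \<Longrightarrow> v i = 0"
  unfolding graded_space_def by blast

lemma graded_space_degree:
  assumes "graded_space scale V" "v \<in> V i" "v \<noteq> 0" "vector_space scale"
  shows "v \<in> V j \<longleftrightarrow> j = i" "vdeg V v = i"
proof -
  interpret vector_space scale by fact
  show 1: "v \<in> V j \<longleftrightarrow> j = i" for j
  proof
    assume j: "v \<in> V j"
    show "j = i"
    proof (rule ccontr)
      assume ne: "j \<noteq> i"
      let ?v = "\<lambda>k. if k = i then v else - v"
      have "subspace (V j)" using assms(1) by (simp add: graded_space_def)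
      hence "?v k \<in> V k" if "k \<in> {i, j}" for k
        using that assms(2) j subspace_neg by auto
      moreover have "(\<Sum>k\<in>{i, j}. ?v k) = 0" using ne by simp
      ultimately have "?v i = 0" by (intro graded_space_direct[OF assms(1), of "{i, j}" ?v i]) auto
      thus False using assms(3) by simp
    qed
  qed (use assms in simp)
  show "vdeg V v = i" unfolding vdeg_def by (rule the_equality) (use assms 1 in auto)
qed

text \<open>Group the basis expansion of \<open>v\<close> by degrees: directness of the sum forces
  the component of degree i to equal \<open>v\<close>.\<close>

lemma (in vector_space) graded_span:
  assumes gs: "graded_space scale V" and B: "B \<subseteq> (\<Union>i. V i)" "independent B" and v: "v \<in> V i" "v \<in> span B"
  shows "v \<in> span (B \<inter> V i)"
proof -
  have vs: "vector_space scale" by unfold_locales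
  let ?r = "representation B v"
  define t where "t = {b. ?r b \<noteq> 0}"
  have t: "finite t" "t \<subseteq> B" using finite_representation representation_ne_zero by (auto simp: t_def)
  have sv: "(\<Sum>b\<in>t. scale (?r b) b) = v" using sum_nonzero_representation_eq[OF B(2) v(2)] by (simp add: t_def)
  have b0: "b \<noteq> 0" if "b \<in> B" for b using that B(2) dependent_zero by blast
  have deg: "b \<in> V (vdeg V b)" if b: "b \<in> B" for b
  proof -
    obtain j where j: "b \<in> V j" using b B(1) by auto
    thus ?thesis using graded_space_degree(2)[OF gs j b0[OF b] vs] by simp
  qed
  let ?u = "\<lambda>j. \<Sum>b\<in>{b \<in> t. vdeg V b = j}. scale (?r b) b"
  let ?J = "insert i (vdeg V ` t)"
  have sub: "subspace (V j)" for j using gs by (simp add: graded_space_def)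
  have u: "?u j \<in> V j" for j
    by (intro subspace_sum[OF sub] subspace_scale[OF sub]) (use deg t in auto)
  have "(\<Sum>j\<in>?J. ?u j) = v"
  proof -
    have "v = (\<Sum>j\<in>vdeg V ` t. ?u j)" using sum.image_gen[OF t(1), of "\<lambda>b. scale (?r b) b" "vdeg V"] sv by simp
    also have "\<dots> = (\<Sum>j\<in>?J. ?u j)"
      by (rule sum.mono_neutral_left) (use t(1) in \<open>auto intro!: sum.neutral\<close>)
    finally show ?thesis by simp
  qed
  moreover have "(\<Sum>j\<in>?J. if j = i then v else 0) = v" using t(1) by simp
  ultimately have "(\<Sum>j\<in>?J. ?u j - (if j = i then v else 0)) = 0" by (simp add: sum_subtractf)
  moreover have "?u j - (if j = i then v else 0) \<in> V j" for j
    using u[of j] v(1) subspace_diff[OF sub] subspace_0[OF sub] by auto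
  moreover have "finite ?J" using t(1) by simp
  ultimately have "?u i - (if i = i then v else 0) = 0"
    by (intro graded_space_direct[OF gs, of ?J "\<lambda>j. ?u j - (if j = i then v else 0)" i]) blast+
  hence "?u i = v" by simp
  moreover have "?u i \<in> span (B \<inter> V i)"
    by (intro span_sum span_scale span_base) (use t deg in auto)
  ultimately show ?thesis by simp
qed

text \<open>In each degree a basis \<open>ZB\<close> of the cocycles is extended to one of
  \<open>V i\<close>. The added vectors form \<open>W i\<close>, a complement of the cocycles, on
  which \<open>d\<close> is injective. The images of \<open>W (i - 1)\<close> are then extended to a
  second basis \<open>EZ\<close> of the cocycles; the vectors added there form \<open>H i\<close>.
  As \<open>EZ\<close> and \<open>ZB\<close> span the same space, one may replace the other.\<close>

lemma (in vector_space) split_complex: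
  assumes gs: "graded_space scale V" and d: "differential scale V d"
  obtains W H where
    "\<And>i. W i \<subseteq> V i" "\<And>i. H i \<subseteq> V i" "\<And>i h. h \<in> H i \<Longrightarrow> d h = 0"
    "\<And>i. independent (W i \<union> d ` W (i - 1) \<union> H i)" "\<And>i. V i \<subseteq> span (W i \<union> d ` W (i - 1) \<union> H i)"
    "\<And>i. inj_on d (span (W i))"
    "\<And>i. d ` W (i - 1) \<inter> H i = {}" "\<And>i. W i \<inter> (d ` W (i - 1) \<union> H i) = {}"
proof -
  have lin: "Vector_Spaces.linear scale scale d" using d by (simp add: differential_def)
  interpret d: Vector_Spaces.linear scale scale d by (rule lin)
  have dV: "d v \<in> V (i + 1)" "d (d v) = 0" if "v \<in> V i" for v i using d that by (auto simp: differential_def)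
  have sub: "subspace (V i)" for i using gs by (simp add: graded_space_def)
  define Z where "Z i = {v \<in> V i. d v = 0}" for i
  have Zsub: "subspace (Z i)" for i
    using sub[of i] unfolding Z_def subspace_def by (auto simp: d.add d.scale)
  have "\<exists>ZB E. ZB \<subseteq> Z i \<and> Z i \<subseteq> span ZB \<and> ZB \<subseteq> E \<and> E \<subseteq> V i \<and> independent E \<and> V i \<subseteq> span E" for i
  proof -
    obtain ZB where ZB: "ZB \<subseteq> Z i" "independent ZB" "Z i \<subseteq> span ZB" by (rule maximal_independent_subset)
    moreover have "ZB \<subseteq> V i" using ZB(1) by (auto simp: Z_def)
    then obtain E where "ZB \<subseteq> E" "E \<subseteq> V i" "independent E" "V i \<subseteq> span E"
      using maximal_independent_subset_extend[OF _ ZB(2)] by metis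
    ultimately show ?thesis by blast
  qed
  then obtain ZB E where E: "\<And>i. ZB i \<subseteq> Z i" "\<And>i. Z i \<subseteq> span (ZB i)" "\<And>i. ZB i \<subseteq> E i" "\<And>i. E i \<subseteq> V i"
    "\<And>i. independent (E i)" "\<And>i. V i \<subseteq> span (E i)" by metis
  define W where "W i = E i - ZB i" for i
  have WE: "W i \<union> ZB i = E i" for i using E(3)[of i] by (auto simp: W_def)
  have WV: "W i \<subseteq> V i" "span (W i) \<subseteq> V i" for i
    using E(4)[of i] span_minimal[OF _ sub[of i], of "W i"] by (auto simp: W_def)
  have WZ: "v = 0" if "v \<in> span (W i)" "v \<in> Z i" for v i
    by (rule span_disjoint[of "W i" "ZB i"]) (use that E(2,5) WE in \<open>auto simp: W_def\<close>)
  have inj: "inj_on d (span (W i))" for i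
    unfolding d.inj_on_iff_eq_0[OF subspace_span]
  proof (intro ballI impI)
    fix x assume x: "x \<in> span (W i)" "d x = 0"
    hence "x \<in> Z i" using WV(2)[of i] by (auto simp: Z_def)
    thus "x = 0" by (rule WZ[OF x(1)])
  qed
  have Wind: "independent (W i)" for i
    using E(5)[of i] by (rule independent_mono) (auto simp: W_def)
  have dWind: "independent (d ` W i)" for i
    by (rule d.independent_injective_image[OF Wind inj])
  have dWZ: "d ` W (i - 1) \<subseteq> Z i" for i
    using WV(1)[of "i - 1"] dV[of _ "i - 1"] by (auto simp: Z_def)
  have "\<exists>EZ. d ` W (i - 1) \<subseteq> EZ \<and> EZ \<subseteq> Z i \<and> independent EZ \<and> Z i \<subseteq> span EZ" for i
    using maximal_independent_subset_extend[OF dWZ dWind, of i] by metis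
  then obtain EZ where EZ: "\<And>i. d ` W (i - 1) \<subseteq> EZ i" "\<And>i. EZ i \<subseteq> Z i" "\<And>i. independent (EZ i)" "\<And>i. Z i \<subseteq> span (EZ i)"
    by metis
  have spZ: "span (EZ i) = Z i" "span (ZB i) = Z i" for i
    by (rule subset_antisym[OF span_minimal[OF EZ(2) Zsub] EZ(4)])
      (rule subset_antisym[OF span_minimal[OF E(1) Zsub] E(2)])
  define H where "H i = EZ i - d ` W (i - 1)" for i
  have un: "W i \<union> d ` W (i - 1) \<union> H i = W i \<union> EZ i" for i using EZ(1)[of i] by (auto simp: H_def)
  show thesis
  proof
    show "W i \<subseteq> V i" for i by (rule WV)
    show "H i \<subseteq> V i" for i using EZ(2)[of i] by (auto simp: H_def Z_def)
    show "d h = 0" if "h \<in> H i" for h i using that EZ(2)[of i] by (auto simp: H_def Z_def)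
    show "independent (W i \<union> d ` W (i - 1) \<union> H i)" for i
      unfolding un by (rule independent_Un[OF Wind EZ(3)]) (use WZ spZ in auto)
    show "V i \<subseteq> span (W i \<union> d ` W (i - 1) \<union> H i)" for i
    proof -
      have "span (W i \<union> EZ i) = span (W i \<union> ZB i)" by (simp add: span_Un spZ)
      thus ?thesis using E(6)[of i] by (simp add: un WE)
    qed
    show "inj_on d (span (W i))" for i by (rule inj)
    show "d ` W (i - 1) \<inter> H i = {}" for i by (auto simp: H_def)
    show "W i \<inter> (d ` W (i - 1) \<union> H i) = {}" for i
    proof -
      have "d ` W (i - 1) \<union> H i = EZ i" using EZ(1)[of i] by (auto simp: H_def)
      moreover have "w \<notin> EZ i" if "w \<in> W i" for w
        using WZ[OF span_base[OF that], of ] EZ(2)[of i] that Wind[of i] dependent_zero by auto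
      ultimately show ?thesis by auto
    qed
  qed
qed

lemma (in vector_space) representation_linear:
  assumes lin: "Vector_Spaces.linear scale scale f"
    and A: "independent A" and C: "independent C" and v: "v \<in> span A" and AC: "\<And>a. a \<in> A \<Longrightarrow> f a \<in> span C"
  shows "lfsum A (\<lambda>a. representation A v a * representation C (f a) c) = representation C (f v) c"
proof -
  interpret f: Vector_Spaces.linear scale scale f by (rule lin)
  let ?t = "{b. representation A v b \<noteq> 0}"
  have t: "finite ?t" "?t \<subseteq> A" using finite_representation representation_ne_zero by auto
  have "f v = f (\<Sum>b\<in>?t. scale (representation A v b) b)"
    using sum_nonzero_representation_eq[OF A v] by simp
  hence "representation C (f v) = representation C (\<Sum>b\<in>?t. scale (representation A v b) (f b))"
    by (simp add: f.sum f.scale)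
  also have "\<dots> = (\<lambda>c. \<Sum>b\<in>?t. representation C (scale (representation A v b) (f b)) c)"
    by (rule representation_sum[OF C]) (use t AC in \<open>auto intro!: span_scale\<close>)
  also have "\<dots> = (\<lambda>c. \<Sum>b\<in>?t. representation A v b * representation C (f b) c)"
  proof (intro ext sum.cong refl)
    fix c b assume "b \<in> ?t"
    hence "f b \<in> span C" using t AC by auto
    thus "representation C (scale (representation A v b) (f b)) c = representation A v b * representation C (f b) c"
      by (simp add: representation_scale[OF C])
  qed
  finally have "representation C (f v) c = (\<Sum>b\<in>?t. representation A v b * representation C (f b) c)" by simp
  also have "\<dots> = lfsum A (\<lambda>b. representation A v b * representation C (f b) c)"
    by (rule lfsum_eq_sum[symmetric]) (use t in auto)
  finally show ?thesis by simp
qed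

lemma (in vector_space) representation_change:
  assumes "independent A" "independent C" "v \<in> span A" "A \<subseteq> span C"
  shows "lfsum A (\<lambda>a. representation A v a * representation C a c) = representation C v c"
  by (rule representation_linear[OF _ assms(1-3)]) (use assms(4) in \<open>auto intro: linear_ident\<close>)


section \<open>The differential of a strongly homotopy Lie 1-bialgebra\<close>

lemma fmul_two:
  "fmul V f g [x, y] = f [x, y] * g [] + f [] * g [x, y] + f [x] * g [y]
     + ksign (cdeg V x) (cdeg V y) * f [y] * g [x]"
  by (simp add: fmul_Cons dL_def tw_def)

text \<open>The coefficient of the master equation at t of \<open>a\<close> and \<chi> of
  \<open>c\<close>. Cubic coefficients would be paired with linear ones, which vanish, so it
  contains only products of quadratic coefficients.\<close>

lemma linear_part_square:
  fixes \<Gamma> :: "('v, 'k::field_char_0) series"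
  assumes \<Gamma>: "is_function V B \<Gamma>" "has_degree V 2 \<Gamma>" "vanishes_on_L \<Gamma>" "vanishes_on_PiL \<Gamma>"
    "bracket V B \<Gamma> \<Gamma> = (\<lambda>w. 0)"
  shows "lfsum B (\<lambda>b. \<Gamma> [Tc a, Chi b] * \<Gamma> [Tc b, Chi c]) = 0"
proof -
  have L: "\<Gamma> [Chi b, Chi c] = 0" "\<Gamma> [Tc b, Tc c] = 0" "\<Gamma> [Chi b] = 0" "\<Gamma> [Tc b] = 0" for b c
    using \<Gamma>(3,4) unfolding vanishes_on_L_def vanishes_on_PiL_def
    by (metis list.map)+
  have G: "\<Gamma> [Chi b, Tc a] = ksign (cdeg V (Chi b)) (cdeg V (Tc a)) * \<Gamma> [Tc a, Chi b]" for a b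
    using gsymD[OF is_function_gsym[OF \<Gamma>(1)], of "[]" "Chi b" "Tc a" "[]"] by simp
  have deg: "vdeg V b = vdeg V a + 1" if "\<Gamma> [Tc a, Chi b] \<noteq> 0" for a b
    using has_degreeD[OF \<Gamma>(2) that] by simp
  have "fmul V (dR (Tc b) \<Gamma>) (dL (Chi b) \<Gamma>) [Tc a, Chi c] - fmul V (dR (Chi b) \<Gamma>) (dL (Tc b) \<Gamma>) [Tc a, Chi c]
     = - 2 * (\<Gamma> [Tc a, Chi b] * \<Gamma> [Tc b, Chi c])" for b
  proof (cases "\<Gamma> [Tc a, Chi b] = 0 \<or> \<Gamma> [Tc b, Chi c] = 0")
    case True
    thus ?thesis by (auto simp: fmul_two dL_def dR_def L G)
  next
    case False
    hence d: "vdeg V b = vdeg V a + 1" "vdeg V c = vdeg V a + 2" using deg[of a b] deg[of b c] by auto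
    \<comment> \<open>The degrees of \<open>a\<close>, \<open>b\<close>, \<open>c\<close> are
      consecutive, and hence the two halves of the bracket add up instead of cancelling.\<close>
    have "ksign (- vdeg V a) (vdeg V c + 1) * ksign (vdeg V c + 1) (- vdeg V b) * ksign (vdeg V b + 1) (- vdeg V a) = (- 1 :: 'k)"
      unfolding d by (auto simp: ksign_def)
    moreover have "ksign (- vdeg V a) (vdeg V c + 1) * (ksign (vdeg V c + 1) (- vdeg V b) * \<Gamma> [Tc b, Chi c]) *
        (ksign (vdeg V b + 1) (- vdeg V a) * \<Gamma> [Tc a, Chi b]) =
      ksign (- vdeg V a) (vdeg V c + 1) * ksign (vdeg V c + 1) (- vdeg V b) * ksign (vdeg V b + 1) (- vdeg V a) *
        (\<Gamma> [Tc b, Chi c] * \<Gamma> [Tc a, Chi b])"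
      by (simp only: mult_ac)
    ultimately have "ksign (- vdeg V a) (vdeg V c + 1) * (ksign (vdeg V c + 1) (- vdeg V b) * \<Gamma> [Tc b, Chi c]) *
        (ksign (vdeg V b + 1) (- vdeg V a) * \<Gamma> [Tc a, Chi b]) = - 1 * (\<Gamma> [Tc b, Chi c] * \<Gamma> [Tc a, Chi b])"
      by (simp only:)
    thus ?thesis by (simp add: fmul_two dL_def dR_def L G mult.commute)
  qed
  hence "lfsum B (\<lambda>b. - 2 * (\<Gamma> [Tc a, Chi b] * \<Gamma> [Tc b, Chi c])) = 0"
    using fun_cong[OF \<Gamma>(5), of "[Tc a, Chi c]"] by (simp only: bracket_def)
  thus ?thesis unfolding lfsum_cmult by simp
qed

text \<open>The images of basis vectors are finite sums by the finiteness clause with one input and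
  one output. Beyond the span of \<open>B\<close> the linear extension is arbitrary.\<close>

lemma linear_part:
  fixes scale :: "'k::field_char_0 \<Rightarrow> 'v::ab_group_add \<Rightarrow> 'v"
  assumes vs: "vector_space scale" and \<Gamma>: "lie1bi scale V B \<Gamma>"
  obtains d where "differential scale V d"
    "\<And>a b. a \<in> B \<Longrightarrow> b \<in> B \<Longrightarrow> module.representation scale B (d a) b = \<Gamma> [Tc a, Chi b]"
proof -
  interpret vector_space scale by fact
  interpret vector_space_pair scale scale by unfold_locales
  have gs: "graded_space scale V" and hb: "homogeneous_basis scale V B"
    and G: "is_function V B \<Gamma>" "has_degree V 2 \<Gamma>" "vanishes_on_L \<Gamma>" "vanishes_on_PiL \<Gamma>" "bracket V B \<Gamma> \<Gamma> = (\<lambda>w. 0)"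
    using \<Gamma> by (auto simp: lie1bi_def)
  have ind: "independent B" and BV: "B \<subseteq> (\<Union>i. V i)" and Vspan: "V i \<subseteq> span B" for i
    using hb by (auto simp: homogeneous_basis_def)
  have sub: "subspace (V i)" for i using gs by (simp add: graded_space_def)
  let ?t = "\<lambda>a. {b \<in> B. \<Gamma> [Tc a, Chi b] \<noteq> 0}"
  have fin: "finite (?t a)" for a
  proof -
    have "fam V B {()} (\<lambda>_. \<Gamma>)" using G(1) by (simp add: fam_singleton)
    from finite_imageI[OF fam_normal_finite[OF this, of 1 "[a]"], of "\<lambda>p. hd (snd p)"]
    show ?thesis by (rule finite_subset[rotated]) (auto intro!: rev_image_eqI[of "((), [_])"])
  qed
  obtain d where d: "Vector_Spaces.linear scale scale d"
    "\<And>a. a \<in> B \<Longrightarrow> d a = (\<Sum>b\<in>?t a. scale (\<Gamma> [Tc a, Chi b]) b)"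
    using linear_independent_extend[OF ind, of "\<lambda>a. \<Sum>b\<in>?t a. scale (\<Gamma> [Tc a, Chi b]) b"] by blast
  interpret d: Vector_Spaces.linear scale scale d by (rule d(1))
  have rep: "representation B (d a) = (\<lambda>b. if b \<in> B then \<Gamma> [Tc a, Chi b] else 0)" if "a \<in> B" for a
  proof (rule representation_eqI[OF ind])
    show "d a \<in> span B" unfolding d(2)[OF that] by (intro span_sum span_scale span_base) auto
    have eq: "{b. (if b \<in> B then \<Gamma> [Tc a, Chi b] else 0) \<noteq> 0} = ?t a" by auto
    show "finite {b. (if b \<in> B then \<Gamma> [Tc a, Chi b] else 0) \<noteq> 0}" unfolding eq by (rule fin)
    show "(\<Sum>b | (if b \<in> B then \<Gamma> [Tc a, Chi b] else 0) \<noteq> 0. scale (if b \<in> B then \<Gamma> [Tc a, Chi b] else 0) b) = d a"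
      unfolding eq d(2)[OF that] by (rule sum.cong) auto
  qed (auto split: if_splits)
  have b0: "b \<noteq> 0" if "b \<in> B" for b using that ind dependent_zero by blast
  have deg: "b \<in> V (vdeg V b)" if b: "b \<in> B" for b
  proof -
    obtain j where j: "b \<in> V j" using b BV by auto
    thus ?thesis using graded_space_degree(2)[OF gs j b0[OF b] vs] by simp
  qed
  have dB: "d a \<in> V (i + 1)" if a: "a \<in> B" "a \<in> V i" for a i
  proof -
    have i: "vdeg V a = i" by (rule graded_space_degree(2)[OF gs a(2) b0[OF a(1)] vs])
    show ?thesis unfolding d(2)[OF a(1)]
    proof (intro subspace_sum[OF sub] subspace_scale[OF sub])
      fix b assume b: "b \<in> ?t a"
      hence "vdeg V b = i + 1" using has_degreeD[OF G(2), of "[Tc a, Chi b]"] i by simp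
      thus "b \<in> V (i + 1)" using deg[of b] b by simp
    qed
  qed
  have ddB: "d (d a) = 0" if a: "a \<in> B" for a
  proof -
    have sp: "d x \<in> span B" if "x \<in> B" for x
      using dB[OF that deg[OF that]] Vspan by blast
    have "d (d a) = (\<Sum>b\<in>?t a. scale (\<Gamma> [Tc a, Chi b]) (d b))"
      by (simp add: d(2)[OF a] d.sum d.scale)
    hence "representation B (d (d a)) = (\<lambda>c. \<Sum>b\<in>?t a. representation B (scale (\<Gamma> [Tc a, Chi b]) (d b)) c)"
      using representation_sum[OF ind, of "?t a" "\<lambda>b. scale (\<Gamma> [Tc a, Chi b]) (d b)"] sp by (simp add: span_scale)
    also have "\<dots> = (\<lambda>c. \<Sum>b\<in>?t a. \<Gamma> [Tc a, Chi b] * (if c \<in> B then \<Gamma> [Tc b, Chi c] else 0))"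
      by (intro ext sum.cong refl) (use sp in \<open>simp add: representation_scale[OF ind] rep\<close>)
    also have "\<dots> = (\<lambda>c. if c \<in> B then lfsum B (\<lambda>b. \<Gamma> [Tc a, Chi b] * \<Gamma> [Tc b, Chi c]) else 0)"
      by (rule ext, subst lfsum_eq_sum[OF fin[of a]]) auto
    also have "\<dots> = (\<lambda>c. 0)"
      by (rule ext) (simp only: linear_part_square[OF G] if_cancel)
    finally have "representation B (d (d a)) = (\<lambda>c. 0)" .
    moreover have "d (d a) \<in> span B"
    proof -
      have "d a \<in> V (vdeg V a + 1)" by (rule dB[OF a deg[OF a]])
      hence "d a \<in> span B" using Vspan by blast
      hence "d (d a) \<in> span (d ` B)" by (simp add: d.span_image)
      moreover have "span (d ` B) \<subseteq> span B" by (rule span_minimal) (use sp in auto)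
      ultimately show ?thesis by blast
    qed
    ultimately show ?thesis using sum_nonzero_representation_eq[OF ind, of "d (d a)"] by simp
  qed
  have "d v \<in> V (i + 1) \<and> d (d v) = 0" if v: "v \<in> V i" for v i
  proof -
    have "v \<in> span (B \<inter> V i)" by (rule graded_span[OF gs BV ind v]) (use v Vspan in blast)
    moreover have "subspace {v. d v \<in> V (i + 1) \<and> d (d v) = 0}"
      using sub[of "i + 1"] by (auto simp: subspace_def d.add d.scale d.zero)
    moreover have "B \<inter> V i \<subseteq> {v. d v \<in> V (i + 1) \<and> d (d v) = 0}" using dB ddB by auto
    ultimately show ?thesis using span_minimal by blast
  qed
  hence "differential scale V d" using d(1) by (auto simp: differential_def)
  thus thesis by (rule that) (simp add: rep)
qed


section \<open>Restriction to a factor\<close>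

text \<open>A factor of a product, with coordinates embedded by \<iota>, and a function on the
  product that involves these coordinates only.\<close>

locale inclusion =
  fixes V :: "int \<Rightarrow> 'v set" and B :: "'v set" and V' :: "int \<Rightarrow> 'w set" and B' :: "'w set"
    and \<iota> :: "'v \<Rightarrow> 'w" and f :: "('w, 'k::field_char_0) series"
  assumes inj: "inj \<iota>" and mem: "\<And>b. \<iota> b \<in> B' \<longleftrightarrow> b \<in> B"
    and deg: "\<And>b. b \<in> B \<Longrightarrow> vdeg V' (\<iota> b) = vdeg V b"
    and f: "is_function V' B' f" and support: "\<And>w. f w \<noteq> 0 \<Longrightarrow> set w \<subseteq> range (map_coord \<iota>)"
begin

abbreviation "j \<equiv> map_coord \<iota>"

definition restr :: "('v, 'k) series" where "restr = (\<lambda>w. f (map j w))"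

lemma j_coords: "j x \<in> coords B' \<longleftrightarrow> x \<in> coords B"
  by (cases x) (auto simp: mem)

lemma j_cdeg: "x \<in> coords B \<Longrightarrow> cdeg V' (j x) = cdeg V x"
  by (cases x) (auto simp: deg)

lemma restr_outside: "\<not> set w \<subseteq> coords B \<Longrightarrow> restr w = 0"
  unfolding restr_def by (rule is_function_outside[OF f]) (auto simp: j_coords)

lemma is_function_restr: "is_function V B restr"
proof -
  have "fam V B {()} (\<lambda>_. restr)"
  proof (rule famI)
    show "gsym V restr"
    proof (rule gsymI)
      fix u x y w
      show "restr (u @ x # y # w) = ksign (cdeg V x) (cdeg V y) * restr (u @ y # x # w)"
      proof (cases "x \<in> coords B \<and> y \<in> coords B")
        case True
        thus ?thesis using gsymD[OF is_function_gsym[OF f], of "map j u" "j x" "j y" "map j w"]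
          by (simp add: restr_def j_cdeg)
      next
        case False
        thus ?thesis using restr_outside[of "u @ x # y # w"] restr_outside[of "u @ y # x # w"] by auto
      qed
    qed
    fix as m
    have "fam V' B' {()} (\<lambda>_. f)" using f by (simp add: fam_singleton)
    from fam_normal_finite[OF this, of m "map \<iota> as"]
    have "finite ((\<lambda>(i, bs). (i, map \<iota> bs)) -`
        {(i, bs). i \<in> {()} \<and> length bs = m \<and> f (map Tc (map \<iota> as) @ map Chi bs) \<noteq> 0})"
      by (rule finite_vimageI) (use inj in \<open>auto simp: inj_on_def inj_map_eq_map\<close>)
    moreover have "map j (map Tc as @ map Chi bs) = map Tc (map \<iota> as) @ map Chi (map \<iota> bs)" for bs by simp
    ultimately show "finite {(i, bs). i \<in> {()} \<and> length bs = m \<and> restr (map Tc as @ map Chi bs) \<noteq> 0}"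
      unfolding restr_def by (elim finite_subset[rotated]) (auto simp del: map_append map_map)
  qed (rule restr_outside)
  thus ?thesis by (simp add: fam_singleton)
qed

lemma restr_degree:
  assumes "has_degree V' p f"
  shows "has_degree V p restr"
proof (rule has_degreeI)
  fix w assume nz: "restr w \<noteq> 0"
  hence "set w \<subseteq> coords B" using restr_outside by blast
  hence "wdeg V' (map j w) = wdeg V w" by (induction w) (auto simp: j_cdeg)
  thus "wdeg V w = p" using has_degreeD[OF assms, of "map j w"] nz by (simp add: restr_def)
qed

lemma restr_vanishes: "vanishes_on_L f \<Longrightarrow> vanishes_on_L restr" "vanishes_on_PiL f \<Longrightarrow> vanishes_on_PiL restr"
proof -
  have "map j (map Chi bs) = map Chi (map \<iota> bs)" "map j (map Tc bs) = map Tc (map \<iota> bs)" for bs by simp_all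
  thus "vanishes_on_L f \<Longrightarrow> vanishes_on_L restr" "vanishes_on_PiL f \<Longrightarrow> vanishes_on_PiL restr"
    unfolding vanishes_on_L_def vanishes_on_PiL_def restr_def by metis+
qed

text \<open>Contractions over basis elements of the other factor contribute nothing, as
  \<open>f\<close> has no derivative in their directions.\<close>

lemma bracket_restr:
  assumes w: "set w \<subseteq> coords B"
  shows "bracket V B restr restr w = bracket V' B' f f (map j w)"
proof -
  have sh: "shuffle_sign V w S = (shuffle_sign V' (map j w) S :: 'k)" for S
    unfolding shuffle_sign_def length_map
  proof (rule prod.cong[OF refl], clarify)
    fix i k :: nat assume "i < k" "k < length w"
    moreover from this have "w ! i \<in> coords B" "w ! k \<in> coords B" using w by auto
    ultimately show "ksign (cdeg V (w ! i)) (cdeg V (w ! k)) = (ksign (cdeg V' (map j w ! i)) (cdeg V' (map j w ! k)) :: 'k)"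
      by (simp add: j_cdeg)
  qed
  have fm: "fmul V (dR x restr) (dL y restr) w = fmul V' (dR (j x) f) (dL (j y) f) (map j w)" for x y
    by (simp add: fmul_def sh restr_def dR_def dL_def nths_map)
  let ?T = "\<lambda>b. fmul V' (dR (Tc b) f) (dL (Chi b) f) (map j w) - fmul V' (dR (Chi b) f) (dL (Tc b) f) (map j w)"
  have "bracket V B restr restr w = lfsum B (\<lambda>b. ?T (\<iota> b))"
    by (simp add: bracket_def fm)
  also have "\<dots> = lfsum (\<iota> ` B) ?T"
    using inj by (intro lfsum_reindex[symmetric]) (auto simp: inj_on_def)
  also have "\<dots> = lfsum B' ?T"
  proof (rule lfsum_superset[symmetric])
    show "\<iota> ` B \<subseteq> B'" using mem by auto
    fix c assume c: "c \<in> B'" "c \<notin> \<iota> ` B"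
    have "c \<notin> range \<iota>" using c mem by auto
    hence "Tc c \<noteq> j y" "Chi c \<noteq> j y" for y by (cases y; auto)+
    hence "Tc c \<notin> range j" "Chi c \<notin> range j" by blast+
    hence "dR (Tc c) f = (\<lambda>w. 0)" "dR (Chi c) f = (\<lambda>w. 0)"
      using support by (fastforce simp: dR_def)+
    thus "?T c = 0" by simp
  qed
  finally show ?thesis by (simp add: bracket_def)
qed

lemma bracket_restr_0: "bracket V' B' f f = (\<lambda>w. 0) \<Longrightarrow> bracket V B restr restr = (\<lambda>w. 0)"
proof
  fix w assume 0: "bracket V' B' f f = (\<lambda>w. 0)"
  show "bracket V B restr restr w = 0"
  proof (cases "set w \<subseteq> coords B")
    case True
    thus ?thesis using 0 by (simp add: bracket_restr)
  next
    case False
    thus ?thesis by (rule is_function_outside[OF is_function_bracket[OF is_function_restr is_function_restr]])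
  qed
qed

lemma restr_pullback:
  assumes g: "\<And>x. g (\<iota> x) = x"
  shows "(if set w \<subseteq> range j then restr (map (map_coord g) w) else 0) = f w"
proof (cases "set w \<subseteq> range j")
  case True
  have "j (map_coord g (j x)) = j x" for x by (cases x) (auto simp: g)
  hence "map j (map (map_coord g) w) = w" using True by (auto intro!: map_idI)
  thus ?thesis using True by (simp add: restr_def)
qed (use support in auto)

end

lemma graded_subspace:
  assumes "vector_space scale" "graded_space scale V"
    and "\<And>i. module.subspace scale (V1 i)" "\<And>i. V1 i \<subseteq> V i"
  shows "graded_space scale V1"
  using assms(2-4) unfolding graded_space_def by (meson subsetD)

theorem theorem3p4p5:
  fixes scale :: "'k::field_char_0 \<Rightarrow> 'v::ab_group_add \<Rightarrow> 'v"
    and V :: "int \<Rightarrow> 'v set" and B :: "'v set" and \<Gamma> :: "('v, 'k) series"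
  assumes "vector_space scale"
    and "lie1bi scale V B \<Gamma>"
  shows "\<exists>(V1 :: int \<Rightarrow> 'v set) B1 \<Gamma>1 (V2 :: int \<Rightarrow> 'v set) B2 \<Gamma>2.
           contractible scale V1 B1 \<Gamma>1 \<and> minimal scale V2 B2 \<Gamma>2 \<and>
           lie1bi_isomorphic V B \<Gamma>
             (prod_space V1 V2) (prod_basis B1 B2) (tensor_fun \<Gamma>1 \<Gamma>2)"
proof -
  note vs = assms(1)
  interpret vector_space scale by (rule vs)
  have gs: "graded_space scale V" and hb: "homogeneous_basis scale V B"
    and \<Gamma>: "is_function V B \<Gamma>" "has_degree V 2 \<Gamma>" "vanishes_on_L \<Gamma>" "vanishes_on_PiL \<Gamma>" "bracket V B \<Gamma> \<Gamma> = (\<lambda>w. 0)"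
    using assms(2) by (auto simp: lie1bi_def)
  have indB: "independent B" and BV: "B \<subseteq> (\<Union>i. V i)" and Vspan: "\<And>i. V i \<subseteq> span B"
    using hb by (auto simp: homogeneous_basis_def)
  have sub: "subspace (V i)" for i using gs by (simp add: graded_space_def)

  \<comment> \<open>The differential and an adapted basis\<close>
  obtain d where d: "differential scale V d"
    and dB: "\<And>a b. a \<in> B \<Longrightarrow> b \<in> B \<Longrightarrow> representation B (d a) b = \<Gamma> [Tc a, Chi b]"
    using linear_part[OF vs assms(2)] by blast
  have lin: "Vector_Spaces.linear scale scale d" using d by (simp add: differential_def)
  interpret d: Vector_Spaces.linear scale scale d by (rule lin)
  have dV: "d v \<in> V (i + 1)" "d (d v) = 0" if "v \<in> V i" for v i using d that by (auto simp: differential_def)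
  obtain W H where WH: "\<And>i. W i \<subseteq> V i" "\<And>i. H i \<subseteq> V i" "\<And>i h. h \<in> H i \<Longrightarrow> d h = 0"
    "\<And>i. independent (W i \<union> d ` W (i - 1) \<union> H i)" "\<And>i. V i \<subseteq> span (W i \<union> d ` W (i - 1) \<union> H i)"
    "\<And>i. inj_on d (span (W i))"
    "\<And>i. d ` W (i - 1) \<inter> H i = {}" "\<And>i. W i \<inter> (d ` W (i - 1) \<union> H i) = {}"
    using split_complex[OF gs d] by blast
  define A where "A i = W i \<union> d ` W (i - 1) \<union> H i" for i
  define BW where "BW = (\<Union>i. W i)"
  define B1 where "B1 = BW \<union> d ` BW"
  define B2 where "B2 = (\<Union>i. H i)"
  define V1 where "V1 i = span (W i \<union> d ` W (i - 1))" for i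
  define V2 where "V2 i = span (H i)" for i
  have dW: "d ` W (i - 1) \<subseteq> V i" for i using WH(1)[of "i - 1"] dV(1)[of _ "i - 1"] by auto
  have AV: "A i \<subseteq> V i" "span (A i) = V i" for i
    using WH(1,2,5)[of i] dW[of i] span_minimal[OF _ sub[of i], of "A i"] by (auto simp: A_def)
  have d_BW: "d ` BW = (\<Union>i. d ` W (i - 1))"
    unfolding BW_def by (auto simp: image_UN) (metis add_diff_cancel_right' imageI)
  have B1_eq: "B1 = (\<Union>i. W i \<union> d ` W (i - 1))" unfolding B1_def d_BW by (auto simp: BW_def)
  have UA: "B1 \<union> B2 = (\<Union>i. A i)" unfolding B1_def B2_def A_def d_BW by (auto simp: BW_def)
  have indA: "independent (B1 \<union> B2)"
    unfolding UA
  proof (rule independent_UN)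
    show "independent (A i)" for i using WH(4) by (simp add: A_def)
    show "\<forall>j\<in>J. v j = 0" if "finite J" "\<And>j. j \<in> J \<Longrightarrow> v j \<in> span (A j)" "(\<Sum>j\<in>J. v j) = 0" for J v
      using graded_space_direct[OF gs that(1) _ that(3)] that(2) AV(2) by auto
  qed
  have nz: "b \<noteq> 0" if "b \<in> B1 \<union> B2" for b using that indA dependent_zero by blast
  have deg: "b \<in> V j \<longleftrightarrow> j = i" "vdeg V b = i" if "b \<in> A i" for b i j
    using that graded_space_degree[OF gs _ nz vs, of b i] AV(1)[of i] UA by auto
  have Aeq: "i = j" if "b \<in> A i" "b \<in> A j" for b i j using deg(2)[OF that(1)] deg(2)[OF that(2)] by simp
  have disj12: "b \<notin> B2" if "b \<in> B1" for b
  proof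
    assume "b \<in> B2"
    then obtain j where j: "b \<in> H j" by (auto simp: B2_def)
    from that obtain i where i: "b \<in> W i \<union> d ` W (i - 1)" unfolding B1_eq by blast
    have "i = j" using i j by (intro Aeq[of b]) (auto simp: A_def)
    thus False using i j WH(7,8)[of i] by auto
  qed
  have disjW: "BW \<inter> d ` BW = {}"
  proof (rule ccontr)
    assume "BW \<inter> d ` BW \<noteq> {}"
    then obtain b i j where b: "b \<in> W i" "b \<in> d ` W (j - 1)" unfolding d_BW by (auto simp: BW_def)
    have "i = j" using b by (intro Aeq[of b]) (auto simp: A_def)
    thus False using b WH(8)[of i] by auto
  qed
  have dWA: "d w \<in> A (i + 1)" if "w \<in> W i" for w i using that by (auto simp: A_def)
  \<comment> \<open>Injectivity is known on each \<open>W i\<close>; the degree of the image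
    determines the index.\<close>
  have injd: "inj_on d BW"
  proof (rule inj_onI)
    fix x y assume xy: "x \<in> BW" "y \<in> BW" "d x = d y"
    then obtain i k where ik: "x \<in> W i" "y \<in> W k" by (auto simp: BW_def)
    have "i + 1 = k + 1" using dWA[OF ik(1)] dWA[OF ik(2)] xy(3) Aeq by metis
    thus "x = y" using WH(6)[of i] ik xy(3) span_base by (auto dest!: inj_onD)
  qed
  have vdegd: "vdeg V (d w) = vdeg V w + 1" if w: "w \<in> BW" for w
  proof -
    obtain i where i: "w \<in> W i" using w by (auto simp: BW_def)
    hence "w \<in> A i" by (auto simp: A_def)
    thus ?thesis using deg(2)[of w i] deg(2)[OF dWA[OF i]] by simp
  qed

  \<comment> \<open>The contractible and the minimal factor as graded spaces\<close>
  have V1V: "V1 i \<subseteq> V i" "V2 i \<subseteq> V i" for i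
    using span_mono[of "W i \<union> d ` W (i - 1)" "A i"] span_mono[of "H i" "A i"] AV(2)[of i]
    by (auto simp: V1_def V2_def A_def)
  have gs1: "graded_space scale V1" "graded_space scale V2"
    by (rule graded_subspace[OF vs gs]; use V1V in \<open>auto simp: V1_def V2_def\<close>)+
  have B1V: "\<exists>i. b \<in> V1 i \<and> b \<in> A i" if b: "b \<in> B1" for b
  proof -
    from b obtain i where "b \<in> W i \<union> d ` W (i - 1)" unfolding B1_eq by blast
    thus ?thesis by (intro exI[of _ i]) (auto simp: V1_def A_def intro: span_base)
  qed
  have B2V: "\<exists>i. b \<in> V2 i \<and> b \<in> A i" if b: "b \<in> B2" for b
  proof -
    from b obtain i where "b \<in> H i" unfolding B2_def by blast
    thus ?thesis by (intro exI[of _ i]) (auto simp: V2_def A_def intro: span_base)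
  qed
  have "B1 \<subseteq> (\<Union>i. V1 i)" "B2 \<subseteq> (\<Union>i. V2 i)" using B1V B2V by blast+
  moreover have "independent B1" "independent B2" using independent_mono[OF indA] by auto
  moreover have "V1 i \<subseteq> span B1" "V2 i \<subseteq> span B2" for i
    unfolding V1_def V2_def B1_eq B2_def by (rule span_mono, blast)+
  ultimately have hb1: "homogeneous_basis scale V1 B1" "homogeneous_basis scale V2 B2"
    by (simp_all add: homogeneous_basis_def)
  have vdeg1: "vdeg V1 b = vdeg V b" if "b \<in> B1" for b
    using B1V[OF that] graded_space_degree(2)[OF gs1(1) _ nz vs, of b] deg(2)[of b] that by auto
  have vdeg2: "vdeg V2 b = vdeg V b" if "b \<in> B2" for b
    using B2V[OF that] graded_space_degree(2)[OF gs1(2) _ nz vs, of b] deg(2)[of b] that by auto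

  \<comment> \<open>The change of basis from the given space to the product\<close>
  define Vp where "Vp = prod_space V1 V2"
  define Bp where "Bp = prod_basis B1 B2"
  define \<beta> where "\<beta> = (\<lambda>(x, y). x + y :: 'v)"
  have zero: "0 \<in> V1 i" "0 \<in> V2 i" for i by (auto simp: V1_def V2_def span_zero)
  have Bp1: "(b, 0) \<in> Bp \<longleftrightarrow> b \<in> B1" "(0, b) \<in> Bp \<longleftrightarrow> b \<in> B2" for b
    using nz by (auto simp: Bp_def prod_basis_def)
  have Bp_cases: "(\<exists>b\<in>B1. q = (b, 0)) \<or> (\<exists>b\<in>B2. q = (0, b))" if "q \<in> Bp" for q
    using that by (auto simp: Bp_def prod_basis_def)
  have \<beta>: "\<beta> (b, 0) = b" "\<beta> (0, b) = b" for b by (simp_all add: \<beta>_def)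
  have \<beta>_image: "\<beta> ` Bp = B1 \<union> B2"
    by (auto simp: Bp_def prod_basis_def image_Un image_image \<beta>)
  have \<beta>_inj: "inj_on \<beta> Bp"
  proof (rule inj_onI)
    fix p q assume "p \<in> Bp" "q \<in> Bp" "\<beta> p = \<beta> q"
    thus "p = q" using Bp_cases[of p] Bp_cases[of q] disj12 by (auto simp: \<beta>)
  qed
  have vdegp1: "vdeg Vp (b, 0) = vdeg V1 b" and vdegp2: "vdeg Vp (0, b) = vdeg V2 b" for b
    by (simp_all add: vdeg_def Vp_def prod_space_def zero)
  have vdegp: "vdeg Vp q = vdeg V (\<beta> q)" if "q \<in> Bp" for q
    using Bp_cases[OF that] by (auto simp: vdegp1 vdegp2 vdeg1 vdeg2 \<beta>)

  have spanA: "V i \<subseteq> span (B1 \<union> B2)" for i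
    using AV(2)[of i] span_mono[of "A i" "B1 \<union> B2"] UA by auto
  have BspanA: "B \<subseteq> span (B1 \<union> B2)" using BV spanA by blast
  have AspanB: "B1 \<union> B2 \<subseteq> span B" using UA AV(1) Vspan by blast
  have repA: "vdeg V b = vdeg V a" if a: "a \<in> B" and r: "representation (B1 \<union> B2) a b \<noteq> 0" for a b
  proof -
    obtain i where i: "a \<in> V i" using a BV by auto
    have "a \<noteq> 0" using a indB dependent_zero by blast
    hence va: "vdeg V a = i" by (rule graded_space_degree(2)[OF gs i _ vs])
    have "representation (B1 \<union> B2) a = representation (A i) a"
      by (rule representation_extend[OF indA]) (use i AV(2) UA in auto)
    hence "b \<in> A i" using r representation_ne_zero[of "A i" a b] by simp
    thus ?thesis using deg(2) va by simp
  qed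
  have repB: "vdeg V a = vdeg V b" if b: "b \<in> B1 \<union> B2" and r: "representation B b a \<noteq> 0" for a b
  proof -
    obtain i where i: "b \<in> A i" using b UA by auto
    hence bV: "b \<in> V i" using AV(1) by blast
    have "b \<in> span (B \<inter> V i)" by (rule graded_span[OF gs BV indB bV]) (use bV Vspan in blast)
    hence "representation B b = representation (B \<inter> V i) b" by (rule representation_extend[OF indB]) auto
    hence a: "a \<in> B" "a \<in> V i" using r representation_ne_zero[of "B \<inter> V i" b a] by auto
    have "a \<noteq> 0" using a indB dependent_zero by blast
    hence "vdeg V a = i" by (rule graded_space_degree(2)[OF gs a(2) _ vs])
    thus ?thesis using deg(2)[OF i] by simp
  qed
  \<comment> \<open>\<open>P\<close> expands the given basis in the adapted one and \<open>Q\<close>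
    the adapted basis in the given one, with the product basis identified through \<beta>.\<close>
  define P where "P a q = (if a \<in> B \<and> q \<in> Bp then representation (B1 \<union> B2) a (\<beta> q) else 0)" for a q
  define Q where "Q q a = (if a \<in> B \<and> q \<in> Bp then representation B (\<beta> q) a else 0)" for q a
  have \<beta>B: "\<beta> q \<in> B1 \<union> B2" if "q \<in> Bp" for q using that \<beta>_image by blast
  have P_reindex: "lfsum Bp (\<lambda>q. h (\<beta> q)) = lfsum (B1 \<union> B2) h" for h :: "'v \<Rightarrow> 'k"
    using lfsum_reindex[OF \<beta>_inj, of h] by (simp add: \<beta>_image)
  interpret bc: base_change V B Vp Bp P Q
  proof
    show "a \<in> B \<and> q \<in> Bp \<and> vdeg V a = vdeg Vp q" if "P a q \<noteq> 0" for a q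
      using that repA[of a "\<beta> q"] vdegp[of q] by (auto simp: P_def split: if_splits)
    show "a \<in> B \<and> q \<in> Bp \<and> vdeg V a = vdeg Vp q" if "Q q a \<noteq> 0" for a q
      using that repB[of "\<beta> q" a] vdegp[of q] \<beta>B[of q] by (auto simp: Q_def split: if_splits)
    show "finite {q. P a q \<noteq> 0}" for a
    proof (rule finite_imageD[of \<beta>])
      show "finite (\<beta> ` {q. P a q \<noteq> 0})"
        by (rule finite_subset[OF _ finite_representation[of "B1 \<union> B2" a]]) (auto simp: P_def split: if_splits)
      show "inj_on \<beta> {q. P a q \<noteq> 0}" by (rule inj_on_subset[OF \<beta>_inj]) (auto simp: P_def split: if_splits)
    qed
    show "finite {a. Q q a \<noteq> 0}" for q
      by (rule finite_subset[OF _ finite_representation[of B "\<beta> q"]]) (auto simp: Q_def split: if_splits)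
    show "lfsum Bp (\<lambda>q. P a q * Q q c) = (if a = c then 1 else 0)" if ac: "a \<in> B" "c \<in> B" for a c
    proof -
      have "lfsum Bp (\<lambda>q. P a q * Q q c) = lfsum Bp (\<lambda>q. representation (B1 \<union> B2) a (\<beta> q) * representation B (\<beta> q) c)"
        by (rule lfsum_cong) (use ac in \<open>simp add: P_def Q_def\<close>)
      also have "\<dots> = lfsum (B1 \<union> B2) (\<lambda>b. representation (B1 \<union> B2) a b * representation B b c)"
        by (rule P_reindex)
      also have "\<dots> = representation B a c"
        by (rule representation_change[OF indA indB _ AspanB]) (use ac BspanA in auto)
      finally show ?thesis using representation_basis[OF indB ac(1)] by (simp add: eq_commute)
    qed
    show "lfsum B (\<lambda>a. Q p a * P a q) = (if p = q then 1 else 0)" if pq: "p \<in> Bp" "q \<in> Bp" for p q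
    proof -
      have "lfsum B (\<lambda>a. Q p a * P a q) = lfsum B (\<lambda>a. representation B (\<beta> p) a * representation (B1 \<union> B2) a (\<beta> q))"
        by (rule lfsum_cong) (use pq in \<open>simp add: P_def Q_def\<close>)
      also have "\<dots> = representation (B1 \<union> B2) (\<beta> p) (\<beta> q)"
        by (rule representation_change[OF indB indA _ BspanA]) (use \<beta>B[OF pq(1)] AspanB in blast)
      also have "\<dots> = (if \<beta> q = \<beta> p then 1 else 0)" by (simp add: representation_basis[OF indA \<beta>B[OF pq(1)]])
      finally show ?thesis using inj_onD[OF \<beta>_inj _ pq] by auto
    qed
  qed
  interpret inv: base_change Vp Bp V B Q P by (rule bc.inverse)

  \<comment> \<open>The structure in product coordinates\<close>
  define \<Gamma>p where "\<Gamma>p = lin Q P B \<Gamma>"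
  have hom: "poisson_hom TYPE(unit) V B Vp Bp (lin Q P B)" by (rule inv.poisson_hom_phi)
  have \<Gamma>p: "is_function Vp Bp \<Gamma>p" "has_degree Vp 2 \<Gamma>p" "vanishes_on_L \<Gamma>p" "vanishes_on_PiL \<Gamma>p"
    unfolding \<Gamma>p_def using \<Gamma> poisson_hom_function[OF hom] poisson_hom_degree[OF hom] poisson_hom_L[OF hom] poisson_hom_PiL[OF hom]
    by auto
  have "lin Q P B (\<lambda>w. 0) = (\<lambda>w. 0)"
    using poisson_hom_mult[OF hom \<Gamma>(1), of 0] by simp
  hence \<Gamma>p0: "bracket Vp Bp \<Gamma>p \<Gamma>p = (\<lambda>w. 0)"
    using poisson_hom_bracket[OF hom \<Gamma>(1) \<Gamma>(1)] \<Gamma>(5) by (simp add: \<Gamma>p_def)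
  have dspan: "d v \<in> span B" if "v \<in> V i" for v i using dV(1)[OF that] Vspan by blast
  \<comment> \<open>The quadratic coefficients transform as the matrix of \<open>d\<close>, which in
    the adapted basis has the shape required by \<open>splitting\<close>.\<close>
  have \<Gamma>p_rep: "\<Gamma>p [Tc p, Chi q] = representation (B1 \<union> B2) (d (\<beta> p)) (\<beta> q)" if pq: "p \<in> Bp" "q \<in> Bp" for p q
  proof -
    have dBs: "d a \<in> span B" "d a \<in> span (B1 \<union> B2)" if "a \<in> B" for a
      using that BV dspan dV(1) spanA by blast+
    have "\<Gamma>p [Tc p, Chi q] = lfsum B (\<lambda>a. Q p a * lfsum B (\<lambda>b. P b q * \<Gamma> [Tc a, Chi b]))"
      unfolding \<Gamma>p_def inv.phi_Cons[OF \<Gamma>(1)] inv.lfsum_M_Tc inv.phi_single[OF is_function_dL[OF \<Gamma>(1)]] inv.lfsum_M_Chi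
      by (simp add: dL_def)
    also have "\<dots> = lfsum B (\<lambda>a. representation B (\<beta> p) a * representation (B1 \<union> B2) (d a) (\<beta> q))"
    proof (rule lfsum_cong)
      fix a assume a: "a \<in> B"
      have "lfsum B (\<lambda>b. P b q * \<Gamma> [Tc a, Chi b]) = lfsum B (\<lambda>b. representation B (d a) b * representation (B1 \<union> B2) b (\<beta> q))"
        by (rule lfsum_cong) (use a pq in \<open>simp add: P_def dB\<close>)
      also have "\<dots> = representation (B1 \<union> B2) (d a) (\<beta> q)"
        by (rule representation_change[OF indB indA dBs(1)[OF a] BspanA])
      finally show "Q p a * lfsum B (\<lambda>b. P b q * \<Gamma> [Tc a, Chi b]) = representation B (\<beta> p) a * representation (B1 \<union> B2) (d a) (\<beta> q)"
        using a pq by (simp add: Q_def)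
    qed
    also have "\<dots> = representation (B1 \<union> B2) (d (\<beta> p)) (\<beta> q)"
      by (rule representation_linear[OF lin indB indA _ dBs(2)]) (use \<beta>B[OF pq(1)] AspanB in blast)
    finally show ?thesis .
  qed

  \<comment> \<open>The normal form on the product\<close>
  define Wp where "Wp = (\<lambda>b. (b, 0 :: 'v)) ` BW"
  define \<delta> where "\<delta> = (\<lambda>(x, y :: 'v). (d x, 0 :: 'v))"
  have \<delta>Wp: "\<delta> ` Wp = (\<lambda>b. (b, 0)) ` d ` BW" by (auto simp: Wp_def \<delta>_def image_image)
  interpret sp: splitting Vp Bp Wp \<delta> \<Gamma>p
  proof
    show "Wp \<subseteq> Bp" "\<delta> ` Wp \<subseteq> Bp" unfolding \<delta>Wp by (auto simp: Wp_def Bp1 B1_def)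
    show "Wp \<inter> \<delta> ` Wp = {}" unfolding \<delta>Wp using disjW by (auto simp: Wp_def)
    show "inj_on \<delta> Wp" using injd by (auto simp: Wp_def \<delta>_def inj_on_def)
    show "vdeg Vp (\<delta> a) = vdeg Vp a + 1" if "a \<in> Wp" for a
      using that vdegd by (auto simp: Wp_def \<delta>_def vdegp1 vdeg1 B1_def)
    show "\<Gamma>p [Tc p, Chi q] = (if p \<in> Wp \<and> q = \<delta> p then 1 else 0)" if pq: "p \<in> Bp" "q \<in> Bp" for p q
    proof (cases "p \<in> Wp")
      case True
      then obtain b where b: "p = (b, 0)" "b \<in> BW" by (auto simp: Wp_def)
      hence db: "d b \<in> B1 \<union> B2" "(d b, 0) \<in> Bp" by (auto simp: B1_def Bp1)
      have "\<beta> q = d b \<longleftrightarrow> q = (d b, 0)" using inj_onD[OF \<beta>_inj _ pq(2) db(2)] \<beta> by auto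
      thus ?thesis using True b \<Gamma>p_rep[OF pq] by (simp add: \<beta> representation_basis[OF indA db(1)] \<delta>_def)
    next
      case False
      have "d (\<beta> p) = 0"
        using Bp_cases[OF pq(1)]
      proof (elim disjE bexE)
        fix b assume b: "b \<in> B1" "p = (b, 0)"
        hence "b \<in> d ` BW" using False by (auto simp: B1_def Wp_def)
        then obtain w i where "b = d w" "w \<in> W i" by (auto simp: BW_def)
        thus ?thesis using b(2) dV(2)[of w i] WH(1)[of i] by (auto simp: \<beta>)
      next
        fix b assume "b \<in> B2" "p = (0, b)"
        thus ?thesis using WH(3) by (auto simp: B2_def \<beta>)
      qed
      thus ?thesis using False by (simp add: \<Gamma>p_rep[OF pq] representation_zero)
    qed
  qed (use \<Gamma>p \<Gamma>p0 in auto)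

  obtain S \<gamma> where S: "hamiltonian Vp Bp S" and \<gamma>: "sp.remainder \<gamma>"
    and nf: "expad Vp Bp S (\<lambda>w. sp.quad w + \<gamma> w) = \<Gamma>p"
    using sp.normal_form by blast
  have \<gamma>': "is_function Vp Bp \<gamma>" "has_degree Vp 2 \<gamma>" "starts 3 \<gamma>" "vanishes_on_L \<gamma>" "vanishes_on_PiL \<gamma>"
    "\<And>w. \<gamma> w \<noteq> 0 \<Longrightarrow> filter (\<lambda>x. x \<in> sp.X \<union> sp.X') w = []"
    using \<gamma> unfolding sp.remainder_def by blast+
  let ?\<Gamma>' = "\<lambda>w. sp.quad w + \<gamma> w"
  have f': "is_function Vp Bp ?\<Gamma>'" by (intro is_function_add sp.is_function_quad \<gamma>')
  \<comment> \<open>The inverse flow transports the master equation to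
    \<open>quad + \<gamma>\<close>, whose bracket with itself is that of \<gamma>.\<close>
  have \<gamma>\<gamma>: "bracket Vp Bp \<gamma> \<gamma> = (\<lambda>w. 0)"
  proof -
    note h = poisson_hom_expad[OF S, where 'i = unit]
    have "expad Vp Bp S (bracket Vp Bp ?\<Gamma>' ?\<Gamma>') = (\<lambda>w. 0)"
      using poisson_hom_bracket[OF h f' f'] nf \<Gamma>p0 by simp
    hence "bracket Vp Bp ?\<Gamma>' ?\<Gamma>' = expad Vp Bp (\<lambda>w. - S w) (\<lambda>w. 0)"
      using expad_uminus_expad[OF S is_function_bracket[OF f' f']] by simp
    also have "\<dots> = (\<lambda>w. 0)"
      using poisson_hom_mult[OF poisson_hom_expad[OF hamiltonian_uminus[OF S]] f', of 0] by simp
    finally show ?thesis by (simp add: sp.bracket_total[OF \<gamma>])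
  qed

  \<comment> \<open>The structures on the two factors\<close>
  interpret i1: inclusion V1 B1 Vp Bp "\<lambda>b. (b, 0)" sp.quad
  proof
    show "set w \<subseteq> range (map_coord (\<lambda>b. (b, 0)))" if "sp.quad w \<noteq> 0" for w
    proof -
      have c: "Tc (b, 0) \<in> range (map_coord (\<lambda>b. (b, 0)))" "Chi (b, 0) \<in> range (map_coord (\<lambda>b. (b, 0)))" for b :: 'v
        by (metis coord.map rangeI)+
      thus ?thesis using sp.quad_nonzero[OF that] by (auto simp: Wp_def \<delta>_def)
    qed
  qed (auto simp: inj_on_def Bp1 vdegp1 sp.is_function_quad)
  interpret i2: inclusion V2 B2 Vp Bp "\<lambda>b. (0, b)" \<gamma>
  proof
    show "set w \<subseteq> range (map_coord (\<lambda>b. (0, b)))" if nz: "\<gamma> w \<noteq> 0" for w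
    proof
      fix x assume x: "x \<in> set w"
      \<comment> \<open>The contractible coordinates are exactly those of the first factor, so
        \<gamma>, which avoids them, lives on the second.\<close>
      have "sp.X \<union> sp.X' = coords (Wp \<union> \<delta> ` Wp)"
        unfolding sp.X_def sp.X'_def coords_def by blast
      also have "Wp \<union> \<delta> ` Wp = (\<lambda>b. (b, 0)) ` B1" unfolding \<delta>Wp B1_def image_Un by (simp add: Wp_def)
      finally have X: "sp.X \<union> sp.X' = coords ((\<lambda>b. (b, 0)) ` B1)" .
      have "x \<in> coords Bp" using is_function_outside[OF \<gamma>'(1), of w] nz x by blast
      moreover have "x \<notin> sp.X \<union> sp.X'" using \<gamma>'(6)[OF nz] x by (auto simp: filter_empty_conv)
      ultimately obtain b where "x = Tc (0, b) \<or> x = Chi (0, b)"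
        unfolding X by (auto simp: Bp_def prod_basis_def coords_def)
      thus "x \<in> range (map_coord (\<lambda>b. (0, b)))" by (metis coord.map rangeI)
    qed
  qed (auto simp: inj_on_def Bp1 vdegp2 \<gamma>')

  have tensor: "tensor_fun i1.restr i2.restr = ?\<Gamma>'"
    unfolding tensor_fun_def pr1_pullback_def pr2_pullback_def
    using i1.restr_pullback[of fst] i2.restr_pullback[of snd] by (intro ext) simp

  have lie1: "lie1bi scale V1 B1 i1.restr"
    unfolding lie1bi_def using gs1 hb1 i1.is_function_restr i1.restr_degree[OF sp.quad_degree]
      i1.restr_vanishes sp.quad_vanishes i1.bracket_restr_0 sp.bracket_quad_quad by auto
  have lie2: "lie1bi scale V2 B2 i2.restr"
    unfolding lie1bi_def using gs1 hb1 i2.is_function_restr i2.restr_degree[OF \<gamma>'(2)]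
      i2.restr_vanishes \<gamma>' i2.bracket_restr_0[OF \<gamma>\<gamma>] by auto
  have "minimal scale V2 B2 i2.restr"
    using lie2 \<gamma>'(3) by (simp add: minimal_def i2.restr_def starts_def)
  moreover have "contractible scale V1 B1 i1.restr"
    unfolding contractible_def
  proof (intro conjI exI[of _ d] allI impI ballI)
    show "lie1bi scale V1 B1 i1.restr" by (rule lie1)
    show "i1.restr w = 0" if "length w \<noteq> 2" for w using that by (simp add: i1.restr_def sp.quad_length)
    have ind1: "independent B1" using hb1(1) by (simp add: homogeneous_basis_def)
    have "(a, 0) \<in> Wp \<longleftrightarrow> a \<in> BW" "\<delta> (a, 0) = (d a, 0)" for a by (auto simp: Wp_def \<delta>_def)
    hence r1: "i1.restr [Tc a, Chi b] = (if a \<in> BW \<and> b = d a then 1 else 0)" for a b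
      by (simp add: i1.restr_def sp.quad_simps)
    show "i1.restr [Tc a, Chi b] = representation B1 (d a) b" if ab: "a \<in> B1" "b \<in> B1" for a b
    proof (cases "a \<in> BW")
      case True
      hence "d a \<in> B1" by (simp add: B1_def)
      thus ?thesis using True
        by (simp add: r1 representation_basis[OF ind1])
    next
      case False
      then obtain w i where "a = d w" "w \<in> W i" using ab(1) by (auto simp: B1_def BW_def)
      hence "d a = 0" using dV(2)[of w i] WH(1)[of i] by auto
      thus ?thesis using False by (simp add: r1 representation_zero)
    qed
    have d1: "d ` V1 i \<subseteq> V1 (i + 1)" for i
    proof -
      have "d ` (W i \<union> d ` W (i - 1)) \<subseteq> V1 (i + 1)"
      proof -
        have "d (d w) = 0" if "w \<in> W (i - 1)" for w using dV(2) that WH(1) by blast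
        moreover have "d w \<in> V1 (i + 1)" if "w \<in> W i" for w using that by (auto simp: V1_def intro: span_base)
        ultimately show ?thesis using zero(1) by auto
      qed
      thus ?thesis unfolding V1_def[of i] d.span_image[symmetric] by (rule span_minimal) (simp add: V1_def)
    qed
    show "differential scale V1 d"
      unfolding differential_def using lin d1 dV(2) V1V(1) by blast
    show "acyclic_differential V1 d"
      unfolding acyclic_differential_def
    proof (intro allI equalityI subsetI)
      fix i v assume "v \<in> {v \<in> V1 i. d v = 0}"
      \<comment> \<open>The component \<open>y\<close> is exact, hence closed, so \<open>x\<close>
        is closed as well; injectivity of \<open>d\<close> on the span of \<open>W i\<close> leaves
        only \<open>y\<close>.\<close>
      then obtain x y where v: "v = x + y" "x \<in> span (W i)" "y \<in> span (d ` W (i - 1))" "d v = 0"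
        by (auto simp: V1_def span_Un)
      obtain z where z: "y = d z" "z \<in> span (W (i - 1))" using v(3) unfolding d.span_image by blast
      have "z \<in> V (i - 1)" using z(2) span_minimal[OF WH(1) sub] by blast
      hence "d y = 0" using z(1) dV(2) by blast
      hence "d x = d 0" using v(1,4) by (simp add: d.add d.zero)
      hence "x = 0" using inj_onD[OF WH(6)[of i], of x 0] v(2) span_zero by blast
      moreover have "z \<in> V1 (i - 1)" using z(2) span_mono[of "W (i - 1)" "W (i - 1) \<union> d ` W (i - 1 - 1)"] by (auto simp: V1_def)
      ultimately show "v \<in> d ` V1 (i - 1)" using v(1) z(1) by simp
    next
      fix i v assume "v \<in> d ` V1 (i - 1)"
      then obtain z where z: "v = d z" "z \<in> V1 (i - 1)" by blast
      thus "v \<in> {v \<in> V1 i. d v = 0}" using d1[of "i - 1"] dV(2)[of z "i - 1"] V1V(1)[of "i - 1"] by auto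
    qed
  qed

  \<comment> \<open>The isomorphism\<close>
  moreover have "lie1bi_isomorphic V B \<Gamma> (prod_space V1 V2) (prod_basis B1 B2) (tensor_fun i1.restr i2.restr)"
    unfolding tensor Vp_def[symmetric] Bp_def[symmetric]
  proof (rule lie1bi_isomorphicI)
    \<comment> \<open>In the direction of pullbacks: the flow takes the normal form to
      \<open>\<Gamma>p\<close>, and the linear substitution then returns to the coordinates of
      \<open>B\<close>.\<close>
    show "poisson_hom TYPE(('v \<times> 'v) coord list) Vp Bp V B (\<lambda>f. lin P Q Bp (expad Vp Bp S f))"
      by (rule poisson_hom_comp[OF bc.poisson_hom_phi poisson_hom_expad[OF S]])
    show "poisson_hom TYPE('v coord list) V B Vp Bp (\<lambda>f. expad Vp Bp (\<lambda>w. - S w) (lin Q P B f))"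
      by (rule poisson_hom_comp[OF poisson_hom_expad[OF hamiltonian_uminus[OF S]] inv.poisson_hom_phi])
    show "lin P Q Bp (expad Vp Bp S (expad Vp Bp (\<lambda>w. - S w) (lin Q P B f))) = f" if "is_function V B f" for f
      using that by (simp add: expad_expad_uminus[OF S] inv.is_function_phi inv.phi_inverse)
    show "expad Vp Bp (\<lambda>w. - S w) (lin Q P B (lin P Q Bp (expad Vp Bp S f))) = f" if f: "is_function Vp Bp f" for f
    proof -
      have "is_function Vp Bp (expad Vp Bp S f)" by (rule poisson_hom_function[OF poisson_hom_expad[OF S] f])
      thus ?thesis using f by (simp add: bc.phi_inverse expad_uminus_expad[OF S])
    qed
    show "lin P Q Bp (expad Vp Bp S ?\<Gamma>') = \<Gamma>"
      unfolding nf \<Gamma>p_def by (rule inv.phi_inverse[OF \<Gamma>(1)])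
  qed (rule \<Gamma>(1), rule f')
  ultimately show ?thesis by blast
qed

end
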